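(* Let the stress function $\boldsymbol\sigma$ be a Carathéodory function satisfying, for a.e. $\boldsymbol x\in\Omega$ and all $\boldsymbol\tau,\boldsymbol\eta\in\mathbb{R}^{d\times d}_{\rm s}$ and with real numbers $C_{\rm gr},C_{\rm cv}\in(0,+\infty)$, the growth condition $|\boldsymbol\sigma(\boldsymbol x,\boldsymbol\tau)|\le C_{\rm gr}|\boldsymbol\tau|$, the coercivity condition $\boldsymbol\sigma(\boldsymbol x,\boldsymbol\tau):\boldsymbol\tau\ge C_{\rm cv}^2|\boldsymbol\tau|^2$, and the strict monotonicity condition $(\boldsymbol\sigma(\boldsymbol x,\boldsymbol\tau)-\boldsymbol\sigma(\boldsymbol x,\boldsymbol\eta)):(\boldsymbol\tau-\boldsymbol\eta)>0$ if $\boldsymbol\eta\neq\boldsymbol\tau$. Let $(\mathcal{M}_h)_{h\in\mathcal{H}}$ be a regular mesh sequence. Then, for all $h\in\mathcal{H}$ and all $N\in\mathbb{N}^*$, there exists a unique solution $(\underline{\boldsymbol u}_h^n,p_h^n)_{1\le n\le N}\in(\underline{\boldsymbol U}^k_{h,\mathrm D}\times P_h^k)^N$ to the discrete problem: for all $1\le n\le N$ and all $(\underline{\boldsymbol v}_h,q_h)\in\underline{\boldsymbol U}^k_{h,\mathrm D}\times P^k(\mathcal{T}_h)$, $$a_h(\underline{\boldsymbol u}_h^n,\underline{\boldsymbol v}_h)+b_h(\underline{\boldsymbol v}_h,p_h^n)=(\overline{\boldsymbol f}^n,\boldsymbol v_h)_\Omega,$$ $$C_0(\delta_tp_h^n,q_h)_\Omega-b_h(\delta_t\underline{\boldsymbol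 u}_h^n,q_h)+c_h(p_h^n,q_h)=(\overline g^n,q_h)_\Omega,$$ where, for $n=1$, the quantity at step $0$ is defined by $C_0(p_h^0,q_h)_\Omega-b_h(\underline{\boldsymbol u}_h^0,q_h):=(\phi^0,q_h)_\Omega$ for all $q_h\in P^k(\mathcal{T}_h)$ (only this combination is needed; $\underline{\boldsymbol u}_h^0$ and $p_h^0$ themselves are not).
   Context: **Domain, data.** $d\in\{2,3\}$; $\Omega\subset\mathbb{R}^d$ is a bounded connected polyhedral domain of diameter $1$; $t_{\rm F}>0$; $C_0\ge0$; $\mathbb{R}^{d\times d}_{\rm s}$ is the set of symmetric real matrices, with Frobenius product $\boldsymbol\tau:\boldsymbol\eta=\sum_{i,j}\tau_{ij}\eta_{ij}$ and norm $|\boldsymbol\tau|=(\boldsymbol\tau:\boldsymbol\tau)^{1/2}$. $\boldsymbol\kappa:\Omega\to\mathbb{R}^{d\times d}_{\rm s}$ is piecewise constant on a polyhedral partition $P_\Omega$ of $\Omega$ and satisfies $\underline\kappa|\boldsymbol\xi|^2\le\boldsymbol\kappa(\boldsymbol x)\boldsymbol\xi\cdot\boldsymbol\xi\le\overline\kappa|\boldsymbol\xi|^2$ for a.e. $\boldsymbol x$ and all $\boldsymbol\xi\in\mathbb{R}^d$, with $0<\underline\kappa\le\overline\kappa$. The stress function is $\boldsymbol\sigma:\Omega\times\mathbb{R}^{d\times d}_{\rm s}\to\mathbb{R}^{d\times d}_{\rm s}$; Carathéodory means continuous in the second variable for a.e. $\boldsymbol x$ and measurable in the first for every $\boldsymbol\tau$.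 The data are $\boldsymbol f\in L^2((0,t_{\rm F});L^2(\Omega)^d)$, $g\in L^2((0,t_{\rm F});L^2(\Omega))$, $\phi^0\in L^2(\Omega)$, with, in addition, $\int_\Omega\phi^0=0$ and $\int_\Omega g(\cdot,t)=0$ for a.e. $t\in(0,t_{\rm F})$ if $C_0=0$. $(\cdot,\cdot)_X$, $\|\cdot\|_X$ are the $L^2(X)$ product and norm. **Space meshes.** A mesh is a couple $\mathcal{M}_h=(\mathcal{T}_h,\mathcal{F}_h)$: $\mathcal{T}_h$ is a finite collection of nonempty, pairwise disjoint, open polygonal/polyhedral elements $T$ of diameter $h_T$ with $\overline\Omega=\bigcup_T\overline T$, $h=\max_Th_T>0$; $\mathcal{F}_h$ is a finite collection of pairwise disjoint hyperplanar faces $F$ (nonempty, relatively open, connected) of diameter $h_F$, each being either an internal face ($F\subset\partial T_{F,1}\cap\partial T_{F,2}$ for two distinct elements, whose ordering is arbitrary but fixed) or a boundary face ($F\subset\partial T\cap\partial\Omega$), and $\partial T=\bigcup_{F\in\mathcal{F}_T}\overline F$ with $\mathcal{F}_T$ the faces lying on $\partial T$. $\mathcal{F}_h^{\rm i}$, $\mathcal{F}_h^{\rm b}$ are the sets of internal and boundary faces; $\boldsymbol n_{TF}$ is the unit normal to $F$ out of $T$. Each $T$ is contained in a single subdomain of $P_\Omega$. The mesh sequence is regular with parameter $\varrho\in(0,1)$: for each mesh there is a matching simplicial submesh (a conforming simplicial mesh each simplex of which lies in exactly one $T$ and each simplicial face of which is, for each $F\in\mathcal{F}_h$, disjoint from or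 contained in $F$) with $\varrho h_S\le r_S$ ($r_S$ the inradius) for each simplex $S$ and $\varrho h_T\le h_S$ for $S\subset T$; moreover elements are star-shaped with respect to every point of a ball of radius uniformly comparable to $h_T$. **Time mesh.** $\tau=t_{\rm F}/N$, $t^n=n\tau$. Time averages: $\overline\psi^n=\tau^{-1}\int_{t^{n-1}}^{t^n}\psi(t)\,{\rm d}t$; backward difference: $\delta_t\varphi^n=(\varphi^n-\varphi^{n-1})/\tau$. **Discrete spaces.** $k\ge1$. $P^k(X)$, $\boldsymbol P^k(X)$, $\mathbb{P}^k_{\rm s}(X)$ are the scalar, $\mathbb{R}^d$-valued, symmetric-tensor-valued polynomials of total degree $\le k$ on $X$; $P^k(\mathcal{T}_h)$ is the broken polynomial space; $\boldsymbol\pi^k_X$ is the component-wise $L^2(X)$-orthogonal projector on polynomials of total degree $\le k$. $\underline{\boldsymbol U}^k_h$ is the set of $\underline{\boldsymbol v}_h=((\boldsymbol v_T)_{T\in\mathcal{T}_h},(\boldsymbol v_F)_{F\in\mathcal{F}_h})$ with $\boldsymbol v_T\in\boldsymbol P^k(T)$, $\boldsymbol v_F\in\boldsymbol P^k(F)$; $\underline{\boldsymbol U}^k_{h,\mathrm D}$ is its subspace with $\boldsymbol v_F=\boldsymbol0$ for all $F\in\mathcal{F}_h^{\rm b}$; $\underline{\boldsymbol v}_T=(\boldsymbol v_T,(\boldsymbol v_F)_{F\in\mathcal{F}_T})$ are the local unknowns; $\boldsymbol v_h$ is the broken polynomial with $(\boldsymbol v_h)_{|T}=\boldsymbol v_T$.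 $P_h^k=P^k(\mathcal{T}_h)$ if $C_0>0$, $P_h^k=\{q_h\in P^k(\mathcal{T}_h):\int_\Omega q_h=0\}$ if $C_0=0$. **Elasticity operator.** With $\boldsymbol\nabla_{\rm s}$ the symmetric gradient: $\boldsymbol G^k_{{\rm s},T}\underline{\boldsymbol v}_T\in\mathbb{P}^k_{\rm s}(T)$ is defined by $\int_T\boldsymbol G^k_{{\rm s},T}\underline{\boldsymbol v}_T:\boldsymbol\tau=-\int_T\boldsymbol v_T\cdot(\boldsymbol\nabla\cdot\boldsymbol\tau)+\sum_{F\in\mathcal{F}_T}\int_F\boldsymbol v_F\cdot(\boldsymbol\tau\boldsymbol n_{TF})$ for all $\boldsymbol\tau\in\mathbb{P}^k_{\rm s}(T)$. $\boldsymbol r^{k+1}_T\underline{\boldsymbol v}_T\in\boldsymbol P^{k+1}(T)$ is defined by $\int_T(\boldsymbol\nabla_{\rm s}\boldsymbol r^{k+1}_T\underline{\boldsymbol v}_T-\boldsymbol G^k_{{\rm s},T}\underline{\boldsymbol v}_T):\boldsymbol\nabla_{\rm s}\boldsymbol w=0$ for all $\boldsymbol w\in\boldsymbol P^{k+1}(T)$, $\int_T\boldsymbol r^{k+1}_T\underline{\boldsymbol v}_T=\int_T\boldsymbol v_T$, and, for all $1\le i<j\le d$, $\int_T(\partial_ir^{k+1}_{T,j}\underline{\boldsymbol v}_T-\partial_jr^{k+1}_{T,i}\underline{\boldsymbol v}_T)=\sum_{F\in\mathcal{F}_T}\int_F(n_{TF,i}v_{F,j}-n_{TF,j}v_{F,i})$.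 Set $\boldsymbol\Delta^k_{TF}\underline{\boldsymbol v}_T=\boldsymbol\pi^k_F(\boldsymbol r^{k+1}_T\underline{\boldsymbol v}_T-\boldsymbol v_F)-\boldsymbol\pi^k_T(\boldsymbol r^{k+1}_T\underline{\boldsymbol v}_T-\boldsymbol v_T)$ and $$a_h(\underline{\boldsymbol w}_h,\underline{\boldsymbol v}_h)=\sum_T\Big(\int_T\boldsymbol\sigma(\cdot,\boldsymbol G^k_{{\rm s},T}\underline{\boldsymbol w}_T):\boldsymbol G^k_{{\rm s},T}\underline{\boldsymbol v}_T+\sum_{F\in\mathcal{F}_T}\frac{\gamma}{h_F}\int_F\boldsymbol\Delta^k_{TF}\underline{\boldsymbol w}_T\cdot\boldsymbol\Delta^k_{TF}\underline{\boldsymbol v}_T\Big),$$ with stabilization parameter $\gamma\in[C_{\rm cv}^2,C_{\rm gr}]$. **Coupling.** $b_h(\underline{\boldsymbol v}_h,q_h)=\sum_T\big(\int_T\boldsymbol v_T\cdot\boldsymbol\nabla q_T-\sum_{F\in\mathcal{F}_T}\int_F(\boldsymbol v_F\cdot\boldsymbol n_{TF})q_T\big)$, $q_T=q_{h|T}$. **Darcy operator.** For $F\in\mathcal{F}_h^{\rm i}$: $\kappa_{F,i}=(\boldsymbol\kappa_{|T_{F,i}}\boldsymbol n_{T_{F,i}F})\cdot\boldsymbol n_{T_{F,i}F}$, $\kappa_F=\frac{2\kappa_{F,1}\kappa_{F,2}}{\kappa_{F,1}+\kappa_{F,2}}$, $[q_h]_F=q_{T_{F,1}}-q_{T_{F,2}}$,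 $\{q_h\}_F=\frac{\sqrt{\kappa_{F,2}}}{\sqrt{\kappa_{F,1}}+\sqrt{\kappa_{F,2}}}q_{T_{F,1}}+\frac{\sqrt{\kappa_{F,1}}}{\sqrt{\kappa_{F,1}}+\sqrt{\kappa_{F,2}}}q_{T_{F,2}}$. With broken gradient $\boldsymbol\nabla_h$, $$c_h(r_h,q_h)=\int_\Omega\boldsymbol\kappa\boldsymbol\nabla_hr_h\cdot\boldsymbol\nabla_hq_h+\sum_{F\in\mathcal{F}_h^{\rm i}}\frac{\varsigma\kappa_F}{h_F}\int_F[r_h]_F[q_h]_F-\sum_{F\in\mathcal{F}_h^{\rm i}}\int_F\big([r_h]_F\{\boldsymbol\kappa\boldsymbol\nabla_hq_h\}_F+[q_h]_F\{\boldsymbol\kappa\boldsymbol\nabla_hr_h\}_F\big)\cdot\boldsymbol n_{T_{F,1}F}.$$ The penalty parameter satisfies $\varsigma>\underline\varsigma>0$, with threshold $\underline\varsigma$ such that $c_h(q_h,q_h)\ge(\varsigma-\underline\varsigma)(1+\varsigma)^{-1}\|q_h\|_{\boldsymbol\kappa,h}^2$ for all $q_h\in P_h^k$, where $\|q_h\|_{\boldsymbol\kappa,h}^2=\sum_T\|\boldsymbol\kappa^{1/2}\boldsymbol\nabla q_T\|_T^2+\sum_{F\in\mathcal{F}_h^{\rm i}}\frac{\kappa_F}{h_F}\|[q_h]_F\|_F^2$. *)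

theory Defs
  imports "HOL-Analysis.Analysis"
begin

subsection \<open>Polynomials and differential operators\<close>

type_synonym 'd point = "real ^ 'd"
type_synonym 'd tensor = "real ^ 'd ^ 'd"

definition sym_tensors :: "'d::finite tensor set" where
  "sym_tensors = {A. transpose A = A}"

definition poly_upto :: "nat \<Rightarrow> ('d::finite point \<Rightarrow> real) set" where
  "poly_upto k = {p. \<exists>c :: ('d \<Rightarrow> nat) \<Rightarrow> real.
      p = (\<lambda>x. \<Sum>\<alpha> | sum \<alpha> UNIV \<le> k. c \<alpha> * (\<Prod>i\<in>UNIV. x $ i ^ \<alpha> i))}"

definition vpoly_upto :: "nat \<Rightarrow> ('d::finite point \<Rightarrow> 'd point) set" where
  "vpoly_upto k = {p. \<forall>i. (\<lambda>x. p x $ i) \<in> poly_upto k}"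

definition stpoly_upto :: "nat \<Rightarrow> ('d::finite point \<Rightarrow> 'd tensor) set" where
  "stpoly_upto k = {p. (\<forall>x. p x \<in> sym_tensors) \<and> (\<forall>i j. (\<lambda>x. p x $ i $ j) \<in> poly_upto k)}"

definition pdiff :: "'d::finite \<Rightarrow> ('d point \<Rightarrow> 'b::real_normed_vector) \<Rightarrow> 'd point \<Rightarrow> 'b" where
  "pdiff i f x = frechet_derivative f (at x) (axis i 1)"

definition grad :: "('d::finite point \<Rightarrow> real) \<Rightarrow> 'd point \<Rightarrow> 'd point" where
  "grad q x = (\<chi> i. pdiff i q x)"

definition sym_grad :: "('d::finite point \<Rightarrow> 'd point) \<Rightarrow> 'd point \<Rightarrow> 'd tensor" where
  "sym_grad v x = (\<chi> i j. (pdiff j v x $ i + pdiff i v x $ j) / 2)"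

definition tensor_div :: "('d::finite point \<Rightarrow> 'd tensor) \<Rightarrow> 'd point \<Rightarrow> 'd point" where
  "tensor_div \<tau> x = (\<chi> i. \<Sum>j\<in>UNIV. pdiff j \<tau> x $ i $ j)"


subsection \<open>Lebesgue spaces\<close>

definition L2_on :: "'d::finite point set \<Rightarrow> ('d point \<Rightarrow> 'b::euclidean_space) set" where
  "L2_on X = {f \<in> borel_measurable (lebesgue_on X).
      integrable (lebesgue_on X) (\<lambda>x. (norm (f x))\<^sup>2)}"

definition l2_prod :: "'d::finite point set \<Rightarrow> ('d point \<Rightarrow> 'b::euclidean_space) \<Rightarrow> ('d point \<Rightarrow> 'b) \<Rightarrow> real" where
  "l2_prod X f g = (LINT x|lebesgue_on X. f x \<bullet> g x)"

text \<open>Every class in the Bochner space of square-integrable functions of time in \<open>(0, T)\<close> with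
  values in the square-integrable functions on \<open>X\<close> has a jointly measurable representative,
  and the Bochner norm of the class is the \<open>L\<^sup>2\<close> norm of this representative over
  \<open>(0, T) \<times> X\<close>. For such a representative, the Bochner mean value over a time interval
  is the function obtained by averaging in time at almost every point of \<open>X\<close>.\<close>

definition L2_time :: "real \<Rightarrow> 'd::finite point set \<Rightarrow> (real \<Rightarrow> 'd point \<Rightarrow> 'b::euclidean_space) set" where
  "L2_time T X = {f.
      (\<lambda>(t, x). f t x) \<in> borel_measurable (lebesgue_on {0<..<T} \<Otimes>\<^sub>M lebesgue_on X) \<and>
      integrable (lebesgue_on {0<..<T} \<Otimes>\<^sub>M lebesgue_on X) (\<lambda>(t, x). (norm (f t x))\<^sup>2)}"

definition time_mean :: "real \<Rightarrow> (real \<Rightarrow> 'd::finite point \<Rightarrow> 'b::euclidean_space) \<Rightarrow> nat \<Rightarrow> 'd point \<Rightarrow> 'b" where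
  "time_mean \<tau> \<psi> n x = (1 / \<tau>) *\<^sub>R (LINT t:{(real n - 1) * \<tau><..<real n * \<tau>}|lebesgue. \<psi> t x)"

definition l2_proj :: "('a \<Rightarrow> real) set \<Rightarrow> 'a measure \<Rightarrow> ('a \<Rightarrow> real) \<Rightarrow> 'a \<Rightarrow> real" where
  "l2_proj V \<mu> f = (THE p. p \<in> V \<and> (\<forall>q\<in>V. (LINT x|\<mu>. p x * q x) = (LINT x|\<mu>. f x * q x)))"


subsection \<open>Polyhedral sets and hyperplanar faces\<close>

text \<open>Polyhedral sets are open and bounded, and need not be convex.\<close>

definition polyhedral_set :: "'d::finite point set \<Rightarrow> bool" where
  "polyhedral_set X \<longleftrightarrow> (\<exists>C. finite C \<and> (\<forall>K\<in>C. polytope K) \<and> X = interior (\<Union>C))"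

definition polyhedral_partition :: "'d::finite point set \<Rightarrow> 'd point set set \<Rightarrow> bool" where
  "polyhedral_partition \<Omega> P \<longleftrightarrow>
     finite P \<and> (\<forall>D\<in>P. polyhedral_set D \<and> D \<noteq> {}) \<and> pairwise disjnt P \<and>
     closure \<Omega> = (\<Union>D\<in>P. closure D)"

definition hyperplanar_face :: "'d::finite point set \<Rightarrow> bool" where
  "hyperplanar_face F \<longleftrightarrow> F \<noteq> {} \<and> connected F \<and>
     (\<exists>a b. a \<noteq> 0 \<and> openin (top_of_set {x. a \<bullet> x = b}) F)"

text \<open>For \<open>F\<close> in the hyperplane with unit normal \<open>n\<close> and offset \<open>b\<close>, the
  \<open>(d-1)\<close>-dimensional Lebesgue measure of a Borel set \<open>A \<subseteq> F\<close> is the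
  \<open>d\<close>-dimensional measure of the right prism of height one with base \<open>A\<close>. So the surface
  measure is the image, under the orthogonal projection onto the hyperplane, of the Lebesgue
  measure on the prism of height one with base \<open>F\<close>. The other choice \<open>(-n, -b)\<close> gives the
  same measure.\<close>

definition face_measure :: "'d::finite point set \<Rightarrow> 'd point measure" where
  "face_measure F =
     (let (n, b) = (SOME (n, b). norm n = 1 \<and> F \<subseteq> {x. n \<bullet> x = b});
          foot = (\<lambda>x. x - (n \<bullet> x - b) *\<^sub>R n)
      in distr (restrict_space lborel {x. b < n \<bullet> x \<and> n \<bullet> x < b + 1 \<and> foot x \<in> F})
           (restrict_space borel F) foot)"

definition normal_out :: "'d::finite point set \<Rightarrow> 'd point set \<Rightarrow> 'd point" where
  "normal_out T F = (THE n. norm n = 1 \<and> (\<exists>b. F \<subseteq> {x. n \<bullet> x = b}) \<and>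
     (\<forall>x\<in>F. \<exists>\<epsilon>>0. \<forall>s. 0 < s \<and> s < \<epsilon> \<longrightarrow> x - s *\<^sub>R n \<in> T \<and> x + s *\<^sub>R n \<notin> T))"


subsection \<open>Meshes\<close>

text \<open>The last two fields fix the ordering of the two elements sharing an internal face; their
  values at other faces are irrelevant.\<close>

record 'd mesh =
  elems :: "(real ^ 'd) set set"
  faces :: "(real ^ 'd) set set"
  side1 :: "(real ^ 'd) set \<Rightarrow> (real ^ 'd) set"
  side2 :: "(real ^ 'd) set \<Rightarrow> (real ^ 'd) set"

definition internal_faces :: "'d::finite mesh \<Rightarrow> 'd point set set" where
  "internal_faces M = {F \<in> faces M. \<exists>T1\<in>elems M. \<exists>T2\<in>elems M.
      T1 \<noteq> T2 \<and> F \<subseteq> frontier T1 \<inter> frontier T2}"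

definition boundary_faces :: "'d::finite point set \<Rightarrow> 'd mesh \<Rightarrow> 'd point set set" where
  "boundary_faces \<Omega> M = {F \<in> faces M. \<exists>T\<in>elems M. F \<subseteq> frontier T \<inter> frontier \<Omega>}"

definition faces_of :: "'d::finite mesh \<Rightarrow> 'd point set \<Rightarrow> 'd point set set" where
  "faces_of M T = {F \<in> faces M. F \<subseteq> frontier T}"

definition mesh_size :: "'d::finite mesh \<Rightarrow> real" where
  "mesh_size M = Max (diameter ` elems M)"

definition is_mesh :: "'d::finite point set \<Rightarrow> 'd mesh \<Rightarrow> bool" where
  "is_mesh \<Omega> M \<longleftrightarrow>
     finite (elems M) \<and> (\<forall>T\<in>elems M. T \<noteq> {} \<and> polyhedral_set T) \<and> pairwise disjnt (elems M) \<and>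
     closure \<Omega> = (\<Union>T\<in>elems M. closure T) \<and>
     finite (faces M) \<and> (\<forall>F\<in>faces M. hyperplanar_face F) \<and> pairwise disjnt (faces M) \<and>
     faces M = internal_faces M \<union> boundary_faces \<Omega> M \<and>
     (\<forall>T\<in>elems M. frontier T = (\<Union>F\<in>faces_of M T. closure F)) \<and>
     (\<forall>F\<in>internal_faces M. side1 M F \<in> elems M \<and> side2 M F \<in> elems M \<and> side1 M F \<noteq> side2 M F \<and>
        F \<subseteq> frontier (side1 M F) \<inter> frontier (side2 M F))"

definition inradius :: "'d::finite point set \<Rightarrow> real" where
  "inradius S = Sup {r. \<exists>c. ball c r \<subseteq> S}"

text \<open>In the library, simplices are closed and \<open>triangulation\<close> expresses conformity. An element
  or a face is open or relatively open, hence the (relative) interiors in the conditions relating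
  the simplices to the mesh.\<close>

definition matching_simplicial_submesh :: "'d::finite point set \<Rightarrow> 'd mesh \<Rightarrow> 'd point set set \<Rightarrow> bool" where
  "matching_simplicial_submesh \<Omega> M \<S> \<longleftrightarrow>
     triangulation \<S> \<and> (\<forall>S\<in>\<S>. int CARD('d) simplex S) \<and> \<Union>\<S> = closure \<Omega> \<and>
     (\<forall>S\<in>\<S>. \<exists>!T. T \<in> elems M \<and> interior S \<subseteq> T) \<and>
     (\<forall>S\<in>\<S>. \<forall>E. E facet_of S \<longrightarrow>
        (\<forall>F\<in>faces M. rel_interior E \<inter> F = {} \<or> rel_interior E \<subseteq> F))"

definition regular_mesh_sequence ::
  "'d::finite point set \<Rightarrow> real \<Rightarrow> real set \<Rightarrow> (real \<Rightarrow> 'd mesh) \<Rightarrow> bool" where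
  "regular_mesh_sequence \<Omega> \<rho> H M \<longleftrightarrow>
     (\<forall>h\<in>H. 0 < h \<and> is_mesh \<Omega> (M h) \<and> mesh_size (M h) = h \<and>
        (\<exists>\<S>. matching_simplicial_submesh \<Omega> (M h) \<S> \<and>
           (\<forall>S\<in>\<S>. \<rho> * diameter S \<le> inradius S) \<and>
           (\<forall>S\<in>\<S>. \<forall>T\<in>elems (M h). interior S \<subseteq> T \<longrightarrow> \<rho> * diameter T \<le> diameter S))) \<and>
     (\<exists>c>0. \<forall>h\<in>H. \<forall>T\<in>elems (M h). \<exists>x r. c * diameter T \<le> r \<and> ball x r \<subseteq> T \<and>
        (\<forall>y\<in>ball x r. \<forall>z\<in>T. closed_segment y z \<subseteq> T))"


subsection \<open>Discrete spaces\<close>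

text \<open>Elements are open and nonempty, so a polynomial on an element is represented by the
  polynomial function on the whole space that extends it; this also gives its derivatives and its
  traces on faces. A polynomial on a face has several such extensions, and is represented by its
  restriction to the face.\<close>

type_synonym 'd broken = "'d point set \<Rightarrow> 'd point \<Rightarrow> real"
type_synonym 'd hho = "('d point set \<Rightarrow> 'd point \<Rightarrow> 'd point) \<times> ('d point set \<Rightarrow> 'd point \<Rightarrow> 'd point)"

definition face_poly :: "nat \<Rightarrow> 'd::finite point set \<Rightarrow> ('d point \<Rightarrow> real) set" where
  "face_poly k F = (\<lambda>p. restrict p F) ` poly_upto k"

definition face_vpoly :: "nat \<Rightarrow> 'd::finite point set \<Rightarrow> ('d point \<Rightarrow> 'd point) set" where
  "face_vpoly k F = (\<lambda>p. restrict p F) ` vpoly_upto k"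

definition U_space :: "nat \<Rightarrow> 'd::finite mesh \<Rightarrow> 'd hho set" where
  "U_space k M = (\<Pi>\<^sub>E T\<in>elems M. vpoly_upto k) \<times> (\<Pi>\<^sub>E F\<in>faces M. face_vpoly k F)"

definition UD_space :: "nat \<Rightarrow> 'd::finite point set \<Rightarrow> 'd mesh \<Rightarrow> 'd hho set" where
  "UD_space k \<Omega> M = {v \<in> U_space k M. \<forall>F\<in>boundary_faces \<Omega> M. \<forall>x\<in>F. snd v F x = 0}"

definition broken_poly :: "nat \<Rightarrow> 'd::finite mesh \<Rightarrow> 'd broken set" where
  "broken_poly k M = (\<Pi>\<^sub>E T\<in>elems M. poly_upto k)"

definition glue :: "'d::finite mesh \<Rightarrow> ('d point set \<Rightarrow> 'd point \<Rightarrow> 'b::euclidean_space) \<Rightarrow> 'd point \<Rightarrow> 'b" where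
  "glue M v x = (\<Sum>T\<in>elems M. indicat_real T x *\<^sub>R v T x)"

definition P_space :: "nat \<Rightarrow> real \<Rightarrow> 'd::finite point set \<Rightarrow> 'd mesh \<Rightarrow> 'd broken set" where
  "P_space k C0 \<Omega> M = (if C0 > 0 then broken_poly k M
     else {q \<in> broken_poly k M. (LINT x|lebesgue_on \<Omega>. glue M q x) = 0})"


subsection \<open>Elasticity operator\<close>

definition sym_grad_rec :: "nat \<Rightarrow> 'd::finite mesh \<Rightarrow> 'd point set \<Rightarrow> 'd hho \<Rightarrow> 'd point \<Rightarrow> 'd tensor" where
  "sym_grad_rec k M T v = (THE G. G \<in> stpoly_upto k \<and> (\<forall>\<tau>\<in>stpoly_upto k.
     (LINT x|lebesgue_on T. G x \<bullet> \<tau> x) =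
       - (LINT x|lebesgue_on T. fst v T x \<bullet> tensor_div \<tau> x)
       + (\<Sum>F\<in>faces_of M T. LINT x|face_measure F. snd v F x \<bullet> (\<tau> x *v normal_out T F))))"

text \<open>The indices are not ordered here: the last condition is antisymmetric in \<open>i\<close> and
  \<open>j\<close>, so that imposing it for \<open>i \<noteq> j\<close> amounts to imposing it for \<open>i < j\<close>.\<close>

definition disp_rec :: "nat \<Rightarrow> 'd::finite mesh \<Rightarrow> 'd point set \<Rightarrow> 'd hho \<Rightarrow> 'd point \<Rightarrow> 'd point" where
  "disp_rec k M T v = (THE r. r \<in> vpoly_upto (k + 1) \<and>
     (\<forall>w\<in>vpoly_upto (k + 1).
        (LINT x|lebesgue_on T. (sym_grad r x - sym_grad_rec k M T v x) \<bullet> sym_grad w x) = 0) \<and>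
     (LINT x|lebesgue_on T. r x) = (LINT x|lebesgue_on T. fst v T x) \<and>
     (\<forall>i j. i \<noteq> j \<longrightarrow>
        (LINT x|lebesgue_on T. pdiff i r x $ j - pdiff j r x $ i) =
        (\<Sum>F\<in>faces_of M T. LINT x|face_measure F.
           normal_out T F $ i * snd v F x $ j - normal_out T F $ j * snd v F x $ i)))"

definition proj_elem :: "nat \<Rightarrow> 'd::finite point set \<Rightarrow> ('d point \<Rightarrow> 'd point) \<Rightarrow> 'd point \<Rightarrow> 'd point" where
  "proj_elem k T w x = (\<chi> i. l2_proj (poly_upto k) (lebesgue_on T) (\<lambda>y. w y $ i) x)"

definition proj_face :: "nat \<Rightarrow> 'd::finite point set \<Rightarrow> ('d point \<Rightarrow> 'd point) \<Rightarrow> 'd point \<Rightarrow> 'd point" where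
  "proj_face k F w x = (\<chi> i. l2_proj (face_poly k F) (face_measure F) (\<lambda>y. w y $ i) x)"

definition face_residual ::
  "nat \<Rightarrow> 'd::finite mesh \<Rightarrow> 'd point set \<Rightarrow> 'd point set \<Rightarrow> 'd hho \<Rightarrow> 'd point \<Rightarrow> 'd point" where
  "face_residual k M T F v x =
     proj_face k F (\<lambda>y. disp_rec k M T v y - snd v F y) x
     - proj_elem k T (\<lambda>y. disp_rec k M T v y - fst v T y) x"

definition a_h ::
  "nat \<Rightarrow> ('d::finite point \<Rightarrow> 'd tensor \<Rightarrow> 'd tensor) \<Rightarrow> real \<Rightarrow> 'd mesh \<Rightarrow> 'd hho \<Rightarrow> 'd hho \<Rightarrow> real" where
  "a_h k \<sigma> \<gamma> M w v = (\<Sum>T\<in>elems M.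
     (LINT x|lebesgue_on T. \<sigma> x (sym_grad_rec k M T w x) \<bullet> sym_grad_rec k M T v x)
     + (\<Sum>F\<in>faces_of M T. \<gamma> / diameter F *
         (LINT x|face_measure F. face_residual k M T F w x \<bullet> face_residual k M T F v x)))"


subsection \<open>Coupling and Darcy operators\<close>

definition b_h :: "'d::finite mesh \<Rightarrow> 'd hho \<Rightarrow> 'd broken \<Rightarrow> real" where
  "b_h M v q = (\<Sum>T\<in>elems M.
     (LINT x|lebesgue_on T. fst v T x \<bullet> grad (q T) x)
     - (\<Sum>F\<in>faces_of M T. LINT x|face_measure F. (snd v F x \<bullet> normal_out T F) * q T x))"

definition const_value :: "('d::finite point \<Rightarrow> 'd tensor) \<Rightarrow> 'd point set \<Rightarrow> 'd tensor" where
  "const_value \<kappa> T = (THE K. \<forall>x\<in>T. \<kappa> x = K)"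

definition normal_perm :: "('d::finite point \<Rightarrow> 'd tensor) \<Rightarrow> 'd point set \<Rightarrow> 'd point set \<Rightarrow> real" where
  "normal_perm \<kappa> T F = (const_value \<kappa> T *v normal_out T F) \<bullet> normal_out T F"

definition face_perm :: "('d::finite point \<Rightarrow> 'd tensor) \<Rightarrow> 'd mesh \<Rightarrow> 'd point set \<Rightarrow> real" where
  "face_perm \<kappa> M F =
     (let k1 = normal_perm \<kappa> (side1 M F) F; k2 = normal_perm \<kappa> (side2 M F) F
      in 2 * k1 * k2 / (k1 + k2))"

definition jump :: "'d::finite mesh \<Rightarrow> 'd point set \<Rightarrow> 'd broken \<Rightarrow> 'd point \<Rightarrow> real" where
  "jump M F q x = q (side1 M F) x - q (side2 M F) x"

definition waverage ::
  "('d::finite point \<Rightarrow> 'd tensor) \<Rightarrow> 'd mesh \<Rightarrow> 'd point set \<Rightarrow>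
    ('d point set \<Rightarrow> 'd point \<Rightarrow> 'b::real_vector) \<Rightarrow> 'd point \<Rightarrow> 'b" where
  "waverage \<kappa> M F q x =
     (let s1 = sqrt (normal_perm \<kappa> (side1 M F) F); s2 = sqrt (normal_perm \<kappa> (side2 M F) F)
      in (s2 / (s1 + s2)) *\<^sub>R q (side1 M F) x + (s1 / (s1 + s2)) *\<^sub>R q (side2 M F) x)"

definition darcy_flux :: "('d::finite point \<Rightarrow> 'd tensor) \<Rightarrow> 'd broken \<Rightarrow> 'd point set \<Rightarrow> 'd point \<Rightarrow> 'd point" where
  "darcy_flux \<kappa> q T x = const_value \<kappa> T *v grad (q T) x"

definition broken_grad :: "'d::finite mesh \<Rightarrow> 'd broken \<Rightarrow> 'd point \<Rightarrow> 'd point" where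
  "broken_grad M q = glue M (\<lambda>T. grad (q T))"

definition c_h ::
  "('d::finite point \<Rightarrow> 'd tensor) \<Rightarrow> real \<Rightarrow> 'd point set \<Rightarrow> 'd mesh \<Rightarrow> 'd broken \<Rightarrow> 'd broken \<Rightarrow> real" where
  "c_h \<kappa> \<zeta> \<Omega> M r q =
     (LINT x|lebesgue_on \<Omega>. (\<kappa> x *v broken_grad M r x) \<bullet> broken_grad M q x)
     + (\<Sum>F\<in>internal_faces M. \<zeta> * face_perm \<kappa> M F / diameter F *
         (LINT x|face_measure F. jump M F r x * jump M F q x))
     - (\<Sum>F\<in>internal_faces M. LINT x|face_measure F.
         (jump M F r x *\<^sub>R waverage \<kappa> M F (darcy_flux \<kappa> q) x
          + jump M F q x *\<^sub>R waverage \<kappa> M F (darcy_flux \<kappa> r) x) \<bullet> normal_out (side1 M F) F)"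

text \<open>The first sum is that of the squared norms of \<open>\<kappa>\<^sup>1\<^sup>/\<^sup>2 \<nabla>q\<^sub>T\<close>: the matrix
  \<open>\<kappa>\<^sup>1\<^sup>/\<^sup>2\<close> is symmetric with square \<open>\<kappa>\<close>.\<close>

definition kappa_norm_sq :: "('d::finite point \<Rightarrow> 'd tensor) \<Rightarrow> 'd mesh \<Rightarrow> 'd broken \<Rightarrow> real" where
  "kappa_norm_sq \<kappa> M q =
     (\<Sum>T\<in>elems M. LINT x|lebesgue_on T. (\<kappa> x *v grad (q T) x) \<bullet> grad (q T) x)
     + (\<Sum>F\<in>internal_faces M. face_perm \<kappa> M F / diameter F * (LINT x|face_measure F. (jump M F q x)\<^sup>2))"


subsection \<open>Discrete problem\<close>

definition bdiff :: "real \<Rightarrow> ('a \<Rightarrow> 'b \<Rightarrow> 'c::real_vector) \<Rightarrow> ('a \<Rightarrow> 'b \<Rightarrow> 'c) \<Rightarrow> 'a \<Rightarrow> 'b \<Rightarrow> 'c" where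
  "bdiff \<tau> u v = (\<lambda>X x. (1 / \<tau>) *\<^sub>R (u X x - v X x))"

definition bdiff_hho :: "real \<Rightarrow> 'd::finite hho \<Rightarrow> 'd hho \<Rightarrow> 'd hho" where
  "bdiff_hho \<tau> u v = (bdiff \<tau> (fst u) (fst v), bdiff \<tau> (snd u) (snd v))"

text \<open>This is the contribution of the two difference quotients to the mass balance. There is no
  discrete solution at step \<open>0\<close>: there, the initial datum tested against \<open>q\<close> stands for
  the fluid content.\<close>

definition content_rate ::
  "real \<Rightarrow> ('d::finite point \<Rightarrow> real) \<Rightarrow> 'd point set \<Rightarrow> 'd mesh \<Rightarrow> real \<Rightarrow>
    (nat \<Rightarrow> 'd hho \<times> 'd broken) \<Rightarrow> nat \<Rightarrow> 'd broken \<Rightarrow> real" where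
  "content_rate C0 \<phi>0 \<Omega> M \<tau> s n q =
     (if n = 1 then
        (C0 * l2_prod \<Omega> (glue M (snd (s 1))) (glue M q) - b_h M (fst (s 1)) q
           - l2_prod \<Omega> \<phi>0 (glue M q)) / \<tau>
      else
        C0 * l2_prod \<Omega> (glue M (bdiff \<tau> (snd (s n)) (snd (s (n - 1))))) (glue M q)
          - b_h M (bdiff_hho \<tau> (fst (s n)) (fst (s (n - 1)))) q)"

definition discrete_problem ::
  "nat \<Rightarrow> ('d::finite point \<Rightarrow> 'd tensor \<Rightarrow> 'd tensor) \<Rightarrow> real \<Rightarrow> real \<Rightarrow>
    ('d point \<Rightarrow> 'd tensor) \<Rightarrow> real \<Rightarrow> (real \<Rightarrow> 'd point \<Rightarrow> 'd point) \<Rightarrow> (real \<Rightarrow> 'd point \<Rightarrow> real) \<Rightarrow>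
    ('d point \<Rightarrow> real) \<Rightarrow> 'd point set \<Rightarrow> 'd mesh \<Rightarrow> real \<Rightarrow> nat \<Rightarrow>
    (nat \<Rightarrow> 'd hho \<times> 'd broken) \<Rightarrow> bool" where
  "discrete_problem k \<sigma> \<gamma> C0 \<kappa> \<zeta> f g \<phi>0 \<Omega> M tF N s \<longleftrightarrow>
     (let \<tau> = tF / real N in
      \<forall>n\<in>{1..N}. \<forall>v\<in>UD_space k \<Omega> M. \<forall>q\<in>broken_poly k M.
        a_h k \<sigma> \<gamma> M (fst (s n)) v + b_h M v (snd (s n))
          = l2_prod \<Omega> (time_mean \<tau> f n) (glue M (fst v)) \<and>
        content_rate C0 \<phi>0 \<Omega> M \<tau> s n q + c_h \<kappa> \<zeta> \<Omega> M (snd (s n)) q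
          = l2_prod \<Omega> (time_mean \<tau> g n) (glue M q))"

end

theory Submission
  imports Defs "HOL-Homology.Homology" "HOL-Library.Function_Algebras"
begin

text \<open>Each time step is a square nonlinear system in a finite-dimensional space, and it has exactly
  one solution because it is strictly monotone and coercive. After multiplication of the mass
  balance by \<open>\<tau>\<close>, step \<open>n\<close> asks for \<open>x = (u, p)\<close> such that, for all
  \<open>y = (v, q)\<close>, \<open>\<Phi>(x, y)\<close> takes a prescribed value, linear in \<open>y\<close> and
  determined by the data and by step \<open>n - 1\<close>, where
  \<open>\<Phi>(x, y) = a(u, v) + b(v, p) + C0 (p, q) - b(u, q) + \<tau> c(p, q)\<close>. The coupling
  terms cancel for \<open>y = x\<close> and in \<open>\<Phi>(x, x - x') - \<Phi>(x', x - x')\<close>, so that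
  coercivity and monotonicity come from those of the stress, of the stabilization and of the Darcy
  form (\<open>step_form_coercive\<close>, \<open>step_form_monotone\<close>). The equations are solved in
  \<open>monotone_coercive_problem_solvable\<close>: in suitable coordinates the map from \<open>x\<close> to
  \<open>\<Phi>(x, \<cdot>)\<close> is continuous and injective, hence open by invariance of domain, and
  coercivity makes its image closed; so the image is everything. Continuity follows from the
  Caratheodory and growth conditions by dominated convergence (\<open>stress_continuous\<close>).

  What remains is definiteness. For the pressure, the Darcy form controls all gradients and jumps,
  and the elements are connected through faces, so that only constants are left; these are excluded
  by the mass term if \<open>C0 > 0\<close> and by the zero mean otherwise (\<open>definite_P\<close>). For the
  displacement, assume that all strains and all face residuals of \<open>v\<close> vanish. The
  displacement reconstruction \<open>r\<close> is then a rigid motion. As \<open>k \<ge> 1\<close>, the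
  projections leave \<open>r\<close> unchanged, and the residual reduces to the difference of the element
  and face unknowns; these therefore agree on every face. Integration by parts in the definition of
  the strain now shows that the symmetric gradient of the element unknown vanishes as well, so that
  this unknown is rigid. A rigid motion that vanishes on a piece of a hyperplane is zero, hence the zero
  boundary values spread from a boundary face to all elements (\<open>global_rigidity\<close>).

  Integration by parts requires the divergence theorem on an element that is only star-shaped with
  respect to a ball. Such an element is, up to a null set, the disjoint union of the cones over its
  faces with apex any point \<open>y\<close> of the ball. Along the rays from \<open>y\<close>, the integral over
  such a cone of \<open>d f + \<nabla>f \<cdot> (x - y)\<close> becomes the integral of \<open>f\<close> over the
  face times the distance from \<open>y\<close> to its hyperplane (\<open>integral_cone\<close>). The difference
  of these formulas for two apices is the divergence theorem (\<open>divergence_theorem\<close>). The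
  geometric arguments rest on one fact: the relative boundaries of all faces are covered by finitely
  many affine subspaces of codimension two (\<open>submesh_thin_family\<close>), which a generic
  segment avoids.

  If \<open>C0 = 0\<close>, the mass balance is tested with all broken polynomials although the pressures
  have zero mean. Testing with a constant gives \<open>0 = 0\<close>: the forms \<open>b\<close> and \<open>c\<close>
  vanish on constants, and the data have zero mean (\<open>mass_balance_all\<close>).\<close>

section \<open>Monotone problems in finite dimension\<close>

text \<open>Functions form a real vector space, so that the spaces of discrete unknowns, which
  consist of families of functions, are subspaces of one ambient type.\<close>

instantiation "fun" :: (type, scaleR) scaleR
begin
definition "c *\<^sub>R f = (\<lambda>x. c *\<^sub>R f x)"
instance ..
end

lemma scaleR_fun_apply [simp]: "(c *\<^sub>R f) x = c *\<^sub>R f x"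
  by (simp add: scaleR_fun_def)

instance "fun" :: (type, real_vector) real_vector
  by standard (simp_all add: fun_eq_iff scaleR_add_right scaleR_add_left)

lemma sum_fun_apply [simp]: "(\<Sum>i\<in>I. f i) x = (\<Sum>i\<in>I. f i x)"
  by (induction I rule: infinite_finite_induct) auto

text \<open>The domain is explicit because the reconstructions are linear only on piecewise
  polynomial unknowns: they are defined by a definite description that has no meaning
  elsewhere.\<close>

definition lin_on :: "'a::real_vector set \<Rightarrow> ('a \<Rightarrow> 'b::real_vector) \<Rightarrow> bool" where
  "lin_on S f \<longleftrightarrow> (\<forall>x\<in>S. \<forall>y\<in>S. f (x + y) = f x + f y) \<and> (\<forall>c. \<forall>x\<in>S. f (c *\<^sub>R x) = c *\<^sub>R f x)"

definition bilin_on :: "'a::real_vector set \<Rightarrow> ('a \<Rightarrow> 'a \<Rightarrow> real) \<Rightarrow> bool" where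
  "bilin_on S B \<longleftrightarrow> (\<forall>x\<in>S. lin_on S (B x)) \<and> (\<forall>y\<in>S. lin_on S (\<lambda>x. B x y))"

definition psd_on :: "'a::real_vector set \<Rightarrow> ('a \<Rightarrow> 'a \<Rightarrow> real) \<Rightarrow> bool" where
  "psd_on S E \<longleftrightarrow> bilin_on S E \<and> (\<forall>x\<in>S. \<forall>y\<in>S. E x y = E y x) \<and> (\<forall>x\<in>S. 0 \<le> E x x)"

definition fin_dim :: "'a::real_vector set \<Rightarrow> bool" where
  "fin_dim S \<longleftrightarrow> (\<exists>B. finite B \<and> S \<subseteq> span B)"

lemma lin_on_add: "lin_on S f \<Longrightarrow> x \<in> S \<Longrightarrow> y \<in> S \<Longrightarrow> f (x + y) = f x + f y"
  and lin_on_scale: "lin_on S f \<Longrightarrow> x \<in> S \<Longrightarrow> f (c *\<^sub>R x) = c *\<^sub>R f x"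
  by (simp_all add: lin_on_def)

lemma lin_on_0: "lin_on S f \<Longrightarrow> subspace S \<Longrightarrow> f 0 = 0"
  using lin_on_scale[of S f 0 0] by (simp add: subspace_0)

lemma lin_on_diff: "lin_on S f \<Longrightarrow> subspace S \<Longrightarrow> x \<in> S \<Longrightarrow> y \<in> S \<Longrightarrow> f (x - y) = f x - f y"
  using lin_on_add[of S f x "(-1) *\<^sub>R y"] lin_on_scale[of S f y "-1"] subspace_scale[of S y "-1"]
  by simp

lemma lin_on_sum:
  assumes "lin_on S f" "subspace S" "\<And>i. i \<in> I \<Longrightarrow> x i \<in> S"
  shows "f (\<Sum>i\<in>I. c i *\<^sub>R x i) = (\<Sum>i\<in>I. c i *\<^sub>R f (x i))"
  using assms(3)
proof (induction I rule: infinite_finite_induct)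
  case (insert i I)
  then have "(\<Sum>i\<in>I. c i *\<^sub>R x i) \<in> S" "c i *\<^sub>R x i \<in> S"
    using assms(2) by (auto intro!: subspace_sum subspace_scale)
  then show ?case using insert assms(1) by (simp add: lin_on_add lin_on_scale)
qed (auto simp: lin_on_0[OF assms(1,2)])

lemma bilin_onD: "bilin_on S B \<Longrightarrow> x \<in> S \<Longrightarrow> lin_on S (B x)"
   "bilin_on S B \<Longrightarrow> y \<in> S \<Longrightarrow> lin_on S (\<lambda>x. B x y)"
  by (simp_all add: bilin_on_def)

definition orthonormal :: "('a \<Rightarrow> 'a \<Rightarrow> real) \<Rightarrow> 'a set \<Rightarrow> bool" where
  "orthonormal E C \<longleftrightarrow> (\<forall>x\<in>C. \<forall>y\<in>C. E x y = (if x = y then 1 else 0))"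

text \<open>The form may be degenerate, so the remainder of the expansion is only a null vector,
  which need not be zero. Orthonormal systems are independent, hence one of maximal cardinality
  exists; normalizing a remainder that is not null would enlarge it.\<close>

lemma orthonormal_system_exists:
  assumes E: "psd_on S E" and S: "subspace S" "fin_dim S"
  shows "\<exists>C. finite C \<and> C \<subseteq> S \<and> orthonormal E C \<and>
    (\<forall>x\<in>S. E (x - (\<Sum>c\<in>C. E x c *\<^sub>R c)) (x - (\<Sum>c\<in>C. E x c *\<^sub>R c)) = 0)"
proof -
  have bl: "bilin_on S E" using E by (auto simp: psd_on_def)
  have sy: "E x y = E y x" if "x \<in> S" "y \<in> S" for x y using E that by (auto simp: psd_on_def)
  obtain B where B: "finite B" "S \<subseteq> span B" using S(2) by (auto simp: fin_dim_def)
  have sm: "E (\<Sum>c\<in>C. u c *\<^sub>R c) d = (if d \<in> C then u d else 0)" 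
    if "finite C" "C \<subseteq> S" "orthonormal E (insert d C)" "d \<in> S" for C u d
  proof -
    have "E (\<Sum>c\<in>C. u c *\<^sub>R c) d = (\<Sum>c\<in>C. u c *\<^sub>R E c d)"
      using lin_on_sum[OF bilin_onD(2)[OF bl that(4)] S(1), of C "\<lambda>c. c" u] that by auto
    also have "\<dots> = (\<Sum>c\<in>C. if c = d then u c else 0)"
      by (rule sum.cong) (use that in \<open>auto simp: orthonormal_def\<close>)
    finally show ?thesis using that by simp
  qed
  let ?P = "\<lambda>C. finite C \<and> C \<subseteq> S \<and> orthonormal E C"
  have bd: "card C \<le> card B" if C: "?P C" for C
  proof -
    have "independent C"
    proof (rule independent_if_scalars_zero)
      fix u x assume "(\<Sum>x\<in>C. u x *\<^sub>R x) = 0" and x: "x \<in> C"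
      moreover have "insert x C = C" using x by auto
      ultimately have "u x = E 0 x" using sm[of C x u] C by auto
      also have "\<dots> = 0" using lin_on_0[OF bilin_onD(2)[OF bl] S(1)] x C by auto
      finally show "u x = 0" .
    qed (use C in auto)
    then show ?thesis using independent_span_bound[OF B(1)] B(2) C by blast
  qed
  have P0: "?P {}" by (auto simp: orthonormal_def)
  have "\<exists>C. ?P C \<and> (\<forall>D. ?P D \<longrightarrow> card D \<le> card C)"
  proof (rule ex_has_greatest_nat[of ?P "{}" card "Suc (card B)"])
    show "?P {}" by (rule P0)
    show "\<forall>D. ?P D \<longrightarrow> card D < Suc (card B)" using bd less_Suc_eq_le by blast
  qed
  then obtain C where C: "?P C" "\<And>D. ?P D \<Longrightarrow> card D \<le> card C" by blast
  have "E (x - (\<Sum>c\<in>C. E x c *\<^sub>R c)) (x - (\<Sum>c\<in>C. E x c *\<^sub>R c)) = 0" if x: "x \<in> S" for x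
  proof (rule ccontr)
    define z where "z = x - (\<Sum>c\<in>C. E x c *\<^sub>R c)"
    have sS: "(\<Sum>c\<in>C. E x c *\<^sub>R c) \<in> S" using C S by (auto intro!: subspace_sum subspace_scale)
    have zS: "z \<in> S" unfolding z_def using sS x S by (auto intro: subspace_diff)
    assume "E (x - (\<Sum>c\<in>C. E x c *\<^sub>R c)) (x - (\<Sum>c\<in>C. E x c *\<^sub>R c)) \<noteq> 0"
    then have pos: "E z z > 0" using E zS by (auto simp: psd_on_def z_def[symmetric] less_le)
    have zd: "E z d = 0" if d: "d \<in> C" for d
    proof -
      have "insert d C = C" using d by auto
      then have "E (\<Sum>c\<in>C. E x c *\<^sub>R c) d = E x d" using sm[of C d "E x"] C d by auto
      then show ?thesis unfolding z_def
        using lin_on_diff[OF bilin_onD(2)[OF bl, of d] S(1) x sS] C d by auto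
    qed
    define w where "w = (1 / sqrt (E z z)) *\<^sub>R z"
    have wS: "w \<in> S" unfolding w_def using zS S by (auto intro: subspace_scale)
    have wy: "E w y = (1 / sqrt (E z z)) * E z y" if "y \<in> S" for y
      unfolding w_def using lin_on_scale[OF bilin_onD(2)[OF bl that] zS] by simp
    have zw: "E z w = (1 / sqrt (E z z)) * E z z"
      unfolding w_def using lin_on_scale[OF bilin_onD(1)[OF bl zS] zS] by simp
    have ww: "E w w = 1" using wy[OF wS] zw pos by (simp add: real_div_sqrt divide_simps)
    have wd: "E w d = 0" "E d w = 0" if "d \<in> C" for d
      using wy[of d] zd[OF that] C that sy[of d w] wS by auto
    have wC: "w \<notin> C" using wd(1)[of w] ww by auto
    have "orthonormal E C" using C(1) by blast
    then have "orthonormal E (insert w C)" using ww wd wC by (auto simp: orthonormal_def)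
    then have "card (insert w C) \<le> card C" by (intro C(2)) (use C(1) wS in auto)
    then show False using C(1) wC by simp
  qed
  then show ?thesis using C by blast
qed

text \<open>Riesz representation for a possibly degenerate form. Degeneracy is essential for the
  displacement reconstruction, where the form is the product of symmetric gradients and has the
  rigid motions as kernel.\<close>

lemma riesz_on:
  assumes E: "psd_on S E" and S: "subspace S" "fin_dim S" and l: "lin_on S l"
    and ker: "\<And>x. x \<in> S \<Longrightarrow> E x x = 0 \<Longrightarrow> l x = 0"
  shows "\<exists>x\<in>S. \<forall>y\<in>S. E x y = l y"
proof -
  have bl: "bilin_on S E" using E by (auto simp: psd_on_def)
  obtain C where C: "finite C" "C \<subseteq> S" "orthonormal E C"
    "\<And>x. x\<in>S \<Longrightarrow> E (x - (\<Sum>c\<in>C. E x c *\<^sub>R c)) (x - (\<Sum>c\<in>C. E x c *\<^sub>R c)) = 0"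
    using orthonormal_system_exists[OF E S] by blast
  let ?x = "\<Sum>c\<in>C. l c *\<^sub>R c"
  have xS: "?x \<in> S" using C S by (auto intro!: subspace_sum subspace_scale)
  have "E ?x y = l y" if y: "y \<in> S" for y
  proof -
    let ?s = "\<Sum>c\<in>C. E y c *\<^sub>R c"
    have sS: "?s \<in> S" using C S by (auto intro!: subspace_sum subspace_scale)
    have "l (y - ?s) = 0" by (rule ker) (use C y sS S in \<open>auto intro: subspace_diff\<close>)
    then have "l y = l ?s" using lin_on_diff[OF l S(1) y sS] by simp
    also have "\<dots> = (\<Sum>c\<in>C. E y c *\<^sub>R l c)" using lin_on_sum[OF l S(1), of C "\<lambda>c. c"] C by auto
    also have "\<dots> = (\<Sum>c\<in>C. l c *\<^sub>R E c y)"
      by (rule sum.cong) (use E C y in \<open>auto simp: psd_on_def subset_iff\<close>)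
    also have "\<dots> = E ?x y"
      using lin_on_sum[OF bilin_onD(2)[OF bl y] S(1), of C "\<lambda>c. c" l] C(2) by (simp add: subset_iff)
    finally show ?thesis by simp
  qed
  with xS show ?thesis by blast
qed

text \<open>The type \<open>nat \<Rightarrow> real\<close> with coordinates vanishing from
  \<open>m\<close> on serves as Euclidean space of dimension \<open>m\<close>, since
  \<open>m\<close> is not known at the level of types. Compactness is Tychonoff.\<close>

lemma compact_coordinate_box:
  "compact {c :: nat \<Rightarrow> real. (\<forall>i<m. \<bar>c i\<bar> \<le> R) \<and> (\<forall>i\<ge>m. c i = 0)}"
proof -
  have "compactin (product_topology (\<lambda>i::nat. euclidean) UNIV)
          (PiE UNIV (\<lambda>i. if i < m then {-R..R} else {0::real}))"
    by (subst compactin_PiE) auto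
  moreover have "(PiE UNIV (\<lambda>i. if i < m then {-R..R} else {0::real})) =
      {c :: nat \<Rightarrow> real. (\<forall>i<m. \<bar>c i\<bar> \<le> R) \<and> (\<forall>i\<ge>m. c i = 0)}" (is "?A = ?B")
  proof -
    have "c \<in> ?A \<longleftrightarrow> (\<forall>i. if i < m then \<bar>c i\<bar> \<le> R else c i = 0)" for c
    proof -
      have "c i \<in> (if i < m then {-R..R} else {0}) \<longleftrightarrow> (if i < m then \<bar>c i\<bar> \<le> R else c i = 0)" for i
        by auto
      then show ?thesis unfolding PiE_UNIV_domain Pi_iff by blast
    qed
    then have "?A = {c. \<forall>i. if i < m then \<bar>c i\<bar> \<le> R else c i = 0}" unfolding set_eq_iff by (simp only: mem_Collect_eq simp_thms)
    also have "\<dots> = ?B" by (intro Collect_cong) (metis not_less)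
    finally show ?thesis .
  qed
  ultimately show ?thesis by (simp add: euclidean_product_topology)
qed

lemma tendsto_coordinate:
  fixes c :: "nat \<Rightarrow> nat \<Rightarrow> real"
  assumes "c \<longlonglongrightarrow> c'"
  shows "(\<lambda>n. c n i) \<longlonglongrightarrow> c' i"
  by (rule continuous_on_tendsto_compose[OF continuous_on_product_coordinates assms]) auto

text \<open>The image is open by invariance of domain. It is closed because coercivity gives
  \<open>\<bar>c\<bar> \<le> \<bar>f c\<bar>\<close>: preimages of a convergent sequence stay in a
  compact box. A nonempty clopen subset of a connected space is the whole space.\<close>

lemma coercive_injective_surj:
  fixes f :: "(nat \<Rightarrow> real) \<Rightarrow> nat \<Rightarrow> real" and m :: nat
  defines "X \<equiv> {c. \<forall>i\<ge>m. c i = 0}"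
  assumes cont: "continuous_on X f" and f: "f ` X \<subseteq> X" and inj: "inj_on f X"
    and coercive: "\<And>c. c \<in> X \<Longrightarrow> (\<Sum>i<m. (c i)\<^sup>2) \<le> (\<Sum>i<m. f c i * c i)"
  shows "f ` X = X"
proof -
  have top: "Euclidean_space m = top_of_set X"
    by (simp add: Euclidean_space_def X_def euclidean_product_topology)
  have bound: "(\<Sum>i<m. (c i)\<^sup>2) \<le> (\<Sum>i<m. (f c i)\<^sup>2)" if "c \<in> X" for c
  proof -
    have "(\<Sum>i<m. 2 * (f c i * c i)) \<le> (\<Sum>i<m. (f c i)\<^sup>2 + (c i)\<^sup>2)"
      by (rule sum_mono) (use sum_squares_bound in \<open>simp add: mult.assoc\<close>)
    then show ?thesis using coercive[OF that] by (simp add: sum.distrib sum_distrib_left[symmetric])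
  qed
  have op: "openin (top_of_set X) (f ` X)"
    using invariance_of_domain_Euclidean_space[of m X f] cont f inj
    by (simp add: top continuous_map_in_subtopology image_subset_iff_funcset subtopology_subtopology)
  have closed_X: "closed X" 
    using closedin_Euclidean_space[of m] by (simp add: topspace_Euclidean_space X_def euclidean_product_topology)
  have "closed (f ` X)"
    unfolding closed_sequential_limits
  proof (intro allI impI, elim conjE)
    fix d l assume d: "\<forall>n. d n \<in> f ` X" and dl: "d \<longlonglongrightarrow> l"
    have "\<forall>n. \<exists>c. c \<in> X \<and> d n = f c" using d by blast
    from choice[OF this] obtain c where c: "\<And>n. c n \<in> X" "\<And>n. d n = f (c n)" by blast
    have di: "(\<lambda>n. d n i) \<longlonglongrightarrow> l i" for i
      by (rule tendsto_coordinate[OF dl])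
    have "(\<lambda>n. \<Sum>i<m. (d n i)\<^sup>2) \<longlonglongrightarrow> (\<Sum>i<m. (l i)\<^sup>2)"
      by (intro tendsto_intros di)
    from bounded_imp_bdd_above[OF convergent_imp_bounded[OF this]]
    obtain K where K: "\<And>n. (\<Sum>i<m. (d n i)\<^sup>2) \<le> K"
      unfolding bdd_above_def by auto
    have "c n \<in> {c. (\<forall>i<m. \<bar>c i\<bar> \<le> sqrt K) \<and> (\<forall>i\<ge>m. c i = 0)}" for n
    proof -
      have "(c n i)\<^sup>2 \<le> K" if "i < m" for i
        using member_le_sum[of i "{..<m}" "\<lambda>i. (c n i)\<^sup>2"] bound[OF c(1)[of n]] K[of n] c(2)[of n] that
        by auto
      then show ?thesis using c(1)[of n] by (auto simp: X_def intro: real_le_rsqrt)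
    qed
    then obtain x r where r: "strict_mono r" "(c \<circ> r) \<longlonglongrightarrow> x"
      using compact_coordinate_box[of m "sqrt K"] unfolding compact_eq_seq_compact_metric
      by (elim seq_compactE[where f = c]) auto
    have xX: "x \<in> X" using closed_sequentially[OF closed_X _ r(2)] c(1) by auto
    have "(\<lambda>n. f ((c \<circ> r) n)) \<longlonglongrightarrow> f x"
      using cont xX r(2) c(1) unfolding continuous_on_sequentially by (auto simp: comp_def)
    moreover have "(\<lambda>n. f ((c \<circ> r) n)) \<longlonglongrightarrow> l"
      using LIMSEQ_subseq_LIMSEQ[OF dl r(1)] c(2) by (simp add: comp_def)
    ultimately show "l \<in> f ` X" using LIMSEQ_unique xX by blast
  qed
  then have cl: "closedin (top_of_set X) (f ` X)"
    using f by (simp add: closed_subset)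
  have "connected X"
    using connected_Euclidean_space[of m] connectedin_def[of euclidean X] by (simp add: top)
  moreover have "(\<lambda>_. 0) \<in> X" by (simp add: X_def)
  ultimately show ?thesis using op cl unfolding connected_clopen by blast
qed

text \<open>The form \<open>B\<close> provides a lower bound and coordinates: the basis is
  orthonormal for its symmetric part, which has the same diagonal. Continuity is required along
  sequences of coordinates, which avoids a topology on the abstract space \<open>S\<close>.\<close>

theorem monotone_coercive_problem_solvable:
  fixes \<Phi> :: "'a::real_vector \<Rightarrow> 'a \<Rightarrow> real"
  assumes S: "subspace S" "fin_dim S"
    and B: "bilin_on S B" "\<And>x. x \<in> S \<Longrightarrow> x \<noteq> 0 \<Longrightarrow> B x x > 0"
    and lin: "\<And>x. x \<in> S \<Longrightarrow> lin_on S (\<Phi> x)"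
    and coercive: "\<And>x. x \<in> S \<Longrightarrow> B x x \<le> \<Phi> x x"
    and mono: "\<And>x y. x \<in> S \<Longrightarrow> y \<in> S \<Longrightarrow> x \<noteq> y \<Longrightarrow> \<Phi> y (x - y) < \<Phi> x (x - y)"
    and cont: "\<And>(m::nat) b c c' y. (\<And>i. i < m \<Longrightarrow> b i \<in> S) \<Longrightarrow> y \<in> S \<Longrightarrow>
       (\<And>i. i < m \<Longrightarrow> (\<lambda>n::nat. c n i) \<longlonglongrightarrow> c' i) \<Longrightarrow>
       (\<lambda>n. \<Phi> (\<Sum>i<m. c n i *\<^sub>R b i) y) \<longlonglongrightarrow> \<Phi> (\<Sum>i<m. c' i *\<^sub>R b i) y"
    and l: "lin_on S l"
  shows "\<exists>!x. x \<in> S \<and> (\<forall>y\<in>S. \<Phi> x y = l y)"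
proof -
  (* the symmetric part of B, an inner product on S *)
  define E where "E x y = (B x y + B y x) / 2" for x y
  have E: "psd_on S E" 
  proof -
    have "bilin_on S E"
      using B(1) by (auto simp: bilin_on_def lin_on_def E_def field_simps)
    moreover have "0 \<le> E x x" if "x \<in> S" for x
      using B(2)[OF that] lin_on_0[OF bilin_onD(1)[OF B(1) that] S(1)] by (cases "x = 0") (auto simp: E_def)
    ultimately show ?thesis by (auto simp: psd_on_def E_def)
  qed
  then have bl: "bilin_on S E" by (simp add: psd_on_def)
  obtain C where C: "finite C" "C \<subseteq> S" "orthonormal E C"
    "\<And>x. x\<in>S \<Longrightarrow> E (x - (\<Sum>c\<in>C. E x c *\<^sub>R c)) (x - (\<Sum>c\<in>C. E x c *\<^sub>R c)) = 0"
    using orthonormal_system_exists[OF E S] by blast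
  have rep: "x = (\<Sum>c\<in>C. E x c *\<^sub>R c)" if "x \<in> S" for x
  proof -
    have "x - (\<Sum>c\<in>C. E x c *\<^sub>R c) \<in> S"
      using that C S by (auto intro!: subspace_diff subspace_sum subspace_scale)
    then show ?thesis using B(2)[of "x - (\<Sum>c\<in>C. E x c *\<^sub>R c)"] C(4)[OF that] by (auto simp: E_def)
  qed
  define m where "m = card C"
  obtain b where b: "bij_betw b {..<m} C"
    using ex_bij_betw_nat_finite[OF C(1)] by (auto simp: m_def atLeast0LessThan)
  have bS: "b i \<in> S" if "i < m" for i using b that C(2) by (auto simp: bij_betw_def)
  have bb: "E (b i) (b j) = (if i = j then 1 else 0)" if "i < m" "j < m" for i j
    using C(3) b that by (auto simp: orthonormal_def bij_betw_def inj_on_def)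
  have rep': "x = (\<Sum>i<m. E x (b i) *\<^sub>R b i)" if "x \<in> S" for x
    by (subst rep[OF that]) (rule sum.reindex_bij_betw[OF b, symmetric])
  define X where "X = {c :: nat \<Rightarrow> real. \<forall>i\<ge>m. c i = 0}"
  define x where "x c = (\<Sum>i<m. c i *\<^sub>R b i)" for c :: "nat \<Rightarrow> real"
  have xS: "x c \<in> S" for c unfolding x_def using bS S by (auto intro!: subspace_sum subspace_scale)
  have Ex: "E (x c) (b j) = c j" if "j < m" for c j
  proof -
    have "E (x c) (b j) = (\<Sum>i<m. c i *\<^sub>R E (b i) (b j))"
      unfolding x_def using lin_on_sum[OF bilin_onD(2)[OF bl bS[OF that]] S(1), of "{..<m}" b c] bS by auto
    also have "\<dots> = (\<Sum>i<m. if i = j then c i else 0)"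
      by (rule sum.cong) (use bb that in auto)
    finally show ?thesis using that by simp
  qed
  have Ell: "l (x c) = (\<Sum>i<m. c i * l (b i))" if "lin_on S l" for l c
    unfolding x_def using lin_on_sum[OF that S(1), of "{..<m}" b c] bS by auto
  (* the functional belonging to the point with coordinates c, in the dual coordinates *)
  define f where "f c = (\<lambda>i. if i < m then \<Phi> (x c) (b i) else 0)" for c
  have uniq: "x1 = x2" if "x1 \<in> S" "x2 \<in> S" "\<And>y. y\<in>S \<Longrightarrow> \<Phi> x1 y = \<Phi> x2 y" for x1 x2
    using mono[OF that(1,2)] that(3)[OF subspace_diff[OF S(1) that(1,2)]] by (cases "x1 = x2") auto
  have "f ` X = X"
    unfolding X_def
  proof (rule coercive_injective_surj; unfold X_def[symmetric])
    show "continuous_on X f"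
    proof (rule continuous_on_coordinatewise_then_product)
      fix i
      show "continuous_on X (\<lambda>c. f c i)"
      proof (cases "i < m")
        case True
        show ?thesis unfolding continuous_on_sequentially
        proof (intro allI impI ballI, elim conjE)
          fix c :: "nat \<Rightarrow> nat \<Rightarrow> real" and c' assume lim: "c \<longlonglongrightarrow> c'"
          have "(\<lambda>n. \<Phi> (\<Sum>i<m. c n i *\<^sub>R b i) (b i)) \<longlonglongrightarrow> \<Phi> (\<Sum>i<m. c' i *\<^sub>R b i) (b i)"
            by (rule cont) (use bS True tendsto_coordinate[OF lim] in auto)
          then show "((\<lambda>c. f c i) \<circ> c) \<longlonglongrightarrow> f c' i"
            using True by (simp add: f_def x_def comp_def)
        qed
      qed (simp add: f_def)
    qed
    show "f ` X \<subseteq> X" by (auto simp: f_def X_def)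
    show "inj_on f X"
    proof (rule inj_onI)
      fix c d assume cd: "c \<in> X" "d \<in> X" "f c = f d"
      have eq: "\<Phi> (x c) (b i) = \<Phi> (x d) (b i)" if "i < m" for i
        using fun_cong[OF cd(3), of i] that by (simp add: f_def)
      have "x c = x d"
      proof (rule uniq)
        fix y assume y: "y \<in> S"
        have yx: "y = x (\<lambda>i. E y (b i))" unfolding x_def using rep'[OF y] .
        show "\<Phi> (x c) y = \<Phi> (x d) y"
          by (subst (1 2) yx) (auto simp: eq Ell[OF lin[OF xS]] intro!: sum.cong)
      qed (auto simp: xS)
      then show "c = d" using Ex cd(1,2) by (auto simp: X_def fun_eq_iff) (metis not_less)
    qed
    fix c assume c: "c \<in> X"
    have "(\<Sum>i<m. (c i)\<^sup>2) = E (x c) (x c)"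
      by (subst Ell[OF bilin_onD(1)[OF bl xS]]) (simp add: Ex power2_eq_square)
    also have "\<dots> = B (x c) (x c)" by (simp add: E_def)
    also have "\<dots> \<le> \<Phi> (x c) (x c)" by (rule coercive[OF xS])
    also have "\<dots> = (\<Sum>i<m. f c i * c i)"
      by (subst Ell[OF lin[OF xS]]) (simp add: f_def mult.commute)
    finally show "(\<Sum>i<m. (c i)\<^sup>2) \<le> (\<Sum>i<m. f c i * c i)" .
  qed
  moreover have "(\<lambda>i. if i < m then l (b i) else 0) \<in> X" by (auto simp: X_def)
  ultimately have "(\<lambda>i. if i < m then l (b i) else 0) \<in> f ` X" by simp
  then obtain c where c: "c \<in> X" "f c = (\<lambda>i. if i < m then l (b i) else 0)" by auto
  have ci: "\<Phi> (x c) (b i) = l (b i)" if "i < m" for i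
    using fun_cong[OF c(2), of i] that by (simp add: f_def)
  have sol: "\<Phi> (x c) y = l y" if "y \<in> S" for y
  proof -
    have yx: "y = x (\<lambda>i. E y (b i))" unfolding x_def using rep'[OF that] .
    show ?thesis by (subst (1 2) yx) (auto simp: ci Ell[OF lin[OF xS]] Ell[OF l] intro!: sum.cong)
  qed
  show ?thesis
  proof (rule ex1I[of _ "x c"])
    show "x c \<in> S \<and> (\<forall>y\<in>S. \<Phi> (x c) y = l y)" using xS sol by blast
    fix z assume "z \<in> S \<and> (\<forall>y\<in>S. \<Phi> z y = l y)"
    then show "z = x c" using uniq[of z "x c"] xS sol by auto
  qed
qed

section \<open>Linear maps on a subspace\<close>

lemma lin_onI:
  assumes "\<And>x y. x \<in> S \<Longrightarrow> y \<in> S \<Longrightarrow> f (x + y) = f x + f y" "\<And>c x. x \<in> S \<Longrightarrow> f (c *\<^sub>R x) = c *\<^sub>R f x"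
  shows "lin_on S f"
  using assms by (simp add: lin_on_def)

text \<open>Introduction rules that prove linearity of an expression in the unknown by its syntactic
  structure.\<close>

named_theorems lin_intros

lemma lin_on_plus [lin_intros]: "lin_on S f \<Longrightarrow> lin_on S g \<Longrightarrow> lin_on S (\<lambda>x. f x + g x)"
  by (simp add: lin_on_def algebra_simps)
lemma lin_on_minus [lin_intros]: "lin_on S f \<Longrightarrow> lin_on S g \<Longrightarrow> lin_on S (\<lambda>x. f x - g x)"
  by (simp add: lin_on_def algebra_simps)
lemma lin_on_uminus [lin_intros]: "lin_on S f \<Longrightarrow> lin_on S (\<lambda>x. - f x)"
  by (simp add: lin_on_def)
lemma lin_on_sums [lin_intros]: "(\<And>i. i \<in> I \<Longrightarrow> lin_on S (f i)) \<Longrightarrow> lin_on S (\<lambda>x. \<Sum>i\<in>I. f i x)"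
  by (simp add: lin_on_def sum.distrib scaleR_sum_right)
lemma lin_on_bounded_linear: "bounded_linear h \<Longrightarrow> lin_on S f \<Longrightarrow> lin_on S (\<lambda>x. h (f x))"
  by (simp add: lin_on_def linear_add linear_scale bounded_linear.linear)
lemmas lin_on_comps [lin_intros] =
  lin_on_bounded_linear[OF bounded_linear_inner_left] lin_on_bounded_linear[OF bounded_linear_inner_right]
  lin_on_bounded_linear[OF bounded_linear_scaleR_left] lin_on_bounded_linear[OF bounded_linear_scaleR_right]
  lin_on_bounded_linear[OF bounded_linear_mult_left] lin_on_bounded_linear[OF bounded_linear_mult_right]
  lin_on_bounded_linear[OF bounded_linear_vec_nth]
lemma lin_on_mult_vec [lin_intros]: "lin_on S f \<Longrightarrow> lin_on S (\<lambda>x. A *v f x)"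
  for A :: "real^'n^'m"
  by (rule lin_on_bounded_linear[OF matrix_vector_mul_bounded_linear])
lemma lin_on_vec_mult [lin_intros]: "lin_on S f \<Longrightarrow> lin_on S (\<lambda>x. f x *v a)"
  for a :: "real^'n" and f :: "'z::real_vector \<Rightarrow> real^'n^'m"
  by (simp add: lin_on_def matrix_vector_mult_add_rdistrib scaleR_matrix_vector_assoc)
lemma lin_on_divide [lin_intros]: "lin_on S f \<Longrightarrow> lin_on S (\<lambda>x. f x / c :: real)"
  by (simp add: lin_on_def add_divide_distrib)
lemma lin_on_vec_lambda [lin_intros]: "(\<And>i. lin_on S (\<lambda>x. f x i)) \<Longrightarrow> lin_on S (\<lambda>x. \<chi> i. f x i)"
  by (simp add: lin_on_def vec_eq_iff)
lemma bilin_onI: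
  assumes "\<And>x. x \<in> S \<Longrightarrow> lin_on S (B x)" "\<And>y. y \<in> S \<Longrightarrow> lin_on S (\<lambda>x. B x y)"
  shows "bilin_on S B"
  using assms by (simp add: bilin_on_def)

lemma lin_on_integral:
  assumes "\<And>f. f \<in> V \<Longrightarrow> integrable \<mu> (H f)" "\<And>x. x \<in> space \<mu> \<Longrightarrow> lin_on V (\<lambda>f. H f x)" "subspace V"
  shows "lin_on V (\<lambda>f. LINT x|\<mu>. H f x :: 'b::{banach,second_countable_topology})"
proof (rule lin_onI)
  fix f g assume fg: "f \<in> V" "g \<in> V"
  have "(LINT x|\<mu>. H (f + g) x) = (LINT x|\<mu>. H f x + H g x)"
    by (rule Bochner_Integration.integral_cong) (use lin_on_add[OF assms(2)] fg in auto)
  then show "(LINT x|\<mu>. H (f + g) x) = (LINT x|\<mu>. H f x) + (LINT x|\<mu>. H g x)"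
    using assms(1) fg by simp
next
  fix c f assume f: "f \<in> V"
  have "(LINT x|\<mu>. H (c *\<^sub>R f) x) = (LINT x|\<mu>. c *\<^sub>R H f x)"
    by (rule Bochner_Integration.integral_cong) (use lin_on_scale[OF assms(2)] f in auto)
  then show "(LINT x|\<mu>. H (c *\<^sub>R f) x) = c *\<^sub>R (LINT x|\<mu>. H f x)" by simp
qed

lemma fin_dim_subset: "fin_dim T \<Longrightarrow> S \<subseteq> T \<Longrightarrow> fin_dim S"
  by (auto simp: fin_dim_def)

lemma fin_dim_linear_image: "linear f \<Longrightarrow> fin_dim S \<Longrightarrow> fin_dim (f ` S)"
  unfolding fin_dim_def by (metis finite_imageI image_mono linear_span_image)

text \<open>Spaces of families of polynomials are finite sums of images of polynomial spaces, which
  is how their finite dimension is obtained.\<close>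

lemma fin_dim_sums:
  assumes "finite I" "\<And>i. i \<in> I \<Longrightarrow> fin_dim (S i)"
  shows "fin_dim {x. \<exists>y. (\<forall>i\<in>I. y i \<in> S i) \<and> x = (\<Sum>i\<in>I. y i)}"
proof -
  have "\<forall>i\<in>I. \<exists>B. finite B \<and> S i \<subseteq> span B" using assms(2) by (auto simp: fin_dim_def)
  then obtain B where B: "\<And>i. i \<in> I \<Longrightarrow> finite (B i) \<and> S i \<subseteq> span (B i)" by metis
  have "(\<Sum>i\<in>I. y i) \<in> span (\<Union>i\<in>I. B i)" if "\<forall>i\<in>I. y i \<in> S i" for y
  proof (rule span_sum)
    fix i assume i: "i \<in> I"
    then show "y i \<in> span (\<Union>i\<in>I. B i)" using that B[OF i] span_mono[of "B i" "\<Union>i\<in>I. B i"] by blast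
  qed
  moreover have "finite (\<Union>i\<in>I. B i)" using assms(1) B by auto
  ultimately show ?thesis unfolding fin_dim_def by blast
qed

lemma fin_dim_Times:
  assumes "fin_dim S" "fin_dim T"
  shows "fin_dim (S \<times> T)"
proof -
  obtain B C where B: "finite B" "S \<subseteq> span B" and C: "finite C" "T \<subseteq> span C"
    using assms by (auto simp: fin_dim_def)
  let ?D = "(\<lambda>x. (x, 0)) ` B \<union> (\<lambda>y. (0, y)) ` C"
  have l1: "linear (\<lambda>x::'a. (x, 0::'b))" and l2: "linear (\<lambda>y::'b. (0::'a, y))"
    by (auto intro!: linearI)
  have "(x, y) \<in> span ?D" if "x \<in> S" "y \<in> T" for x y
  proof -
    have "(x, 0) \<in> span ((\<lambda>x. (x, 0::'b)) ` B)" "(0, y) \<in> span ((\<lambda>y. (0::'a, y)) ` C)"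
      using that B C linear_span_image[OF l1, of B] linear_span_image[OF l2, of C] by auto
    then have "(x, 0) \<in> span ?D" "(0, y) \<in> span ?D"
      using span_mono[of _ ?D] by (meson Un_upper1 Un_upper2 subsetD)+
    then show ?thesis using span_add[of "(x,0)" ?D "(0,y)"] by simp
  qed
  then show ?thesis unfolding fin_dim_def using B C by (intro exI[of _ ?D]) auto
qed

section \<open>Polynomial maps\<close>

definition monomial :: "('d::finite \<Rightarrow> nat) \<Rightarrow> 'd point \<Rightarrow> real" where
  "monomial \<alpha> x = (\<Prod>i\<in>UNIV. x $ i ^ \<alpha> i)"

lemma finite_exponents: "finite {\<alpha> :: 'd::finite \<Rightarrow> nat. sum \<alpha> UNIV \<le> k}"
proof (rule finite_subset)
  show "{\<alpha> :: 'd \<Rightarrow> nat. sum \<alpha> UNIV \<le> k} \<subseteq> PiE UNIV (\<lambda>_. {..k})"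
  proof
    fix \<alpha> :: "'d \<Rightarrow> nat" assume "\<alpha> \<in> {\<alpha>. sum \<alpha> UNIV \<le> k}"
    then have "\<alpha> i \<le> k" for i using member_le_sum[of i UNIV \<alpha>] by auto
    then show "\<alpha> \<in> PiE UNIV (\<lambda>_. {..k})" by auto
  qed
  show "finite (PiE (UNIV::'d set) (\<lambda>_. {..k}))" by (intro finite_PiE) auto
qed

lemma poly_upto_iff:
  "p \<in> poly_upto k \<longleftrightarrow> (\<exists>c. p = (\<Sum>\<alpha> | sum \<alpha> UNIV \<le> k. c \<alpha> *\<^sub>R monomial \<alpha>))"
  by (simp add: poly_upto_def monomial_def fun_eq_iff)

lemma subspace_poly_upto: "subspace (poly_upto k :: ('d::finite point \<Rightarrow> real) set)"
proof (rule subspaceI)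
  show "0 \<in> (poly_upto k :: ('d point \<Rightarrow> real) set)"
    unfolding poly_upto_iff by (intro exI[of _ "\<lambda>_. 0"]) simp
next
  fix p q :: "'d point \<Rightarrow> real" assume "p \<in> poly_upto k" "q \<in> poly_upto k"
  then obtain c d where "p = (\<Sum>\<alpha> | sum \<alpha> UNIV \<le> k. c \<alpha> *\<^sub>R monomial \<alpha>)" "q = (\<Sum>\<alpha> | sum \<alpha> UNIV \<le> k. d \<alpha> *\<^sub>R monomial \<alpha>)"
    unfolding poly_upto_iff by blast
  then show "p + q \<in> poly_upto k"
    unfolding poly_upto_iff by (intro exI[of _ "\<lambda>\<alpha>. c \<alpha> + d \<alpha>"]) (simp add: scaleR_add_left sum.distrib)
next
  fix p :: "'d point \<Rightarrow> real" and r assume "p \<in> poly_upto k"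
  then obtain c where "p = (\<Sum>\<alpha> | sum \<alpha> UNIV \<le> k. c \<alpha> *\<^sub>R monomial \<alpha>)"
    unfolding poly_upto_iff by blast
  then show "r *\<^sub>R p \<in> poly_upto k"
    unfolding poly_upto_iff by (intro exI[of _ "\<lambda>\<alpha>. r * c \<alpha>"]) (simp add: scaleR_sum_right)
qed

lemma monomial_in_poly_upto:
  assumes "sum \<alpha> UNIV \<le> k"
  shows "monomial \<alpha> \<in> poly_upto k"
  unfolding poly_upto_iff
proof (intro exI[of _ "\<lambda>\<beta>. if \<beta> = \<alpha> then 1 else 0"])
  have "(\<Sum>\<beta> | sum \<beta> UNIV \<le> k. (if \<beta> = \<alpha> then 1 else 0) *\<^sub>R monomial \<beta>) = 
      (\<Sum>\<beta> | sum \<beta> UNIV \<le> k. if \<beta> = \<alpha> then monomial \<beta> else 0)"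
    by (rule sum.cong) auto
  also have "\<dots> = monomial \<alpha>" using assms by (simp add: sum.delta[OF finite_exponents])
  finally show "monomial \<alpha> = (\<Sum>\<beta> | sum \<beta> UNIV \<le> k. (if \<beta> = \<alpha> then 1 else 0) *\<^sub>R monomial \<beta>)" ..
qed

lemma fin_dim_poly_upto: "fin_dim (poly_upto k)"
  unfolding fin_dim_def
proof (intro exI conjI)
  show "finite (monomial ` {\<alpha>. sum \<alpha> UNIV \<le> k})" using finite_exponents by auto
  show "poly_upto k \<subseteq> span (monomial ` {\<alpha>. sum \<alpha> UNIV \<le> k})"
    unfolding subset_iff poly_upto_iff by (auto intro!: span_sum span_scale intro: span_base)
qed

lemma const_in_poly_upto: "(\<lambda>x. a) \<in> poly_upto k"
proof -
  have "(\<lambda>x. a) = a *\<^sub>R monomial (\<lambda>_. 0)" by (simp add: fun_eq_iff monomial_def)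
  also have "\<dots> \<in> poly_upto k"
    by (intro subspace_scale[OF subspace_poly_upto] monomial_in_poly_upto) simp
  finally show ?thesis .
qed

lemma coordinate_in_poly_upto: "1 \<le> k \<Longrightarrow> (\<lambda>x. x $ i) \<in> poly_upto k"
proof -
  assume k: "1 \<le> k"
  have "(\<Prod>j\<in>UNIV. x $ j ^ (if j = i then 1 else 0)) = x $ i" for x :: "real ^ 'a"
  proof -
    have "(\<Prod>j\<in>UNIV. x $ j ^ (if j = i then 1 else 0)) = (\<Prod>j\<in>UNIV. if j = i then x $ j else 1)"
      by (rule prod.cong) auto
    then show ?thesis by simp
  qed
  then have "(\<lambda>x. x $ i) = monomial (\<lambda>j. if j = i then 1 else 0)" by (simp add: fun_eq_iff monomial_def)
  then show ?thesis using monomial_in_poly_upto[of "\<lambda>j. if j = i then 1 else 0" k] k by simp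
qed

lemma poly_upto_on_line:
  assumes "p \<in> poly_upto k"
  shows "\<exists>P. \<forall>s. p (a + s *\<^sub>R v) = poly P s"
proof -
  obtain c where "p = (\<Sum>\<alpha> | sum \<alpha> UNIV \<le> k. c \<alpha> *\<^sub>R monomial \<alpha>)"
    using assms unfolding poly_upto_iff by blast
  then have "p (a + s *\<^sub>R v) = poly (\<Sum>\<alpha> | sum \<alpha> UNIV \<le> k. [:c \<alpha>:] * (\<Prod>i\<in>UNIV. [:a $ i, v $ i:] ^ \<alpha> i)) s" for s
    by (simp add: poly_sum poly_prod monomial_def)
  then show ?thesis by blast
qed

text \<open>The restriction to the line through \<open>x\<close> and a point of \<open>U\<close> is
  a univariate polynomial with infinitely many zeros.\<close>

lemma poly_upto_zero:
  assumes p: "p \<in> poly_upto k" and U: "open U" "U \<noteq> {}" and z: "\<And>x. x \<in> U \<Longrightarrow> p x = 0"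
  shows "p x = 0"
proof -
  obtain a where "a \<in> U" using U by auto
  obtain P where P: "\<And>s. p (a + s *\<^sub>R (x - a)) = poly P s" using poly_upto_on_line[OF p] by metis
  have "open ((\<lambda>s. a + s *\<^sub>R (x - a)) -` U)" 
    by (rule open_vimage[OF U(1)]) (intro continuous_intros)
  moreover have "0 \<in> (\<lambda>s. a + s *\<^sub>R (x - a)) -` U" using \<open>a \<in> U\<close> by simp
  ultimately have "infinite ((\<lambda>s. a + s *\<^sub>R (x - a)) -` U)" using finite_imp_not_open by blast
  moreover have "(\<lambda>s. a + s *\<^sub>R (x - a)) -` U \<subseteq> {s. poly P s = 0}" using z P by (auto simp: P[symmetric])
  ultimately have "P = 0" using poly_roots_finite finite_subset by blast
  then show ?thesis using P[of 1] by simp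
qed

subsection \<open>Derivatives\<close>

lemma pdiff_eq: "(f has_derivative f') (at x) \<Longrightarrow> pdiff i f x = f' (axis i 1)"
  unfolding pdiff_def using frechet_derivative_at by metis

lemma pdiff_bounded_linear:
  assumes "f differentiable at x" "bounded_linear h"
  shows "pdiff i (\<lambda>x. h (f x)) x = h (pdiff i f x)"
proof -
  obtain f' where f': "(f has_derivative f') (at x)" using assms by (auto simp: differentiable_def)
  have "((\<lambda>x. h (f x)) has_derivative (\<lambda>y. h (f' y))) (at x)"
    by (rule bounded_linear.has_derivative[OF assms(2) f'])
  then show ?thesis using f' by (simp add: pdiff_eq)
qed

lemma pdiff_add: "f differentiable at x \<Longrightarrow> g differentiable at x \<Longrightarrow> pdiff i (f + g) x = pdiff i f x + pdiff i g x"
  unfolding differentiable_def plus_fun_def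
  by (auto simp: pdiff_eq[OF has_derivative_add] pdiff_eq)

lemma pdiff_scaleR: "f differentiable at x \<Longrightarrow> pdiff i (c *\<^sub>R f) x = c *\<^sub>R pdiff i f x"
  using pdiff_bounded_linear[OF _ bounded_linear_scaleR_right] by (simp add: scaleR_fun_def)

lemma has_derivative_monomial:
  "(monomial \<alpha> has_derivative (\<lambda>h. \<Sum>j\<in>UNIV. (real (\<alpha> j) * h $ j * x $ j ^ (\<alpha> j - 1)) * (\<Prod>l\<in>UNIV-{j}. x $ l ^ \<alpha> l))) (at x)"
  unfolding monomial_def [abs_def]
  by (rule has_derivative_prod) (auto intro!: derivative_eq_intros bounded_linear_imp_has_derivative bounded_linear_vec_nth)

lemma pdiff_monomial: "pdiff i (monomial \<alpha>) x = real (\<alpha> i) * monomial (\<alpha>(i := \<alpha> i - 1)) x"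
proof -
  have "pdiff i (monomial \<alpha>) x = (\<Sum>j\<in>UNIV. if j = i then (real (\<alpha> j) * x $ j ^ (\<alpha> j - 1)) * (\<Prod>l\<in>UNIV-{j}. x $ l ^ \<alpha> l) else 0)"
    unfolding pdiff_eq[OF has_derivative_monomial] by (rule sum.cong) (auto simp: axis_def)
  also have "\<dots> = (real (\<alpha> i) * x $ i ^ (\<alpha> i - 1)) * (\<Prod>l\<in>UNIV-{i}. x $ l ^ \<alpha> l)" by simp
  also have "(\<Prod>l\<in>UNIV-{i}. x $ l ^ \<alpha> l) = (\<Prod>l\<in>UNIV-{i}. x $ l ^ (\<alpha>(i := \<alpha> i - 1)) l)"
    by (rule prod.cong) auto
  finally have "pdiff i (monomial \<alpha>) x =
    (real (\<alpha> i) * x $ i ^ (\<alpha> i - 1)) * (\<Prod>l\<in>UNIV-{i}. x $ l ^ (\<alpha>(i := \<alpha> i - 1)) l)" .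
  moreover have "monomial (\<alpha>(i := \<alpha> i - 1)) x =
    x $ i ^ (\<alpha> i - 1) * (\<Prod>l\<in>UNIV-{i}. x $ l ^ (\<alpha>(i := \<alpha> i - 1)) l)"
    unfolding monomial_def by (subst prod.remove[of UNIV i]) auto
  ultimately show ?thesis by simp
qed

lemma poly_upto_differentiable: "p \<in> poly_upto k \<Longrightarrow> p differentiable at x"
proof -
  assume "p \<in> poly_upto k"
  then obtain c where "p = (\<Sum>\<alpha> | sum \<alpha> UNIV \<le> k. c \<alpha> *\<^sub>R monomial \<alpha>)"
    unfolding poly_upto_iff by blast
  then have "p = (\<lambda>x. \<Sum>\<alpha> | sum \<alpha> UNIV \<le> k. c \<alpha> *\<^sub>R monomial \<alpha> x)" by (simp add: fun_eq_iff)
  moreover have "monomial \<alpha> differentiable at x" for \<alpha> using has_derivative_monomial by (auto simp: differentiable_def)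
  ultimately show ?thesis by (auto intro!: differentiable_sum finite_exponents)
qed

lemma pdiff_in_poly_upto: "p \<in> poly_upto k \<Longrightarrow> pdiff i p \<in> poly_upto k"
proof -
  assume "p \<in> poly_upto k"
  then obtain c where p: "p = (\<Sum>\<alpha> | sum \<alpha> UNIV \<le> k. c \<alpha> *\<^sub>R monomial \<alpha>)"
    unfolding poly_upto_iff by blast
  have l: "lin_on (poly_upto k) (\<lambda>p. pdiff i p :: 'a point \<Rightarrow> real)"
    by (rule lin_onI) (auto simp: fun_eq_iff pdiff_add pdiff_scaleR poly_upto_differentiable)
  have "pdiff i p = (\<Sum>\<alpha> | sum \<alpha> UNIV \<le> k. c \<alpha> *\<^sub>R pdiff i (monomial \<alpha>))"
    unfolding p by (rule lin_on_sum[OF l subspace_poly_upto]) (auto intro: monomial_in_poly_upto)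
  also have "\<dots> \<in> poly_upto k"
  proof (intro subspace_sum subspace_scale subspace_poly_upto)
    fix \<alpha> :: "'a \<Rightarrow> nat" assume a: "\<alpha> \<in> {\<alpha>. sum \<alpha> UNIV \<le> k}"
    have "pdiff i (monomial \<alpha>) = real (\<alpha> i) *\<^sub>R monomial (\<alpha>(i := \<alpha> i - 1))"
      by (simp add: fun_eq_iff pdiff_monomial del: fun_upd_apply)
    moreover have "sum (\<alpha>(i := \<alpha> i - 1)) UNIV \<le> sum \<alpha> UNIV" by (rule sum_mono) auto
    ultimately show "pdiff i (monomial \<alpha>) \<in> poly_upto k"
      using a by (auto intro!: subspace_scale subspace_poly_upto monomial_in_poly_upto simp del: fun_upd_apply)
  qed
  finally show ?thesis .
qed

subsection \<open>Vector- and tensor-valued polynomials\<close>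

text \<open>A common description of scalar, vector and tensor polynomials by their components in the
  Euclidean basis.\<close>

definition poly_maps :: "nat \<Rightarrow> ('d::finite point \<Rightarrow> 'b::euclidean_space) set" where
  "poly_maps k = {f. \<forall>b\<in>Basis. (\<lambda>x. f x \<bullet> b) \<in> poly_upto k}"

lemma poly_maps_real: "poly_maps k = poly_upto k"
  by (simp add: poly_maps_def)

lemma poly_maps_vector: "poly_maps k = vpoly_upto k"
  by (auto simp: poly_maps_def vpoly_upto_def Basis_vec_def inner_axis)

lemma stpoly_upto_eq: "stpoly_upto k = {f \<in> poly_maps k. \<forall>x. f x \<in> sym_tensors}"
  by (auto simp: poly_maps_def stpoly_upto_def Basis_vec_def inner_axis)

lemma poly_maps_comp_linear:
  assumes "f \<in> poly_maps k" "linear h"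
  shows "(\<lambda>x. h (f x)) \<in> poly_maps k"
  unfolding poly_maps_def
proof (intro CollectI ballI)
  fix b :: 'c assume "b \<in> Basis"
  have "h (f x) = (\<Sum>c\<in>Basis. (f x \<bullet> c) *\<^sub>R h c)" for x
    by (subst euclidean_representation[of "f x", symmetric]) (simp add: linear_sum[OF assms(2)] linear_scale[OF assms(2)])
  then have "(\<lambda>x. h (f x) \<bullet> b) = (\<Sum>c\<in>Basis. (h c \<bullet> b) *\<^sub>R (\<lambda>x. f x \<bullet> c))"
    by (simp add: fun_eq_iff inner_sum_left mult.commute)
  then show "(\<lambda>x. h (f x) \<bullet> b) \<in> poly_upto k"
    using assms(1) by (auto simp: poly_maps_def intro!: subspace_sum subspace_scale subspace_poly_upto)
qed

lemma subspace_poly_maps: "subspace (poly_maps k)"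
  by (rule subspaceI)
    (auto simp: poly_maps_def inner_add_left
      intro: subspace_0[OF subspace_poly_upto, unfolded zero_fun_def]
        subspace_add[OF subspace_poly_upto, unfolded plus_fun_def]
        subspace_scale[OF subspace_poly_upto, unfolded scaleR_fun_def real_scaleR_def])

lemma poly_maps_representation: "f = (\<Sum>b\<in>Basis. (\<lambda>x. (f x \<bullet> b) *\<^sub>R b))"
  by (simp add: fun_eq_iff euclidean_representation)

lemma fin_dim_poly_maps: "fin_dim (poly_maps k :: ('d::finite point \<Rightarrow> 'b::euclidean_space) set)"
proof (rule fin_dim_subset)
  let ?S = "\<lambda>b::'b. (\<lambda>p x::'d point. p x *\<^sub>R b) ` poly_upto k"
  have "linear (\<lambda>p x::'d point. p x *\<^sub>R b :: 'b)" for b 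
    by (rule linearI) (auto simp: fun_eq_iff scaleR_add_left)
  then show "fin_dim {x. \<exists>y. (\<forall>b\<in>Basis. y b \<in> ?S b) \<and> x = (\<Sum>b\<in>Basis. y b)}"
    by (intro fin_dim_sums fin_dim_linear_image fin_dim_poly_upto) auto
  show "poly_maps k \<subseteq> {x. \<exists>y. (\<forall>b\<in>Basis. y b \<in> ?S b) \<and> x = (\<Sum>b\<in>Basis. y b)}"
  proof
    fix f :: "'d point \<Rightarrow> 'b" assume f: "f \<in> poly_maps k"
    show "f \<in> {x. \<exists>y. (\<forall>b\<in>Basis. y b \<in> ?S b) \<and> x = (\<Sum>b\<in>Basis. y b)}"
      by (intro CollectI exI[of _ "\<lambda>b x. (f x \<bullet> b) *\<^sub>R b"] conjI poly_maps_representation ballI)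
        (use f in \<open>auto simp: poly_maps_def\<close>)
  qed
qed

lemma const_in_poly_maps: "(\<lambda>x. a) \<in> poly_maps k"
  by (simp add: poly_maps_def const_in_poly_upto)

lemma linear_in_poly_maps: "linear h \<Longrightarrow> 1 \<le> k \<Longrightarrow> h \<in> poly_maps k"
proof -
  assume h: "linear h" "1 \<le> k"
  have "(\<lambda>x. x) \<in> poly_maps k" 
    using coordinate_in_poly_upto[OF h(2)] by (auto simp: poly_maps_def Basis_vec_def inner_axis)
  from poly_maps_comp_linear[OF this h(1)] show ?thesis by simp
qed

lemma poly_maps_differentiable: "f \<in> poly_maps k \<Longrightarrow> f differentiable at x"
proof -
  assume f: "f \<in> poly_maps k"
  have "(\<lambda>x. \<Sum>b\<in>Basis. (f x \<bullet> b) *\<^sub>R b) differentiable at x"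
    using f poly_upto_differentiable
    by (intro differentiable_sum ballI differentiable_scaleR) (auto simp: poly_maps_def)
  then show ?thesis by (simp add: euclidean_representation)
qed

lemma poly_maps_has_derivative: "f \<in> poly_maps k \<Longrightarrow> (f has_derivative frechet_derivative f (at x)) (at x)"
  using poly_maps_differentiable frechet_derivative_works by blast

lemma poly_maps_continuous: "f \<in> poly_maps k \<Longrightarrow> continuous_on S f"
  by (intro continuous_at_imp_continuous_on ballI differentiable_imp_continuous_within poly_maps_differentiable)

lemma pdiff_in_poly_maps: "f \<in> poly_maps k \<Longrightarrow> pdiff i f \<in> poly_maps k"
proof -
  assume f: "f \<in> poly_maps k"
  have "(\<lambda>x. pdiff i f x \<bullet> b) = pdiff i (\<lambda>x. f x \<bullet> b)" for b
    using pdiff_bounded_linear[OF poly_maps_differentiable[OF f] bounded_linear_inner_left] by (simp add: fun_eq_iff)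
  then show ?thesis using f by (auto simp: poly_maps_def pdiff_in_poly_upto)
qed

lemma poly_maps_zero:
  assumes "f \<in> poly_maps k" "open U" "U \<noteq> {}" "\<And>x. x \<in> U \<Longrightarrow> f x = 0"
  shows "f = 0"
proof
  fix x
  have "f x = 0"
  proof (rule euclidean_eqI)
    fix b :: 'b assume "b \<in> Basis"
    then show "f x \<bullet> b = 0 \<bullet> b"
      using poly_upto_zero[of "\<lambda>x. f x \<bullet> b" k U x] assms by (simp add: poly_maps_def)
  qed
  then show "f x = 0 x" by simp
qed

lemma poly_maps_eq_on_open:
  assumes "f \<in> poly_maps k" "g \<in> poly_maps k" "open U" "U \<noteq> {}" "\<And>x. x \<in> U \<Longrightarrow> f x = g x"
  shows "f = g"
  using poly_maps_zero[of "f - g" k U] subspace_diff[OF subspace_poly_maps assms(1,2)] assms(3-) by auto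

lemma lin_on_pdiff [lin_intros]: "V \<subseteq> poly_maps k \<Longrightarrow> lin_on V (\<lambda>f. pdiff i f x)"
proof -
  assume "V \<subseteq> poly_maps k"
  then have "f differentiable at x" if "f \<in> V" for f using that by (blast intro: poly_maps_differentiable)
  then show ?thesis by (intro lin_onI) (auto simp: pdiff_add pdiff_scaleR)
qed

section \<open>Integration of continuous functions on elements and faces\<close>

text \<open>A face unknown is a polynomial on its face and arbitrary elsewhere, so it need not be
  continuous on the whole space. On the face it agrees with a function that is, and this suffices
  for integrability.\<close>

definition tame :: "'a::topological_space set \<Rightarrow> ('a \<Rightarrow> 'b::topological_space) \<Rightarrow> bool" where
  "tame X f \<longleftrightarrow> (\<exists>g. continuous_on UNIV g \<and> (\<forall>x\<in>X. f x = g x))"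

named_theorems tame_intros

lemma tame_continuous: "continuous_on UNIV f \<Longrightarrow> tame X f"
  by (auto simp: tame_def)

lemma tame_cong: "(\<And>x. x \<in> X \<Longrightarrow> f x = g x) \<Longrightarrow> tame X f \<longleftrightarrow> tame X g"
  by (auto simp: tame_def)

lemma tame_const [tame_intros]: "tame X (\<lambda>x. c)"
  by (auto intro: tame_continuous)

lemma tame_compose: "continuous_on UNIV h \<Longrightarrow> tame X f \<Longrightarrow> tame X (\<lambda>x. h (f x))"
  unfolding tame_def by (elim exE conjE, rule_tac x="\<lambda>x. h (g x)" in exI) (auto intro: continuous_on_compose2)

lemma tame_compose2:
  assumes "continuous_on UNIV (\<lambda>(a, b). h a b)" "tame X f" "tame X g"
  shows "tame X (\<lambda>x. h (f x) (g x))"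
proof -
  obtain f' g' where fg: "continuous_on UNIV f'" "\<forall>x\<in>X. f x = f' x" "continuous_on UNIV g'" "\<forall>x\<in>X. g x = g' x"
    using assms(2,3) by (auto simp: tame_def)
  have "continuous_on UNIV (\<lambda>x. (f' x, g' x))" by (intro continuous_on_Pair fg)
  then have "continuous_on UNIV (\<lambda>x. case (f' x, g' x) of (a, b) \<Rightarrow> h a b)"
    by (rule continuous_on_compose2[OF assms(1)]) auto
  then show ?thesis unfolding tame_def using fg by (intro exI[of _ "\<lambda>x. h (f' x) (g' x)"]) auto
qed

lemma tame_add [tame_intros]: "tame X f \<Longrightarrow> tame X g \<Longrightarrow> tame X (\<lambda>x. f x + g x)"
  for f g :: "_ \<Rightarrow> 'b::real_normed_vector"
  by (rule tame_compose2) (auto intro!: continuous_intros simp: case_prod_beta)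

lemma tame_diff [tame_intros]: "tame X f \<Longrightarrow> tame X g \<Longrightarrow> tame X (\<lambda>x. f x - g x)"
  for f g :: "_ \<Rightarrow> 'b::real_normed_vector"
  by (rule tame_compose2) (auto intro!: continuous_intros simp: case_prod_beta)

lemma tame_mult [tame_intros]: "tame X f \<Longrightarrow> tame X g \<Longrightarrow> tame X (\<lambda>x. f x * g x)"
  for f g :: "_ \<Rightarrow> 'b::real_normed_algebra"
  by (rule tame_compose2) (auto intro!: continuous_intros simp: case_prod_beta)

lemma tame_inner [tame_intros]: "tame X f \<Longrightarrow> tame X g \<Longrightarrow> tame X (\<lambda>x. f x \<bullet> g x)"
  for f g :: "_ \<Rightarrow> 'b::real_inner"
  by (rule tame_compose2) (auto intro!: continuous_intros simp: case_prod_beta)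

lemma tame_scaleR [tame_intros]: "tame X f \<Longrightarrow> tame X g \<Longrightarrow> tame X (\<lambda>x. f x *\<^sub>R g x)"
  for g :: "_ \<Rightarrow> 'b::real_normed_vector"
  by (rule tame_compose2) (auto intro!: continuous_intros simp: case_prod_beta)

lemma tame_power [tame_intros]: "tame X f \<Longrightarrow> tame X (\<lambda>x. f x ^ n)"
  for f :: "_ \<Rightarrow> real"
  by (rule tame_compose) (auto intro!: continuous_intros)

lemma tame_vec_nth [tame_intros]: "tame X f \<Longrightarrow> tame X (\<lambda>x. f x $ i)"
  for f :: "_ \<Rightarrow> 'b::real_normed_vector ^ 'n"
  by (rule tame_compose[where h = "\<lambda>y. y $ i"]) (auto intro!: continuous_intros)

lemma tame_linear: "linear h \<Longrightarrow> tame X f \<Longrightarrow> tame X (\<lambda>x. h (f x))"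
  for f :: "_ \<Rightarrow> 'b::euclidean_space" and h :: "'b \<Rightarrow> 'c::real_normed_vector"
  by (rule tame_compose[where h = h]) (auto intro!: linear_continuous_on simp: linear_conv_bounded_linear[symmetric])

lemma tame_matrix_vector [tame_intros]: "tame X f \<Longrightarrow> tame X (\<lambda>x. A *v f x)"
  for A :: "real^'n^'m"
  by (rule tame_linear) simp_all

lemma tame_matrix_vector' [tame_intros]: "tame X f \<Longrightarrow> tame X (\<lambda>x. f x *v a)"
  for a :: "real^'n" and f :: "_ \<Rightarrow> real^'n^'m"
  by (rule tame_linear[where h = "\<lambda>A. A *v a"])
    (auto intro!: linearI simp: matrix_vector_mult_add_rdistrib scaleR_matrix_vector_assoc)

lemma tame_sum [tame_intros]: "(\<And>i. i \<in> I \<Longrightarrow> tame X (f i)) \<Longrightarrow> tame X (\<lambda>x. \<Sum>i\<in>I. f i x)"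
  for f :: "_ \<Rightarrow> _ \<Rightarrow> 'b::real_normed_vector"
  by (induction I rule: infinite_finite_induct) (auto intro: tame_add tame_const)

lemma tame_vec_lambda [tame_intros]: "(\<And>i. tame X (\<lambda>x. f x i)) \<Longrightarrow> tame X (\<lambda>x. \<chi> i. f x i)"
  for f :: "'a::topological_space \<Rightarrow> 'n::finite \<Rightarrow> real"
proof -
  assume "\<And>i. tame X (\<lambda>x. f x i)"
  then have "\<forall>i. \<exists>g. continuous_on UNIV g \<and> (\<forall>x\<in>X. f x i = g x)" by (simp add: tame_def)
  from choice[OF this] obtain g where g: "\<And>i. continuous_on UNIV (g i)" "\<And>i x. x \<in> X \<Longrightarrow> f x i = g i x" by auto
  have "continuous_on UNIV (\<lambda>x. \<chi> i. g i x)" by (intro continuous_on_vec_lambda g)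
  then show ?thesis unfolding tame_def using g(2) by (intro exI[of _ "\<lambda>x. \<chi> i. g i x"]) (auto simp: vec_eq_iff)
qed

lemma tame_poly_maps: "f \<in> poly_maps k \<Longrightarrow> tame X f"
  by (intro tame_continuous poly_maps_continuous)

lemma tame_pdiff_poly [tame_intros]: "f \<in> poly_maps k \<Longrightarrow> tame X (\<lambda>x. pdiff i f x)"
  using tame_poly_maps[OF pdiff_in_poly_maps[of f k i]] by simp

text \<open>The common properties of Lebesgue measure on a bounded open set and of the surface
  measure on a bounded face: tame functions are integrable, and a tame function that vanishes almost
  everywhere vanishes everywhere, as every relative ball has positive measure.\<close>

definition solid :: "'a::euclidean_space measure \<Rightarrow> bool" where
  "solid \<mu> \<longleftrightarrow> finite_measure \<mu> \<and> bounded (space \<mu>) \<and> (\<lambda>x. x) \<in> borel_measurable \<mu> \<and>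
     (\<forall>x\<in>space \<mu>. \<forall>e>0. 0 < measure \<mu> (ball x e \<inter> space \<mu>))"

lemma tame_bounded:
  assumes "bounded (X :: 'a::euclidean_space set)" "tame X f"
  shows "\<exists>C. \<forall>x\<in>X. norm (f x :: 'b::real_normed_vector) \<le> C"
proof -
  obtain g where g: "continuous_on UNIV g" "\<forall>x\<in>X. f x = g x" using assms(2) by (auto simp: tame_def)
  have "compact (g ` closure X)"
    using assms(1) continuous_on_subset[OF g(1)] by (intro compact_continuous_image) auto
  then obtain C where "\<forall>y \<in> g ` closure X. norm y \<le> C" using compact_imp_bounded bounded_iff by metis
  then show ?thesis using g(2) closure_subset by (intro exI[of _ C]) auto
qed

lemma tame_measurable:
  fixes f :: "'a::euclidean_space \<Rightarrow> 'b::real_normed_vector"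
  assumes "solid \<mu>" "tame (space \<mu>) f"
  shows "f \<in> borel_measurable \<mu>"
proof -
  obtain g where g: "continuous_on UNIV g" "\<forall>x\<in>space \<mu>. f x = g x" using assms(2) by (auto simp: tame_def)
  have "(\<lambda>x. x) \<in> borel_measurable \<mu>" using assms(1) by (simp add: solid_def)
  then have "(\<lambda>x. g x) \<in> borel_measurable \<mu>"
    using measurable_compose borel_measurable_continuous_onI[OF g(1)] by fastforce
  then show ?thesis using g(2) by (subst measurable_cong) auto
qed

lemma tame_integrable:
  fixes f :: "'a::euclidean_space \<Rightarrow> 'b::euclidean_space"
  assumes "solid \<mu>" "tame (space \<mu>) f"
  shows "integrable \<mu> f"
proof -
  obtain C where "\<forall>x\<in>space \<mu>. norm (f x) \<le> C" using tame_bounded assms by (metis solid_def)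
  then show ?thesis
    using tame_measurable[OF assms] assms(1)
    by (intro finite_measure.integrable_const_bound[of \<mu> f C]) (auto simp: solid_def)
qed

lemma solid_AE_zero:
  fixes h :: "'a::euclidean_space \<Rightarrow> 'b::real_normed_vector"
  assumes \<mu>: "solid \<mu>" and h: "tame (space \<mu>) h" and ae: "AE x in \<mu>. h x = 0" and x: "x \<in> space \<mu>"
  shows "h x = 0"
proof (rule ccontr)
  assume "h x \<noteq> 0"
  obtain g where g: "continuous_on UNIV g" "\<forall>x\<in>space \<mu>. h x = g x" using h by (auto simp: tame_def)
  have "open (g -` (- {0}))" by (rule open_vimage) (use g in auto)
  moreover have "x \<in> g -` (- {0})" using g x \<open>h x \<noteq> 0\<close> by auto
  ultimately obtain e where e: "e > 0" "ball x e \<subseteq> g -` (- {0})" using open_contains_ball by blast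
  have meas: "ball x e \<inter> space \<mu> \<in> sets \<mu>"
    using measurable_sets[of "\<lambda>x. x" \<mu> borel "ball x e"] \<mu> by (auto simp: solid_def)
  have "AE x' in \<mu>. x' \<notin> ball x e \<inter> space \<mu>"
    using ae by eventually_elim (use e g in auto)
  then have "ball x e \<inter> space \<mu> \<in> null_sets \<mu>"
    using meas by (subst (asm) AE_iff_null_sets[symmetric]) auto
  then have "measure \<mu> (ball x e \<inter> space \<mu>) = 0" by (simp add: measure_eq_0_null_sets)
  moreover have "0 < measure \<mu> (ball x e \<inter> space \<mu>)" using \<mu> x e(1) unfolding solid_def by blast
  ultimately show False by simp
qed

lemma solid_integral_zero:
  fixes h :: "'a::euclidean_space \<Rightarrow> real"
  assumes "solid \<mu>" "tame (space \<mu>) h" "\<And>x. x \<in> space \<mu> \<Longrightarrow> 0 \<le> h x" "(LINT x|\<mu>. h x) = 0" "x \<in> space \<mu>"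
  shows "h x = 0"
proof -
  have "AE x in \<mu>. h x = 0"
    using integral_nonneg_eq_0_iff_AE[OF tame_integrable[OF assms(1,2)]] assms(3,4) by auto
  then show ?thesis using solid_AE_zero assms by blast
qed

lemma solid_norm_zero:
  fixes h :: "'a::euclidean_space \<Rightarrow> 'b::euclidean_space"
  assumes "solid \<mu>" "tame (space \<mu>) h" "(LINT x|\<mu>. h x \<bullet> h x) = 0" "x \<in> space \<mu>"
  shows "h x = 0"
  using solid_integral_zero[of \<mu> "\<lambda>x. h x \<bullet> h x" x] assms by (auto intro: tame_intros)

lemma solid_lebesgue_on:
  assumes "open T" "bounded T"
  shows "solid (lebesgue_on T)"
proof -
  have T: "T \<in> lmeasurable" using assms by (simp add: lmeasurable_open)
  have "0 < measure (lebesgue_on T) (ball x e \<inter> T)" if x: "x \<in> T" "e > 0" for x e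
  proof -
    have op: "open (ball x e \<inter> T)" using assms by auto
    have lm: "ball x e \<inter> T \<in> lmeasurable" using assms by (intro lmeasurable_open) auto
    have "\<not> negligible (ball x e \<inter> T)" using open_not_negligible[OF op] x centre_in_ball[of x e] by blast
    then have "measure lebesgue (ball x e \<inter> T) \<noteq> 0" using negligible_iff_measure lm by blast
    then show ?thesis
      using T lm by (subst measure_restrict_space) (auto simp: less_le)
  qed
  moreover have "(\<lambda>x. x) \<in> borel_measurable lebesgue"
    using measurable_completion[of "\<lambda>x. x" lborel borel] by simp
  ultimately show ?thesis unfolding solid_def
    using assms T by (auto intro!: finite_measure_lebesgue_on measurable_restrict_space1 simp: space_restrict_space)
qed

lemma lin_on_integral_tame:
  fixes H :: "'v::real_vector \<Rightarrow> 'a::euclidean_space \<Rightarrow> 'b::euclidean_space"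
  assumes "solid \<mu>" "subspace V" "\<And>f. f \<in> V \<Longrightarrow> tame (space \<mu>) (H f)"
    "\<And>x. x \<in> space \<mu> \<Longrightarrow> lin_on V (\<lambda>f. H f x)"
  shows "lin_on V (\<lambda>f. LINT x|\<mu>. H f x)"
  using assms by (intro lin_on_integral tame_integrable) auto

text \<open>Products of the form \<open>(L f, L g)\<close> for a linear operator \<open>L\<close>
  are positive semidefinite; \<open>L\<close> is the identity for projections and the symmetric
  gradient for the displacement.\<close>

lemma psd_on_L2:
  fixes L :: "'v::real_vector \<Rightarrow> 'a::euclidean_space \<Rightarrow> 'b::euclidean_space"
  assumes "solid \<mu>" "subspace V" "\<And>f. f \<in> V \<Longrightarrow> tame (space \<mu>) (L f)"
    "\<And>x. x \<in> space \<mu> \<Longrightarrow> lin_on V (\<lambda>f. L f x)"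
  shows "psd_on V (\<lambda>f g. LINT x|\<mu>. L f x \<bullet> L g x)"
  unfolding psd_on_def
proof (intro conjI bilin_onI ballI)
  fix f assume "f \<in> V"
  then show "lin_on V (\<lambda>g. LINT x|\<mu>. L f x \<bullet> L g x)" "lin_on V (\<lambda>g. LINT x|\<mu>. L g x \<bullet> L f x)"
    using assms by (auto intro!: lin_on_integral_tame tame_intros lin_intros)
qed (simp_all add: inner_commute)

section \<open>Orthogonal projection\<close>

text \<open>On elements a polynomial is a function on the whole space, on faces it is cut off to the
  face. The operator \<open>R\<close> (the identity, or the restriction to the face) covers both: it
  keeps the values on the space of \<open>\<mu>\<close> and depends on nothing else.\<close>

lemma l2_proj_works:
  fixes R :: "('d::finite point \<Rightarrow> real) \<Rightarrow> 'd point \<Rightarrow> real"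
  assumes \<mu>: "solid \<mu>" and f: "tame (space \<mu>) f"
    and R: "\<And>p x. x \<in> space \<mu> \<Longrightarrow> R p x = p x"
    "\<And>p q. p \<in> poly_upto k \<Longrightarrow> q \<in> poly_upto k \<Longrightarrow> (\<And>x. x \<in> space \<mu> \<Longrightarrow> p x = q x) \<Longrightarrow> R p = R q"
  shows "\<exists>p\<in>poly_upto k. \<forall>q\<in>poly_upto k. (LINT x|\<mu>. p x * q x) = (LINT x|\<mu>. f x * q x)" (is ?ex)
    and "\<And>p. p \<in> poly_upto k \<Longrightarrow> (\<forall>q\<in>poly_upto k. (LINT x|\<mu>. p x * q x) = (LINT x|\<mu>. f x * q x)) \<Longrightarrow>
      l2_proj (R ` poly_upto k) \<mu> f = R p"
proof -
  have tp: "tame (space \<mu>) p" if "p \<in> poly_upto k" for p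
    using that tame_poly_maps[of p k] by (simp add: poly_maps_real)
  have psd: "psd_on (poly_upto k) (\<lambda>f g. LINT x|\<mu>. f x \<bullet> g x)"
    by (rule psd_on_L2[OF \<mu> subspace_poly_upto tp]) (auto simp: lin_on_def)
  show ?ex
  proof -
    have "\<exists>p\<in>poly_upto k. \<forall>q\<in>poly_upto k. (LINT x|\<mu>. p x \<bullet> q x) = (LINT x|\<mu>. f x * q x)"
    proof (rule riesz_on[OF psd subspace_poly_upto fin_dim_poly_upto])
      show "lin_on (poly_upto k) (\<lambda>q. LINT x|\<mu>. f x * q x)"
        by (intro lin_on_integral_tame[OF \<mu> subspace_poly_upto] tame_intros f tp lin_intros) (auto simp: lin_on_def)
      fix q assume q: "q \<in> poly_upto k" "(LINT x|\<mu>. q x \<bullet> q x) = 0"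
      have "(LINT x|\<mu>. f x * q x) = (LINT x|\<mu>. 0)"
        by (rule Bochner_Integration.integral_cong) (use solid_norm_zero[OF \<mu> tp[OF q(1)] q(2)] in auto)
      then show "(LINT x|\<mu>. f x * q x) = 0" by simp
    qed
    then show ?thesis by simp
  qed
  fix p assume p: "p \<in> poly_upto k" "\<forall>q\<in>poly_upto k. (LINT x|\<mu>. p x * q x) = (LINT x|\<mu>. f x * q x)"
  have Rint: "(LINT x|\<mu>. u x * R q x) = (LINT x|\<mu>. u x * q x)" "(LINT x|\<mu>. R q x * u x) = (LINT x|\<mu>. q x * u x)" for u q
    by (auto intro!: Bochner_Integration.integral_cong simp: R(1))
  show "l2_proj (R ` poly_upto k) \<mu> f = R p"
    unfolding l2_proj_def
  proof (rule the_equality)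
    show "R p \<in> R ` poly_upto k \<and> (\<forall>q\<in>R ` poly_upto k. (LINT x|\<mu>. R p x * q x) = (LINT x|\<mu>. f x * q x))"
      using p by (auto simp: Rint)
    fix p' assume p': "p' \<in> R ` poly_upto k \<and> (\<forall>q\<in>R ` poly_upto k. (LINT x|\<mu>. p' x * q x) = (LINT x|\<mu>. f x * q x))"
    then obtain r where r: "r \<in> poly_upto k" "p' = R r" by auto
    have r2: "(LINT x|\<mu>. r x * q x) = (LINT x|\<mu>. f x * q x)" if "q \<in> poly_upto k" for q
      using p' that by (auto simp: r Rint)
    have d: "r - p \<in> poly_upto k" using p(1) r(1) by (intro subspace_diff subspace_poly_upto)
    have i: "integrable \<mu> (\<lambda>x. a x * b x)" if "a \<in> poly_upto k" "b \<in> poly_upto k" for a b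
      using that by (intro tame_integrable \<mu> tame_intros tp)
    have "(LINT x|\<mu>. (r - p) x \<bullet> (r - p) x) = (LINT x|\<mu>. r x * (r - p) x) - (LINT x|\<mu>. p x * (r - p) x)"
      using i[OF r(1) d] i[OF p(1) d] by (subst Bochner_Integration.integral_diff[symmetric]) (auto simp: algebra_simps)
    also have "\<dots> = 0" using r2[OF d] bspec[OF p(2) d] by simp
    finally have "(r - p) x = 0" if "x \<in> space \<mu>" for x
      using solid_norm_zero[OF \<mu> tp[OF d]] that by blast
    then have "R r = R p" by (intro R(2) r p) auto
    then show "p' = R p" using r by simp
  qed
qed

section \<open>Star-shaped elements and their faces\<close>

lemma negligible_low_aff_dim:
  fixes S :: "'a::euclidean_space set"
  assumes "aff_dim S < int DIM('a)"
  shows "negligible S"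
proof -
  obtain a b where "a \<noteq> 0" "S \<subseteq> {x. a \<bullet> x = b}" using aff_lowdim_subset_hyperplane[OF assms] by metis
  then show ?thesis using negligible_hyperplane[of a b] negligible_subset by blast
qed

text \<open>The exceptional set of all geometric arguments, of codimension two: it contains the
  relative boundaries of the faces, it is null, and so are the cones over it with any apex.\<close>

definition thin_family :: "'a::euclidean_space set set \<Rightarrow> bool" where
  "thin_family \<A> \<longleftrightarrow> finite \<A> \<and> (\<forall>A\<in>\<A>. affine A \<and> aff_dim A \<le> int DIM('a) - 2)"

lemma negligible_cone_over_thin:
  assumes "thin_family \<A>"
  shows "negligible (\<Union>A\<in>\<A>. affine hull (insert (y::'a::euclidean_space) A))"
proof (rule negligible_Union)
  fix S assume "S \<in> (\<lambda>A. affine hull (insert y A)) ` \<A>"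
  then obtain A where "A \<in> \<A>" and S: "S = affine hull (insert y A)" by blast
  then have "aff_dim A \<le> int DIM('a) - 2" using assms by (auto simp: thin_family_def)
  then have "aff_dim (affine hull (insert y A)) < int DIM('a)"
    using aff_dim_insert[of y A] by (auto split: if_splits)
  then show "negligible S" unfolding S by (rule negligible_low_aff_dim)
qed (use assms in \<open>auto simp: thin_family_def\<close>)

lemma negligible_thin: "thin_family \<A> \<Longrightarrow> negligible (\<Union>\<A>)"
  by (rule negligible_subset[OF negligible_cone_over_thin[of _ 0]])
    (auto intro: hull_inc)

text \<open>After \<open>y\<close> is chosen off the exceptional set, the segment to
  \<open>z\<close> can only meet a member \<open>A\<close> if \<open>z\<close> lies in the affine
  hull of \<open>y\<close> and \<open>A\<close>. These hulls are proper subspaces.\<close>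

lemma generic_segment:
  fixes \<A> :: "'a::euclidean_space set set"
  assumes \<A>: "thin_family \<A>" and U: "open U" "U \<noteq> {}" and V: "open V" "V \<noteq> {}"
  shows "\<exists>y\<in>U. \<exists>z\<in>V. closed_segment y z \<inter> \<Union>\<A> = {}"
proof -
  obtain y where y: "y \<in> U" "y \<notin> \<Union>\<A>"
    using open_not_negligible[OF U] negligible_subset[OF negligible_thin[OF \<A>]] by blast
  obtain z where z: "z \<in> V" "z \<notin> (\<Union>A\<in>\<A>. affine hull (insert y A))"
    using open_not_negligible[OF V] negligible_subset[OF negligible_cone_over_thin[OF \<A>, of y]] by blast
  have "w \<notin> A" if w: "w \<in> closed_segment y z" and A: "A \<in> \<A>" for w A
  proof
    assume wA: "w \<in> A"
    obtain t where t: "w = (1 - t) *\<^sub>R y + t *\<^sub>R z" using w by (auto simp: closed_segment_def)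
    have t0: "t \<noteq> 0" using t wA A y by auto
    have "z = (1 - 1/t) *\<^sub>R y + (1/t) *\<^sub>R w"
    proof -
      have "(1/t) *\<^sub>R w = ((1 - t) / t) *\<^sub>R y + z" using t0 by (simp add: t scaleR_add_right)
      then have "(1 - 1/t) *\<^sub>R y + (1/t) *\<^sub>R w = ((1 - 1/t) + (1 - t) / t) *\<^sub>R y + z"
        by (simp add: scaleR_add_left)
      moreover have "(1 - 1/t) + (1 - t) / t = 0" using t0 by (simp add: field_simps)
      ultimately show ?thesis by simp
    qed
    moreover have "(1 - 1/t) *\<^sub>R y + (1/t) *\<^sub>R w \<in> affine hull (insert y A)"
      using mem_affine[OF affine_affine_hull, of y "insert y A" w "1 - 1/t" "1/t"] wA by (auto intro: hull_inc)
    ultimately show False using z A by auto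
  qed
  then show ?thesis using y z by blast
qed

lemma hyperplanar_face_unit_normal:
  assumes "hyperplanar_face F"
  shows "\<exists>n b. norm n = 1 \<and> openin (top_of_set {x. n \<bullet> x = b}) F"
proof -
  obtain a b where a: "a \<noteq> 0" "openin (top_of_set {x. a \<bullet> x = b}) F" using assms by (auto simp: hyperplanar_face_def)
  have "{x. a \<bullet> x = b} = {x. ((1 / norm a) *\<^sub>R a) \<bullet> x = b / norm a}" using a(1) by auto
  then show ?thesis using a by (intro exI[of _ "(1 / norm a) *\<^sub>R a"] exI[of _ "b / norm a"]) auto
qed

lemma openin_hyperplane_ball:
  assumes "openin (top_of_set {x. n \<bullet> x = b}) F" "x \<in> F"
  obtains e where "e > 0" "\<And>z. n \<bullet> z = b \<Longrightarrow> dist x z < e \<Longrightarrow> z \<in> F" "n \<bullet> x = b"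
proof -
  obtain e where "e > 0" "ball x e \<inter> {x. n \<bullet> x = b} \<subseteq> F" "F \<subseteq> {x. n \<bullet> x = b}"
    using assms by (metis openin_contains_ball)
  then show ?thesis using assms(2) by (intro that[of e]) auto
qed

text \<open>A relatively open piece of a hyperplane contains two points on a line in every
  tangential direction, hence determines the hyperplane and its unit normal up to sign.\<close>

lemma unit_normal_unique:
  fixes n m :: "'a::euclidean_space"
  assumes F: "openin (top_of_set {x. n \<bullet> x = b}) F" "x \<in> F" and n: "norm n = 1" and m: "norm m = 1" "F \<subseteq> {x. m \<bullet> x = c}"
  shows "m = n \<and> c = b \<or> m = - n \<and> c = - b"
proof -
  obtain e where e: "e > 0" "\<And>z. n \<bullet> z = b \<Longrightarrow> dist x z < e \<Longrightarrow> z \<in> F" and nx: "n \<bullet> x = b"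
    using openin_hyperplane_ball[OF F] by metis
  (* the tangential part of m, which is shown to vanish *)
  define v where "v = m - (n \<bullet> m) *\<^sub>R n"
  have nn: "n \<bullet> n = 1" "m \<bullet> m = 1" using n m by (simp_all add: dot_square_norm)
  have nv: "n \<bullet> v = 0" by (simp add: v_def inner_diff_right nn)
  (* small enough to stay in the face; the denominator is positive even if v = 0 *)
  define t where "t = e / 2 / (norm v + 1)"
  have t: "t > 0" using e by (auto simp: t_def add_nonneg_pos)
  have "norm v + 1 > 0" by (simp add: add_nonneg_pos)
  then have "t * norm v < e" using e(1) by (simp add: t_def field_simps) (smt (verit) mult_nonneg_nonneg norm_ge_zero)
  then have "x + t *\<^sub>R v \<in> F" using t nx nv by (intro e(2)) (auto simp: inner_add_right dist_norm)
  then have "m \<bullet> (x + t *\<^sub>R v) = c" "m \<bullet> x = c" using m F(2) by auto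
  then have "m \<bullet> v = 0" using t by (simp add: inner_add_right)
  then have "v \<bullet> v = 0" using nv by (simp add: v_def inner_diff_left)
  then have mn: "m = (n \<bullet> m) *\<^sub>R n" by (simp add: v_def)
  then have "norm m = \<bar>n \<bullet> m\<bar> * norm n" by (metis norm_scaleR)
  then have "n \<bullet> m = 1 \<or> n \<bullet> m = - 1" using n m by auto
  then have "m = n \<or> m = - n" using mn by auto
  then show ?thesis using \<open>m \<bullet> x = c\<close> nx by auto
qed

text \<open>An element \<open>T\<close>, star-shaped with respect to the ball \<open>ball y0
  r\<close>, with its faces \<open>FS\<close>; \<open>\<A>\<close> covers the relative boundaries of
  the faces.\<close>

locale star_element =
  fixes T :: "'d::finite point set" and y0 :: "'d point" and r :: real and FS :: "'d point set set"
    and \<A> :: "'d point set set"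
  assumes open_T: "open T" and bounded_T: "bounded T" and r: "r > 0" and ball_T: "ball y0 r \<subseteq> T"
    and star: "\<And>y z. y \<in> ball y0 r \<Longrightarrow> z \<in> T \<Longrightarrow> closed_segment y z \<subseteq> T"
    and finite_FS: "finite FS" and face: "\<And>F. F \<in> FS \<Longrightarrow> hyperplanar_face F"
    and disj_FS: "pairwise disjnt FS" and frontier_T: "frontier T = (\<Union>F\<in>FS. closure F)"
    and thin: "thin_family \<A>" and face_boundary: "\<And>F. F \<in> FS \<Longrightarrow> closure F - F \<subseteq> \<Union>\<A>"
begin

lemma T_nonempty: "T \<noteq> {}" using ball_T r by auto

lemma face_frontier: "F \<in> FS \<Longrightarrow> F \<subseteq> frontier T"
  unfolding frontier_T using closure_subset by blast

lemma face_not_T: "F \<in> FS \<Longrightarrow> x \<in> F \<Longrightarrow> x \<notin> T"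
  using face_frontier open_T frontier_disjoint_eq by blast

text \<open>Star-shapedness with respect to a whole ball passes to the closure with a gain: moving
  towards the ball leads into the interior, because a perturbation of \<open>z\<close> is
  compensated by one of the apex within the ball.\<close>

lemma star_closure:
  assumes y: "y \<in> ball y0 r" and z: "z \<in> closure T" and s: "0 \<le> s" "s < 1"
  shows "y + s *\<^sub>R (z - y) \<in> T"
proof -
  define \<epsilon> where "\<epsilon> = (1 - s) * (r - dist y0 y)"
  have "\<epsilon> > 0" using y s by (simp add: \<epsilon>_def)
  then obtain z' where z': "z' \<in> T" "dist z' z < \<epsilon>" using z by (meson closure_approachable)
  (* the apex that sees z' where y sees z *)
  define y' where "y' = y + (s / (1 - s)) *\<^sub>R (z - z')"
  have "dist y y' = s / (1 - s) * dist z' z" using s by (simp add: y'_def dist_norm norm_minus_commute)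
  also have "\<dots> \<le> s / (1 - s) * \<epsilon>" using z' s by (intro mult_left_mono) auto
  also have "\<dots> = s * (r - dist y0 y)" using s by (simp add: \<epsilon>_def)
  also have "\<dots> < r - dist y0 y" using s y by simp
  finally have "y' \<in> ball y0 r" using dist_triangle[of y0 y' y] by simp
  then have "closed_segment y' z' \<subseteq> T" using star z' by blast
  moreover have "y + s *\<^sub>R (z - y) = (1 - s) *\<^sub>R y' + s *\<^sub>R z'"
  proof -
    have "(1 - s) *\<^sub>R y' = (1 - s) *\<^sub>R y + s *\<^sub>R (z - z')" using s by (simp add: y'_def scaleR_add_right)
    then show ?thesis by (simp add: algebra_simps)
  qed
  moreover have "(1 - s) *\<^sub>R y' + s *\<^sub>R z' \<in> closed_segment y' z'"
    unfolding closed_segment_def using s by (intro CollectI exI[of _ s]) auto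
  ultimately show ?thesis by auto
qed

text \<open>Orientation of the unit normal by the side on which the ball lies. This agrees with the
  pointwise definition of the outer normal, but it is global and can be read off directly.\<close>

definition outward :: "'d point set \<Rightarrow> 'd point \<Rightarrow> real \<Rightarrow> bool" where
  "outward F n b \<longleftrightarrow> norm n = 1 \<and> openin (top_of_set {x. n \<bullet> x = b}) F \<and> (\<forall>y\<in>ball y0 r. n \<bullet> y < b)"

text \<open>If the hyperplane met the ball, say in \<open>y\<close>, points of the face could be
  moved towards \<open>y\<close> within the hyperplane: they would stay in the face but enter the
  element.\<close>

lemma face_avoids_ball:
  assumes F: "F \<in> FS" "openin (top_of_set {x. n \<bullet> x = b}) F" and y: "y \<in> ball y0 r"
  shows "n \<bullet> y \<noteq> b"
proof
  assume nb: "n \<bullet> y = b"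
  obtain z where z: "z \<in> F" using face[OF F(1)] by (auto simp: hyperplanar_face_def)
  obtain e where e: "e > 0" "\<And>w. n \<bullet> w = b \<Longrightarrow> dist z w < e \<Longrightarrow> w \<in> F" and nz: "n \<bullet> z = b"
    using openin_hyperplane_ball[OF F(2) z] by metis
  (* small enough to keep w in the face *)
  define t where "t = min 1 (e / 2 / (norm (z - y) + 1))"
  have t: "0 < t" "t \<le> 1" using e by (auto simp: t_def add_nonneg_pos)
  define w where "w = y + (1 - t) *\<^sub>R (z - y)"
  have "w \<in> T" unfolding w_def using star_closure[OF y] t z face_frontier[OF F(1)]
    by (auto simp: frontier_def)
  moreover have "w \<in> F"
  proof (rule e(2))
    show "n \<bullet> w = b" by (simp add: w_def inner_add_right inner_diff_right nb nz)
    have "dist z w = t * norm (z - y)"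
    proof -
      have "z - w = t *\<^sub>R (z - y)" by (simp add: w_def algebra_simps)
      then show ?thesis using t by (simp add: dist_norm)
    qed
    also have "\<dots> \<le> e / 2 / (norm (z - y) + 1) * norm (z - y)" by (intro mult_right_mono) (auto simp: t_def)
    also have "\<dots> \<le> e / 2" using e by (simp add: divide_simps add_nonneg_pos)
    also have "\<dots> < e" using e by simp
    finally show "dist z w < e" .
  qed
  ultimately show False using face_not_T F by blast
qed

lemma outward_exists:
  assumes F: "F \<in> FS"
  shows "\<exists>n b. outward F n b"
proof -
  obtain n b where n: "norm n = 1" "openin (top_of_set {x. n \<bullet> x = b}) F"
    using hyperplanar_face_unit_normal[OF face[OF F]] by blast
  have ne: "n \<bullet> y \<noteq> b" if "y \<in> ball y0 r" for y using face_avoids_ball[OF F n(2) that] .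
  have conn: "connected (ball y0 r)" by simp
  have y0: "y0 \<in> ball y0 r" using r by simp
  show ?thesis
  proof (cases "n \<bullet> y0 < b")
    case True
    have "n \<bullet> y < b" if y: "y \<in> ball y0 r" for y
    proof (rule ccontr)
      assume "\<not> n \<bullet> y < b"
      then have "\<exists>z\<in>ball y0 r. n \<bullet> z = b" 
        using connected_ivt_hyperplane[OF conn y0 y, of n b] True by auto
      then show False using ne by blast
    qed
    then show ?thesis using n unfolding outward_def by blast
  next
    case False
    have "(- n) \<bullet> y < - b" if y: "y \<in> ball y0 r" for y
    proof (rule ccontr)
      assume "\<not> (- n) \<bullet> y < - b"
      then have "\<exists>z\<in>ball y0 r. n \<bullet> z = b" 
        using connected_ivt_hyperplane[OF conn y y0, of n b] False by auto
      then show False using ne by blast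
    qed
    moreover have "{x. (- n) \<bullet> x = - b} = {x. n \<bullet> x = b}" by auto
    ultimately show ?thesis using n unfolding outward_def by (intro exI[of _ "-n"] exI[of _ "-b"]) simp
  qed
qed

text \<open>Near a point of a face, the element is exactly the half-ball behind the hyperplane. The
  point \<open>w\<close> is projected from the centre \<open>y0\<close> to \<open>z\<close> in the
  hyperplane. If \<open>w\<close> is close to \<open>x\<close>, then \<open>z\<close> lies in the
  face; whether \<open>w\<close> is in front of or behind \<open>z\<close> as seen from
  \<open>y0\<close> decides whether it belongs to \<open>T\<close>.\<close>

lemma half_ball:
  assumes F: "F \<in> FS" and o: "outward F n b" and x: "x \<in> F"
  shows "\<exists>e>0. \<forall>w\<in>ball x e. (n \<bullet> w < b \<longrightarrow> w \<in> T) \<and> (b \<le> n \<bullet> w \<longrightarrow> w \<notin> T) \<and> (n \<bullet> w = b \<longrightarrow> w \<in> F)"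
proof -
  have n: "norm n = 1" "openin (top_of_set {x. n \<bullet> x = b}) F" and nb: "n \<bullet> y0 < b"
    using o r by (auto simp: outward_def)
  obtain e0 where e0: "e0 > 0" "\<And>w. n \<bullet> w = b \<Longrightarrow> dist x w < e0 \<Longrightarrow> w \<in> F" and nx: "n \<bullet> x = b"
    using openin_hyperplane_ball[OF n(2) x] by metis
  define \<delta> where "\<delta> = b - n \<bullet> y0"
  have \<delta>: "\<delta> > 0" using nb by (simp add: \<delta>_def)
  define R where "R = norm (x - y0) + \<delta>"
  have R: "R > 0" using \<delta> by (simp add: R_def add_nonneg_pos)
  (* the projection from y0 expands distances to x at most by the factor K *)
  define K where "K = 2 * R / \<delta> + 1"
  have K: "K > 1" using R \<delta> by (simp add: K_def)
  define e where "e = min (\<delta> / 2) (e0 / K)"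
  have e: "e > 0" using \<delta> e0 K by (auto simp: e_def)
  moreover have "e \<le> \<delta> / 2" unfolding e_def by (rule min.cobounded1)
  ultimately have e: "e > 0" "e \<le> \<delta> / 2" by auto
  have "(n \<bullet> w < b \<longrightarrow> w \<in> T) \<and> (b \<le> n \<bullet> w \<longrightarrow> w \<notin> T) \<and> (n \<bullet> w = b \<longrightarrow> w \<in> F)" if w: "w \<in> ball x e" for w
  proof -
    have wx: "norm (w - x) < e" using w by (simp add: dist_norm norm_minus_commute)
    have nw: "\<bar>b - n \<bullet> w\<bar> \<le> norm (w - x)"
      using Cauchy_Schwarz_ineq2[of n "x - w"] n(1) nx by (simp add: inner_diff_right norm_minus_commute)
    have den: "n \<bullet> w - n \<bullet> y0 \<ge> \<delta> / 2" using nw wx e by (simp add: \<delta>_def)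
    then have den0: "n \<bullet> w - n \<bullet> y0 > 0" using \<delta> by simp
    (* the dilation that moves w into the hyperplane *)
    define l where "l = \<delta> / (n \<bullet> w - n \<bullet> y0)"
    have l0: "l > 0" using den0 \<delta> by (simp add: l_def)
    define z where "z = y0 + l *\<^sub>R (w - y0)"
    have "n \<bullet> z = n \<bullet> y0 + l * (n \<bullet> w - n \<bullet> y0)" by (simp add: z_def inner_add_right inner_diff_right)
    also have "\<dots> = b" using den0 by (simp add: l_def \<delta>_def)
    finally have nz: "n \<bullet> z = b" .
    have l1: "\<bar>l - 1\<bar> \<le> 2 / \<delta> * norm (w - x)"
    proof -
      have "l - 1 = (b - n \<bullet> w) / (n \<bullet> w - n \<bullet> y0)" using den0 by (simp add: l_def \<delta>_def field_simps)
      then have "\<bar>l - 1\<bar> = \<bar>b - n \<bullet> w\<bar> / (n \<bullet> w - n \<bullet> y0)" using den0 by simp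
      also have "\<dots> \<le> norm (w - x) / (\<delta> / 2)" using nw den \<delta> by (intro frac_le) auto
      finally show ?thesis by (simp add: mult.commute)
    qed
    have "norm (w - y0) \<le> R" using norm_triangle_ineq[of "w - x" "x - y0"] wx e \<delta> by (simp add: R_def)
    then have "\<bar>l - 1\<bar> * norm (w - y0) \<le> 2 / \<delta> * norm (w - x) * R"
      using l1 by (intro mult_mono) auto
    moreover have "z - x = (l - 1) *\<^sub>R (w - y0) + (w - x)" by (simp add: z_def algebra_simps)
    then have "norm (z - x) \<le> \<bar>l - 1\<bar> * norm (w - y0) + norm (w - x)"
      by (metis norm_triangle_ineq norm_scaleR)
    ultimately have "norm (z - x) \<le> K * norm (w - x)" by (simp add: K_def algebra_simps)
    also have "\<dots> < K * (e0 / K)" using wx K by (intro mult_strict_left_mono) (auto simp: e_def)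
    finally have "z \<in> F" using K nz by (intro e0(2)) (auto simp: dist_norm norm_minus_commute)
    have "w \<in> T" if "n \<bullet> w < b"
    proof -
      have "l > 1" using that den0 by (simp add: l_def \<delta>_def)
      have "y0 + (1 / l) *\<^sub>R (z - y0) \<in> T"
        using \<open>l > 1\<close> \<open>z \<in> F\<close> face_frontier[OF F] r by (intro star_closure) (auto simp: frontier_def)
      then show ?thesis using l0 by (simp add: z_def)
    qed
    moreover have "w \<notin> T" if "b \<le> n \<bullet> w"
    proof
      assume "w \<in> T"
      have "l \<le> 1" using that den0 by (simp add: l_def \<delta>_def)
      then have "z \<in> closed_segment y0 w" unfolding closed_segment_def
        using l0 by (auto simp: z_def algebra_simps intro!: exI[of _ l])
      then have "z \<in> T" using star[of y0 w] \<open>w \<in> T\<close> r by auto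
      then show False using face_not_T[OF F] \<open>z \<in> F\<close> by blast
    qed
    moreover have "w \<in> F" if "n \<bullet> w = b"
    proof -
      have "l = 1" using that den0 \<delta> by (simp add: l_def \<delta>_def)
      then show ?thesis using \<open>z \<in> F\<close> by (simp add: z_def)
    qed
    ultimately show ?thesis by blast
  qed
  then show ?thesis using e by blast
qed

text \<open>The half-ball shows that \<open>n\<close> satisfies the defining condition of the outer
  normal and that \<open>-n\<close> does not; there are no other candidates.\<close>

lemma outward_normal_out:
  assumes F: "F \<in> FS" and o: "outward F n b"
  shows "normal_out T F = n"
  unfolding normal_out_def
proof (rule the_equality)
  have n: "norm n = 1" "openin (top_of_set {x. n \<bullet> x = b}) F" using o by (auto simp: outward_def)
  have Fs: "F \<subseteq> {x. n \<bullet> x = b}" using n(2) openin_imp_subset by blast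
  have nn: "n \<bullet> n = 1" using n(1) by (simp add: dot_square_norm)
  have loc: "\<exists>\<epsilon>>0. \<forall>s. 0 < s \<and> s < \<epsilon> \<longrightarrow> x - s *\<^sub>R n \<in> T \<and> x + s *\<^sub>R n \<notin> T" if x: "x \<in> F" for x
  proof -
    obtain e where e: "e > 0" "\<And>w. w \<in> ball x e \<Longrightarrow> (n \<bullet> w < b \<longrightarrow> w \<in> T) \<and> (b \<le> n \<bullet> w \<longrightarrow> w \<notin> T)"
      using half_ball[OF F o x] by blast
    have nx: "n \<bullet> x = b" using x Fs by auto
    have "x - s *\<^sub>R n \<in> T \<and> x + s *\<^sub>R n \<notin> T" if s: "0 < s \<and> s < e" for s
      using e(2)[of "x - s *\<^sub>R n"] e(2)[of "x + s *\<^sub>R n"] s nx n(1) nn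
      by (auto simp: dist_norm inner_add_right inner_diff_right)
    then show ?thesis using e(1) by blast
  qed
  then show "norm n = 1 \<and> (\<exists>b. F \<subseteq> {x. n \<bullet> x = b}) \<and>
     (\<forall>x\<in>F. \<exists>\<epsilon>>0. \<forall>s. 0 < s \<and> s < \<epsilon> \<longrightarrow> x - s *\<^sub>R n \<in> T \<and> x + s *\<^sub>R n \<notin> T)"
    using n Fs by blast
  fix m assume m: "norm m = 1 \<and> (\<exists>b. F \<subseteq> {x. m \<bullet> x = b}) \<and>
     (\<forall>x\<in>F. \<exists>\<epsilon>>0. \<forall>s. 0 < s \<and> s < \<epsilon> \<longrightarrow> x - s *\<^sub>R m \<in> T \<and> x + s *\<^sub>R m \<notin> T)"
  obtain x where x: "x \<in> F" using face[OF F] by (auto simp: hyperplanar_face_def)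
  obtain c where c: "F \<subseteq> {x. m \<bullet> x = c}" using m by blast
  have "m = n \<or> m = - n" using unit_normal_unique[OF n(2) x n(1) _ c] m by blast
  moreover have "m \<noteq> - n"
  proof
    assume mn: "m = - n"
    obtain e1 where e1: "e1 > 0" "\<forall>s. 0 < s \<and> s < e1 \<longrightarrow> x - s *\<^sub>R n \<in> T \<and> x + s *\<^sub>R n \<notin> T" using loc[OF x] by blast
    obtain e2 where e2: "e2 > 0" "\<forall>s. 0 < s \<and> s < e2 \<longrightarrow> x - s *\<^sub>R m \<in> T \<and> x + s *\<^sub>R m \<notin> T" using m x by blast
    have "0 < min e1 e2 / 2" "min e1 e2 / 2 < e1" "min e1 e2 / 2 < e2" using e1(1) e2(1) by auto
    then show False using e1(2) e2(2) mn by fastforce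
  qed
  ultimately show "m = n" by blast
qed

lemma outward_normal:
  assumes "F \<in> FS" shows "\<exists>b. outward F (normal_out T F) b"
  using outward_exists[OF assms] outward_normal_out[OF assms] by blast

end

text \<open>Two disjoint elements with a common face lie locally on opposite sides of it, since two
  half-balls on the same side intersect. Together they fill a neighbourhood of each point of the
  face.\<close>

lemma opposite_normals:
  assumes "star_element T1 y1 r1 FS1 \<A>1" "star_element T2 y2 r2 FS2 \<A>2"
    and F: "F \<in> FS1" "F \<in> FS2" and d: "T1 \<inter> T2 = {}"
  shows "normal_out T2 F = - normal_out T1 F"
    and "x \<in> F \<Longrightarrow> \<exists>e>0. ball x e \<subseteq> closure T1 \<union> closure T2"
proof -
  interpret A: star_element T1 y1 r1 FS1 \<A>1 by fact
  interpret B: star_element T2 y2 r2 FS2 \<A>2 by fact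
  let ?n = "normal_out T1 F"
  obtain b where b: "A.outward F ?n b" using A.outward_normal[OF F(1)] by blast
  obtain c where c: "B.outward F (normal_out T2 F) c" using B.outward_normal[OF F(2)] by blast
  have n: "norm ?n = 1" "openin (top_of_set {x. ?n \<bullet> x = b}) F" using b by (auto simp: A.outward_def)
  have m: "norm (normal_out T2 F) = 1" "F \<subseteq> {x. normal_out T2 F \<bullet> x = c}"
    using c openin_imp_subset by (auto simp: B.outward_def)
  obtain x0 where x0: "x0 \<in> F" using A.face[OF F(1)] by (auto simp: hyperplanar_face_def)
  have nn: "?n \<bullet> ?n = 1" using n(1) by (simp add: dot_square_norm)
  have "\<not> (normal_out T2 F = ?n \<and> c = b)"
  proof
    assume eq: "normal_out T2 F = ?n \<and> c = b"
    have nx: "?n \<bullet> x0 = b" using x0 m eq by auto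
    obtain e1 where e1: "e1 > 0" "\<And>w. w \<in> ball x0 e1 \<Longrightarrow> (?n \<bullet> w < b \<longrightarrow> w \<in> T1)"
      using A.half_ball[OF F(1) b x0] by blast
    obtain e2 where e2: "e2 > 0" "\<And>w. w \<in> ball x0 e2 \<Longrightarrow> (normal_out T2 F \<bullet> w < c \<longrightarrow> w \<in> T2)"
      using B.half_ball[OF F(2) c x0] by blast
    define w where "w = x0 - (min e1 e2 / 2) *\<^sub>R ?n"
    have "w \<in> ball x0 e1" "w \<in> ball x0 e2" "?n \<bullet> w < b"
      using e1(1) e2(1) nx n(1) by (auto simp: w_def dist_norm inner_diff_right nn)
    then have "w \<in> T1" "w \<in> T2" using e1(2) e2(2) eq by auto
    then show False using d by blast
  qed
  then have op: "normal_out T2 F = - ?n" "c = - b"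
    using unit_normal_unique[OF n(2) x0 n(1) m] by auto
  show "normal_out T2 F = - ?n" by fact
  assume x: "x \<in> F"
  obtain e1 where e1: "e1 > 0" "\<And>w. w \<in> ball x e1 \<Longrightarrow> (?n \<bullet> w < b \<longrightarrow> w \<in> T1) \<and> (?n \<bullet> w = b \<longrightarrow> w \<in> F)"
    using A.half_ball[OF F(1) b x] by blast
  obtain e2 where e2: "e2 > 0" "\<And>w. w \<in> ball x e2 \<Longrightarrow> (normal_out T2 F \<bullet> w < c \<longrightarrow> w \<in> T2)"
    using B.half_ball[OF F(2) c x] by blast
  have "w \<in> closure T1 \<union> closure T2" if w: "w \<in> ball x (min e1 e2)" for w
  proof -
    have "w \<in> T1" if "?n \<bullet> w < b" using e1(2)[of w] w that by auto
    moreover have "w \<in> F" if "?n \<bullet> w = b" using e1(2)[of w] w that by auto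
    moreover have "w \<in> T2" if "?n \<bullet> w > b" using e2(2)[of w] w that op by auto
    ultimately have "w \<in> T1 \<or> w \<in> F \<or> w \<in> T2" by (meson linorder_less_linear)
    then show ?thesis using A.face_frontier[OF F(1)] closure_subset by (auto simp: frontier_def)
  qed
  then have "ball x (min e1 e2) \<subseteq> closure T1 \<union> closure T2" by blast
  moreover have "min e1 e2 > 0" using e1(1) e2(1) by simp
  ultimately show "\<exists>e>0. ball x e \<subseteq> closure T1 \<union> closure T2" by blast
qed

section \<open>Meshes\<close>

text \<open>A mesh of the regular sequence, reduced to what is used of it: the element
  \<open>T\<close> is star-shaped with respect to \<open>ball (ctr T) (rad T)\<close>, and one
  family \<open>\<A>\<close> of codimension two is shared by all elements. The domain equals the
  interior of its closure, as every polyhedral set does.\<close>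

locale hho_mesh =
  fixes \<Omega> :: "'d::finite point set" and M :: "'d mesh"
    and ctr :: "'d point set \<Rightarrow> 'd point" and rad :: "'d point set \<Rightarrow> real" and \<A> :: "'d point set set"
  assumes dim2: "2 \<le> CARD('d)" and mesh: "is_mesh \<Omega> M"
    and open_\<Omega>: "open \<Omega>" and bounded_\<Omega>: "bounded \<Omega>" and connected_\<Omega>: "connected \<Omega>" and nonempty_\<Omega>: "\<Omega> \<noteq> {}"
    and regular_\<Omega>: "interior (closure \<Omega>) = \<Omega>"
    and elem: "\<And>T. T \<in> elems M \<Longrightarrow> star_element T (ctr T) (rad T) (faces_of M T) \<A>"
begin

lemma finite_elems [simp]: "finite (elems M)" and finite_faces [simp]: "finite (faces M)"
  using mesh by (auto simp: is_mesh_def)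

lemma finite_faces_of [simp]: "finite (faces_of M T)" and finite_internal [simp]: "finite (internal_faces M)"
  by (simp_all add: faces_of_def internal_faces_def)

lemma closure_\<Omega>: "closure \<Omega> = (\<Union>T\<in>elems M. closure T)"
  and disjoint_faces: "pairwise disjnt (faces M)"
  and faces_split: "faces M = internal_faces M \<union> boundary_faces \<Omega> M"
  using mesh by (auto simp: is_mesh_def)

lemma disjoint_elems: "T \<in> elems M \<Longrightarrow> T' \<in> elems M \<Longrightarrow> T \<noteq> T' \<Longrightarrow> T \<inter> T' = {}"
  using mesh pairwiseD[of disjnt "elems M" T T'] by (simp add: is_mesh_def disjnt_def)

lemma open_elem: "T \<in> elems M \<Longrightarrow> open T" and bounded_elem: "T \<in> elems M \<Longrightarrow> bounded T"
  and elem_nonempty: "T \<in> elems M \<Longrightarrow> T \<noteq> {}"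
  using elem star_element.open_T star_element.bounded_T star_element.T_nonempty by blast+

lemma faces_ofD: "F \<in> faces_of M T \<Longrightarrow> F \<in> faces M" "F \<in> faces_of M T \<Longrightarrow> F \<subseteq> frontier T"
  by (simp_all add: faces_of_def)

lemma elem_subset_\<Omega>: "T \<in> elems M \<Longrightarrow> T \<subseteq> \<Omega>"
proof -
  assume T: "T \<in> elems M"
  have "T \<subseteq> closure T" by (rule closure_subset)
  also have "\<dots> \<subseteq> closure \<Omega>" using T by (auto simp: closure_\<Omega>)
  finally have "T \<subseteq> interior (closure \<Omega>)" using open_elem[OF T] by (simp add: interior_maximal)
  then show ?thesis by (simp add: regular_\<Omega>)
qed

lemma elems_nonempty: "elems M \<noteq> {}"
  using closure_\<Omega> nonempty_\<Omega> closure_subset by fastforce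

lemma face_has_elem: "F \<in> faces M \<Longrightarrow> \<exists>T\<in>elems M. F \<in> faces_of M T"
proof -
  assume F: "F \<in> faces M"
  then have "F \<in> internal_faces M \<or> F \<in> boundary_faces \<Omega> M" using faces_split by blast
  then show ?thesis unfolding internal_faces_def boundary_faces_def faces_of_def by blast
qed

lemma faceD:
  assumes "F \<in> faces M"
  shows "F \<noteq> {}" "bounded F" "hyperplanar_face F"
proof -
  show h: "hyperplanar_face F" using mesh assms by (auto simp: is_mesh_def)
  then show "F \<noteq> {}" by (simp add: hyperplanar_face_def)
  obtain T where T: "T \<in> elems M" "F \<in> faces_of M T" using face_has_elem[OF assms] by blast
  show "bounded F"
    using bounded_subset[OF bounded_closure[OF bounded_elem[OF T(1)]], of F] faces_ofD(2)[OF T(2)]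
    by (auto simp: frontier_def)
qed

text \<open>This is where the dimension must be at least two: in dimension one, faces are
  points.\<close>

lemma face_diameter_pos:
  assumes "F \<in> faces M"
  shows "diameter F > 0"
proof -
  obtain n b where n: "norm n = 1" "openin (top_of_set {x. n \<bullet> x = b}) F"
    using hyperplanar_face_unit_normal[OF faceD(3)[OF assms]] by blast
  obtain x where x: "x \<in> F" using faceD(1)[OF assms] by blast
  obtain e where e: "e > 0" "\<And>w. n \<bullet> w = b \<Longrightarrow> dist x w < e \<Longrightarrow> w \<in> F" and nx: "n \<bullet> x = b"
    using openin_hyperplane_ball[OF n(2) x] by metis
  obtain v where v: "v \<noteq> 0" "orthogonal n v"
    using orthogonal_to_vector_exists[of n] dim2 by auto
  define w where "w = x + (e / 2 / norm v) *\<^sub>R v"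
  have d: "dist x w = e / 2" using v e by (simp add: w_def dist_norm)
  have "w \<in> F"
    using v nx d e(1) by (intro e(2)) (auto simp: w_def inner_add_right orthogonal_def)
  then have "dist x w \<le> diameter F" using diameter_bounded_bound[OF faceD(2)[OF assms] x] by blast
  then show ?thesis using d e by simp
qed

lemma shared_face:
  assumes "T1 \<in> elems M" "T2 \<in> elems M" "T1 \<noteq> T2" "F \<in> faces_of M T1" "F \<in> faces_of M T2"
  shows "normal_out T2 F = - normal_out T1 F"
    and "x \<in> F \<Longrightarrow> \<exists>e>0. ball x e \<subseteq> closure T1 \<union> closure T2"
  using opposite_normals[OF elem elem, of T1 T2 F] disjoint_elems assms by blast+

lemma norm_normal_out: "T \<in> elems M \<Longrightarrow> F \<in> faces_of M T \<Longrightarrow> norm (normal_out T F) = 1"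
  using star_element.outward_normal[OF elem] star_element.outward_def[OF elem] by blast

text \<open>Three elements at one face would have pairwise opposite unit normals.\<close>

lemma at_most_two:
  assumes T: "T1 \<in> elems M" "T2 \<in> elems M" "T1 \<noteq> T2" "F \<in> faces_of M T1" "F \<in> faces_of M T2"
    and T3: "T3 \<in> elems M" "F \<in> faces_of M T3"
  shows "T3 = T1 \<or> T3 = T2"
proof (rule ccontr)
  assume "\<not> (T3 = T1 \<or> T3 = T2)"
  then have "normal_out T3 F = - normal_out T1 F" "normal_out T3 F = - normal_out T2 F"
    "normal_out T2 F = - normal_out T1 F"
    using shared_face(1)[of T1 T3 F] shared_face(1)[of T2 T3 F] shared_face(1)[of T1 T2 F] assms by auto
  then have "normal_out T1 F = - normal_out T1 F" "normal_out T3 F = normal_out T1 F" by auto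
  then have "normal_out T3 F = 0" by (simp add: vec_eq_iff)
  then show False using norm_normal_out[OF T3] by simp
qed

lemma sides:
  assumes "F \<in> internal_faces M"
  shows "side1 M F \<in> elems M" "side2 M F \<in> elems M" "side1 M F \<noteq> side2 M F"
    "F \<in> faces_of M (side1 M F)" "F \<in> faces_of M (side2 M F)"
    "normal_out (side2 M F) F = - normal_out (side1 M F) F"
    "{T \<in> elems M. F \<in> faces_of M T} = {side1 M F, side2 M F}"
proof -
  have "F \<in> faces M" using assms by (simp add: internal_faces_def)
  then show s: "side1 M F \<in> elems M" "side2 M F \<in> elems M" "side1 M F \<noteq> side2 M F"
    "F \<in> faces_of M (side1 M F)" "F \<in> faces_of M (side2 M F)"
    using mesh assms by (auto simp: is_mesh_def faces_of_def)
  show "normal_out (side2 M F) F = - normal_out (side1 M F) F" by (rule shared_face(1)[OF s])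
  show "{T \<in> elems M. F \<in> faces_of M T} = {side1 M F, side2 M F}"
    using at_most_two[OF s] s by blast
qed

lemma internal_facesI:
  assumes "T1 \<in> elems M" "T2 \<in> elems M" "T1 \<noteq> T2" "F \<in> faces_of M T1" "F \<in> faces_of M T2"
  shows "F \<in> internal_faces M" "{side1 M F, side2 M F} = {T1, T2}"
proof -
  show i: "F \<in> internal_faces M" using assms unfolding internal_faces_def faces_of_def by blast
  show "{side1 M F, side2 M F} = {T1, T2}" using sides[OF i] at_most_two[OF assms] by blast
qed

lemma thin: "thin_family \<A>"
  using elems_nonempty elem star_element.thin by blast

lemma frontier_point_in_face:
  assumes "T \<in> elems M" "x \<in> closure T" "x \<notin> T" "x \<notin> \<Union>\<A>"
  shows "\<exists>F\<in>faces_of M T. x \<in> F"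
proof -
  interpret star_element T "ctr T" "rad T" "faces_of M T" \<A> by (rule elem[OF assms(1)])
  have "x \<in> frontier T" using assms open_T by (simp add: frontier_def interior_open)
  then show ?thesis using frontier_T face_boundary assms(4) by blast
qed

text \<open>The closures of the elements in \<open>A\<close> and of the others cover the connected
  domain, so they meet inside it, at a point in the closures of \<open>T\<close> and
  \<open>T'\<close>. This point may lie on an edge or vertex, where the elements need not share a
  face. A generic segment from \<open>T\<close> to \<open>T'\<close> nearby also passes from one
  group to the other, and it does so inside a face.\<close>

lemma elements_connected_through_faces:
  assumes A: "A \<subseteq> elems M" "A \<noteq> {}" "A \<noteq> elems M"
  shows "\<exists>F\<in>internal_faces M. side1 M F \<in> A \<and> side2 M F \<notin> A \<or> side1 M F \<notin> A \<and> side2 M F \<in> A"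
proof -
  define K where "K A = (\<Union>T\<in>A. closure T)" for A :: "'d point set set"
  let ?B = "elems M - A"
  have fin: "finite A" "finite ?B" using finite_subset[OF A(1) finite_elems] by simp_all
  have cl: "closed (K A)" "closed (K ?B)" using fin by (auto simp: K_def intro!: closed_UN)
  have cov: "\<Omega> \<subseteq> K A \<union> K ?B" 
  proof
    fix x assume "x \<in> \<Omega>"
    then obtain T where "T \<in> elems M" "x \<in> closure T" using closure_\<Omega> closure_subset by blast
    then show "x \<in> K A \<union> K ?B" unfolding K_def by (cases "T \<in> A") auto
  qed
  have meet: "K C \<inter> \<Omega> \<noteq> {}" if C: "C \<subseteq> elems M" "C \<noteq> {}" for C
  proof -
    obtain T where T: "T \<in> C" "T \<in> elems M" using C by blast
    obtain y where "y \<in> T" using elem_nonempty[OF T(2)] by blast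
    then show ?thesis using T elem_subset_\<Omega> closure_subset unfolding K_def by blast
  qed
  have "K A \<inter> K ?B \<inter> \<Omega> \<noteq> {}"
    using connected_\<Omega> cl cov meet[of A] meet[of ?B] A unfolding connected_closed by blast
  then obtain x T T' where x: "x \<in> \<Omega>" "T \<in> A" "x \<in> closure T" "T' \<in> ?B" "x \<in> closure T'" unfolding K_def by blast
  obtain e where e: "e > 0" "ball x e \<subseteq> \<Omega>" using open_\<Omega> x(1) open_contains_ball by blast
  have ne: "ball x e \<inter> S \<noteq> {}" if "x \<in> closure S" for S
    using that e(1) unfolding closure_approachable by (metis IntI dist_commute empty_iff mem_ball)
  obtain y z where yz: "y \<in> ball x e \<inter> T" "z \<in> ball x e \<inter> T'" "closed_segment y z \<inter> \<Union>\<A> = {}"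
  proof -
    have "open (ball x e \<inter> T)" "open (ball x e \<inter> T')" using open_elem x A(1) by (auto intro!: open_Int)
    from generic_segment[OF thin this(1) ne[OF x(3)] this(2) ne[OF x(5)]] show ?thesis using that by blast
  qed
  have "closed_segment y z \<subseteq> ball x e" using yz by (intro closed_segment_subset) auto
  then have "closed_segment y z \<subseteq> K A \<union> K ?B" using cov e by blast
  moreover have "y \<in> K A" "z \<in> K ?B" using yz x closure_subset unfolding K_def by blast+
  moreover have "connected (closed_segment y z)" by (rule connected_segment)
  ultimately have "K A \<inter> K ?B \<inter> closed_segment y z \<noteq> {}"
    using cl ends_in_segment[of y z] unfolding connected_closed by blast
  then obtain w T1 T2 where w: "w \<in> closed_segment y z" "T1 \<in> A" "w \<in> closure T1" "T2 \<in> ?B" "w \<in> closure T2"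
    unfolding K_def by blast
  have T12: "T1 \<in> elems M" "T2 \<in> elems M" "T1 \<noteq> T2" using w A by auto
  have wA: "w \<notin> \<Union>\<A>" using w(1) yz(3) by blast
  have nin: "w \<notin> T1" "w \<notin> T2"
    using w disjoint_elems[OF T12] open_Int_closure_eq_empty[OF open_elem[OF T12(1)], of T2] 
      open_Int_closure_eq_empty[OF open_elem[OF T12(2)], of T1] by blast+
  obtain F1 where F1: "F1 \<in> faces_of M T1" "w \<in> F1" using frontier_point_in_face[OF T12(1) w(3) nin(1) wA] by blast
  obtain F2 where F2: "F2 \<in> faces_of M T2" "w \<in> F2" using frontier_point_in_face[OF T12(2) w(5) nin(2) wA] by blast
  have "F1 = F2" using pairwiseD[OF disjoint_faces faces_ofD(1)[OF F1(1)] faces_ofD(1)[OF F2(1)]] F1(2) F2(2)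
    unfolding disjnt_def by blast
  then have "F1 \<in> internal_faces M" "{side1 M F1, side2 M F1} = {T1, T2}"
    using internal_facesI[OF T12 F1(1)] F2 by auto
  then show ?thesis using w T12 by (intro bexI[of _ F1]) (auto simp: doubleton_eq_iff)
qed

text \<open>A generic segment that leaves the domain crosses the frontier inside a face. The face is
  not internal, because the two elements at an internal face would fill a neighbourhood of the
  crossing point.\<close>

lemma boundary_face_exists: "\<exists>T\<in>elems M. \<exists>F\<in>faces_of M T. F \<in> boundary_faces \<Omega> M"
proof -
  have "- closure \<Omega> \<noteq> {}"
  proof
    assume "- closure \<Omega> = {}"
    then have "closure \<Omega> = UNIV" by auto
    then show False using bounded_closure[OF bounded_\<Omega>] not_bounded_UNIV by metis
  qed
  then obtain y z where yz: "y \<in> \<Omega>" "z \<in> - closure \<Omega>" "closed_segment y z \<inter> \<Union>\<A> = {}"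
    using generic_segment[OF thin open_\<Omega> nonempty_\<Omega>, of "- closure \<Omega>"] by auto
  have "closed_segment y z \<inter> frontier \<Omega> \<noteq> {}"
    using yz(1,2) closure_subset[of \<Omega>] ends_in_segment[of y z]
    by (intro connected_Int_frontier[OF connected_segment]) blast+
  then obtain w where w: "w \<in> closed_segment y z" "w \<in> frontier \<Omega>" by blast
  have wA: "w \<notin> \<Union>\<A>" using w(1) yz(3) by blast
  have w\<Omega>: "w \<in> closure \<Omega>" "w \<notin> \<Omega>" using w(2) open_\<Omega> by (auto simp: frontier_def interior_open)
  obtain T where T: "T \<in> elems M" "w \<in> closure T" using w\<Omega> closure_\<Omega> by auto
  have "w \<notin> T" using elem_subset_\<Omega>[OF T(1)] w\<Omega> by blast
  then obtain F where F: "F \<in> faces_of M T" "w \<in> F" using frontier_point_in_face[OF T _ wA] by blast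
  have "F \<notin> internal_faces M"
  proof
    assume "F \<in> internal_faces M"
    then obtain e where e: "e > 0" "ball w e \<subseteq> closure (side1 M F) \<union> closure (side2 M F)"
      using shared_face(2)[OF sides(1-5)] F(2) by blast
    have "ball w e \<subseteq> closure \<Omega>" using e(2) sides(1,2)[OF \<open>F \<in> internal_faces M\<close>] by (auto simp: closure_\<Omega>)
    then have "w \<in> interior (closure \<Omega>)" using e(1) by (auto simp: mem_interior)
    then show False using w\<Omega> regular_\<Omega> by simp
  qed
  then have "F \<in> boundary_faces \<Omega> M" using F(1) faces_split faces_ofD(1) by blast
  then show ?thesis using T F by blast
qed

lemma negligible_skeleton: "negligible (\<Omega> - \<Union>(elems M))"
proof (rule negligible_subset)
  show "negligible (\<Union>T\<in>elems M. frontier T)"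
  proof (rule negligible_Union)
    fix X assume "X \<in> frontier ` elems M"
    then obtain T where T: "T \<in> elems M" "X = frontier T" by blast
    interpret star_element T "ctr T" "rad T" "faces_of M T" \<A> by (rule elem[OF T(1)])
    show "negligible X" unfolding T frontier_T
    proof (rule negligible_Union)
      fix Y assume "Y \<in> closure ` faces_of M T"
      then obtain F where F: "F \<in> faces_of M T" "Y = closure F" by blast
      obtain n b where n: "norm n = 1" "openin (top_of_set {x. n \<bullet> x = b}) F"
        using hyperplanar_face_unit_normal[OF face[OF F(1)]] by blast
      have "F \<subseteq> {x. n \<bullet> x = b}" using n(2) openin_imp_subset by blast
      then have "Y \<subseteq> {x. n \<bullet> x = b}" unfolding F(2) by (rule closure_minimal) (rule closed_hyperplane)
      moreover have "n \<noteq> 0" using n(1) by auto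
      ultimately show "negligible Y" using negligible_hyperplane[of n b] negligible_subset by blast
    qed simp
  qed simp
  show "\<Omega> - \<Union>(elems M) \<subseteq> (\<Union>T\<in>elems M. frontier T)"
  proof
    fix x assume x: "x \<in> \<Omega> - \<Union>(elems M)"
    then obtain T where "T \<in> elems M" "x \<in> closure T" using closure_\<Omega> closure_subset by blast
    then show "x \<in> (\<Union>T\<in>elems M. frontier T)" using x open_elem by (auto simp: frontier_def interior_open)
  qed
qed

end

lemma polyhedral_set_open: "polyhedral_set X \<Longrightarrow> open X" by (auto simp: polyhedral_set_def)

lemma polyhedral_set_regular:
  assumes "polyhedral_set X" shows "interior (closure X) = X"
proof -
  obtain C where C: "finite C" "\<forall>K\<in>C. polytope K" "X = interior (\<Union>C)" using assms by (auto simp: polyhedral_set_def)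
  have "closed (\<Union>C)" using C by (auto intro: closed_Union polytope_imp_closed)
  then have "closure X \<subseteq> \<Union>C" unfolding C(3) by (intro closure_minimal interior_subset)
  then have "interior (closure X) \<subseteq> X" unfolding C(3) using interior_mono by blast
  moreover have "X \<subseteq> interior (closure X)"
    by (rule interior_maximal[OF closure_subset polyhedral_set_open[OF assms]])
  ultimately show ?thesis by blast
qed

lemma polyhedral_set_bounded: 
  assumes "polyhedral_set X" shows "bounded X"
proof -
  obtain C where C: "finite C" "\<forall>K\<in>C. polytope K" "X = interior (\<Union>C)" using assms by (auto simp: polyhedral_set_def)
  have "bounded (\<Union>C)" using C by (auto intro: bounded_Union polytope_imp_bounded)
  then show ?thesis using C(3) interior_subset bounded_subset by blast
qed

text \<open>A point \<open>w\<close> of the relative boundary of a face lies on some facet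
  \<open>E\<close> of the simplicial submesh. Either \<open>w\<close> is in the relative boundary of
  \<open>E\<close>, hence in one of the finitely many facets of facets, or, by conformity, the
  relative interior of \<open>E\<close> contains \<open>w\<close> and is disjoint from the face. In
  the second case the hyperplanes of \<open>E\<close> and of the face are distinct: otherwise the
  relative interior of \<open>E\<close> would be a neighbourhood of \<open>w\<close> in this
  hyperplane and would meet the face, as \<open>w\<close> is in its closure. So \<open>w\<close>
  lies in the intersection of two distinct hyperplanes.\<close>

lemma submesh_thin_family:
  fixes \<Omega> :: "'d::finite point set"
  assumes M: "is_mesh \<Omega> M" and sub: "matching_simplicial_submesh \<Omega> M \<S>"
  shows "\<exists>\<A>. thin_family \<A> \<and> (\<forall>T\<in>elems M. \<forall>F\<in>faces_of M T. closure F - F \<subseteq> \<Union>\<A>)"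
proof -
  have tri: "triangulation \<S>" and simp: "\<And>S. S \<in> \<S> \<Longrightarrow> int CARD('d) simplex S" and cov: "\<Union>\<S> = closure \<Omega>"
    and ex1: "\<forall>S\<in>\<S>. \<exists>!T. T \<in> elems M \<and> interior S \<subseteq> T"
    and fac': "\<forall>S\<in>\<S>. \<forall>E. E facet_of S \<longrightarrow> (\<forall>F\<in>faces M. rel_interior E \<inter> F = {} \<or> rel_interior E \<subseteq> F)"
    using sub by (simp_all add: matching_simplicial_submesh_def)
  have inT: "\<exists>T. T \<in> elems M \<and> interior S \<subseteq> T" if "S \<in> \<S>" for S
    using bspec[OF ex1 that] by (rule ex1_implies_ex)
  have fac: "rel_interior E \<inter> F = {} \<or> rel_interior E \<subseteq> F" if "S \<in> \<S>" "E facet_of S" "F \<in> faces M" for S E F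
    using fac' that by blast
  have fin\<S>: "finite \<S>" using tri by (simp add: triangulation_def)
  have poly: "polytope S" if "S \<in> \<S>" for S using simp[OF that] simplex_imp_polytope by blast
  define \<E> where "\<E> = (\<Union>S\<in>\<S>. {E. E facet_of S})"
  have fin\<E>: "finite \<E>" unfolding \<E>_def using fin\<S> poly finite_polytope_facets by blast
  have E: "polytope E" "aff_dim E = int CARD('d) - 1" if Ein: "E \<in> \<E>" for E
  proof -
    obtain S where S: "S \<in> \<S>" "E facet_of S" using Ein by (auto simp: \<E>_def)
    show "polytope E" using S poly face_of_polytope_polytope facet_of_imp_face_of by blast
    show "aff_dim E = int CARD('d) - 1" using S simp[OF S(1)] aff_dim_simplex by (auto simp: facet_of_def)
  qed
  (* the spans of the facets of the facets of simplices *)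
  define \<A>1 where "\<A>1 = (\<Union>E\<in>\<E>. (\<lambda>E'. affine hull E') ` {E'. E' facet_of E})"
  define hyp where "hyp F = (SOME H. \<exists>a b. a \<noteq> 0 \<and> H = {x. a \<bullet> x = b} \<and> openin (top_of_set H) F)" for F :: "'d point set"
  (* transversal intersections of the hyperplanes of facets and faces *)
  define \<A>2 where "\<A>2 = {A \<in> (\<lambda>(E, F). affine hull E \<inter> hyp F) ` (\<E> \<times> faces M). aff_dim A \<le> int CARD('d) - 2}"
  have hyp: "\<exists>a b. a \<noteq> 0 \<and> hyp F = {x. a \<bullet> x = b} \<and> openin (top_of_set (hyp F)) F" if "F \<in> faces M" for F
  proof -
    have "hyperplanar_face F" using M that by (auto simp: is_mesh_def)
    then have "\<exists>H a b. a \<noteq> 0 \<and> H = {x. a \<bullet> x = b} \<and> openin (top_of_set H) F" by (auto simp: hyperplanar_face_def)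
    then show ?thesis unfolding hyp_def by (rule someI_ex)
  qed
  have "thin_family (\<A>1 \<union> \<A>2)" unfolding thin_family_def
  proof (intro conjI ballI)
    have "finite \<A>1" unfolding \<A>1_def using fin\<E> E(1) finite_polytope_facets by blast
    moreover have "finite \<A>2" unfolding \<A>2_def using fin\<E> M by (auto simp: is_mesh_def)
    ultimately show "finite (\<A>1 \<union> \<A>2)" by blast
    fix A assume A: "A \<in> \<A>1 \<union> \<A>2"
    show "affine A"
    proof (cases "A \<in> \<A>1")
      case False
      then obtain E F where EF: "F \<in> faces M" "A = affine hull E \<inter> hyp F" using A by (auto simp: \<A>2_def)
      obtain a b where "hyp F = {x. a \<bullet> x = b}" using hyp[OF EF(1)] by blast
      then show ?thesis unfolding EF(2) using affine_hyperplane[of a b] by (auto intro: affine_Int)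
    qed (auto simp: \<A>1_def)
    show "aff_dim A \<le> int DIM('d point) - 2"
    proof (cases "A \<in> \<A>1")
      case True
      then obtain E E' where E': "E \<in> \<E>" "E' facet_of E" "A = affine hull E'" by (auto simp: \<A>1_def)
      then show ?thesis using E(2)[OF E'(1)] by (simp add: facet_of_def)
    qed (use A in \<open>auto simp: \<A>2_def\<close>)
  qed
  moreover have "w \<in> \<Union>(\<A>1 \<union> \<A>2)" if T: "T \<in> elems M" and F: "F \<in> faces_of M T" and w: "w \<in> closure F" "w \<notin> F" for T F w
  proof -
    have Ff: "F \<in> faces M" "F \<subseteq> frontier T" using F by (auto simp: faces_of_def)
    have wT: "w \<in> frontier T" using w(1) Ff(2) closure_minimal[OF Ff(2) frontier_closed] by blast
    have "closure T \<subseteq> closure \<Omega>" using M T by (auto simp: is_mesh_def)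
    then obtain S where S: "S \<in> \<S>" "w \<in> S" using wT cov by (auto simp: frontier_def)
    have opT: "open X" if "X \<in> elems M" for X using M that polyhedral_set_open by (auto simp: is_mesh_def)
    have "w \<notin> interior S"
    proof
      assume wi: "w \<in> interior S"
      obtain T' where T': "T' \<in> elems M" "interior S \<subseteq> T'" using inT[OF S(1)] by blast
      have "w \<in> T'" "w \<in> closure T" "w \<notin> T" using wi T' wT opT[OF T] by (auto simp: frontier_def interior_open)
      moreover have "T' \<inter> T = {}" if "T' \<noteq> T"
        using M T T'(1) that pairwiseD[of disjnt "elems M" T' T] by (simp add: is_mesh_def disjnt_def)
      ultimately show False using open_Int_closure_eq_empty[OF opT[OF T'(1)], of T] by blast
    qed
    moreover have "S \<subseteq> affine hull S" by (rule hull_subset)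
    have fd: "interior S = rel_interior S"
    proof -
      have "aff_dim S = int DIM('d point)" using aff_dim_simplex[OF simp[OF S(1)]] by simp
      then have "affine hull S = UNIV" using aff_dim_eq_full by blast
      then show ?thesis by (rule rel_interior_interior[symmetric])
    qed
    ultimately have "w \<in> rel_frontier S" using S(2) closure_subset by (auto simp: rel_frontier_def)
    then obtain E where wE: "E facet_of S" "w \<in> E"
      using rel_frontier_of_polyhedron[OF polytope_imp_polyhedron[OF poly[OF S(1)]]] by auto
    then have EE: "E \<in> \<E>" using S by (auto simp: \<E>_def)
    show ?thesis
    proof (cases "w \<in> rel_interior E")
      case False
      then have "w \<in> rel_frontier E" using wE(2) closure_subset by (auto simp: rel_frontier_def)
      then obtain E' where "E' facet_of E" "w \<in> E'"
        using rel_frontier_of_polyhedron[OF polytope_imp_polyhedron[OF E(1)[OF EE]]] by auto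
      then have "affine hull E' \<in> \<A>1" "w \<in> affine hull E'" using EE by (auto simp: \<A>1_def intro: hull_inc)
      then show ?thesis by blast
    next
      case True
      have dj: "rel_interior E \<inter> F = {}" using fac[OF S(1) wE(1) Ff(1)] True w(2) by blast
      obtain a b where ab: "a \<noteq> 0" "hyp F = {x. a \<bullet> x = b}" "openin (top_of_set (hyp F)) F" using hyp[OF Ff(1)] by blast
      have Fh: "F \<subseteq> hyp F" using ab(3) openin_imp_subset by blast
      then have "closure F \<subseteq> hyp F" unfolding ab(2) by (rule closure_minimal) (rule closed_hyperplane)
      then have wh: "w \<in> hyp F" using w(1) by blast
      have wE': "w \<in> affine hull E" using wE(2) by (rule hull_inc)
      have "\<not> affine hull E \<subseteq> hyp F"
      proof
        assume sub: "affine hull E \<subseteq> hyp F"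
        have "aff_dim (affine hull E) = aff_dim (hyp F)"
          using E(2)[OF EE] ab by (simp add: aff_dim_hyperplane)
        moreover have "affine (hyp F)" unfolding ab(2) by (rule affine_hyperplane)
        moreover have "affine hull E \<noteq> {}" using wE' by blast
        ultimately have eq: "affine hull E = hyp F" using affine_dim_equal[OF affine_affine_hull] sub by blast
        have "openin (top_of_set (hyp F)) (rel_interior E)" unfolding eq[symmetric] by (rule openin_rel_interior)
        then obtain U where U: "open U" "rel_interior E = hyp F \<inter> U" by (auto simp: openin_open)
        then have "w \<in> U" using True by blast
        then have "U \<inter> F \<noteq> {}" using w(1) open_Int_closure_eq_empty[OF U(1), of F] by blast
        then show False using dj U Fh by blast
      qed
      then have "aff_dim (affine hull E \<inter> hyp F) = aff_dim (affine hull E) - 1"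
        using aff_dim_affine_Int_hyperplane[OF affine_affine_hull, of E a b] wh wE' by (auto simp: ab(2))
      then have "aff_dim (affine hull E \<inter> hyp F) \<le> int CARD('d) - 2" using E(2)[OF EE] by simp
      then have "affine hull E \<inter> hyp F \<in> \<A>2" using EE Ff by (auto simp: \<A>2_def)
      then show ?thesis using wh wE' by blast
    qed
  qed
  ultimately show ?thesis by blast
qed

lemma regular_mesh_imp_hho_mesh:
  fixes \<Omega> :: "'d::finite point set"
  assumes d: "CARD('d) \<ge> 2" and \<Omega>: "polyhedral_set \<Omega>" "bounded \<Omega>" "connected \<Omega>" "\<Omega> \<noteq> {}"
    and reg: "regular_mesh_sequence \<Omega> \<rho> H M" and h: "h \<in> H"
  shows "\<exists>ctr rad \<A>. hho_mesh \<Omega> (M h) ctr rad \<A>"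
proof -
  have mesh: "is_mesh \<Omega> (M h)" using reg h by (auto simp: regular_mesh_sequence_def)
  obtain \<S> where "matching_simplicial_submesh \<Omega> (M h) \<S>" using reg h unfolding regular_mesh_sequence_def by blast
  then obtain \<A> where \<A>: "thin_family \<A>" "\<forall>T\<in>elems (M h). \<forall>F\<in>faces_of (M h) T. closure F - F \<subseteq> \<Union>\<A>"
    using submesh_thin_family[OF mesh] by blast
  obtain c where c: "c > 0" "\<forall>T\<in>elems (M h). \<exists>x r. c * diameter T \<le> r \<and> ball x r \<subseteq> T \<and>
        (\<forall>y\<in>ball x r. \<forall>z\<in>T. closed_segment y z \<subseteq> T)"
    using reg h unfolding regular_mesh_sequence_def by blast
  have "\<forall>T\<in>elems (M h). \<exists>xr. star_element T (fst xr) (snd xr) (faces_of (M h) T) \<A>"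
  proof
    fix T assume T: "T \<in> elems (M h)"
    then obtain x r where xr: "c * diameter T \<le> r" "ball x r \<subseteq> T" "\<forall>y\<in>ball x r. \<forall>z\<in>T. closed_segment y z \<subseteq> T"
      using c by blast
    have pT: "polyhedral_set T" "T \<noteq> {}" using mesh T by (auto simp: is_mesh_def)
    have oT: "open T" "bounded T" using pT polyhedral_set_open polyhedral_set_bounded by auto
    obtain z where z: "z \<in> T" using pT by blast
    have "infinite T" using finite_imp_not_open[of T] oT(1) pT(2) by blast
    then obtain z' where z': "z' \<in> T" "z' \<noteq> z" using z by (metis finite.emptyI finite_insert insertCI subset_singletonD subsetI finite_subset)
    have "0 < dist z z'" using z' by simp
    also have "\<dots> \<le> diameter T" using diameter_bounded_bound[OF oT(2) z z'(1)] .
    finally have "diameter T > 0" .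
    then have "r > 0" using xr(1) c(1) by (smt (verit) mult_pos_pos)
    have m: "finite (faces (M h))" "\<forall>F\<in>faces (M h). hyperplanar_face F" "pairwise disjnt (faces (M h))"
      "\<forall>T\<in>elems (M h). frontier T = (\<Union>F\<in>faces_of (M h) T. closure F)"
      using mesh unfolding is_mesh_def by - (elim conjE, assumption)+
    have sub: "faces_of (M h) T \<subseteq> faces (M h)" by (auto simp: faces_of_def)
    have "star_element T x r (faces_of (M h) T) \<A>"
    proof (rule star_element.intro)
      show "finite (faces_of (M h) T)" using m(1) sub finite_subset by blast
      show "pairwise disjnt (faces_of (M h) T)" using m(3) sub by (rule pairwise_subset)
      show "closure F - F \<subseteq> \<Union>\<A>" if "F \<in> faces_of (M h) T" for F using \<A>(2) T that by blast
    qed (use oT xr m T sub \<A>(1) \<open>r > 0\<close> in blast)+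
    then show "\<exists>xr. star_element T (fst xr) (snd xr) (faces_of (M h) T) \<A>" by (intro exI[of _ "(x, r)"]) simp
  qed
  from bchoice[OF this] obtain xr where "\<forall>T\<in>elems (M h). star_element T (fst (xr T)) (snd (xr T)) (faces_of (M h) T) \<A>" ..
  then have "hho_mesh \<Omega> (M h) (\<lambda>T. fst (xr T)) (\<lambda>T. snd (xr T)) \<A>"
    using d \<Omega> mesh polyhedral_set_open[OF \<Omega>(1)] polyhedral_set_regular[OF \<Omega>(1)]
    by (intro hho_mesh.intro) blast+
  then show ?thesis by blast
qed

section \<open>The divergence theorem on a star-shaped element\<close>

subsection \<open>Slices and cones\<close>

text \<open>The foot of the perpendicular to the hyperplane through the origin with normal
  \<open>n\<close>. Together with \<open>slab\<close>, a prism of height one over that hyperplane,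
  it expresses surface integrals as volume integrals.\<close>

definition foot :: "'a::euclidean_space \<Rightarrow> 'a \<Rightarrow> 'a" where
  "foot n x = x - (n \<bullet> x) *\<^sub>R n"

definition slab :: "'a::euclidean_space \<Rightarrow> 'a set" where
  "slab n = {x. 0 < n \<bullet> x \<and> n \<bullet> x < 1}"

lemma foot_measurable [measurable]: "foot n \<in> borel_measurable borel"
  unfolding foot_def by measurable

lemma slab_measurable [measurable]: "slab n \<in> sets borel"
  unfolding slab_def by measurable

lemma nn_integral_translation:
  fixes f :: "'a::euclidean_space \<Rightarrow> ennreal"
  assumes [measurable]: "f \<in> borel_measurable borel"
  shows "(\<integral>\<^sup>+x. f x \<partial>lborel) = (\<integral>\<^sup>+x. f (a + x) \<partial>lborel)"
  by (subst lborel_distr_plus[of a, symmetric]) (simp add: nn_integral_distr)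

lemma foot_shift: "norm n = 1 \<Longrightarrow> foot n (x + c *\<^sub>R n) = foot n x"
  by (simp add: foot_def inner_add_right algebra_simps dot_square_norm)

lemma inner_foot: "norm n = 1 \<Longrightarrow> n \<bullet> foot n x = 0"
  by (simp add: foot_def inner_diff_right dot_square_norm)

lemma foot_scale: "foot n (s *\<^sub>R x) = s *\<^sub>R foot n x"
  by (simp add: foot_def algebra_simps)

text \<open>Fubini for the hyperplanes \<open>n \<bullet> x = c\<close>, where the integral over a
  hyperplane is the volume integral over the slab of a function of the foot. Instead of an
  orthogonal change of variables, the constant 1 is inserted as the integral over
  \<open>\<sigma>\<close> of the indicator of the slab moved by \<open>\<sigma> n\<close>, and the
  rest is Fubini and translation.\<close>

lemma nn_integral_slices:
  fixes n :: "'a::euclidean_space" and k :: "'a \<Rightarrow> ennreal"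
  assumes k [measurable]: "k \<in> borel_measurable borel" and n: "norm n = 1"
  shows "(\<integral>\<^sup>+x. k x \<partial>lborel) =
    (\<integral>\<^sup>+c. \<integral>\<^sup>+x. indicator (slab n) x * k (foot n x + c *\<^sub>R n) \<partial>lborel \<partial>lborel)"
proof -
  have nn: "n \<bullet> n = 1" using n by (simp add: dot_square_norm)
  have one: "(\<integral>\<^sup>+\<sigma>. indicator (slab n) (x - \<sigma> *\<^sub>R n) \<partial>lborel) = 1" for x
  proof -
    have "(\<integral>\<^sup>+\<sigma>. indicator (slab n) (x - \<sigma> *\<^sub>R n) \<partial>lborel) = (\<integral>\<^sup>+\<sigma>. indicator {n \<bullet> x - 1<..<n \<bullet> x} \<sigma> \<partial>lborel)"
      by (rule nn_integral_cong) (auto simp: indicator_def slab_def inner_diff_right nn)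
    also have "\<dots> = 1" by simp
    finally show ?thesis .
  qed
  have "(\<integral>\<^sup>+x. k x \<partial>lborel) = (\<integral>\<^sup>+x. \<integral>\<^sup>+\<sigma>. k x * indicator (slab n) (x - \<sigma> *\<^sub>R n) \<partial>lborel \<partial>lborel)"
    by (subst nn_integral_cmult) (simp_all add: one)
  also have "\<dots> = (\<integral>\<^sup>+\<sigma>. \<integral>\<^sup>+x. k x * indicator (slab n) (x - \<sigma> *\<^sub>R n) \<partial>lborel \<partial>lborel)"
    by (rule lborel_pair.Fubini') measurable
  also have "\<dots> = (\<integral>\<^sup>+\<sigma>. \<integral>\<^sup>+x. k (\<sigma> *\<^sub>R n + x) * indicator (slab n) x \<partial>lborel \<partial>lborel)"
  proof (rule nn_integral_cong)
    fix \<sigma> :: real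
    show "(\<integral>\<^sup>+x. k x * indicator (slab n) (x - \<sigma> *\<^sub>R n) \<partial>lborel) = (\<integral>\<^sup>+x. k (\<sigma> *\<^sub>R n + x) * indicator (slab n) x \<partial>lborel)"
      by (subst nn_integral_translation[of _ "\<sigma> *\<^sub>R n"]) simp_all
  qed
  also have "\<dots> = (\<integral>\<^sup>+x. \<integral>\<^sup>+\<sigma>. k (\<sigma> *\<^sub>R n + x) * indicator (slab n) x \<partial>lborel \<partial>lborel)"
    by (rule lborel_pair.Fubini'[symmetric]) measurable
  also have "\<dots> = (\<integral>\<^sup>+x. \<integral>\<^sup>+c. indicator (slab n) x * k (foot n x + c *\<^sub>R n) \<partial>lborel \<partial>lborel)"
  proof (rule nn_integral_cong)
    fix x
    have "(\<integral>\<^sup>+\<sigma>. k (\<sigma> *\<^sub>R n + x) * indicator (slab n) x \<partial>lborel) =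
        (\<integral>\<^sup>+c. k ((- (n \<bullet> x) + c) *\<^sub>R n + x) * indicator (slab n) x \<partial>lborel)"
      by (rule nn_integral_translation) measurable
    also have "\<dots> = (\<integral>\<^sup>+c. indicator (slab n) x * k (foot n x + c *\<^sub>R n) \<partial>lborel)"
      by (rule nn_integral_cong) (simp add: foot_def algebra_simps mult.commute)
    finally show "(\<integral>\<^sup>+\<sigma>. k (\<sigma> *\<^sub>R n + x) * indicator (slab n) x \<partial>lborel) =
      (\<integral>\<^sup>+c. indicator (slab n) x * k (foot n x + c *\<^sub>R n) \<partial>lborel)" .
  qed
  also have "\<dots> = (\<integral>\<^sup>+c. \<integral>\<^sup>+x. indicator (slab n) x * k (foot n x + c *\<^sub>R n) \<partial>lborel \<partial>lborel)"
    by (rule lborel_pair.Fubini') measurable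
  finally show ?thesis .
qed

text \<open>Integrals over hyperplanes scale with exponent \<open>d - 1\<close>: a dilation
  contributes \<open>s ^ d\<close> and stretches the slab to the height \<open>1 /
  s\<close>.\<close>

lemma nn_integral_slab_scale:
  fixes n :: "'a::euclidean_space" and Q :: "'a \<Rightarrow> ennreal"
  assumes Q [measurable]: "Q \<in> borel_measurable borel" and n: "norm n = 1" and s: "s > 0"
  shows "(\<integral>\<^sup>+x. indicator (slab n) x * Q ((1/s) *\<^sub>R foot n x) \<partial>lborel) =
    ennreal (s ^ (DIM('a) - 1)) * (\<integral>\<^sup>+x. indicator (slab n) x * Q (foot n x) \<partial>lborel)"
proof -
  let ?I = "\<integral>\<^sup>+x. indicator (slab n) x * Q (foot n x) \<partial>lborel"
  have nn: "n \<bullet> n = 1" using n by (simp add: dot_square_norm)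
  have "(\<integral>\<^sup>+x. indicator (slab n) x * Q ((1/s) *\<^sub>R foot n x) \<partial>lborel) =
      (\<integral>\<^sup>+x. ennreal (\<bar>s\<bar> ^ DIM('a)) * (indicator (slab n) (s *\<^sub>R x) * Q ((1/s) *\<^sub>R foot n (s *\<^sub>R x))) \<partial>lborel)"
    using s by (subst lborel_affine[of s 0]) (simp_all add: nn_integral_density nn_integral_distr)
  also have "\<dots> = ennreal (s ^ DIM('a)) * (\<integral>\<^sup>+x. indicator {0<..<1/s} (n \<bullet> x) * Q (foot n x) \<partial>lborel)"
    using s by (subst nn_integral_cmult[symmetric])
      (auto intro!: nn_integral_cong simp: foot_scale slab_def indicator_def field_simps zero_less_mult_iff)
  also have "(\<integral>\<^sup>+x. indicator {0<..<1/s} (n \<bullet> x) * Q (foot n x) \<partial>lborel) = 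
      (\<integral>\<^sup>+c. \<integral>\<^sup>+x. indicator (slab n) x * (indicator {0<..<1/s} (n \<bullet> (foot n x + c *\<^sub>R n)) * Q (foot n (foot n x + c *\<^sub>R n))) \<partial>lborel \<partial>lborel)"
    by (rule nn_integral_slices[OF _ n]) measurable
  also have "\<dots> = (\<integral>\<^sup>+c. indicator {0<..<1/s} (c::real) * ?I \<partial>lborel)"
  proof (rule nn_integral_cong)
    fix c :: real
    have "foot n (foot n x) = foot n x" for x by (simp add: foot_def inner_diff_right nn)
    then have "(\<integral>\<^sup>+x. indicator (slab n) x * (indicator {0<..<1/s} (n \<bullet> (foot n x + c *\<^sub>R n)) * Q (foot n (foot n x + c *\<^sub>R n))) \<partial>lborel) =
      (\<integral>\<^sup>+x. indicator {0<..<1/s} c * (indicator (slab n) x * Q (foot n x)) \<partial>lborel)"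
      by (intro nn_integral_cong) (simp add: inner_add_right inner_foot[OF n] nn foot_shift[OF n] mult_ac)
    also have "\<dots> = indicator {0<..<1/s} c * ?I" by (rule nn_integral_cmult) measurable
    finally show "(\<integral>\<^sup>+x. indicator (slab n) x * (indicator {0<..<1/s} (n \<bullet> (foot n x + c *\<^sub>R n)) * Q (foot n (foot n x + c *\<^sub>R n))) \<partial>lborel) =
      indicator {0<..<1/s} c * ?I" .
  qed
  also have "\<dots> = ennreal (1/s) * ?I" using s by (simp add: nn_integral_multc)
  also have "ennreal (s ^ DIM('a)) * (ennreal (1/s) * ?I) = ennreal (s ^ DIM('a) * (1/s)) * ?I"
    using ennreal_mult[of "s ^ DIM('a)" "1/s"] s by (simp only: mult.assoc zero_le_power zero_le_divide_1_iff less_imp_le)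
  also have "s ^ DIM('a) * (1/s) = s ^ (DIM('a) - 1)"
    using s power_Suc[of s "DIM('a) - 1"] DIM_positive[where 'a='a] by (simp add: field_simps)
  finally show ?thesis .
qed

lemma cone_with_apex_0:
  fixes n :: "'a::euclidean_space"
  assumes \<beta>: "\<beta> > 0" and F: "F \<subseteq> {z. n \<bullet> z = \<beta>}"
  shows "{s *\<^sub>R z |s z. 0 < s \<and> s < 1 \<and> z \<in> F} = {x. 0 < n \<bullet> x \<and> n \<bullet> x < \<beta> \<and> (\<beta> / (n \<bullet> x)) *\<^sub>R x \<in> F}"
proof (intro subset_antisym subsetI)
  fix x assume "x \<in> {s *\<^sub>R z |s z. 0 < s \<and> s < 1 \<and> z \<in> F}"
  then obtain s z where sz: "x = s *\<^sub>R z" "0 < s" "s < 1" "z \<in> F" by auto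
  then have "n \<bullet> x = s * \<beta>" using F by auto
  then show "x \<in> {x. 0 < n \<bullet> x \<and> n \<bullet> x < \<beta> \<and> (\<beta> / (n \<bullet> x)) *\<^sub>R x \<in> F}"
    using sz \<beta> by simp
next
  fix x assume x: "x \<in> {x. 0 < n \<bullet> x \<and> n \<bullet> x < \<beta> \<and> (\<beta> / (n \<bullet> x)) *\<^sub>R x \<in> F}"
  then show "x \<in> {s *\<^sub>R z |s z. 0 < s \<and> s < 1 \<and> z \<in> F}" using \<beta>
    by (intro CollectI exI[of _ "n \<bullet> x / \<beta>"] exI[of _ "(\<beta> / (n \<bullet> x)) *\<^sub>R x"]) (auto simp: field_simps)
qed

text \<open>Polar-like coordinates on the cone: the slice of the cone at height \<open>\<beta>
  s\<close> is the base dilated by \<open>s\<close>. The factor \<open>\<beta>\<close> is the height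
  of the cone.\<close>

lemma nn_integral_cone_origin:
  fixes n :: "'a::euclidean_space" and g :: "'a \<Rightarrow> ennreal"
  assumes g [measurable]: "g \<in> borel_measurable borel" and n: "norm n = 1" and \<beta>: "\<beta> > 0"
    and F [measurable]: "F \<in> sets borel" and Fn: "F \<subseteq> {z. n \<bullet> z = \<beta>}"
  shows "(\<integral>\<^sup>+x. indicator {s *\<^sub>R z |s z. 0 < s \<and> s < 1 \<and> z \<in> F} x * g x \<partial>lborel) =
    (\<integral>\<^sup>+s. indicator {0<..<1} s * ennreal (\<beta> * s ^ (DIM('a) - 1)) *
       (\<integral>\<^sup>+x. indicator (slab n) x * (indicator F (foot n x + \<beta> *\<^sub>R n) * g (s *\<^sub>R (foot n x + \<beta> *\<^sub>R n))) \<partial>lborel) \<partial>lborel)"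
proof -
  have nn: "n \<bullet> n = 1" using n by (simp add: dot_square_norm)
  define K where "K = {s *\<^sub>R z |s z. 0 < s \<and> s < 1 \<and> z \<in> F}"
  have K: "K = {x. 0 < n \<bullet> x \<and> n \<bullet> x < \<beta> \<and> (\<beta> / (n \<bullet> x)) *\<^sub>R x \<in> F}"
    unfolding K_def by (rule cone_with_apex_0[OF \<beta> Fn])
  have [measurable]: "K \<in> sets borel" unfolding K by measurable
  define G where "G s x = (indicator (slab n) x * (indicator F (foot n x + \<beta> *\<^sub>R n) * g (s *\<^sub>R (foot n x + \<beta> *\<^sub>R n))))" for s x
  have "(\<integral>\<^sup>+x. indicator K x * g x \<partial>lborel) =
    (\<integral>\<^sup>+c. \<integral>\<^sup>+x. indicator (slab n) x * (indicator K (foot n x + c *\<^sub>R n) * g (foot n x + c *\<^sub>R n)) \<partial>lborel \<partial>lborel)"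
    by (rule nn_integral_slices[OF _ n]) measurable
  also have "\<dots> = ennreal \<bar>\<beta>\<bar> * (\<integral>\<^sup>+s. \<integral>\<^sup>+x. indicator (slab n) x * (indicator K (foot n x + (0 + \<beta> * s) *\<^sub>R n) * g (foot n x + (0 + \<beta> * s) *\<^sub>R n)) \<partial>lborel \<partial>lborel)"
  proof (rule nn_integral_real_affine)
    show "\<beta> \<noteq> 0" using \<beta> by simp
  qed measurable
  also have "\<dots> = (\<integral>\<^sup>+s. ennreal \<beta> * (\<integral>\<^sup>+x. indicator (slab n) x * (indicator K (foot n x + (\<beta> * s) *\<^sub>R n) * g (foot n x + (\<beta> * s) *\<^sub>R n)) \<partial>lborel) \<partial>lborel)"
    using \<beta> by (subst nn_integral_cmult[symmetric]) simp_all
  also have "\<dots> = (\<integral>\<^sup>+s. indicator {0<..<1} s * ennreal (\<beta> * s ^ (DIM('a) - 1)) * (\<integral>\<^sup>+x. G s x \<partial>lborel) \<partial>lborel)"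
  proof (rule nn_integral_cong)
    fix s :: real
    show "ennreal \<beta> * (\<integral>\<^sup>+x. indicator (slab n) x * (indicator K (foot n x + (\<beta> * s) *\<^sub>R n) * g (foot n x + (\<beta> * s) *\<^sub>R n)) \<partial>lborel) =
       indicator {0<..<1} s * ennreal (\<beta> * s ^ (DIM('a) - 1)) * (\<integral>\<^sup>+x. G s x \<partial>lborel)"
    proof (cases "0 < s \<and> s < 1")
      case True
      define Q where "Q w = indicator F (w + \<beta> *\<^sub>R n) * g (s *\<^sub>R (w + \<beta> *\<^sub>R n))" for w
      have [measurable]: "Q \<in> borel_measurable borel" unfolding Q_def by measurable
      have "(\<integral>\<^sup>+x. indicator (slab n) x * (indicator K (foot n x + (\<beta> * s) *\<^sub>R n) * g (foot n x + (\<beta> * s) *\<^sub>R n)) \<partial>lborel) =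
        (\<integral>\<^sup>+x. indicator (slab n) x * Q ((1/s) *\<^sub>R foot n x) \<partial>lborel)"
      proof (rule nn_integral_cong)
        fix x
        have e: "n \<bullet> (foot n x + (\<beta> * s) *\<^sub>R n) = \<beta> * s" by (simp add: inner_add_right inner_foot[OF n] nn)
        have e2: "(1/s) *\<^sub>R (foot n x + (\<beta> * s) *\<^sub>R n) = (1/s) *\<^sub>R foot n x + \<beta> *\<^sub>R n"
          using True by (simp add: scaleR_add_right)
        have "foot n x + (\<beta> * s) *\<^sub>R n \<in> K \<longleftrightarrow> (1/s) *\<^sub>R foot n x + \<beta> *\<^sub>R n \<in> F"
          unfolding K mem_Collect_eq e e2[symmetric] using True \<beta> by (simp add: divide_simps)
        moreover have "foot n x + (\<beta> * s) *\<^sub>R n = s *\<^sub>R ((1/s) *\<^sub>R foot n x + \<beta> *\<^sub>R n)"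
          unfolding e2[symmetric] using True by simp
        ultimately show "indicator (slab n) x * (indicator K (foot n x + (\<beta> * s) *\<^sub>R n) * g (foot n x + (\<beta> * s) *\<^sub>R n)) = indicator (slab n) x * Q ((1/s) *\<^sub>R foot n x)"
          by (simp add: Q_def indicator_def)
      qed
      also have "\<dots> = ennreal (s ^ (DIM('a) - 1)) * (\<integral>\<^sup>+x. indicator (slab n) x * Q (foot n x) \<partial>lborel)"
        by (rule nn_integral_slab_scale) (use True n in auto)
      finally show ?thesis using True \<beta> by (simp add: G_def Q_def ennreal_mult mult.assoc)
    next
      case False
      have "indicator K (foot n x + (\<beta> * s) *\<^sub>R n) = (0::ennreal)" for x
        using False \<beta> by (auto simp: K inner_add_right inner_foot[OF n] nn zero_less_mult_iff indicator_def)
      then show ?thesis using False by (auto simp: indicator_def)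
    qed
  qed
  finally show ?thesis unfolding K_def G_def .
qed

text \<open>The same formula for a cone with apex \<open>y\<close>, as an identity of measures:
  Lebesgue measure on the cone is the image of a weighted product measure on \<open>P \<times>
  {0<..<1}\<close>. In this form it also applies to integrals of signed functions. The set
  \<open>P\<close> is the part of the slab above the face.\<close>

lemma cone_measure_eq:
  fixes n y :: "'a::euclidean_space"
  assumes n: "norm n = 1" and b: "n \<bullet> y < b" and F [measurable]: "F \<in> sets borel" and Fn: "F \<subseteq> {z. n \<bullet> z = b}"
  defines "\<beta> \<equiv> b - n \<bullet> y" and "K \<equiv> {y + s *\<^sub>R (z - y) |s z. 0 < s \<and> s < 1 \<and> z \<in> F}"
  defines "a \<equiv> y + \<beta> *\<^sub>R n"
  defines "P \<equiv> {x. x \<in> slab n \<and> foot n x + a \<in> F}"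
  shows "K \<in> sets borel"
    and "density lborel (indicator K) =
     distr (density (lborel \<Otimes>\<^sub>M lborel) (\<lambda>(x, s). indicator P x * (indicator {0<..<1} s * ennreal (\<beta> * s ^ (DIM('a) - 1)))))
       borel (\<lambda>(x, s::real). y + s *\<^sub>R (foot n x + a - y))"
proof -
  have \<beta>: "\<beta> > 0" using b by (simp add: \<beta>_def)
  have nn: "n \<bullet> n = 1" using n by (simp add: dot_square_norm)
  define F' where "F' = (\<lambda>z. y + z) -` F"
  have F' [measurable]: "F' \<in> sets borel"
    using measurable_sets[of "\<lambda>z. y + z" borel borel F] F by (simp add: F'_def)
  have F'n: "F' \<subseteq> {z. n \<bullet> z = \<beta>}" using Fn by (auto simp: F'_def \<beta>_def inner_add_right)
  define K' where "K' = {s *\<^sub>R z |s z. 0 < s \<and> s < 1 \<and> z \<in> F'}"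
  have KK': "x \<in> K \<longleftrightarrow> x - y \<in> K'" for x
  proof
    assume "x \<in> K"
    then obtain s z where "x = y + s *\<^sub>R (z - y)" "0 < s" "s < 1" "z \<in> F" by (auto simp: K_def)
    then show "x - y \<in> K'" unfolding K'_def F'_def by (intro CollectI exI[of _ s] exI[of _ "z - y"]) auto
  next
    assume "x - y \<in> K'"
    then obtain s z where "x - y = s *\<^sub>R z" "0 < s" "s < 1" "y + z \<in> F" by (auto simp: K'_def F'_def)
    then show "x \<in> K" unfolding K_def by (intro CollectI exI[of _ s] exI[of _ "y + z"]) (auto simp: algebra_simps)
  qed
  have K': "K' = {x. 0 < n \<bullet> x \<and> n \<bullet> x < \<beta> \<and> (\<beta> / (n \<bullet> x)) *\<^sub>R x \<in> F'}"
    unfolding K'_def by (rule cone_with_apex_0[OF \<beta> F'n])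
  have [measurable]: "K' \<in> sets borel" unfolding K' by measurable
  have "K = (\<lambda>x. x - y) -` K'" using KK' by auto
  moreover have "(\<lambda>x. x - y) -` K' \<in> sets borel"
    using measurable_sets[of "\<lambda>x. x - y" borel borel K'] by simp
  ultimately show Km [measurable]: "K \<in> sets borel" by simp
  have Pm [measurable]: "P \<in> sets borel" unfolding P_def by measurable
  show "density lborel (indicator K) =
     distr (density (lborel \<Otimes>\<^sub>M lborel) (\<lambda>(x, s). indicator P x * (indicator {0<..<1} s * ennreal (\<beta> * s ^ (DIM('a) - 1)))))
       borel (\<lambda>(x, s::real). y + s *\<^sub>R (foot n x + a - y))" (is "_ = distr ?N borel ?\<Phi>")
  proof (rule measure_eqI)
    fix A assume "A \<in> sets (density lborel (indicator K))"
    then have A [measurable]: "A \<in> sets borel" by simp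
    have "emeasure (density lborel (indicator K)) A = (\<integral>\<^sup>+x. indicator K x * indicator A x \<partial>lborel)"
      by (subst emeasure_density) auto
    also have "\<dots> = (\<integral>\<^sup>+x. indicator K (y + x) * indicator A (y + x) \<partial>lborel)"
      by (rule nn_integral_translation) measurable
    also have "\<dots> = (\<integral>\<^sup>+x. indicator K' x * indicator A (y + x) \<partial>lborel)"
      by (rule nn_integral_cong) (simp add: KK' indicator_def)
    also have "\<dots> = (\<integral>\<^sup>+s. indicator {0<..<1} s * ennreal (\<beta> * s ^ (DIM('a) - 1)) *
       (\<integral>\<^sup>+x. indicator (slab n) x * (indicator F' (foot n x + \<beta> *\<^sub>R n) * indicator A (y + s *\<^sub>R (foot n x + \<beta> *\<^sub>R n))) \<partial>lborel) \<partial>lborel)"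
      unfolding K'_def by (rule nn_integral_cone_origin[OF _ n \<beta> F' F'n]) measurable
    also have "\<dots> = (\<integral>\<^sup>+s. \<integral>\<^sup>+x. indicator P x * (indicator {0<..<1} s * ennreal (\<beta> * s ^ (DIM('a) - 1))) * indicator A (?\<Phi> (x, s)) \<partial>lborel \<partial>lborel)"
    proof (rule nn_integral_cong)
      fix s :: real
      have "indicator {0<..<1} s * ennreal (\<beta> * s ^ (DIM('a) - 1)) *
         (\<integral>\<^sup>+x. indicator (slab n) x * (indicator F' (foot n x + \<beta> *\<^sub>R n) * indicator A (y + s *\<^sub>R (foot n x + \<beta> *\<^sub>R n))) \<partial>lborel) =
        (\<integral>\<^sup>+x. indicator {0<..<1} s * ennreal (\<beta> * s ^ (DIM('a) - 1)) *
         (indicator (slab n) x * (indicator F' (foot n x + \<beta> *\<^sub>R n) * indicator A (y + s *\<^sub>R (foot n x + \<beta> *\<^sub>R n)))) \<partial>lborel)"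
        by (rule nn_integral_cmult[symmetric]) measurable
      also have "\<dots> = (\<integral>\<^sup>+x. indicator P x * (indicator {0<..<1} s * ennreal (\<beta> * s ^ (DIM('a) - 1))) * indicator A (?\<Phi> (x, s)) \<partial>lborel)"
      proof (rule nn_integral_cong)
        fix x
        have e: "foot n x + \<beta> *\<^sub>R n \<in> F' \<longleftrightarrow> foot n x + a \<in> F" "y + s *\<^sub>R (foot n x + a - y) = y + s *\<^sub>R (foot n x + \<beta> *\<^sub>R n)"
          by (simp_all add: F'_def a_def algebra_simps)
        show "indicator {0<..<1} s * ennreal (\<beta> * s ^ (DIM('a) - 1)) *
         (indicator (slab n) x * (indicator F' (foot n x + \<beta> *\<^sub>R n) * indicator A (y + s *\<^sub>R (foot n x + \<beta> *\<^sub>R n)))) =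
         indicator P x * (indicator {0<..<1} s * ennreal (\<beta> * s ^ (DIM('a) - 1))) * indicator A (?\<Phi> (x, s))"
          unfolding prod.case e(2) by (simp add: P_def indicator_def e(1))
      qed
      finally show "indicator {0<..<1} s * ennreal (\<beta> * s ^ (DIM('a) - 1)) *
         (\<integral>\<^sup>+x. indicator (slab n) x * (indicator F' (foot n x + \<beta> *\<^sub>R n) * indicator A (y + s *\<^sub>R (foot n x + \<beta> *\<^sub>R n))) \<partial>lborel) =
        (\<integral>\<^sup>+x. indicator P x * (indicator {0<..<1} s * ennreal (\<beta> * s ^ (DIM('a) - 1))) * indicator A (?\<Phi> (x, s)) \<partial>lborel)" .
    qed
    also have "\<dots> = (\<integral>\<^sup>+x. \<integral>\<^sup>+s. indicator P x * (indicator {0<..<1} s * ennreal (\<beta> * s ^ (DIM('a) - 1))) * indicator A (?\<Phi> (x, s)) \<partial>lborel \<partial>lborel)"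
      by (rule lborel_pair.Fubini') measurable
    also have "\<dots> = (\<integral>\<^sup>+xs. (case xs of (x, s) \<Rightarrow> indicator P x * (indicator {0<..<1} s * ennreal (\<beta> * s ^ (DIM('a) - 1)))) * indicator A (?\<Phi> xs) \<partial>(lborel \<Otimes>\<^sub>M lborel))"
      by (subst lborel.nn_integral_fst[symmetric]) simp_all
    also have "\<dots> = (\<integral>\<^sup>+xs. (case xs of (x, s) \<Rightarrow> indicator P x * (indicator {0<..<1} s * ennreal (\<beta> * s ^ (DIM('a) - 1)))) * indicator (?\<Phi> -` A \<inter> space ?N) xs \<partial>(lborel \<Otimes>\<^sub>M lborel))"
      by (rule nn_integral_cong) (auto simp: indicator_def space_pair_measure)
    also have "\<dots> = emeasure ?N (?\<Phi> -` A \<inter> space ?N)"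
    proof (rule emeasure_density[symmetric])
      have "?\<Phi> \<in> borel_measurable (lborel \<Otimes>\<^sub>M lborel)" by measurable
      from measurable_sets[OF this A] show "?\<Phi> -` A \<inter> space ?N \<in> sets (lborel \<Otimes>\<^sub>M lborel)" by simp
    qed measurable
    also have "\<dots> = emeasure (distr ?N borel ?\<Phi>) A"
      by (rule emeasure_distr[symmetric]) measurable
    finally show "emeasure (density lborel (indicator K)) A = emeasure (distr ?N borel ?\<Phi>) A" .
  qed simp
qed

subsection \<open>The surface measure\<close>

lemma face_borel:
  assumes "openin (top_of_set {x. n \<bullet> x = b}) F"
  shows "F \<in> sets borel"
proof -
  obtain U where "open U" "F = {x. n \<bullet> x = b} \<inter> U" using assms by (auto simp: openin_open)
  then show ?thesis using closed_hyperplane[of n b] by auto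
qed

text \<open>The surface measure is defined with some choice of unit normal and with the prism
  attached to the face. Neither choice matters: the slab may be at the origin, and \<open>a\<close>
  may be any point of the hyperplane.\<close>

lemma face_measure_eq:
  fixes F :: "'d::finite point set"
  assumes n: "norm n = 1" and F: "openin (top_of_set {x. n \<bullet> x = b}) F" "F \<noteq> {}" and a: "n \<bullet> a = b"
  shows "face_measure F = distr (restrict_space lborel {x. x \<in> slab n \<and> foot n x + a \<in> F})
    (restrict_space borel F) (\<lambda>x. foot n x + a)"
proof -
  have Fb [measurable]: "F \<in> sets borel" by (rule face_borel[OF F(1)])
  have Fs: "F \<subseteq> {x. n \<bullet> x = b}" using F(1) openin_imp_subset by blast
  have nn: "n \<bullet> n = 1" using n by (simp add: dot_square_norm)
  obtain x0 where x0: "x0 \<in> F" using F(2) by blast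
  define m c where "m = fst (SOME (n, b). norm n = 1 \<and> F \<subseteq> {x. n \<bullet> x = b})"
    and "c = snd (SOME (n, b). norm n = 1 \<and> F \<subseteq> {x. n \<bullet> x = b})"
  have "case (SOME (n, b). norm n = 1 \<and> F \<subseteq> {x. n \<bullet> x = b}) of (n, b) \<Rightarrow> norm n = 1 \<and> F \<subseteq> {x. n \<bullet> x = b}"
    by (rule someI[of _ "(n, b)"]) (use n Fs in auto)
  then have mc: "norm m = 1" "F \<subseteq> {x. m \<bullet> x = c}" by (auto simp: m_def c_def split: prod.splits)
  define ft where "ft = (\<lambda>x. x - (m \<bullet> x - c) *\<^sub>R m)"
  define P1 where "P1 = {x. c < m \<bullet> x \<and> m \<bullet> x < c + 1 \<and> ft x \<in> F}"
  define P2 where "P2 = {x. x \<in> slab n \<and> foot n x + a \<in> F}"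
  have fm: "face_measure F = distr (restrict_space lborel P1) (restrict_space borel F) ft"
    unfolding face_measure_def P1_def ft_def m_def c_def by (simp add: Let_def case_prod_beta)
  have [measurable]: "ft \<in> borel_measurable borel" unfolding ft_def by measurable
  have [measurable]: "P1 \<in> sets borel" unfolding P1_def by measurable
  have [measurable]: "P2 \<in> sets borel" unfolding P2_def by measurable
  have mt: "ft \<in> measurable (restrict_space lborel P1) (restrict_space borel F)"
    by (intro measurable_restrict_space3) (auto simp: P1_def)
  have mf: "(\<lambda>x. foot n x + a) \<in> measurable (restrict_space lborel P2) (restrict_space borel F)"
    by (intro measurable_restrict_space3) (auto simp: P2_def)
  define sh where "sh = (if m = n then a else a - n)"
  have shift: "sh + x \<in> P1 \<longleftrightarrow> x \<in> P2" "ft (sh + x) = foot n x + a" for x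
  proof -
    have "n \<noteq> - n" 
    proof
      assume "n = - n"
      then have "n \<bullet> n = - (n \<bullet> n)" by (metis inner_minus_left)
      then show False using nn by simp
    qed
    then consider "m = n" "c = b" | "m = - n" "c = - b" "m \<noteq> n"
      using unit_normal_unique[OF F(1) x0 n mc] by metis
    then have "ft (sh + x) = foot n x + a \<and> (c < m \<bullet> (sh + x) \<and> m \<bullet> (sh + x) < c + 1 \<longleftrightarrow> x \<in> slab n)"
      by cases (auto simp: ft_def sh_def foot_def slab_def inner_add_right inner_diff_right nn a algebra_simps)
    then show "sh + x \<in> P1 \<longleftrightarrow> x \<in> P2" "ft (sh + x) = foot n x + a" by (auto simp: P1_def P2_def)
  qed
  show ?thesis unfolding fm P2_def[symmetric]
  proof (rule measure_eqI)
    fix A assume "A \<in> sets (distr (restrict_space lborel P1) (restrict_space borel F) ft)"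
    then have A: "A \<in> sets (restrict_space borel F)" by simp
    then have Ab [measurable]: "A \<in> sets borel" "A \<subseteq> F" by (auto simp: sets_restrict_space_iff)
    have "emeasure (distr (restrict_space lborel P1) (restrict_space borel F) ft) A
      = emeasure lborel (ft -` A \<inter> P1)"
      by (subst emeasure_distr[OF mt A], subst emeasure_restrict_space) (auto simp: space_restrict_space)
    also have "\<dots> = emeasure (distr lborel borel ((+) sh)) (ft -` A \<inter> P1)" by (simp add: lborel_distr_plus)
    also have "\<dots> = emeasure lborel ((+) sh -` (ft -` A \<inter> P1))"
    proof -
      have "ft -` A \<in> sets borel" using measurable_sets[of ft borel borel A] by simp
      then show ?thesis by (subst emeasure_distr) auto
    qed
    also have "(+) sh -` (ft -` A \<inter> P1) = (\<lambda>x. foot n x + a) -` A \<inter> P2" using shift by auto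
    also have "emeasure lborel \<dots> = emeasure (distr (restrict_space lborel P2) (restrict_space borel F) (\<lambda>x. foot n x + a)) A"
      by (subst emeasure_distr[OF mf A], subst emeasure_restrict_space) (auto simp: space_restrict_space)
    finally show "emeasure (distr (restrict_space lborel P1) (restrict_space borel F) ft) A =
      emeasure (distr (restrict_space lborel P2) (restrict_space borel F) (\<lambda>x. foot n x + a)) A" .
  qed simp
qed

lemma space_face_measure [simp]: "space (face_measure F) = F"
  by (simp add: face_measure_def Let_def case_prod_beta space_restrict_space)

lemma sets_face_measure: "sets (face_measure F) = sets (restrict_space borel F)"
  by (simp add: face_measure_def Let_def case_prod_beta)

lemma integral_face_measure:
  fixes F :: "'d::finite point set" and \<phi> :: "'d point \<Rightarrow> 'b::euclidean_space"
  assumes n: "norm n = 1" and F: "openin (top_of_set {x. n \<bullet> x = b}) F" "F \<noteq> {}" and a: "n \<bullet> a = b"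
    and \<phi>: "\<phi> \<in> borel_measurable (restrict_space borel F)"
  shows "(LINT x|face_measure F. \<phi> x) =
    (LINT x|lborel. indicat_real {x. x \<in> slab n \<and> foot n x + a \<in> F} x *\<^sub>R \<phi> (foot n x + a))"
proof -
  have [measurable]: "F \<in> sets borel" by (rule face_borel[OF F(1)])
  let ?P = "{x. x \<in> slab n \<and> foot n x + a \<in> F}"
  have P: "?P \<in> sets borel" by measurable
  have mf: "(\<lambda>x. foot n x + a) \<in> measurable (restrict_space lborel ?P) (restrict_space borel F)"
    by (intro measurable_restrict_space3) auto
  show ?thesis unfolding face_measure_eq[OF n F a]
    by (subst integral_distr[OF mf \<phi>], subst integral_restrict_space) (use P in auto)
qed

lemma solid_face_measure:
  fixes F :: "'d::finite point set"
  assumes F: "hyperplanar_face F" "bounded F"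
  shows "solid (face_measure F)"
proof -
  obtain n b where n: "norm n = 1" and o: "openin (top_of_set {x. n \<bullet> x = b}) F"
    using hyperplanar_face_unit_normal[OF F(1)] by blast
  have ne: "F \<noteq> {}" using F(1) by (simp add: hyperplanar_face_def)
  have nn: "n \<bullet> n = 1" using n by (simp add: dot_square_norm)
  define a where "a = b *\<^sub>R n"
  have a: "n \<bullet> a = b" by (simp add: a_def nn)
  have [measurable]: "F \<in> sets borel" by (rule face_borel[OF o])
  let ?P = "\<lambda>A. {x. x \<in> slab n \<and> foot n x + a \<in> A}"
  have P [measurable]: "?P F \<in> sets borel" by measurable
  note fm = face_measure_eq[OF n o ne a]
  have mf: "(\<lambda>x. foot n x + a) \<in> measurable (restrict_space lborel (?P F)) (restrict_space borel F)"
    by (intro measurable_restrict_space3) auto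
  have em: "emeasure (face_measure F) (A \<inter> F) = emeasure lborel (?P (A \<inter> F))" if "A \<in> sets borel" for A
  proof -
    have A: "A \<inter> F \<in> sets (restrict_space borel F)" using that by (auto simp: sets_restrict_space_iff)
    show ?thesis unfolding fm
      by (subst emeasure_distr[OF mf A], subst emeasure_restrict_space)
        (auto simp: space_restrict_space intro!: arg_cong[where f = "emeasure lborel"])
  qed
  obtain R where R: "\<And>x. x \<in> F \<Longrightarrow> norm x \<le> R" using F(2) by (auto simp: bounded_iff)
  have "bounded (?P F)" unfolding bounded_iff
  proof (intro exI ballI)
    fix x assume x: "x \<in> ?P F"
    have "norm x = norm ((foot n x + a) - a + (n \<bullet> x) *\<^sub>R n)" by (simp add: foot_def)
    also have "\<dots> \<le> norm ((foot n x + a) - a) + norm ((n \<bullet> x) *\<^sub>R n)" by (rule norm_triangle_ineq)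
    also have "\<dots> \<le> norm (foot n x + a) + norm a + norm ((n \<bullet> x) *\<^sub>R n)"
      by (intro add_right_mono norm_triangle_ineq4)
    also have "\<dots> \<le> R + norm a + 1" using x R n by (intro add_mono) (auto simp: slab_def)
    finally show "norm x \<le> R + norm a + 1" .
  qed
  then have fin: "emeasure lborel (?P F) < \<infinity>" by (rule emeasure_bounded_finite)
  have fm_fin: "finite_measure (face_measure F)"
    using em[of UNIV] fin by (intro finite_measureI) auto
  obtain U where U: "open U" "F = {x. n \<bullet> x = b} \<inter> U" using o by (auto simp: openin_open)
  have pos: "0 < measure (face_measure F) (ball x e \<inter> F)" if x: "x \<in> F" and e: "e > 0" for x e
  proof -
    have eq: "?P (ball x e \<inter> F) = slab n \<inter> (\<lambda>x. foot n x + a) -` (ball x e \<inter> U)"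
      using U(2) by (auto simp: inner_add_right inner_foot[OF n] a)
    have op: "open (?P (ball x e \<inter> F))" unfolding eq
    proof (intro open_Int open_vimage)
      show "open (slab n)" unfolding slab_def by (intro open_Collect_conj open_Collect_less continuous_intros)
      show "continuous_on UNIV (\<lambda>x. foot n x + a)" unfolding foot_def by (intro continuous_intros)
    qed (use U in auto)
    have nx: "n \<bullet> x = b" using x U by auto
    have "x - a + (1/2) *\<^sub>R n \<in> ?P (ball x e \<inter> F)"
      using x e nx by (auto simp: slab_def foot_def inner_add_right inner_diff_right nn a algebra_simps)
    then have "\<not> negligible (?P (ball x e \<inter> F))" using open_not_negligible[OF op] by blast
    then have "emeasure lborel (?P (ball x e \<inter> F)) \<noteq> 0"
      using op by (auto simp: negligible_iff_null_sets null_sets_def emeasure_completion)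
    then have "emeasure (face_measure F) (ball x e \<inter> F) \<noteq> 0" using em[of "ball x e"] by simp
    then show ?thesis using finite_measure.emeasure_eq_measure[OF fm_fin, of "ball x e \<inter> F"]
      by (simp add: less_le zero_less_measure_iff)
  qed
  have "(\<lambda>x. x) \<in> borel_measurable (face_measure F)"
    by (subst measurable_cong_sets[OF sets_face_measure refl]) (rule measurable_restrict_space1, simp)
  then show ?thesis unfolding solid_def using F(2) fm_fin pos by simp
qed

subsection \<open>Integrals over cones and elements\<close>

text \<open>Along the ray \<open>s \<mapsto> y + s w\<close>, the integrand weighted by \<open>s ^
  (d - 1)\<close> is the derivative of \<open>s ^ d f(y + s w)\<close>. Its integral from 0 to 1 is
  the value of \<open>f\<close> at the end point in the face. The factor \<open>b - n \<bullet>
  y\<close> is the height of the cone.\<close>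

lemma integral_cone:
  fixes F :: "'d::finite point set" and f :: "'d point \<Rightarrow> real"
  assumes n: "norm n = 1" and o: "openin (top_of_set {x. n \<bullet> x = b}) F" and ne: "F \<noteq> {}" and bd: "bounded F"
    and y: "n \<bullet> y < b"
    and f: "\<And>x. (f has_derivative (\<lambda>h. Df x \<bullet> h)) (at x)" and Df: "continuous_on UNIV Df"
  defines "g \<equiv> \<lambda>x. real CARD('d) * f x + Df x \<bullet> (x - y)"
    and "K \<equiv> {y + s *\<^sub>R (z - y) |s z. 0 < s \<and> s < 1 \<and> z \<in> F}"
  shows "K \<in> sets borel" "integrable lborel (\<lambda>x. indicat_real K x *\<^sub>R g x)"
    and "(LINT x|lborel. indicat_real K x *\<^sub>R g x) = (b - n \<bullet> y) * (LINT x|face_measure F. f x)"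
proof -
  define \<beta> where "\<beta> = b - n \<bullet> y"
  have \<beta>: "\<beta> > 0" using y by (simp add: \<beta>_def)
  have nn: "n \<bullet> n = 1" using n by (simp add: dot_square_norm)
  define a where "a = y + \<beta> *\<^sub>R n"
  have na: "n \<bullet> a = b" by (simp add: a_def inner_add_right nn \<beta>_def)
  have Fb [measurable]: "F \<in> sets borel" by (rule face_borel[OF o])
  have Fs: "F \<subseteq> {x. n \<bullet> x = b}" using o openin_imp_subset by blast
  define P where "P = {x. x \<in> slab n \<and> foot n x + a \<in> F}"
  have Pm [measurable]: "P \<in> sets borel" unfolding P_def by measurable
  note cm = cone_measure_eq[OF n y Fb Fs, folded K_def \<beta>_def, folded a_def, folded P_def]
  show Km [measurable]: "K \<in> sets borel" by (rule cm(1))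
  have contf: "continuous_on UNIV f" by (intro continuous_at_imp_continuous_on ballI has_derivative_continuous[OF f])
  have contg: "continuous_on UNIV g" unfolding g_def by (intro continuous_intros contf Df)
  have gm [measurable]: "g \<in> borel_measurable borel" by (rule borel_measurable_continuous_onI[OF contg])
  obtain R where R: "\<And>x. x \<in> F \<Longrightarrow> norm x \<le> R" using bd by (auto simp: bounded_iff)
  have Kb: "bounded K" unfolding bounded_iff
  proof (intro exI ballI)
    fix x assume "x \<in> K"
    then obtain s z where sz: "x = y + s *\<^sub>R (z - y)" "0 < s" "s < 1" "z \<in> F" by (auto simp: K_def)
    have "norm x \<le> norm y + \<bar>s\<bar> * norm (z - y)" unfolding sz(1) by (metis norm_triangle_ineq norm_scaleR)
    also have "\<dots> \<le> norm y + 1 * (R + norm y)"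
      using sz R[OF sz(4)] norm_triangle_ineq4[of z y] by (intro add_left_mono mult_mono) auto
    finally show "norm x \<le> norm y + 1 * (R + norm y)" .
  qed
  show int: "integrable lborel (\<lambda>x. indicat_real K x *\<^sub>R g x)"
  proof -
    have "tame K g" using contg by (rule tame_continuous)
    then obtain C where C: "\<And>x. x \<in> K \<Longrightarrow> norm (g x) \<le> C" using tame_bounded[OF Kb] by blast
    have C': "\<bar>g x\<bar> \<le> \<bar>C\<bar>" if "x \<in> K" for x using C[OF that] by simp
    have "emeasure lborel K < \<infinity>" by (rule emeasure_bounded_finite[OF Kb])
    then have "integrable lborel (\<lambda>x. indicat_real K x * C)" by (intro integrable_mult_left) simp
    then show ?thesis
      by (rule Bochner_Integration.integrable_bound) (use C' in \<open>auto simp: indicator_def\<close>)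
  qed
  (* the density of the cone measure in the coordinates (x, s) of the face and the ray *)
  define W where "W xs = indicat_real P (fst xs) * (indicat_real {0<..<1} (snd xs) * (\<beta> * snd xs ^ (CARD('d) - 1)))" for xs :: "'d point \<times> real"
  define \<Phi> where "\<Phi> xs = y + snd xs *\<^sub>R (foot n (fst xs) + a - y)" for xs :: "'d point \<times> real"
  have Wm [measurable]: "W \<in> borel_measurable (lborel \<Otimes>\<^sub>M lborel)" unfolding W_def by measurable
  have \<Phi>m [measurable]: "\<Phi> \<in> borel_measurable (lborel \<Otimes>\<^sub>M lborel)" unfolding \<Phi>_def by measurable
  have W0: "0 \<le> W xs" for xs unfolding W_def using \<beta> by (auto simp: indicator_def)
  have eq: "density lborel (\<lambda>x. ennreal (indicat_real K x)) = distr (density (lborel \<Otimes>\<^sub>M lborel) (\<lambda>xs. ennreal (W xs))) borel \<Phi>"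
  proof -
    have "(\<lambda>(x, s). indicator P x * (indicator {0<..<1} s * ennreal (\<beta> * s ^ (DIM('d point) - 1)))) = (\<lambda>xs. ennreal (W xs))"
      by (auto simp: fun_eq_iff W_def indicator_def)
    moreover have "(\<lambda>(x, s::real). y + s *\<^sub>R (foot n x + a - y)) = \<Phi>" by (auto simp: fun_eq_iff \<Phi>_def)
    ultimately show ?thesis using cm(2) by (simp add: ennreal_indicator)
  qed
  have "(LINT x|lborel. indicat_real K x *\<^sub>R g x) = (LINT x|density lborel (\<lambda>x. ennreal (indicat_real K x)). g x)"
    by (rule integral_density[symmetric]) auto
  also have "\<dots> = (LINT xs|density (lborel \<Otimes>\<^sub>M lborel) (\<lambda>xs. ennreal (W xs)). g (\<Phi> xs))"
    unfolding eq by (rule integral_distr) auto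
  also have "\<dots> = (LINT xs|(lborel \<Otimes>\<^sub>M lborel). W xs *\<^sub>R g (\<Phi> xs))"
    by (rule integral_density) (use W0 in auto)
  also have "\<dots> = (LINT x|lborel. LINT s|lborel. W (x, s) *\<^sub>R g (\<Phi> (x, s)))"
  proof (rule lborel_pair.integral_fst'[symmetric])
    have "integrable (density lborel (\<lambda>x. ennreal (indicat_real K x))) g"
      using int by (subst integrable_density) auto
    then have "integrable (density (lborel \<Otimes>\<^sub>M lborel) (\<lambda>xs. ennreal (W xs))) (\<lambda>xs. g (\<Phi> xs))"
      unfolding eq by (subst (asm) integrable_distr_eq) auto
    then show "integrable (lborel \<Otimes>\<^sub>M lborel) (\<lambda>xs. W xs *\<^sub>R g (\<Phi> xs))"
      by (subst (asm) integrable_density) (use W0 in auto)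
  qed
  also have "\<dots> = (LINT x|lborel. indicat_real P x *\<^sub>R (\<beta> * f (foot n x + a)))"
  proof (rule Bochner_Integration.integral_cong[OF refl])
    fix x
    define w where "w = foot n x + a - y"
    let ?h = "\<lambda>s. s ^ CARD('d) * f (y + s *\<^sub>R w)"
    let ?h' = "\<lambda>s. s ^ (CARD('d) - 1) * g (y + s *\<^sub>R w)"
    have D: "(?h has_real_derivative ?h' s) (at s)" for s
    proof -
      have c: "((\<lambda>s. f (y + s *\<^sub>R w)) has_real_derivative (Df (y + s *\<^sub>R w) \<bullet> w)) (at s)"
      proof -
        have "((\<lambda>s. y + s *\<^sub>R w) has_derivative (\<lambda>h. h *\<^sub>R w)) (at s)"
          by (auto intro!: derivative_eq_intros)
        from has_derivative_compose[OF this f]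
        show ?thesis unfolding has_field_derivative_def
          by (rule has_derivative_eq_rhs) (simp add: fun_eq_iff)
      qed
      have "s ^ CARD('d) = s ^ (CARD('d) - 1) * s"
        using power_Suc2[of s "CARD('d) - 1"] by simp
      then have "real CARD('d) * s ^ (CARD('d) - 1) * f (y + s *\<^sub>R w) + Df (y + s *\<^sub>R w) \<bullet> w * s ^ CARD('d) = ?h' s"
        by (simp add: g_def algebra_simps)
      moreover have "(?h has_real_derivative (real CARD('d) * s ^ (CARD('d) - 1) * f (y + s *\<^sub>R w) + Df (y + s *\<^sub>R w) \<bullet> w * s ^ CARD('d))) (at s)"
        using DERIV_mult[OF DERIV_pow[of "CARD('d)" s] c] by simp
      ultimately show ?thesis by simp
    qed
    have cont: "isCont ?h' s" for s
    proof -
      have "continuous_on UNIV (\<lambda>s. g (y + s *\<^sub>R w))"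
        by (rule continuous_on_compose2[OF contg]) (auto intro!: continuous_intros)
      then have "continuous_on UNIV ?h'" by (intro continuous_intros)
      then show ?thesis by (simp add: continuous_on_eq_continuous_at)
    qed
    have "(LINT s|lborel. W (x, s) *\<^sub>R g (\<Phi> (x, s))) = (LINT s|lborel. (indicat_real P x * \<beta>) * (?h' s * indicat_real {0..1} s))"
    proof (rule integral_cong_AE)
      have "AE s in lborel. s \<noteq> (0::real)" "AE s in lborel. s \<noteq> (1::real)" by (rule AE_lborel_singleton)+
      then show "AE s in lborel. W (x, s) *\<^sub>R g (\<Phi> (x, s)) = (indicat_real P x * \<beta>) * (?h' s * indicat_real {0..1} s)"
        by eventually_elim (auto simp: W_def \<Phi>_def w_def indicator_def)
      show "(\<lambda>s. W (x, s) *\<^sub>R g (\<Phi> (x, s))) \<in> borel_measurable lborel" unfolding W_def \<Phi>_def by simp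
    qed simp
    also have "\<dots> = (indicat_real P x * \<beta>) * (LINT s|lborel. ?h' s * indicat_real {0..1} s)"
      by simp
    also have "(LINT s|lborel. ?h' s * indicat_real {0..1} s) = ?h 1 - ?h 0"
      by (rule integral_FTC_Icc_real) (use D cont in auto)
    also have "\<dots> = f (foot n x + a)" by (simp add: w_def power_0_left)
    finally show "(LINT s|lborel. W (x, s) *\<^sub>R g (\<Phi> (x, s))) = indicat_real P x *\<^sub>R (\<beta> * f (foot n x + a))" by simp
  qed
  also have "\<dots> = (LINT x|face_measure F. \<beta> * f x)"
    unfolding P_def
    by (rule integral_face_measure[OF n o ne na, symmetric])
      (auto intro!: measurable_restrict_space1 borel_measurable_continuous_onI continuous_intros contf)
  also have "\<dots> = \<beta> * (LINT x|face_measure F. f x)" by simp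
  finally show "(LINT x|lborel. indicat_real K x *\<^sub>R g x) = (b - n \<bullet> y) * (LINT x|face_measure F. f x)"
    unfolding \<beta>_def .
qed

context star_element
begin

definition cone :: "'d point \<Rightarrow> 'd point set \<Rightarrow> 'd point set" where
  "cone y F = {y + s *\<^sub>R (z - y) |s z. 0 < s \<and> s < 1 \<and> z \<in> F}"

lemma cone_subset: "y \<in> ball y0 r \<Longrightarrow> F \<in> FS \<Longrightarrow> cone y F \<subseteq> T"
  using star_closure face_frontier unfolding cone_def frontier_def by fastforce

text \<open>If two cones share a point, then one of the end points of the ray through it is the
  other one moved towards the apex, hence it is interior to \<open>T\<close>, or the end points
  coincide; distinct faces are disjoint.\<close>

lemma cone_disjoint:
  assumes y: "y \<in> ball y0 r" and F: "F \<in> FS" "F' \<in> FS" and x: "x \<in> cone y F" "x \<in> cone y F'"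
  shows "F = F'"
proof -
  have same: "\<not> t < s" if st: "0 < s" "0 < t" "y + s *\<^sub>R (z - y) = y + t *\<^sub>R (z' - y)"
     "z \<in> G" "G \<in> FS" "z' \<in> G'" "G' \<in> FS" for s t z z' G G'
  proof
    assume ts: "t < s"
    have "s *\<^sub>R (z - y) = t *\<^sub>R (z' - y)" using st(3) by simp
    then have "(1 / s) *\<^sub>R (s *\<^sub>R (z - y)) = (1 / s) *\<^sub>R (t *\<^sub>R (z' - y))" by simp
    then have "z - y = (t / s) *\<^sub>R (z' - y)" using st(1) by simp
    then have "z = y + (t / s) *\<^sub>R (z' - y)" by (simp add: algebra_simps)
    moreover have "z' \<in> closure T" using face_frontier[OF st(7)] st(6) by (auto simp: frontier_def)
    ultimately have "z \<in> T" using star_closure[OF y, of z' "t / s"] st ts by simp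
    then show False using face_not_T st(4,5) by blast
  qed
  obtain s z where s: "x = y + s *\<^sub>R (z - y)" "0 < s" "s < 1" "z \<in> F" using x(1) by (auto simp: cone_def)
  obtain t z' where t: "x = y + t *\<^sub>R (z' - y)" "0 < t" "t < 1" "z' \<in> F'" using x(2) by (auto simp: cone_def)
  have e: "y + s *\<^sub>R (z - y) = y + t *\<^sub>R (z' - y)" using s t by simp
  have "s = t" using same[OF s(2) t(2) e s(4) F(1) t(4) F(2)] same[OF t(2) s(2) e[symmetric] t(4) F(2) s(4) F(1)] by simp
  then have "z = z'" using e s(2) by simp
  then show ?thesis using pairwiseD[OF disj_FS F] s(4) t(4) by (auto simp: disjnt_def)
qed

text \<open>The ray from \<open>y\<close> through a point of \<open>T\<close> leaves
  \<open>T\<close> in the closure of some face. If the exit point is in the face, the point is in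
  the cone; otherwise the point lies in a cone over a subspace of codimension two, which is
  null.\<close>

lemma negligible_outside_cones:
  assumes y: "y \<in> ball y0 r"
  shows "negligible (T - (\<Union>F\<in>FS. cone y F))"
proof (rule negligible_subset)
  show "negligible ((\<Union>A\<in>\<A>. affine hull (insert y A)) \<union> {y})"
    using negligible_cone_over_thin[OF thin] by (simp add: negligible_Un)
  show "T - (\<Union>F\<in>FS. cone y F) \<subseteq> (\<Union>A\<in>\<A>. affine hull (insert y A)) \<union> {y}"
  proof
    fix x assume x: "x \<in> T - (\<Union>F\<in>FS. cone y F)"
    have "x \<in> (\<Union>A\<in>\<A>. affine hull (insert y A))" if xy: "x \<noteq> y"
    proof -
      obtain R where R: "\<And>w. w \<in> T \<Longrightarrow> norm (w - y) \<le> R"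
        using bounded_T bounded_any_center[of T y] by (auto simp: dist_norm norm_minus_commute)
      define L where "L = (\<bar>R\<bar> + 1) / norm (x - y)"
      (* a point of the ray outside the bounded set T *)
      define q where "q = y + L *\<^sub>R (x - y)"
      have "norm (q - y) = \<bar>R\<bar> + 1" using xy by (simp add: q_def L_def)
      then have "q \<notin> T" using R[of q] by auto
      have "closed_segment x q \<inter> frontier T \<noteq> {}"
        using x \<open>q \<notin> T\<close> ends_in_segment[of x q] by (intro connected_Int_frontier[OF connected_segment]) blast+
      then obtain z where z: "z \<in> closed_segment x q" "z \<in> frontier T" by blast
      obtain u where u: "z = (1 - u) *\<^sub>R x + u *\<^sub>R q" "0 \<le> u" "u \<le> 1" using z(1) by (auto simp: closed_segment_def)
      define l where "l = 1 + u * (L - 1)"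
      have zl: "z - y = l *\<^sub>R (x - y)" unfolding u(1) q_def l_def by (simp add: algebra_simps)
      have "norm (x - y) \<le> R" using R x by blast
      then have "1 \<le> L" using xy by (simp add: L_def divide_simps)
      then have "0 \<le> u * (L - 1)" using u by simp
      then have l1: "1 \<le> l" by (simp add: l_def)
      have "z \<notin> T" using z(2) open_T frontier_disjoint_eq by blast
      then have "z \<noteq> x" using x by blast
      then have l2: "1 < l" using l1 zl by (cases "l = 1") auto
      have xz: "x = y + (1 / l) *\<^sub>R (z - y)" unfolding zl using l2 by simp
      obtain F where F: "F \<in> FS" "z \<in> closure F" using z(2) frontier_T by blast
      have "z \<notin> F"
      proof
        assume "z \<in> F"
        then have "x \<in> cone y F" unfolding cone_def using xz l2 by (intro CollectI exI[of _ "1 / l"] exI[of _ z]) auto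
        then show False using x F(1) by blast
      qed
      then obtain A where A: "A \<in> \<A>" "z \<in> A" using face_boundary F by blast
      have "x = (1 - 1 / l) *\<^sub>R y + (1 / l) *\<^sub>R z" using xz by (simp add: algebra_simps)
      moreover have "(1 - 1 / l) *\<^sub>R y + (1 / l) *\<^sub>R z \<in> affine hull (insert y A)"
        by (rule mem_affine[OF affine_affine_hull]) (use A in \<open>auto intro: hull_inc\<close>)
      ultimately show ?thesis using A by blast
    qed
    then show "x \<in> (\<Union>A\<in>\<A>. affine hull (insert y A)) \<union> {y}" by blast
  qed
qed

lemma bounded_face: "F \<in> FS \<Longrightarrow> bounded F"
  using bounded_subset[OF bounded_closure[OF bounded_T], of F] face_frontier by (auto simp: frontier_def)

lemma face_nonempty: "F \<in> FS \<Longrightarrow> F \<noteq> {}"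
  using face by (auto simp: hyperplanar_face_def)

lemma solid_T: "solid (lebesgue_on T)" by (rule solid_lebesgue_on[OF open_T bounded_T])

lemma solid_F: "F \<in> FS \<Longrightarrow> solid (face_measure F)"
  by (rule solid_face_measure[OF face bounded_face])

definition offset :: "'d point set \<Rightarrow> real" where
  "offset F = (SOME b. outward F (normal_out T F) b)"

lemma outward_offset: "F \<in> FS \<Longrightarrow> outward F (normal_out T F) (offset F)"
  unfolding offset_def using someI_ex[OF outward_normal] .

text \<open>The cones over the faces decompose the element up to a null set.\<close>

lemma radial_formula:
  fixes f :: "'d point \<Rightarrow> real"
  assumes y: "y \<in> ball y0 r"
    and f: "\<And>x. (f has_derivative (\<lambda>h. Df x \<bullet> h)) (at x)" and Df: "continuous_on UNIV Df"
  shows "(LINT x|lebesgue_on T. real CARD('d) * f x + Df x \<bullet> (x - y)) =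
    (\<Sum>F\<in>FS. (offset F - normal_out T F \<bullet> y) * (LINT x|face_measure F. f x))"
proof -
  define g where "g x = real CARD('d) * f x + Df x \<bullet> (x - y)" for x
  have contf: "continuous_on UNIV f" by (intro continuous_at_imp_continuous_on ballI has_derivative_continuous[OF f])
  have contg: "continuous_on UNIV g" unfolding g_def by (intro continuous_intros contf Df)
  have gm [measurable]: "g \<in> borel_measurable borel" by (rule borel_measurable_continuous_onI[OF contg])
  have o: "norm (normal_out T F) = 1" "openin (top_of_set {x. normal_out T F \<bullet> x = offset F}) F"
     "normal_out T F \<bullet> y < offset F" if "F \<in> FS" for F
    using outward_offset[OF that] y by (auto simp: outward_def)
  have cone: "cone y F \<in> sets borel" "integrable lborel (\<lambda>x. indicat_real (cone y F) x *\<^sub>R g x)"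
    "(LINT x|lborel. indicat_real (cone y F) x *\<^sub>R g x) = (offset F - normal_out T F \<bullet> y) * (LINT x|face_measure F. f x)"
    if "F \<in> FS" for F
    using integral_cone[OF o(1,2)[OF that] face_nonempty[OF that] bounded_face[OF that] o(3)[OF that] f Df]
    unfolding cone_def g_def by auto
  have Tm [measurable]: "T \<in> sets borel" using open_T by simp
  have "(LINT x|lebesgue_on T. g x) = (LINT x|lebesgue. indicat_real T x *\<^sub>R g x)"
    by (rule integral_restrict_space) simp
  also have "\<dots> = (LINT x|lborel. indicat_real T x *\<^sub>R g x)"
    by (rule integral_completion) simp
  also have "\<dots> = (LINT x|lborel. (\<Sum>F\<in>FS. indicat_real (cone y F) x *\<^sub>R g x))"
  proof (rule integral_cong_AE)
    have "T - (\<Union>F\<in>FS. cone y F) \<in> sets borel"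
      by (intro sets.Diff sets.finite_UN finite_FS) (auto intro: cone(1) open_T)
    then have "T - (\<Union>F\<in>FS. cone y F) \<in> null_sets lborel"
      using negligible_outside_cones[OF y] by (auto simp: negligible_iff_null_sets null_sets_def emeasure_completion)
    then have "AE x in lborel. x \<notin> T - (\<Union>F\<in>FS. cone y F)" by (rule AE_not_in)
    then show "AE x in lborel. indicat_real T x *\<^sub>R g x = (\<Sum>F\<in>FS. indicat_real (cone y F) x *\<^sub>R g x)"
    proof eventually_elim
      case (elim x)
      show ?case
      proof (cases "x \<in> T")
        case True
        then obtain F where F: "F \<in> FS" "x \<in> cone y F" using elim by blast
        have "indicat_real (cone y F') x *\<^sub>R g x = (if F' = F then g x else 0)" if "F' \<in> FS" for F'
        proof (cases "F' = F")
          case False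
          then have "x \<notin> cone y F'" using cone_disjoint[OF y F(1) that F(2)] by blast
          then show ?thesis using False by simp
        qed (use F(2) in simp)
        then have "(\<Sum>F'\<in>FS. indicat_real (cone y F') x *\<^sub>R g x) = (\<Sum>F'\<in>FS. if F' = F then g x else 0)"
          by (intro sum.cong) auto
        then show ?thesis using True F finite_FS by simp
      next
        case False
        then have "indicat_real (cone y F') x *\<^sub>R g x = 0" if "F' \<in> FS" for F'
          using cone_subset[OF y that] by (auto simp: indicator_def)
        then have z: "(\<Sum>F\<in>FS. indicat_real (cone y F) x *\<^sub>R g x) = 0" by (intro sum.neutral ballI)
        show ?thesis unfolding z using False by simp
      qed
    qed
    show "(\<lambda>x. \<Sum>F\<in>FS. indicat_real (cone y F) x *\<^sub>R g x) \<in> borel_measurable lborel"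
      by (intro borel_measurable_sum borel_measurable_scaleR borel_measurable_indicator) (use cone(1) in auto)
  qed simp
  also have "\<dots> = (\<Sum>F\<in>FS. LINT x|lborel. indicat_real (cone y F) x *\<^sub>R g x)"
    by (rule Bochner_Integration.integral_sum) (rule cone(2))
  also have "\<dots> = (\<Sum>F\<in>FS. (offset F - normal_out T F \<bullet> y) * (LINT x|face_measure F. f x))"
    by (rule sum.cong[OF refl]) (rule cone(3))
  finally show ?thesis unfolding g_def .
qed

text \<open>The radial formula is affine in the apex; its difference at two apices \<open>y0\<close>
  and \<open>y0 + t e\<close> contains only the derivative of \<open>f\<close> in direction
  \<open>e\<close>.\<close>

theorem divergence_theorem:
  fixes f :: "'d point \<Rightarrow> real"
  assumes f: "\<And>x. (f has_derivative (\<lambda>h. Df x \<bullet> h)) (at x)" and Df: "continuous_on UNIV Df"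
  shows "(LINT x|lebesgue_on T. Df x \<bullet> e) = (\<Sum>F\<in>FS. LINT x|face_measure F. f x * (normal_out T F \<bullet> e))"
proof -
  (* keeps the second apex in the ball *)
  define t where "t = r / (2 * (norm e + 1))"
  have ne: "norm e + 1 > 0" by (simp add: add_nonneg_pos)
  then have t: "t > 0" using r by (simp add: t_def)
  define y where "y = y0 + t *\<^sub>R e"
  have "norm (t *\<^sub>R e) = r * (norm e / (2 * (norm e + 1)))" using t r by (simp add: t_def)
  also have "\<dots> < r * 1" using r ne by (intro mult_strict_left_mono) (auto simp: divide_simps)
  finally have y: "y \<in> ball y0 r" by (simp add: y_def dist_norm)
  have y0: "y0 \<in> ball y0 r" using r by simp
  have contf: "continuous_on UNIV f" by (intro continuous_at_imp_continuous_on ballI has_derivative_continuous[OF f])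
  have i: "integrable (lebesgue_on T) (\<lambda>x. real CARD('d) * f x + Df x \<bullet> (x - y))" for y
    by (intro tame_integrable[OF solid_T] tame_continuous continuous_intros contf Df)
  have "t * (LINT x|lebesgue_on T. Df x \<bullet> e) = (LINT x|lebesgue_on T. t * (Df x \<bullet> e))" by simp
  also have "\<dots> = (LINT x|lebesgue_on T. (real CARD('d) * f x + Df x \<bullet> (x - y0)) - (real CARD('d) * f x + Df x \<bullet> (x - y)))"
    by (rule Bochner_Integration.integral_cong) (simp_all add: y_def inner_diff_right inner_add_right)
  also have "\<dots> = (LINT x|lebesgue_on T. real CARD('d) * f x + Df x \<bullet> (x - y0)) - (LINT x|lebesgue_on T. real CARD('d) * f x + Df x \<bullet> (x - y))"
    by (rule Bochner_Integration.integral_diff) (rule i)+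
  also have "\<dots> = (\<Sum>F\<in>FS. (offset F - normal_out T F \<bullet> y0) * (LINT x|face_measure F. f x) - (offset F - normal_out T F \<bullet> y) * (LINT x|face_measure F. f x))"
    unfolding radial_formula[OF y0 f Df] radial_formula[OF y f Df] by (simp add: sum_subtractf)
  also have "\<dots> = (\<Sum>F\<in>FS. t * (LINT x|face_measure F. f x * (normal_out T F \<bullet> e)))"
    by (rule sum.cong) (simp_all add: y_def inner_add_right algebra_simps)
  finally show ?thesis using t by (simp add: sum_distrib_left[symmetric])
qed

end

section \<open>Symmetric gradients and rigid motions\<close>

lemma frechet_derivative_pdiff:
  fixes f :: "'d::finite point \<Rightarrow> 'b::real_normed_vector"
  assumes "f differentiable at x"
  shows "frechet_derivative f (at x) h = (\<Sum>j\<in>UNIV. h $ j *\<^sub>R pdiff j f x)"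
proof -
  have l: "linear (frechet_derivative f (at x))" by (rule linear_frechet_derivative[OF assms])
  have "h = (\<Sum>j\<in>UNIV. h $ j *\<^sub>R axis j 1)" by (simp add: vec_eq_iff axis_def if_distrib cong: if_cong)
  then have "frechet_derivative f (at x) h = frechet_derivative f (at x) (\<Sum>j\<in>UNIV. h $ j *\<^sub>R axis j 1)" by simp
  also have "\<dots> = (\<Sum>j\<in>UNIV. h $ j *\<^sub>R frechet_derivative f (at x) (axis j 1))"
    by (simp add: linear_sum[OF l] linear_scale[OF l])
  finally show ?thesis by (simp add: pdiff_def)
qed

lemma grad_has_derivative:
  fixes f :: "'d::finite point \<Rightarrow> real"
  assumes "f differentiable at x"
  shows "(f has_derivative (\<lambda>h. grad f x \<bullet> h)) (at x)"
proof -
  have "frechet_derivative f (at x) = (\<lambda>h. grad f x \<bullet> h)"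
    by (simp add: fun_eq_iff frechet_derivative_pdiff[OF assms] grad_def inner_vec_def mult.commute)
  then show ?thesis using assms frechet_derivative_works by metis
qed

lemma pdiff_inner:
  fixes u v :: "'d::finite point \<Rightarrow> 'b::real_inner"
  assumes "u differentiable at x" "v differentiable at x"
  shows "(\<lambda>x. u x \<bullet> v x) differentiable at x" "pdiff i (\<lambda>x. u x \<bullet> v x) x = pdiff i u x \<bullet> v x + u x \<bullet> pdiff i v x"
proof -
  obtain u' v' where d: "(u has_derivative u') (at x)" "(v has_derivative v') (at x)"
    using assms by (auto simp: differentiable_def)
  have p: "((\<lambda>x. u x \<bullet> v x) has_derivative (\<lambda>h. u x \<bullet> v' h + u' h \<bullet> v x)) (at x)"
    by (rule has_derivative_inner[OF d])
  show "(\<lambda>x. u x \<bullet> v x) differentiable at x" using p by (auto simp: differentiable_def)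
  show "pdiff i (\<lambda>x. u x \<bullet> v x) x = pdiff i u x \<bullet> v x + u x \<bullet> pdiff i v x"
    by (simp add: pdiff_eq[OF p] pdiff_eq[OF d(1)] pdiff_eq[OF d(2)])
qed

lemma poly_component:
  fixes f :: "'d::finite point \<Rightarrow> 'd point"
  assumes "f \<in> poly_maps k" shows "(\<lambda>x. f x $ i) \<in> poly_upto k"
  using assms by (simp add: poly_maps_vector vpoly_upto_def)

lemma vec_poly_mapsI:
  fixes f :: "'d::finite point \<Rightarrow> 'd point"
  assumes "\<And>i. (\<lambda>x. f x $ i) \<in> poly_upto k" shows "f \<in> poly_maps k"
  using assms by (simp add: poly_maps_vector vpoly_upto_def)

lemma pdiff_component:
  fixes f :: "'d::finite point \<Rightarrow> real ^ 'n"
  assumes "f differentiable at x" shows "pdiff i (\<lambda>x. f x $ j) x = pdiff i f x $ j"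
  using pdiff_bounded_linear[OF assms bounded_linear_vec_nth] .

lemma sym_grad_sym: "sym_grad v x \<in> sym_tensors"
  by (simp add: sym_tensors_def sym_grad_def transpose_def vec_eq_iff add.commute)

lemma sym_grad_poly:
  assumes "v \<in> poly_maps k" shows "sym_grad v \<in> stpoly_upto k"
proof -
  have c: "(\<lambda>x. pdiff j v x $ i) \<in> poly_upto k" for i j
    by (rule poly_component[OF pdiff_in_poly_maps[OF assms]])
  have "(\<lambda>x. (pdiff j v x $ i + pdiff i v x $ j) / 2) \<in> poly_upto k" for i j
  proof -
    have "(\<lambda>x. (pdiff j v x $ i + pdiff i v x $ j) / 2) = (1/2) *\<^sub>R ((\<lambda>x. pdiff j v x $ i) + (\<lambda>x. pdiff i v x $ j))"
      by (simp add: fun_eq_iff)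
    also have "\<dots> \<in> poly_upto k"
      by (intro subspace_scale[OF subspace_poly_upto] subspace_add[OF subspace_poly_upto] c)
    finally show ?thesis .
  qed
  then have "(\<lambda>x. sym_grad v x $ i $ j) \<in> poly_upto k" for i j by (simp add: sym_grad_def)
  then show ?thesis unfolding stpoly_upto_def by (intro CollectI conjI allI sym_grad_sym)
qed

lemma stpoly_poly: "f \<in> stpoly_upto k \<Longrightarrow> f \<in> poly_maps k"
  by (simp add: stpoly_upto_eq)

lemma lin_on_sym_grad [lin_intros]:
  assumes "V \<subseteq> poly_maps k" shows "lin_on V (\<lambda>v. sym_grad v x)"
  unfolding sym_grad_def
  by (intro lin_intros lin_on_pdiff[OF assms])

lemma lin_on_tensor_div [lin_intros]:
  assumes "V \<subseteq> poly_maps k" shows "lin_on V (\<lambda>v. tensor_div v x)"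
  unfolding tensor_div_def
  by (intro lin_intros lin_on_pdiff[OF assms])

lemma tame_sym_grad [tame_intros]: "v \<in> poly_maps k \<Longrightarrow> tame X (sym_grad v)"
  by (rule tame_poly_maps[OF stpoly_poly[OF sym_grad_poly]])

lemma tame_tensor_div [tame_intros]: "v \<in> poly_maps k \<Longrightarrow> tame X (tensor_div v)"
  unfolding tensor_div_def [abs_def] by (intro tame_intros) auto

lemma subspace_stpoly: "subspace (stpoly_upto k)"
proof -
  have "subspace (sym_tensors :: 'a tensor set)"
    by (rule subspaceI) (auto simp: sym_tensors_def transpose_def vec_eq_iff)
  then show ?thesis
    unfolding stpoly_upto_eq using subspace_poly_maps[of k]
    by (auto simp: subspace_def)
qed

lemma sym_inner:
  fixes S A :: "real ^ 'd::finite ^ 'd"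
  assumes "A \<in> sym_tensors"
  shows "(\<chi> i j. (S $ j $ i + S $ i $ j) / 2) \<bullet> A = (\<Sum>i\<in>UNIV. \<Sum>j\<in>UNIV. S $ j $ i * A $ i $ j)"
proof -
  have A: "A $ j $ i = A $ i $ j" for i j using assms by (auto simp: sym_tensors_def transpose_def vec_eq_iff)
  have "(\<chi> i j. (S $ j $ i + S $ i $ j) / 2) \<bullet> A = (\<Sum>i\<in>UNIV. \<Sum>j\<in>UNIV. S $ j $ i * A $ i $ j / 2) + (\<Sum>i\<in>UNIV. \<Sum>j\<in>UNIV. S $ i $ j * A $ i $ j / 2)"
    by (simp add: inner_vec_def sum.distrib[symmetric] algebra_simps add_divide_distrib)
  also have "(\<Sum>i\<in>UNIV. \<Sum>j\<in>UNIV. S $ i $ j * A $ i $ j / 2) = (\<Sum>i\<in>UNIV. \<Sum>j\<in>UNIV. S $ j $ i * A $ i $ j / 2)"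
    by (subst sum.swap) (simp add: A)
  finally show ?thesis by (simp add: sum.distrib[symmetric] mult.commute)
qed

text \<open>This condition characterizes infinitesimal rigid motions, the affine maps with
  skew-symmetric linear part, and it involves no derivatives.\<close>

definition rigid :: "('d::finite point \<Rightarrow> 'd point) \<Rightarrow> bool" where
  "rigid v \<longleftrightarrow> (\<forall>x y. (v x - v y) \<bullet> (x - y) = 0)"

text \<open>Along a segment with direction \<open>h\<close>, the derivative of \<open>v \<bullet>
  h\<close> is the symmetric gradient applied to \<open>h\<close> twice.\<close>

lemma sym_grad_zero_rigid:
  fixes v :: "'d::finite point \<Rightarrow> 'd point"
  assumes v: "v \<in> poly_maps k" and z: "sym_grad v = 0"
  shows "rigid v"
  unfolding rigid_def
proof (intro allI)
  fix x y :: "'d point"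
  define h where "h = x - y"
  define \<phi> where "\<phi> t = v (y + t *\<^sub>R h) \<bullet> h" for t
  have "(\<phi> has_real_derivative 0) (at t)" for t
  proof -
    let ?p = "y + t *\<^sub>R h"
    have "((\<lambda>t. y + t *\<^sub>R h) has_derivative (\<lambda>s. s *\<^sub>R h)) (at t)" by (auto intro!: derivative_eq_intros)
    from has_derivative_compose[OF this poly_maps_has_derivative[OF v]]
    have "((\<lambda>t. v (y + t *\<^sub>R h)) has_derivative (\<lambda>s. frechet_derivative v (at ?p) (s *\<^sub>R h))) (at t)" .
    from has_derivative_inner_left[OF this, of h]
    have d: "(\<phi> has_derivative (\<lambda>s. frechet_derivative v (at ?p) (s *\<^sub>R h) \<bullet> h)) (at t)" unfolding \<phi>_def .
    have "frechet_derivative v (at ?p) (s *\<^sub>R h) \<bullet> h = 0" for s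
    proof -
      let ?A = "(\<chi> i j. h $ i * h $ j) :: 'd tensor"
      let ?S = "(\<chi> j i. pdiff j v ?p $ i) :: 'd tensor"
      have A: "?A \<in> sym_tensors" by (simp add: sym_tensors_def transpose_def vec_eq_iff mult.commute)
      have "frechet_derivative v (at ?p) (s *\<^sub>R h) \<bullet> h = (\<Sum>j\<in>UNIV. (s *\<^sub>R h) $ j *\<^sub>R pdiff j v ?p) \<bullet> h"
        by (simp only: frechet_derivative_pdiff[OF poly_maps_differentiable[OF v]])
      also have "\<dots> = s * (\<Sum>j\<in>UNIV. h $ j * (pdiff j v ?p \<bullet> h))"
        by (simp add: inner_sum_left sum_distrib_left mult_ac)
      also have "\<dots> = s * (\<Sum>j\<in>UNIV. \<Sum>i\<in>UNIV. pdiff j v ?p $ i * (h $ i * h $ j))"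
        by (simp add: inner_vec_def sum_distrib_left mult_ac)
      also have "(\<Sum>j\<in>UNIV. \<Sum>i\<in>UNIV. pdiff j v ?p $ i * (h $ i * h $ j)) = (\<Sum>i\<in>UNIV. \<Sum>j\<in>UNIV. ?S $ j $ i * ?A $ i $ j)"
        by (subst sum.swap) simp
      also have "\<dots> = sym_grad v ?p \<bullet> ?A" 
        using sym_inner[OF A, of ?S] by (simp add: sym_grad_def)
      finally show ?thesis using z by simp
    qed
    then show ?thesis using d by (simp add: has_field_derivative_def lambda_zero[symmetric])
  qed
  then have "\<phi> 1 = \<phi> 0" using DERIV_isconst_all by blast
  then show "(v x - v y) \<bullet> (x - y) = 0" by (simp add: \<phi>_def h_def inner_diff_left)
qed

text \<open>Polarization gives skew-symmetry of \<open>w\<close>, and a skew-symmetric map is linear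
  because it has an adjoint.\<close>

lemma rigid_affine:
  fixes v :: "'d::finite point \<Rightarrow> 'd point"
  assumes "rigid v"
  defines "w \<equiv> \<lambda>x. v x - v 0"
  shows "linear w" "\<And>x y. w x \<bullet> y = - (w y \<bullet> x)"
proof -
  have r: "(v x - v y) \<bullet> (x - y) = 0" for x y using assms by (simp add: rigid_def)
  have wx: "w x \<bullet> x = 0" for x using r[of x 0] by (simp add: w_def)
  show skew: "w x \<bullet> y = - (w y \<bullet> x)" for x y
  proof -
    have "(w x - w y) \<bullet> (x - y) = 0" using r[of x y] by (simp add: w_def)
    then show ?thesis using wx[of x] wx[of y] by (simp add: inner_diff_left inner_diff_right)
  qed
  show "linear w"
  proof (rule linearI)
    fix a b :: "'d point" and c :: real
    show "w (a + b) = w a + w b"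
    proof (rule vector_eq_ldot[THEN iffD1], intro allI)
      fix y show "y \<bullet> w (a + b) = y \<bullet> (w a + w b)"
        using skew[of "a + b" y] skew[of a y] skew[of b y] by (simp add: inner_add_right inner_commute)
    qed
    show "w (c *\<^sub>R a) = c *\<^sub>R w a"
    proof (rule vector_eq_ldot[THEN iffD1], intro allI)
      fix y show "y \<bullet> w (c *\<^sub>R a) = y \<bullet> (c *\<^sub>R w a)"
        using skew[of "c *\<^sub>R a" y] skew[of a y] by (simp add: inner_commute)
    qed
  qed
qed

lemma rigid_in_poly_maps:
  assumes "rigid v" "1 \<le> k" shows "v \<in> poly_maps k"
proof -
  have "(\<lambda>x. v x - v 0) + (\<lambda>x. v 0) \<in> poly_maps k"
    by (intro subspace_add[OF subspace_poly_maps] linear_in_poly_maps rigid_affine(1) assms const_in_poly_maps)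
  then show ?thesis by (simp add: plus_fun_def)
qed

text \<open>The linear part vanishes on tangential vectors. By skew-symmetry its value at the normal
  is orthogonal to all tangential vectors and to the normal itself.\<close>

lemma rigid_vanishing_on_face:
  fixes v :: "'d::finite point \<Rightarrow> 'd point"
  assumes v: "rigid v" and F: "hyperplanar_face F" and z: "\<And>x. x \<in> F \<Longrightarrow> v x = 0"
  shows "v = 0"
proof -
  define w where "w x = v x - v 0" for x
  note w = rigid_affine[OF v, folded w_def]
  obtain n b where n: "norm n = 1" and o: "openin (top_of_set {x. n \<bullet> x = b}) F"
    using hyperplanar_face_unit_normal[OF F] by blast
  have nn: "n \<bullet> n = 1" using n by (simp add: dot_square_norm)
  obtain x where x: "x \<in> F" using F by (auto simp: hyperplanar_face_def)
  obtain e where e: "e > 0" "\<And>z. n \<bullet> z = b \<Longrightarrow> dist x z < e \<Longrightarrow> z \<in> F" and nx: "n \<bullet> x = b"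
    using openin_hyperplane_ball[OF o x] by metis
  have tang: "w t = 0" if t: "n \<bullet> t = 0" for t
  proof -
    (* small enough to stay in the face *)
    define s where "s = e / 2 / (norm t + 1)"
    have p: "norm t + 1 > 0" by (simp add: add_nonneg_pos)
    then have s: "s > 0" using e by (simp add: s_def)
    have "s * norm t = (e / 2) * (norm t / (norm t + 1))" by (simp add: s_def)
    also have "\<dots> \<le> (e / 2) * 1" using e p by (intro mult_left_mono) (auto simp: divide_simps)
    finally have "x + s *\<^sub>R t \<in> F" using t nx s e(1) by (intro e(2)) (auto simp: inner_add_right dist_norm)
    then have "v (x + s *\<^sub>R t) = 0" "v x = 0" using z x by auto
    then have "w (x + s *\<^sub>R t) - w x = 0" by (simp add: w_def)
    then have "s *\<^sub>R w t = 0" by (simp add: linear_add[OF w(1)] linear_scale[OF w(1)])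
    then show ?thesis using s by simp
  qed
  have wn: "w n = 0"
  proof -
    have "w n \<bullet> n = 0" using w(2)[of n n] by simp
    moreover have wt: "w n \<bullet> t = 0" if "n \<bullet> t = 0" for t using w(2)[of n t] tang[OF that] by simp
    have "w n \<bullet> (w n - (n \<bullet> w n) *\<^sub>R n) = 0" by (rule wt) (simp add: inner_diff_right nn)
    ultimately have "w n \<bullet> w n = 0" by (simp add: inner_diff_right)
    then show ?thesis by simp
  qed
  have "w y = 0" for y
  proof -
    have "w (y - (n \<bullet> y) *\<^sub>R n) = 0" by (rule tang) (simp add: inner_diff_right nn)
    then show ?thesis by (simp add: linear_diff[OF w(1)] linear_scale[OF w(1)] wn)
  qed
  then have "v y = v 0" for y by (simp add: w_def)
  moreover have "v x = 0" using z x by blast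
  ultimately show ?thesis by (metis ext zero_fun_apply)
qed

section \<open>Gradient and displacement reconstructions\<close>

text \<open>On an open set, polynomials with vanishing \<open>L\<^sup>2\<close> norm are zero, so
  the \<open>L\<^sup>2\<close> product is nondegenerate and the representative is unique.\<close>

lemma poly_riesz:
  fixes S :: "('d::finite point \<Rightarrow> 'b::euclidean_space) set"
  assumes T: "open T" "bounded T" "T \<noteq> {}" and S: "subspace S" "S \<subseteq> poly_maps k" and l: "lin_on S l"
  shows "\<exists>!G. G \<in> S \<and> (\<forall>\<tau>\<in>S. (LINT x|lebesgue_on T. G x \<bullet> \<tau> x) = l \<tau>)"
proof -
  have sol: "solid (lebesgue_on T)" by (rule solid_lebesgue_on[OF T(1,2)])
  have tm: "tame (space (lebesgue_on T)) f" if "f \<in> S" for f using that S(2) tame_poly_maps by blast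
  have E: "psd_on S (\<lambda>f g. LINT x|lebesgue_on T. f x \<bullet> g x)"
    by (rule psd_on_L2[OF sol S(1) tm]) (auto simp: lin_on_def)
  have z: "f = 0" if "f \<in> S" "(LINT x|lebesgue_on T. f x \<bullet> f x) = 0" for f
  proof (rule poly_maps_zero[of f k T])
    fix x assume "x \<in> T" then show "f x = 0" using solid_norm_zero[OF sol tm[OF that(1)] that(2), of x] by simp
  qed (use T S that in auto)
  have "\<exists>G\<in>S. \<forall>\<tau>\<in>S. (LINT x|lebesgue_on T. G x \<bullet> \<tau> x) = l \<tau>"
    by (rule riesz_on[OF E S(1) fin_dim_subset[OF fin_dim_poly_maps S(2)] l]) (use z lin_on_0[OF l S(1)] in auto)
  then obtain G where G: "G \<in> S" "\<forall>\<tau>\<in>S. (LINT x|lebesgue_on T. G x \<bullet> \<tau> x) = l \<tau>" by blast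
  show ?thesis
  proof (rule ex1I[of _ G])
    fix G' assume G': "G' \<in> S \<and> (\<forall>\<tau>\<in>S. (LINT x|lebesgue_on T. G' x \<bullet> \<tau> x) = l \<tau>)"
    have d: "G' - G \<in> S" using G(1) G' by (intro subspace_diff[OF S(1)]) auto
    have "(LINT x|lebesgue_on T. G' x \<bullet> (G' - G) x) = l (G' - G)" "(LINT x|lebesgue_on T. G x \<bullet> (G' - G) x) = l (G' - G)"
      using G G' d by blast+
    moreover have "G' \<in> S" using G' by blast
    ultimately have "(LINT x|lebesgue_on T. (G' - G) x \<bullet> (G' - G) x) = 0"
      using lin_on_diff[OF bilin_onD(2)[OF _ d] S(1), of "\<lambda>f g. LINT x|lebesgue_on T. f x \<bullet> g x" G' G] E G(1)
      by (simp add: psd_on_def)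
    then have "G' - G = 0" by (rule z[OF d])
    then show "G' = G" by simp
  qed (use G in blast)
qed

context star_element begin

text \<open>The divergence theorem for the components \<open>v \<bullet> \<tau> e\<^sub>j\<close>,
  summed over \<open>j\<close>.\<close>

lemma integration_by_parts:
  fixes v :: "'d point \<Rightarrow> 'd point"
  assumes v: "v \<in> poly_maps k" and \<tau>: "\<tau> \<in> stpoly_upto l"
  shows "(LINT x|lebesgue_on T. sym_grad v x \<bullet> \<tau> x) =
    - (LINT x|lebesgue_on T. v x \<bullet> tensor_div \<tau> x) + (\<Sum>F\<in>FS. LINT x|face_measure F. v x \<bullet> (\<tau> x *v normal_out T F))"
proof -
  have \<tau>p: "\<tau> \<in> poly_maps l" and \<tau>s: "\<And>x. \<tau> x \<in> sym_tensors" using \<tau> by (auto simp: stpoly_upto_eq)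
  (* the columns of the tensor *)
  define u where "u j x = (\<chi> i. \<tau> x $ i $ j)" for j x
  have u: "u j \<in> poly_maps l" for j
    using \<tau> by (intro vec_poly_mapsI) (simp add: u_def stpoly_upto_def)
  have pu: "pdiff i (u j) x $ m = pdiff i \<tau> x $ m $ j" for i j m x
  proof -
    have "pdiff i (u j) x $ m = pdiff i (\<lambda>x. u j x $ m) x" by (rule pdiff_component[symmetric, OF poly_maps_differentiable[OF u]])
    also have "\<dots> = pdiff i (\<lambda>x. \<tau> x $ m $ j) x" by (simp add: u_def)
    also have "\<dots> = pdiff i \<tau> x $ m $ j"
      by (rule pdiff_bounded_linear[OF poly_maps_differentiable[OF \<tau>p]])
        (intro bounded_linear_compose[OF bounded_linear_vec_nth bounded_linear_vec_nth])
    finally show ?thesis .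
  qed
  let ?f = "\<lambda>j x. v x \<bullet> u j x"
  have dv: "v differentiable at x" and du: "u j differentiable at x" for x j
    using v u poly_maps_differentiable by blast+
  have D: "(?f j has_derivative (\<lambda>h. grad (?f j) x \<bullet> h)) (at x)" for j x
    by (rule grad_has_derivative[OF pdiff_inner(1)[OF dv du]])
  have gr: "grad (?f j) x = (\<chi> i. pdiff i v x \<bullet> u j x + v x \<bullet> pdiff i (u j) x)" for j x
    by (simp add: grad_def pdiff_inner(2)[OF dv du])
  have contD: "continuous_on UNIV (grad (?f j))" for j
    unfolding gr[abs_def]
    by (intro continuous_on_vec_lambda continuous_intros poly_maps_continuous[OF v] poly_maps_continuous[OF u]
        poly_maps_continuous[OF pdiff_in_poly_maps[OF v]] poly_maps_continuous[OF pdiff_in_poly_maps[OF u]])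
  have div: "(LINT x|lebesgue_on T. grad (?f j) x \<bullet> axis j 1) = (\<Sum>F\<in>FS. LINT x|face_measure F. ?f j x * (normal_out T F \<bullet> axis j 1))" for j
    by (rule divergence_theorem[OF D contD])
  have int1: "integrable (lebesgue_on T) (\<lambda>x. grad (?f j) x \<bullet> axis j 1)" for j
    by (intro tame_integrable[OF solid_T] tame_intros tame_continuous contD)
  have int2: "integrable (face_measure F) (\<lambda>x. ?f j x * (normal_out T F \<bullet> axis j 1))" if "F \<in> FS" for j F
    by (intro tame_integrable[OF solid_F[OF that]] tame_intros tame_poly_maps[OF v] tame_poly_maps[OF u])
  have int3: "integrable (lebesgue_on T) (\<lambda>x. sym_grad v x \<bullet> \<tau> x)" "integrable (lebesgue_on T) (\<lambda>x. v x \<bullet> tensor_div \<tau> x)"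
    by (intro tame_integrable[OF solid_T] tame_intros tame_poly_maps[OF v] tame_poly_maps[OF \<tau>p] tame_sym_grad[OF v] tame_tensor_div[OF \<tau>p])+
  have pt: "(\<Sum>j\<in>UNIV. grad (?f j) x \<bullet> axis j 1) = sym_grad v x \<bullet> \<tau> x + v x \<bullet> tensor_div \<tau> x" for x
  proof -
    have "sym_grad v x \<bullet> \<tau> x = (\<Sum>i\<in>UNIV. \<Sum>j\<in>UNIV. pdiff j v x $ i * \<tau> x $ i $ j)"
      using sym_inner[OF \<tau>s, of "\<chi> j i. pdiff j v x $ i"] by (simp add: sym_grad_def)
    also have "\<dots> = (\<Sum>j\<in>UNIV. pdiff j v x \<bullet> u j x)"
      by (subst sum.swap) (simp add: u_def inner_vec_def)
    finally have 1: "sym_grad v x \<bullet> \<tau> x = (\<Sum>j\<in>UNIV. pdiff j v x \<bullet> u j x)" .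
    have "v x \<bullet> tensor_div \<tau> x = (\<Sum>i\<in>UNIV. \<Sum>j\<in>UNIV. v x $ i * pdiff j \<tau> x $ i $ j)"
      by (simp add: tensor_div_def inner_vec_def sum_distrib_left)
    also have "\<dots> = (\<Sum>j\<in>UNIV. v x \<bullet> pdiff j (u j) x)"
      by (subst sum.swap) (simp add: pu inner_vec_def)
    finally have 2: "v x \<bullet> tensor_div \<tau> x = (\<Sum>j\<in>UNIV. v x \<bullet> pdiff j (u j) x)" .
    show ?thesis unfolding 1 2 by (simp add: gr inner_axis sum.distrib)
  qed
  have "(LINT x|lebesgue_on T. sym_grad v x \<bullet> \<tau> x) + (LINT x|lebesgue_on T. v x \<bullet> tensor_div \<tau> x) =
     (LINT x|lebesgue_on T. (\<Sum>j\<in>UNIV. grad (?f j) x \<bullet> axis j 1))"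
    unfolding pt using int3 by simp
  also have "\<dots> = (\<Sum>j\<in>UNIV. LINT x|lebesgue_on T. grad (?f j) x \<bullet> axis j 1)"
    by (rule Bochner_Integration.integral_sum) (rule int1)
  also have "\<dots> = (\<Sum>F\<in>FS. \<Sum>j\<in>UNIV. LINT x|face_measure F. ?f j x * (normal_out T F \<bullet> axis j 1))"
    unfolding div by (rule sum.swap)
  also have "\<dots> = (\<Sum>F\<in>FS. LINT x|face_measure F. v x \<bullet> (\<tau> x *v normal_out T F))"
  proof (rule sum.cong[OF refl])
    fix F assume F: "F \<in> FS"
    have "(\<Sum>j\<in>UNIV. ?f j x * (normal_out T F \<bullet> axis j 1)) = v x \<bullet> (\<tau> x *v normal_out T F)" for x
    proof -
      have "(\<Sum>j\<in>UNIV. ?f j x * (normal_out T F \<bullet> axis j 1)) = (\<Sum>j\<in>UNIV. \<Sum>i\<in>UNIV. v x $ i * (\<tau> x $ i $ j * normal_out T F $ j))"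
        by (simp add: inner_vec_def[of "v x"] u_def sum_distrib_right inner_axis mult.assoc)
      also have "\<dots> = v x \<bullet> (\<tau> x *v normal_out T F)"
        by (subst sum.swap) (simp add: inner_vec_def matrix_vector_mult_def sum_distrib_left)
      finally show ?thesis .
    qed
    then show "(\<Sum>j\<in>UNIV. LINT x|face_measure F. ?f j x * (normal_out T F \<bullet> axis j 1)) = (LINT x|face_measure F. v x \<bullet> (\<tau> x *v normal_out T F))"
      using int2[OF F] by (subst Bochner_Integration.integral_sum[symmetric]) auto
  qed
  finally show ?thesis by simp
qed

end

text \<open>The unknowns of the method without any convention on their values at sets that are not
  elements or faces, nor at points off a face. These values do not enter the forms. The result
  contains both the extensional functions of the discrete spaces, which are not closed under
  addition, and a genuine vector space of zero-extended functions.\<close>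

definition raw_U :: "nat \<Rightarrow> 'd::finite mesh \<Rightarrow> 'd hho set" where
  "raw_U k M = {v. (\<forall>T\<in>elems M. fst v T \<in> poly_maps k) \<and>
     (\<forall>F\<in>faces M. \<exists>p\<in>poly_maps k. \<forall>x\<in>F. snd v F x = p x)}"

lemma subspace_raw_U: "subspace (raw_U k M)"
proof (rule subspaceI)
  show "0 \<in> raw_U k M"
    unfolding raw_U_def using subspace_0[OF subspace_poly_maps[of k]]
    by (auto intro!: bexI[of _ 0])
next
  fix u v :: "'a hho" assume u: "u \<in> raw_U k M" and v: "v \<in> raw_U k M"
  have "\<exists>p\<in>poly_maps k. \<forall>x\<in>F. snd (u + v) F x = p x" if F: "F \<in> faces M" for F
  proof -
    obtain p q where "p \<in> poly_maps k" "\<forall>x\<in>F. snd u F x = p x" "q \<in> poly_maps k" "\<forall>x\<in>F. snd v F x = q x"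
      using u v F unfolding raw_U_def by blast
    then show ?thesis by (intro bexI[of _ "p + q"]) (auto intro: subspace_add[OF subspace_poly_maps])
  qed
  then show "u + v \<in> raw_U k M"
    using u v by (auto simp: raw_U_def intro: subspace_add[OF subspace_poly_maps])
next
  fix c and u :: "'a hho" assume u: "u \<in> raw_U k M"
  have "\<exists>p\<in>poly_maps k. \<forall>x\<in>F. snd (c *\<^sub>R u) F x = p x" if F: "F \<in> faces M" for F
  proof -
    obtain p where "p \<in> poly_maps k" "\<forall>x\<in>F. snd u F x = p x"
      using u F unfolding raw_U_def by blast
    then show ?thesis by (intro bexI[of _ "c *\<^sub>R p"]) (auto intro: subspace_scale[OF subspace_poly_maps])
  qed
  then show "c *\<^sub>R u \<in> raw_U k M"
    using u by (auto simp: raw_U_def intro: subspace_scale[OF subspace_poly_maps])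
qed

lemma lin_on_fst [lin_intros]: "lin_on V (\<lambda>v. fst v T x)" for V :: "'d::finite hho set"
  by (simp add: lin_on_def)

lemma lin_on_snd [lin_intros]: "lin_on V (\<lambda>v. snd v F x)" for V :: "'d::finite hho set"
  by (simp add: lin_on_def)

text \<open>The reconstructions are unique solutions of problems that are linear in the data, and
  inherit their linearity.\<close>

lemma lin_on_the:
  assumes "\<And>v. v \<in> V \<Longrightarrow> \<exists>!G. Q v G"
    and "\<And>u v G H. u \<in> V \<Longrightarrow> v \<in> V \<Longrightarrow> Q u G \<Longrightarrow> Q v H \<Longrightarrow> Q (u + v) (G + H)"
    and "\<And>c u G. u \<in> V \<Longrightarrow> Q u G \<Longrightarrow> Q (c *\<^sub>R u) (c *\<^sub>R G)" and "subspace V"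
  shows "lin_on V (\<lambda>v. THE G. Q v G)"
proof (rule lin_onI)
  fix u v assume uv: "u \<in> V" "v \<in> V"
  have "Q u (THE G. Q u G)" "Q v (THE G. Q v G)" using theI'[OF assms(1)] uv by blast+
  then have "Q (u + v) ((THE G. Q u G) + (THE G. Q v G))" using assms(2) uv by blast
  then show "(THE G. Q (u + v) G) = (THE G. Q u G) + (THE G. Q v G)"
    using assms(1)[OF subspace_add[OF assms(4) uv]] by (rule the1_equality[rotated])
next
  fix c u assume u: "u \<in> V"
  have "Q u (THE G. Q u G)" using theI'[OF assms(1)] u by blast
  then have "Q (c *\<^sub>R u) (c *\<^sub>R (THE G. Q u G))" using assms(3) u by blast
  then show "(THE G. Q (c *\<^sub>R u) G) = c *\<^sub>R (THE G. Q u G)"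
    using assms(1)[OF subspace_scale[OF assms(4) u]] by (rule the1_equality[rotated])
qed

text \<open>Used for both projections of the face residual, with \<open>R\<close> as in
  \<open>l2_proj_works\<close>.\<close>

lemma l2_proj_linear:
  fixes R :: "('d::finite point \<Rightarrow> real) \<Rightarrow> 'd point \<Rightarrow> real"
  assumes \<mu>: "solid \<mu>" and V: "subspace V" and H: "\<And>v. v \<in> V \<Longrightarrow> tame (space \<mu>) (H v)"
    and lin: "\<And>y. y \<in> space \<mu> \<Longrightarrow> lin_on V (\<lambda>v. H v y)"
    and R: "\<And>p x. x \<in> space \<mu> \<Longrightarrow> R p x = p x"
    "\<And>p q. p \<in> poly_upto k \<Longrightarrow> q \<in> poly_upto k \<Longrightarrow> (\<And>x. x \<in> space \<mu> \<Longrightarrow> p x = q x) \<Longrightarrow> R p = R q"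
    and x: "\<And>p. R p x = p x"
  shows "lin_on V (\<lambda>v. l2_proj (R ` poly_upto k) \<mu> (H v) x)"
proof -
  let ?Q = "\<lambda>v p. p \<in> poly_upto k \<and> (\<forall>q\<in>poly_upto k. (LINT x|\<mu>. p x * q x) = (LINT x|\<mu>. H v x * q x))"
  have tp: "tame (space \<mu>) p" if "p \<in> poly_upto k" for p
    using that tame_poly_maps[of p k] by (simp add: poly_maps_real)
  have i: "integrable \<mu> (\<lambda>x. p x * q x)" if "tame (space \<mu>) p" "q \<in> poly_upto k" for p q
    by (rule tame_integrable[OF \<mu> tame_mult[OF that(1) tp[OF that(2)]]])
  have ex: "\<exists>p. ?Q v p" if "v \<in> V" for v
    using l2_proj_works(1)[OF \<mu> H[OF that] R] by blast
  have val: "l2_proj (R ` poly_upto k) \<mu> (H v) x = p x" if "v \<in> V" "?Q v p" for v p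
  proof -
    have "l2_proj (R ` poly_upto k) \<mu> (H v) = R p"
      by (rule l2_proj_works(2)[OF \<mu> H[OF that(1)] R]) (use that(2) in auto)
    then show ?thesis using x by simp
  qed
  show ?thesis
  proof (rule lin_onI)
    fix u v assume uv: "u \<in> V" "v \<in> V"
    obtain p q where p: "?Q u p" and q: "?Q v q" using ex uv by blast
    have "?Q (u + v) (p + q)"
    proof (intro conjI ballI subspace_add[OF subspace_poly_upto])
      fix s :: "'d point \<Rightarrow> real" assume s: "s \<in> poly_upto k"
      have "(LINT x|\<mu>. (p + q) x * s x) = (LINT x|\<mu>. p x * s x) + (LINT x|\<mu>. q x * s x)"
        using i[OF tp s] p q by (simp add: distrib_right)
      also have "\<dots> = (LINT x|\<mu>. H u x * s x) + (LINT x|\<mu>. H v x * s x)" using p q s by simp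
      also have "\<dots> = (LINT x|\<mu>. H u x * s x + H v x * s x)" using i[OF H s] uv by simp
      also have "\<dots> = (LINT x|\<mu>. H (u + v) x * s x)"
        by (rule Bochner_Integration.integral_cong) (use lin_on_add[OF lin] uv in \<open>auto simp: distrib_right\<close>)
      finally show "(LINT x|\<mu>. (p + q) x * s x) = (LINT x|\<mu>. H (u + v) x * s x)" .
    qed (use p q in auto)
    then show "l2_proj (R ` poly_upto k) \<mu> (H (u + v)) x = l2_proj (R ` poly_upto k) \<mu> (H u) x + l2_proj (R ` poly_upto k) \<mu> (H v) x"
      using val[OF uv(1) p] val[OF uv(2) q] val[OF subspace_add[OF V uv], of "p + q"] by simp
  next
    fix c u assume u: "u \<in> V"
    obtain p where p: "?Q u p" using ex u by blast
    have "?Q (c *\<^sub>R u) (c *\<^sub>R p)"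
    proof (intro conjI ballI subspace_scale[OF subspace_poly_upto])
      fix s :: "'d point \<Rightarrow> real" assume s: "s \<in> poly_upto k"
      have "(LINT x|\<mu>. (c *\<^sub>R p) x * s x) = c * (LINT x|\<mu>. p x * s x)" by (simp add: mult.assoc)
      also have "\<dots> = c * (LINT x|\<mu>. H u x * s x)" using p s by simp
      also have "\<dots> = (LINT x|\<mu>. c * (H u x * s x))" by simp
      also have "\<dots> = (LINT x|\<mu>. H (c *\<^sub>R u) x * s x)"
        by (rule Bochner_Integration.integral_cong) (use lin_on_scale[OF lin] u in \<open>auto simp: mult.assoc\<close>)
      finally show "(LINT x|\<mu>. (c *\<^sub>R p) x * s x) = (LINT x|\<mu>. H (c *\<^sub>R u) x * s x)" .
    qed (use p in auto)
    then show "l2_proj (R ` poly_upto k) \<mu> (H (c *\<^sub>R u)) x = c *\<^sub>R l2_proj (R ` poly_upto k) \<mu> (H u) x"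
      using val[OF u p] val[OF subspace_scale[OF V u], of "c *\<^sub>R p"] by simp
  qed
qed

locale hho_disc = hho_mesh \<Omega> M ctr rad \<A>
  for \<Omega> :: "'d::finite point set" and M :: "'d mesh" and ctr rad \<A> +
  fixes k :: nat
  assumes k1: "1 \<le> k"
begin

abbreviation "V \<equiv> raw_U k M"

lemma raw_elem: "v \<in> V \<Longrightarrow> T \<in> elems M \<Longrightarrow> fst v T \<in> poly_maps k"
  by (simp add: raw_U_def)

lemma raw_face: "v \<in> V \<Longrightarrow> F \<in> faces M \<Longrightarrow> \<exists>p\<in>poly_maps k. \<forall>x\<in>F. snd v F x = p x"
  by (simp add: raw_U_def)

lemma tame_elem: "v \<in> V \<Longrightarrow> T \<in> elems M \<Longrightarrow> tame X (fst v T)"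
  by (rule tame_poly_maps[OF raw_elem])

lemma tame_face: "v \<in> V \<Longrightarrow> F \<in> faces M \<Longrightarrow> tame F (snd v F)"
  using raw_face[of v F] poly_maps_continuous unfolding tame_def by blast

lemma solid_elem: "T \<in> elems M \<Longrightarrow> solid (lebesgue_on T)"
  by (rule solid_lebesgue_on[OF open_elem bounded_elem])

lemma solid_face: "F \<in> faces M \<Longrightarrow> solid (face_measure F)"
  by (rule solid_face_measure[OF faceD(3) faceD(2)])

subsection \<open>The symmetric gradient\<close>

definition sym_grad_rhs :: "'d point set \<Rightarrow> 'd hho \<Rightarrow> ('d point \<Rightarrow> 'd tensor) \<Rightarrow> real" where
  "sym_grad_rhs T v \<tau> = - (LINT x|lebesgue_on T. fst v T x \<bullet> tensor_div \<tau> x)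
       + (\<Sum>F\<in>faces_of M T. LINT x|face_measure F. snd v F x \<bullet> (\<tau> x *v normal_out T F))"

lemma sym_grad_rhs_linear:
  assumes T: "T \<in> elems M"
  shows "v \<in> V \<Longrightarrow> lin_on (stpoly_upto k) (sym_grad_rhs T v)"
    and "\<tau> \<in> stpoly_upto k \<Longrightarrow> lin_on V (\<lambda>v. sym_grad_rhs T v \<tau>)"
proof -
  have sp: "stpoly_upto k \<subseteq> poly_maps k" using stpoly_poly by blast
  have t: "tame (space (lebesgue_on T)) (\<lambda>x. fst v T x \<bullet> tensor_div \<tau> x)"
     "F \<in> faces_of M T \<Longrightarrow> tame (space (face_measure F)) (\<lambda>x. snd v F x \<bullet> (\<tau> x *v normal_out T F))"
    if "v \<in> V" "\<tau> \<in> stpoly_upto k" for v \<tau> F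
    using that by (auto intro!: tame_intros tame_elem[OF _ T] tame_face tame_tensor_div[OF stpoly_poly] tame_poly_maps[OF stpoly_poly]
        intro: faces_ofD(1))
  { assume v: "v \<in> V"
    show "lin_on (stpoly_upto k) (sym_grad_rhs T v)"
      unfolding sym_grad_rhs_def
      by (intro lin_on_plus lin_on_uminus lin_on_sums lin_on_integral_tame solid_elem[OF T] solid_face faces_ofD(1) subspace_stpoly t v
           lin_intros lin_on_tensor_div[OF sp]) (auto simp: lin_on_def) }
  { assume \<tau>: "\<tau> \<in> stpoly_upto k"
    show "lin_on V (\<lambda>v. sym_grad_rhs T v \<tau>)"
      unfolding sym_grad_rhs_def
      by (intro lin_on_plus lin_on_uminus lin_on_sums lin_on_integral_tame solid_elem[OF T] solid_face faces_ofD(1) subspace_raw_U t \<tau>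
           lin_intros) }
qed

abbreviation "G \<equiv> sym_grad_rec k M"

lemma sym_grad_rec_eq: "G T v = (THE G. G \<in> stpoly_upto k \<and> (\<forall>\<tau>\<in>stpoly_upto k.
     (LINT x|lebesgue_on T. G x \<bullet> \<tau> x) = sym_grad_rhs T v \<tau>))"
  by (simp add: sym_grad_rec_def sym_grad_rhs_def)

lemma sym_grad_rec_ex1:
  assumes T: "T \<in> elems M" and v: "v \<in> V"
  shows "\<exists>!G. G \<in> stpoly_upto k \<and> (\<forall>\<tau>\<in>stpoly_upto k. (LINT x|lebesgue_on T. G x \<bullet> \<tau> x) = sym_grad_rhs T v \<tau>)"
  using stpoly_poly
  by (intro poly_riesz[where k = k] open_elem bounded_elem elem_nonempty T subspace_stpoly sym_grad_rhs_linear v) blast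

lemma sym_grad_rec:
  assumes T: "T \<in> elems M" and v: "v \<in> V"
  shows "G T v \<in> stpoly_upto k" "\<tau> \<in> stpoly_upto k \<Longrightarrow> (LINT x|lebesgue_on T. G T v x \<bullet> \<tau> x) = sym_grad_rhs T v \<tau>"
  using theI'[OF sym_grad_rec_ex1[OF T v]] unfolding sym_grad_rec_eq by blast+

lemma tame_G [tame_intros]: "T \<in> elems M \<Longrightarrow> v \<in> V \<Longrightarrow> tame X (G T v)"
  by (rule tame_poly_maps[OF stpoly_poly[OF sym_grad_rec(1)]])

lemma L2_bilinear:
  fixes f g h :: "'d point \<Rightarrow> 'b::euclidean_space"
  assumes "solid \<mu>" "tame (space \<mu>) f" "tame (space \<mu>) g" "tame (space \<mu>) h"
  shows "(LINT x|\<mu>. (f + g) x \<bullet> h x) = (LINT x|\<mu>. f x \<bullet> h x) + (LINT x|\<mu>. g x \<bullet> h x)"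
    "(LINT x|\<mu>. (c *\<^sub>R f) x \<bullet> h x) = c * (LINT x|\<mu>. f x \<bullet> h x)"
proof -
  have "integrable \<mu> (\<lambda>x. f x \<bullet> h x)" "integrable \<mu> (\<lambda>x. g x \<bullet> h x)" by (auto intro!: tame_integrable tame_inner assms)
  then show "(LINT x|\<mu>. (f + g) x \<bullet> h x) = (LINT x|\<mu>. f x \<bullet> h x) + (LINT x|\<mu>. g x \<bullet> h x)"
    by (simp add: inner_add_left)
qed simp

lemma lin_on_G: "T \<in> elems M \<Longrightarrow> lin_on V (\<lambda>v. G T v)"
  unfolding sym_grad_rec_eq
proof (rule lin_on_the)
  assume T: "T \<in> elems M"
  have tm: "tame (space (lebesgue_on T)) G" if "G \<in> stpoly_upto k" for G :: "'d point \<Rightarrow> 'd tensor"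
    by (rule tame_poly_maps[OF stpoly_poly[OF that]])
  let ?Q = "\<lambda>v G. G \<in> stpoly_upto k \<and> (\<forall>\<tau>\<in>stpoly_upto k. (LINT x|lebesgue_on T. G x \<bullet> \<tau> x) = sym_grad_rhs T v \<tau>)"
  show "?Q (u + v) (G + H)" if "u \<in> V" "v \<in> V" "?Q u G" "?Q v H" for u v G H
    using that lin_on_add[OF sym_grad_rhs_linear(2)[OF T] that(1,2)]
    by (auto simp: L2_bilinear(1)[OF solid_elem[OF T] tm tm tm] simp del: plus_fun_apply intro: subspace_add[OF subspace_stpoly])
  show "?Q (c *\<^sub>R u) (c *\<^sub>R G)" if "u \<in> V" "?Q u G" for c u G
    using that lin_on_scale[OF sym_grad_rhs_linear(2)[OF T] that(1)]
    by (auto simp: L2_bilinear(2)[OF solid_elem[OF T] tm tm tm] simp del: scaleR_fun_apply intro: subspace_scale[OF subspace_stpoly])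
  show "subspace V" by (rule subspace_raw_U)
  show "\<exists>!G. ?Q v G" if "v \<in> V" for v by (rule sym_grad_rec_ex1[OF T that])
qed

subsection \<open>The displacement\<close>

definition face_skew :: "'d point set \<Rightarrow> 'd hho \<Rightarrow> 'd \<Rightarrow> 'd \<Rightarrow> real" where
  "face_skew T v i j = (\<Sum>F\<in>faces_of M T. LINT x|face_measure F.
           normal_out T F $ i * snd v F x $ j - normal_out T F $ j * snd v F x $ i)"

lemma lin_on_face_skew: "lin_on V (\<lambda>v. face_skew T v i j)"
  unfolding face_skew_def
  by (intro lin_on_sums lin_on_integral_tame solid_face faces_ofD(1) subspace_raw_U lin_intros tame_intros)
    (auto intro: tame_face faces_ofD(1))

lemma face_skew_antisym: "face_skew T v i j = - face_skew T v j i"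
proof -
  have "(LINT x|face_measure F. normal_out T F $ i * snd v F x $ j - normal_out T F $ j * snd v F x $ i) =
    - (LINT x|face_measure F. normal_out T F $ j * snd v F x $ i - normal_out T F $ i * snd v F x $ j)" for F
    by (subst Bochner_Integration.integral_minus[symmetric]) simp
  then show ?thesis unfolding face_skew_def sum_negf[symmetric] by (intro sum.cong refl)
qed

text \<open>The characterization of the displacement reconstruction, as a relation, to treat
  existence, linearity and uniqueness separately.\<close>

definition is_disp_rec :: "'d point set \<Rightarrow> 'd hho \<Rightarrow> ('d point \<Rightarrow> 'd point) \<Rightarrow> bool" where
  "is_disp_rec T v r \<longleftrightarrow> r \<in> poly_maps (k + 1) \<and>
     (\<forall>w\<in>poly_maps (k + 1). (LINT x|lebesgue_on T. (sym_grad r x - G T v x) \<bullet> sym_grad w x) = 0) \<and>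
     (LINT x|lebesgue_on T. r x) = (LINT x|lebesgue_on T. fst v T x) \<and>
     (\<forall>i j. i \<noteq> j \<longrightarrow> (LINT x|lebesgue_on T. pdiff i r x $ j - pdiff j r x $ i) = face_skew T v i j)"

lemma disp_rec_eq: "disp_rec k M T v = (THE r. is_disp_rec T v r)"
  by (simp add: disp_rec_def is_disp_rec_def face_skew_def poly_maps_vector)

lemma measure_elem_pos: "T \<in> elems M \<Longrightarrow> 0 < measure lebesgue T"
proof -
  assume T: "T \<in> elems M"
  have lm: "T \<in> lmeasurable" using open_elem[OF T] bounded_elem[OF T] by (simp add: lmeasurable_open)
  have "\<not> negligible T" using open_not_negligible[OF open_elem[OF T] elem_nonempty[OF T]] .
  then show ?thesis using negligible_iff_measure lm by (metis measure_nonneg less_le)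
qed

lemma measure_elem: "T \<in> elems M \<Longrightarrow> measure (lebesgue_on T) T = measure lebesgue T"
  using open_elem[of T] by (simp add: measure_restrict_space)

lemma affine_map:
  fixes A :: "'d tensor" and a :: "'d point"
  shows "(\<lambda>x. a + A *v x) \<in> poly_maps (k + 1)" "pdiff i (\<lambda>x. a + A *v x) x $ j = A $ j $ i"
proof -
  have "(\<lambda>x. a) + (\<lambda>x. A *v x) \<in> poly_maps (k + 1)"
    by (intro subspace_add[OF subspace_poly_maps] const_in_poly_maps linear_in_poly_maps) simp_all
  then show "(\<lambda>x. a + A *v x) \<in> poly_maps (k + 1)" by (simp add: plus_fun_def)
  have "((\<lambda>x. a + A *v x) has_derivative (\<lambda>h. 0 + A *v h)) (at x)"
    by (intro has_derivative_add has_derivative_const bounded_linear_imp_has_derivative) simp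
  then show "pdiff i (\<lambda>x. a + A *v x) x $ j = A $ j $ i"
    by (simp add: pdiff_eq matrix_vector_mul_component inner_axis)
qed

text \<open>Riesz representation gives a polynomial \<open>r1\<close> with the right symmetric
  gradient. Its rigid part is free: a skew-symmetric matrix \<open>A\<close> adjusts the mean of the
  rotation, and a constant \<open>a\<close> adjusts the mean.\<close>

lemma is_disp_rec_ex:
  assumes T: "T \<in> elems M" and v: "v \<in> V"
  shows "\<exists>r. is_disp_rec T v r"
proof -
  note sol = solid_elem[OF T]
  let ?P = "poly_maps (k + 1) :: ('d point \<Rightarrow> 'd point) set"
  define \<mu> where "\<mu> = measure lebesgue T"
  have \<mu>: "\<mu> > 0" unfolding \<mu>_def by (rule measure_elem_pos[OF T])
  have E: "psd_on ?P (\<lambda>r w. LINT x|lebesgue_on T. sym_grad r x \<bullet> sym_grad w x)"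
    by (intro psd_on_L2 sol subspace_poly_maps lin_on_sym_grad[OF order_refl] tame_sym_grad)
  have tG: "tame X (G T v)" for X by (rule tame_G[OF T v])
  have "\<exists>r\<in>?P. \<forall>w\<in>?P. (LINT x|lebesgue_on T. sym_grad r x \<bullet> sym_grad w x) = (LINT x|lebesgue_on T. G T v x \<bullet> sym_grad w x)"
  proof (rule riesz_on[OF E subspace_poly_maps fin_dim_poly_maps])
    show "lin_on ?P (\<lambda>w. LINT x|lebesgue_on T. G T v x \<bullet> sym_grad w x)"
      by (intro lin_on_integral_tame sol subspace_poly_maps lin_intros lin_on_sym_grad[OF order_refl] tame_inner tame_sym_grad tG)
    fix w :: "'d point \<Rightarrow> 'd point" assume w: "w \<in> ?P" "(LINT x|lebesgue_on T. sym_grad w x \<bullet> sym_grad w x) = 0"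
    have "(LINT x|lebesgue_on T. G T v x \<bullet> sym_grad w x) = (LINT x|lebesgue_on T. 0)"
      by (rule Bochner_Integration.integral_cong) (use solid_norm_zero[OF sol tame_sym_grad[OF w(1)] w(2)] in auto)
    then show "(LINT x|lebesgue_on T. G T v x \<bullet> sym_grad w x) = 0" by simp
  qed
  then obtain r1 where r1: "r1 \<in> ?P"
    "\<And>w. w \<in> ?P \<Longrightarrow> (LINT x|lebesgue_on T. sym_grad r1 x \<bullet> sym_grad w x) = (LINT x|lebesgue_on T. G T v x \<bullet> sym_grad w x)" by blast
  define s where "s i j = (LINT x|lebesgue_on T. pdiff i r1 x $ j - pdiff j r1 x $ i)" for i j
  have s_anti: "s i j = - s j i" for i j
    unfolding s_def by (subst Bochner_Integration.integral_minus[symmetric]) simp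
  define A :: "'d tensor" where "A = (\<chi> j i. (face_skew T v i j - s i j) / (2 * \<mu>))"
  have A_anti: "A $ j $ i = - A $ i $ j" for i j
    unfolding A_def using s_anti[of i j] face_skew_antisym[of T v i j] by (simp add: minus_divide_left)
  define q where "q = (LINT x|lebesgue_on T. fst v T x) - (LINT x|lebesgue_on T. r1 x) - (LINT x|lebesgue_on T. A *v x)"
  define a where "a = (1 / \<mu>) *\<^sub>R q"
  define e where "e = (\<lambda>x. a + A *v x)"
  note e = affine_map[where a = a and A = A, folded e_def]
  define r where "r = r1 + e"
  have rP: "r \<in> ?P" unfolding r_def by (rule subspace_add[OF subspace_poly_maps r1(1) e(1)])
  have pd: "pdiff i r x = pdiff i r1 x + pdiff i e x" for i x
    unfolding r_def by (rule pdiff_add) (rule poly_maps_differentiable[OF r1(1)] poly_maps_differentiable[OF e(1)])+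
  have se: "sym_grad e x = 0" for x
  proof -
    have "pdiff j e x $ i + pdiff i e x $ j = 0" for i j using A_anti[of i j] by (simp add: e(2))
    then show ?thesis by (simp add: sym_grad_def vec_eq_iff)
  qed
  have sr: "sym_grad r x = sym_grad r1 x" for x
    using lin_on_add[OF lin_on_sym_grad[OF order_refl] r1(1) e(1), of x] se by (simp add: r_def)
  have i1: "integrable (lebesgue_on T) (\<lambda>x. pdiff i r1 x $ j - pdiff j r1 x $ i)" for i j
    by (intro tame_integrable[OF sol] tame_intros tame_pdiff_poly[OF r1(1)])
  have is_r: "is_disp_rec T v r" unfolding is_disp_rec_def
  proof (intro conjI rP ballI allI impI)
    fix w :: "'d point \<Rightarrow> 'd point" assume w: "w \<in> ?P"
    have "integrable (lebesgue_on T) (\<lambda>x. sym_grad r1 x \<bullet> sym_grad w x)" "integrable (lebesgue_on T) (\<lambda>x. G T v x \<bullet> sym_grad w x)"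
      by (intro tame_integrable[OF sol] tame_inner tame_sym_grad[OF w] tame_sym_grad[OF r1(1)] tG)+
    then show "(LINT x|lebesgue_on T. (sym_grad r x - G T v x) \<bullet> sym_grad w x) = 0"
      using r1(2)[OF w] by (simp add: sr inner_diff_left)
  next
    have "(LINT x|lebesgue_on T. r x) = (LINT x|lebesgue_on T. r1 x + (a + A *v x))" by (simp add: r_def e_def)
    also have "\<dots> = (LINT x|lebesgue_on T. r1 x) + ((LINT x|lebesgue_on T. a) + (LINT x|lebesgue_on T. A *v x))"
    proof -
      have ii: "integrable (lebesgue_on T) r1" "integrable (lebesgue_on T) (\<lambda>x. a)" "integrable (lebesgue_on T) (\<lambda>x. A *v x)"
        by (intro tame_integrable[OF sol] tame_intros tame_poly_maps[OF r1(1)] tame_continuous continuous_on_id)+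
      then show ?thesis by (subst Bochner_Integration.integral_add) (auto intro: Bochner_Integration.integral_add)
    qed
    also have "(LINT x|lebesgue_on T. a) = q" using \<mu> by (simp add: measure_elem[OF T] a_def \<mu>_def)
    finally show "(LINT x|lebesgue_on T. r x) = (LINT x|lebesgue_on T. fst v T x)" by (simp add: q_def)
  next
    fix i j :: 'd assume "i \<noteq> j"
    have "(LINT x|lebesgue_on T. pdiff i r x $ j - pdiff j r x $ i) = (LINT x|lebesgue_on T. (pdiff i r1 x $ j - pdiff j r1 x $ i) + 2 * A $ j $ i)"
      by (rule Bochner_Integration.integral_cong) (simp_all add: pd e(2) A_anti[of i j])
    also have "\<dots> = s i j + (LINT x|lebesgue_on T. 2 * A $ j $ i)"
      unfolding s_def by (rule Bochner_Integration.integral_add[OF i1]) (intro tame_integrable[OF sol] tame_intros)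
    also have "\<dots> = face_skew T v i j" using \<mu> by (simp add: measure_elem[OF T] A_def \<mu>_def[symmetric] field_simps)
    finally show "(LINT x|lebesgue_on T. pdiff i r x $ j - pdiff j r x $ i) = face_skew T v i j" .
  qed
  then show ?thesis by blast
qed

lemma is_disp_rec_add:
  assumes T: "T \<in> elems M" and "u \<in> V" "v \<in> V" and r: "is_disp_rec T u r" "is_disp_rec T v q"
  shows "is_disp_rec T (u + v) (r + q)"
proof -
  note sol = solid_elem[OF T]
  let ?P = "poly_maps (k + 1) :: ('d point \<Rightarrow> 'd point) set"
  have P: "r \<in> ?P" "q \<in> ?P" using r by (auto simp: is_disp_rec_def)
  have sg: "sym_grad (r + q) x = sym_grad r x + sym_grad q x" for x
    using lin_on_add[OF lin_on_sym_grad[OF order_refl] P] .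
  have pd: "pdiff i (r + q) x = pdiff i r x + pdiff i q x" for i x
    by (rule pdiff_add) (rule poly_maps_differentiable[OF P(1)] poly_maps_differentiable[OF P(2)])+
  have Gl: "G T (u + v) = G T u + G T v" by (rule lin_on_add[OF lin_on_G[OF T] assms(2,3)])
  have ip: "integrable (lebesgue_on T) (\<lambda>x. pdiff i p x $ j - pdiff j p x $ i)" if "p \<in> ?P" for p i j
    by (intro tame_integrable[OF sol] tame_intros tame_pdiff_poly[OF that])
  show ?thesis unfolding is_disp_rec_def
  proof (intro conjI ballI allI impI)
    show "r + q \<in> ?P" by (rule subspace_add[OF subspace_poly_maps P])
    fix w :: "'d point \<Rightarrow> 'd point" assume w: "w \<in> ?P"
    have ig: "integrable (lebesgue_on T) (\<lambda>x. (sym_grad p x - G T z x) \<bullet> sym_grad w x)" if "p \<in> ?P" "z \<in> V" for p z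
      by (intro tame_integrable[OF sol] tame_inner tame_diff tame_sym_grad[OF w] tame_sym_grad[OF that(1)] tame_G[OF T that(2)])
    have "(LINT x|lebesgue_on T. (sym_grad (r + q) x - G T (u + v) x) \<bullet> sym_grad w x) =
      (LINT x|lebesgue_on T. (sym_grad r x - G T u x) \<bullet> sym_grad w x + (sym_grad q x - G T v x) \<bullet> sym_grad w x)"
      by (rule Bochner_Integration.integral_cong) (simp_all add: sg Gl inner_add_left inner_diff_left)
    also have "\<dots> = 0" 
      using ig[OF P(1) assms(2)] ig[OF P(2) assms(3)] r w by (simp add: is_disp_rec_def)
    finally show "(LINT x|lebesgue_on T. (sym_grad (r + q) x - G T (u + v) x) \<bullet> sym_grad w x) = 0" .
  next
    have "integrable (lebesgue_on T) p" if "tame (space (lebesgue_on T)) p" for p :: "'d point \<Rightarrow> 'd point"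
      using that by (rule tame_integrable[OF sol])
    then show "(LINT x|lebesgue_on T. (r + q) x) = (LINT x|lebesgue_on T. fst (u + v) T x)"
      using r tame_poly_maps[OF P(1)] tame_poly_maps[OF P(2)] tame_elem[OF assms(2) T] tame_elem[OF assms(3) T]
      by (simp add: is_disp_rec_def)
  next
    fix i j :: 'd assume ij: "i \<noteq> j"
    have "(LINT x|lebesgue_on T. pdiff i (r + q) x $ j - pdiff j (r + q) x $ i) = 
      (LINT x|lebesgue_on T. (pdiff i r x $ j - pdiff j r x $ i) + (pdiff i q x $ j - pdiff j q x $ i))"
      by (rule Bochner_Integration.integral_cong) (simp_all add: pd)
    also have "\<dots> = (LINT x|lebesgue_on T. pdiff i r x $ j - pdiff j r x $ i) + (LINT x|lebesgue_on T. pdiff i q x $ j - pdiff j q x $ i)"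
      by (rule Bochner_Integration.integral_add[OF ip[OF P(1)] ip[OF P(2)]])
    also have "\<dots> = face_skew T u i j + face_skew T v i j" using r ij by (simp add: is_disp_rec_def)
    also have "\<dots> = face_skew T (u + v) i j" by (rule lin_on_add[OF lin_on_face_skew assms(2,3), symmetric])
    finally show "(LINT x|lebesgue_on T. pdiff i (r + q) x $ j - pdiff j (r + q) x $ i) = face_skew T (u + v) i j" .
  qed
qed

lemma is_disp_rec_scale:
  assumes T: "T \<in> elems M" and "u \<in> V" and r: "is_disp_rec T u r"
  shows "is_disp_rec T (c *\<^sub>R u) (c *\<^sub>R r)"
proof -
  let ?P = "poly_maps (k + 1) :: ('d point \<Rightarrow> 'd point) set"
  have P: "r \<in> ?P" using r by (auto simp: is_disp_rec_def)
  have sg: "sym_grad (c *\<^sub>R r) x = c *\<^sub>R sym_grad r x" for x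
    using lin_on_scale[OF lin_on_sym_grad[OF order_refl] P] .
  have pd: "pdiff i (c *\<^sub>R r) x = c *\<^sub>R pdiff i r x" for i x
    by (rule pdiff_scaleR) (rule poly_maps_differentiable[OF P])
  have Gl: "G T (c *\<^sub>R u) = c *\<^sub>R G T u" by (rule lin_on_scale[OF lin_on_G[OF T] assms(2)])
  show ?thesis unfolding is_disp_rec_def
  proof (intro conjI ballI allI impI)
    show "c *\<^sub>R r \<in> ?P" by (rule subspace_scale[OF subspace_poly_maps P])
    fix w :: "'d point \<Rightarrow> 'd point" assume w: "w \<in> ?P"
    have "(LINT x|lebesgue_on T. (sym_grad (c *\<^sub>R r) x - G T (c *\<^sub>R u) x) \<bullet> sym_grad w x) =
      (LINT x|lebesgue_on T. c * ((sym_grad r x - G T u x) \<bullet> sym_grad w x))"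
      by (rule Bochner_Integration.integral_cong) (simp_all add: sg Gl scaleR_diff_right[symmetric])
    also have "\<dots> = 0" using r w by (simp add: is_disp_rec_def)
    finally show "(LINT x|lebesgue_on T. (sym_grad (c *\<^sub>R r) x - G T (c *\<^sub>R u) x) \<bullet> sym_grad w x) = 0" .
  next
    show "(LINT x|lebesgue_on T. (c *\<^sub>R r) x) = (LINT x|lebesgue_on T. fst (c *\<^sub>R u) T x)"
      using r by (simp add: is_disp_rec_def)
  next
    fix i j :: 'd assume ij: "i \<noteq> j"
    have "(LINT x|lebesgue_on T. pdiff i (c *\<^sub>R r) x $ j - pdiff j (c *\<^sub>R r) x $ i) = 
      (LINT x|lebesgue_on T. c * (pdiff i r x $ j - pdiff j r x $ i))"
      by (rule Bochner_Integration.integral_cong) (simp_all add: pd right_diff_distrib)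
    also have "\<dots> = c * face_skew T u i j" using r ij by (simp add: is_disp_rec_def)
    also have "\<dots> = face_skew T (c *\<^sub>R u) i j" using lin_on_scale[OF lin_on_face_skew[of T i j] assms(2), of c] by simp
    finally show "(LINT x|lebesgue_on T. pdiff i (c *\<^sub>R r) x $ j - pdiff j (c *\<^sub>R r) x $ i) = face_skew T (c *\<^sub>R u) i j" .
  qed
qed

lemma sym_grad_zero_on_elem:
  assumes T: "T \<in> elems M" and v: "v \<in> poly_maps m" and z: "(LINT x|lebesgue_on T. sym_grad v x \<bullet> sym_grad v x) = 0"
  shows "sym_grad v = 0" "rigid v"
proof -
  show "sym_grad v = 0"
    using solid_norm_zero[OF solid_elem[OF T] tame_sym_grad[OF v] z]
    by (intro poly_maps_zero[OF stpoly_poly[OF sym_grad_poly[OF v]] open_elem[OF T] elem_nonempty[OF T]]) simp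
  then show "rigid v" by (rule sym_grad_zero_rigid[OF v])
qed

text \<open>By linearity, the difference of two solutions solves the problem with zero data. It is
  rigid, its skew-symmetric part has zero mean, and finally its mean is zero.\<close>

lemma is_disp_rec_ex1:
  assumes T: "T \<in> elems M" and v: "v \<in> V"
  shows "\<exists>!r. is_disp_rec T v r"
proof (rule ex_ex1I[OF is_disp_rec_ex[OF T v]])
  fix r q assume r: "is_disp_rec T v r" and q: "is_disp_rec T v q"
  let ?P = "poly_maps (k + 1) :: ('d point \<Rightarrow> 'd point) set"
  have "is_disp_rec T ((-1) *\<^sub>R v) ((-1) *\<^sub>R q)" by (rule is_disp_rec_scale[OF T v q])
  then have "is_disp_rec T (v + (-1) *\<^sub>R v) (r + (-1) *\<^sub>R q)"
    by (intro is_disp_rec_add[OF T v subspace_scale[OF subspace_raw_U v] r])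
  then have d: "is_disp_rec T 0 (r - q)" by simp
  define e where "e = r - q"
  have eP: "e \<in> ?P" using d by (simp add: e_def is_disp_rec_def)
  have G0: "G T 0 = 0" by (rule lin_on_0[OF lin_on_G[OF T] subspace_raw_U])
  have "(LINT x|lebesgue_on T. sym_grad e x \<bullet> sym_grad e x) = 0"
    using d eP by (auto simp: is_disp_rec_def e_def[symmetric] G0)
  from sym_grad_zero_on_elem(2)[OF T eP this] have rig: "rigid e" .
  define w where "w x = e x - e 0" for x
  note w = rigid_affine[OF rig, folded w_def]
  have ew: "e x = e 0 + matrix w *v x" for x using matrix_works[OF w(1)[folded linear_matrix_vector_mul_eq]] by (simp add: w_def)
  define A where "A = matrix w"
  have eA: "e = (\<lambda>x. e 0 + A *v x)" unfolding A_def by (rule ext) (rule ew)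
  have anti: "A $ j $ i = - A $ i $ j" for i j
    using w(2)[of "axis i 1" "axis j 1"] by (simp add: A_def matrix_def inner_axis)
  have "A $ j $ i = 0" for i j
  proof (cases "i = j")
    case False
    have "pdiff i e x $ j - pdiff j e x $ i = 2 * A $ j $ i" for x
      using anti[of i j] by (subst (1 2) eA) (simp add: affine_map(2))
    moreover have "(LINT x|lebesgue_on T. pdiff i e x $ j - pdiff j e x $ i) = face_skew T 0 i j"
      using d False unfolding is_disp_rec_def e_def by blast
    ultimately have "(LINT x|lebesgue_on T. 2 * A $ j $ i) = face_skew T 0 i j" by (simp only:)
    also have "\<dots> = 0" by (rule lin_on_0[OF lin_on_face_skew subspace_raw_U])
    finally show ?thesis using measure_elem_pos[OF T] by (simp add: measure_elem[OF T])
  qed (use anti[of i i] in simp)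
  then have "A = 0" by (simp add: vec_eq_iff)
  then have e0: "e = (\<lambda>x. e 0)" using eA by simp
  have "(LINT x|lebesgue_on T. e x) = 0" using d by (simp add: is_disp_rec_def e_def)
  then have "(LINT x|lebesgue_on T. e 0) = 0" using e0 by metis
  then have "e 0 = 0" using measure_elem_pos[OF T] by (simp add: measure_elem[OF T])
  then have "e = 0" using e0 by (simp add: fun_eq_iff)
  then show "r = q" by (simp add: e_def)
qed

abbreviation "R \<equiv> disp_rec k M"

lemma disp_rec: "T \<in> elems M \<Longrightarrow> v \<in> V \<Longrightarrow> is_disp_rec T v (R T v)"
  unfolding disp_rec_eq by (rule theI'[OF is_disp_rec_ex1])

lemma R_poly: "T \<in> elems M \<Longrightarrow> v \<in> V \<Longrightarrow> R T v \<in> poly_maps (k + 1)"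
  using disp_rec by (simp add: is_disp_rec_def)

lemma lin_on_R: "T \<in> elems M \<Longrightarrow> lin_on V (\<lambda>v. R T v)"
  unfolding disp_rec_eq
  by (rule lin_on_the) (use is_disp_rec_ex1 is_disp_rec_add is_disp_rec_scale subspace_raw_U in blast)+

end

section \<open>Rigidity\<close>

lemma l2_proj_poly:
  fixes R :: "('d::finite point \<Rightarrow> real) \<Rightarrow> 'd point \<Rightarrow> real"
  assumes "solid \<mu>" "tame (space \<mu>) f" "\<And>p x. x \<in> space \<mu> \<Longrightarrow> R p x = p x"
    "\<And>p q. p \<in> poly_upto k \<Longrightarrow> q \<in> poly_upto k \<Longrightarrow> (\<And>x. x \<in> space \<mu> \<Longrightarrow> p x = q x) \<Longrightarrow> R p = R q"
  shows "\<exists>p\<in>poly_upto k. l2_proj (R ` poly_upto k) \<mu> f = R p"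
    and "p \<in> poly_upto k \<Longrightarrow> (\<And>x. x \<in> space \<mu> \<Longrightarrow> f x = p x) \<Longrightarrow> l2_proj (R ` poly_upto k) \<mu> f = R p"
proof -
  show "\<exists>p\<in>poly_upto k. l2_proj (R ` poly_upto k) \<mu> f = R p"
    using l2_proj_works[OF assms] by blast
  assume p: "p \<in> poly_upto k" "\<And>x. x \<in> space \<mu> \<Longrightarrow> f x = p x"
  show "l2_proj (R ` poly_upto k) \<mu> f = R p"
    by (rule l2_proj_works(2)[OF assms p(1)]) (auto intro!: Bochner_Integration.integral_cong simp: p(2))
qed

context hho_disc begin

lemma restrict_poly_determined:
  "(\<And>x. x \<in> space (face_measure F) \<Longrightarrow> p x = q x) \<Longrightarrow> restrict p F = restrict q F"
  by (auto simp: restrict_def)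

lemma elem_poly_determined:
  assumes "T \<in> elems M" "p \<in> poly_upto k" "q \<in> poly_upto k" "\<And>x. x \<in> space (lebesgue_on T) \<Longrightarrow> p x = q x"
  shows "p = q"
  using poly_maps_eq_on_open[of p k q T] assms open_elem elem_nonempty by (simp add: poly_maps_real)

lemmas l2_face = l2_proj_poly[where \<mu> = "face_measure F" and R = "\<lambda>p. restrict p F" for F, folded face_poly_def]
lemmas l2_elem = l2_proj_poly[where \<mu> = "lebesgue_on T" and R = "\<lambda>p. p" for T, simplified image_ident]

lemma tame_R: "T \<in> elems M \<Longrightarrow> v \<in> V \<Longrightarrow> tame X (R T v)"
  by (rule tame_poly_maps[OF R_poly])

lemma tame_face_diff:
  assumes T: "T \<in> elems M" and F: "F \<in> faces_of M T" and v: "v \<in> V"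
  shows "tame F (\<lambda>y. (R T v y - snd v F y) $ i)"
  by (intro tame_vec_nth tame_diff tame_R[OF T v] tame_face[OF v faces_ofD(1)[OF F]])

lemma tame_elem_diff:
  assumes T: "T \<in> elems M" and v: "v \<in> V"
  shows "tame X (\<lambda>y. (R T v y - fst v T y) $ i)"
  by (intro tame_vec_nth tame_diff tame_R[OF T v] tame_elem[OF v T])

lemma tame_residual:
  assumes T: "T \<in> elems M" and F: "F \<in> faces_of M T" and v: "v \<in> V"
  shows "tame F (face_residual k M T F v)"
proof -
  have "tame F (\<lambda>x. l2_proj (face_poly k F) (face_measure F) (\<lambda>y. (R T v y - snd v F y) $ i) x)" for i
  proof -
    have "\<exists>p\<in>poly_upto k. l2_proj (face_poly k F) (face_measure F) (\<lambda>y. (R T v y - snd v F y) $ i) = restrict p F"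
    proof (rule l2_face(1)[OF solid_face[OF faces_ofD(1)[OF F]]])
      show "tame (space (face_measure F)) (\<lambda>y. (R T v y - snd v F y) $ i)"
        using tame_face_diff[OF T F v] by simp
    qed (auto simp: restrict_def)
    then obtain p where p: "p \<in> poly_upto k" "l2_proj (face_poly k F) (face_measure F) (\<lambda>y. (R T v y - snd v F y) $ i) = restrict p F"
      by blast
    have "tame F p" using p(1) tame_poly_maps[of p k] by (simp add: poly_maps_real)
    then show ?thesis unfolding p(2) by (subst tame_cong[of F _ p]) auto
  qed
  moreover have "tame F (\<lambda>x. l2_proj (poly_upto k) (lebesgue_on T) (\<lambda>y. (R T v y - fst v T y) $ i) x)" for i
  proof -
    obtain p where p: "p \<in> poly_upto k" "l2_proj (poly_upto k) (lebesgue_on T) (\<lambda>y. (R T v y - fst v T y) $ i) = p"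
      using l2_elem(1)[OF solid_elem[OF T] tame_elem_diff[OF T v] refl elem_poly_determined[OF T]] by blast
    show ?thesis using p tame_poly_maps[of p k] by (simp add: poly_maps_real)
  qed
  ultimately show ?thesis
    unfolding face_residual_def[abs_def] proj_face_def proj_elem_def by (intro tame_diff tame_vec_lambda)
qed

lemma lin_on_R_at: "T \<in> elems M \<Longrightarrow> lin_on V (\<lambda>v. R T v x)"
  using lin_on_R[of T] by (simp add: lin_on_def)

lemma lin_on_G_at: "T \<in> elems M \<Longrightarrow> lin_on V (\<lambda>v. G T v x)"
  using lin_on_G[of T] by (simp add: lin_on_def)

lemma lin_on_residual:
  assumes T: "T \<in> elems M" and F: "F \<in> faces_of M T" and x: "x \<in> F"
  shows "lin_on V (\<lambda>v. face_residual k M T F v x)"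
  unfolding face_residual_def proj_face_def proj_elem_def
proof (intro lin_on_minus lin_on_vec_lambda)
  fix i
  show "lin_on V (\<lambda>v. l2_proj (face_poly k F) (face_measure F) (\<lambda>y. (R T v y - snd v F y) $ i) x)"
    unfolding face_poly_def
  proof (rule l2_proj_linear[where R = "\<lambda>p. restrict p F"])
    show "solid (face_measure F)" by (rule solid_face[OF faces_ofD(1)[OF F]])
    show "tame (space (face_measure F)) (\<lambda>y. (R T v y - snd v F y) $ i)" if "v \<in> V" for v
      using tame_face_diff[OF T F that] by simp
  qed (use x in \<open>auto intro!: lin_intros lin_on_R_at T subspace_raw_U restrict_poly_determined\<close>)
  have "lin_on V (\<lambda>v. l2_proj ((\<lambda>p. p) ` poly_upto k) (lebesgue_on T) (\<lambda>y. (R T v y - fst v T y) $ i) x)"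
  proof (rule l2_proj_linear)
    show "solid (lebesgue_on T)" by (rule solid_elem[OF T])
    show "tame (space (lebesgue_on T)) (\<lambda>y. (R T v y - fst v T y) $ i)" if "v \<in> V" for v
      by (rule tame_elem_diff[OF T that])
    show "lin_on V (\<lambda>v. (R T v y - fst v T y) $ i)" for y
      by (intro lin_intros lin_on_R_at T)
    show "p = q" if "p \<in> poly_upto k" "q \<in> poly_upto k" "\<And>x. x \<in> space (lebesgue_on T) \<Longrightarrow> p x = q x" for p q
      using elem_poly_determined[OF T] that by blast
  qed (auto intro: subspace_raw_U)
  then show "lin_on V (\<lambda>v. l2_proj (poly_upto k) (lebesgue_on T) (\<lambda>y. (R T v y - fst v T y) $ i) x)"
    by simp
qed

text \<open>The reconstruction \<open>r\<close> has zero symmetric gradient, hence is rigid and of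
  degree at most \<open>1 \<le> k\<close>. Both projections in the residual then act on polynomials
  of degree \<open>k\<close> and leave them unchanged, so that \<open>r\<close> cancels and the
  residual is \<open>v\<^sub>T - v\<^sub>F\<close>. With \<open>v\<^sub>F = v\<^sub>T\<close> on the
  faces, the definition of the strain is the integration by parts formula for
  \<open>v\<^sub>T\<close>, and the strain is the symmetric gradient of
  \<open>v\<^sub>T\<close>.\<close>

lemma local_rigidity:
  assumes T: "T \<in> elems M" and v: "v \<in> V" and G0: "G T v = 0"
    and D0: "\<And>F x. F \<in> faces_of M T \<Longrightarrow> x \<in> F \<Longrightarrow> face_residual k M T F v x = 0"
  shows "rigid (fst v T)" "\<And>F x. F \<in> faces_of M T \<Longrightarrow> x \<in> F \<Longrightarrow> snd v F x = fst v T x"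
proof -
  interpret E: star_element T "ctr T" "rad T" "faces_of M T" \<A> by (rule elem[OF T])
  define r where "r = R T v"
  have dr: "is_disp_rec T v r" unfolding r_def by (rule disp_rec[OF T v])
  have rP: "r \<in> poly_maps (k + 1)" using dr by (simp add: is_disp_rec_def)
  have "(LINT x|lebesgue_on T. sym_grad r x \<bullet> sym_grad r x) = 0"
    using dr rP by (auto simp: is_disp_rec_def G0)
  then have "rigid r" by (rule sym_grad_zero_on_elem(2)[OF T rP])
  then have rk: "r \<in> poly_maps k" by (rule rigid_in_poly_maps[OF _ k1])
  have vk: "fst v T \<in> poly_maps k" by (rule raw_elem[OF v T])
  have dk: "(\<lambda>y. (r y - fst v T y) $ i) \<in> poly_upto k" for i
    using poly_component[OF subspace_diff[OF subspace_poly_maps rk vk], of i] by simp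
  have pe: "proj_elem k T (\<lambda>y. r y - fst v T y) x = r x - fst v T x" for x
  proof -
    have "l2_proj (poly_upto k) (lebesgue_on T) (\<lambda>y. (r y - fst v T y) $ i) = (\<lambda>y. (r y - fst v T y) $ i)" for i
      by (rule l2_elem(2)[OF solid_elem[OF T] _ refl elem_poly_determined[OF T] dk refl])
        (use tame_elem_diff[OF T v] in \<open>simp add: r_def\<close>)
    then show ?thesis by (simp add: proj_elem_def vec_eq_iff)
  qed
  show eq: "snd v F x = fst v T x" if F: "F \<in> faces_of M T" and x: "x \<in> F" for F x
  proof -
    have Ff: "F \<in> faces M" by (rule faces_ofD(1)[OF F])
    obtain p where p: "p \<in> poly_maps k" "\<forall>x\<in>F. snd v F x = p x" using raw_face[OF v Ff] by blast
    have dp: "(\<lambda>y. (r y - p y) $ i) \<in> poly_upto k" for i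
      using poly_component[OF subspace_diff[OF subspace_poly_maps rk p(1)], of i] by simp
    have "l2_proj (face_poly k F) (face_measure F) (\<lambda>y. (r y - snd v F y) $ i) = restrict (\<lambda>y. (r y - p y) $ i) F" for i
    proof (rule l2_face(2)[OF solid_face[OF Ff]])
      show "tame (space (face_measure F)) (\<lambda>y. (r y - snd v F y) $ i)"
        using tame_face_diff[OF T F v] by (simp add: r_def)
      show "(r x - snd v F x) $ i = (r x - p x) $ i" if "x \<in> space (face_measure F)" for x
        using p(2) that by simp
    qed (use dp in \<open>auto simp: restrict_def\<close>)
    then have "proj_face k F (\<lambda>y. r y - snd v F y) x = r x - snd v F x"
      using x p(2) by (simp add: proj_face_def vec_eq_iff)
    then have "face_residual k M T F v x = (r x - snd v F x) - (r x - fst v T x)"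
      using pe by (simp add: face_residual_def r_def)
    then show ?thesis using D0[OF F x] by simp
  qed
  have st: "sym_grad (fst v T) \<in> stpoly_upto k" by (rule sym_grad_poly[OF vk])
  have "(LINT x|lebesgue_on T. sym_grad (fst v T) x \<bullet> sym_grad (fst v T) x) = sym_grad_rhs T v (sym_grad (fst v T))"
    unfolding sym_grad_rhs_def E.integration_by_parts[OF vk st]
    by (intro arg_cong2[where f = "(+)"] refl sum.cong Bochner_Integration.integral_cong) (simp add: eq)
  also have "\<dots> = (LINT x|lebesgue_on T. G T v x \<bullet> sym_grad (fst v T) x)"
    by (rule sym_grad_rec(2)[OF T v st, symmetric])
  also have "\<dots> = 0" by (simp add: G0)
  finally show "rigid (fst v T)" by (rule sym_grad_zero_on_elem(2)[OF T vk])
qed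

text \<open>The discrete Korn argument: the element unknown vanishes where it vanishes on one face,
  so the set \<open>A\<close> of elements where it vanishes contains an element with a boundary face
  and is closed under passing through internal faces.\<close>

theorem global_rigidity:
  assumes v: "v \<in> V" and bd: "\<And>F x. F \<in> boundary_faces \<Omega> M \<Longrightarrow> x \<in> F \<Longrightarrow> snd v F x = 0"
    and G0: "\<And>T. T \<in> elems M \<Longrightarrow> G T v = 0"
    and D0: "\<And>T F x. T \<in> elems M \<Longrightarrow> F \<in> faces_of M T \<Longrightarrow> x \<in> F \<Longrightarrow> face_residual k M T F v x = 0"
  shows "T \<in> elems M \<Longrightarrow> fst v T = 0" "F \<in> faces M \<Longrightarrow> x \<in> F \<Longrightarrow> snd v F x = 0"
proof -
  have rig: "rigid (fst v T)" and eq: "\<And>F x. F \<in> faces_of M T \<Longrightarrow> x \<in> F \<Longrightarrow> snd v F x = fst v T x" if "T \<in> elems M" for T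
    using local_rigidity[OF that v G0[OF that] D0[OF that]] by blast+
  define A where "A = {T \<in> elems M. fst v T = 0}"
  have van: "T \<in> A" if T: "T \<in> elems M" and F: "F \<in> faces_of M T" and z: "\<And>x. x \<in> F \<Longrightarrow> snd v F x = 0" for T F
  proof -
    have "fst v T = 0"
      by (rule rigid_vanishing_on_face[OF rig[OF T] faceD(3)[OF faces_ofD(1)[OF F]]]) (use eq[OF T F] z in simp)
    then show ?thesis using T by (simp add: A_def)
  qed
  obtain T0 F0 where "T0 \<in> elems M" "F0 \<in> faces_of M T0" "F0 \<in> boundary_faces \<Omega> M" using boundary_face_exists by blast
  then have ne: "A \<noteq> {}" using van[of T0 F0] bd by blast
  have step: "T2 \<in> A" if T: "T1 \<in> A" "T2 \<in> elems M" "F \<in> faces_of M T1" "F \<in> faces_of M T2" for T1 T2 F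
  proof (rule van[OF T(2,4)])
    fix x assume "x \<in> F"
    then show "snd v F x = 0" using eq[of T1 F x] T(1,3) by (simp add: A_def)
  qed
  have all: "A = elems M"
  proof (rule ccontr)
    assume "A \<noteq> elems M"
    moreover have "A \<subseteq> elems M" by (auto simp: A_def)
    ultimately obtain F where F: "F \<in> internal_faces M"
      "side1 M F \<in> A \<and> side2 M F \<notin> A \<or> side1 M F \<notin> A \<and> side2 M F \<in> A"
      using elements_connected_through_faces ne by blast
    then show False using step sides(1-5)[OF F(1)] by blast
  qed
  show "fst v T = 0" if "T \<in> elems M" for T using that all by (auto simp: A_def)
  then show "snd v F x = 0" if "F \<in> faces M" "x \<in> F" for F x
    using face_has_elem[OF that(1)] eq that(2) by fastforce
qed

section \<open>The coupling form\<close>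

definition raw_P :: "'d broken set" where
  "raw_P = {q. \<forall>T\<in>elems M. q T \<in> poly_upto k}"

lemma subspace_raw_P: "subspace raw_P"
  using subspace_poly_upto[of k] by (auto simp: raw_P_def subspace_def)

lemma raw_P_elem: "q \<in> raw_P \<Longrightarrow> T \<in> elems M \<Longrightarrow> q T \<in> poly_maps k"
  by (simp add: raw_P_def poly_maps_real)

lemma tame_P: "q \<in> raw_P \<Longrightarrow> T \<in> elems M \<Longrightarrow> tame X (q T)"
  by (rule tame_poly_maps[OF raw_P_elem])

lemma tame_grad: "q \<in> raw_P \<Longrightarrow> T \<in> elems M \<Longrightarrow> tame X (grad (q T))"
  unfolding grad_def[abs_def] by (intro tame_vec_lambda tame_pdiff_poly[OF raw_P_elem])

lemma lin_on_P: "lin_on raw_P (\<lambda>q. q T x)" by (simp add: lin_on_def)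

lemma lin_on_grad: "T \<in> elems M \<Longrightarrow> lin_on raw_P (\<lambda>q. grad (q T) x)"
  unfolding grad_def
proof (intro lin_on_vec_lambda lin_onI)
  fix i p q assume T: "T \<in> elems M" and pq: "p \<in> raw_P" "q \<in> raw_P"
  show "pdiff i ((p + q) T) x = pdiff i (p T) x + pdiff i (q T) x"
    using pdiff_add[OF poly_maps_differentiable[OF raw_P_elem[OF pq(1) T]] poly_maps_differentiable[OF raw_P_elem[OF pq(2) T]]] by simp
next
  fix i c q assume T: "T \<in> elems M" and q: "q \<in> raw_P"
  show "pdiff i ((c *\<^sub>R q) T) x = c *\<^sub>R pdiff i (q T) x"
    using pdiff_scaleR[OF poly_maps_differentiable[OF raw_P_elem[OF q T]]] by simp
qed

lemma lin_on_b_h: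
  shows "q \<in> raw_P \<Longrightarrow> lin_on V (\<lambda>v. b_h M v q)" and "v \<in> V \<Longrightarrow> lin_on raw_P (b_h M v)"
proof -
  have t1: "tame (space (lebesgue_on T)) (\<lambda>x. fst v T x \<bullet> grad (q T) x)" if "q \<in> raw_P" "v \<in> V" "T \<in> elems M" for q v T
    by (intro tame_inner tame_elem tame_grad that)
  have t2: "tame (space (face_measure F)) (\<lambda>x. (snd v F x \<bullet> normal_out T F) * q T x)"
    if "q \<in> raw_P" "v \<in> V" "T \<in> elems M" "F \<in> faces_of M T" for q v T F
    unfolding space_face_measure by (intro tame_mult tame_inner tame_face tame_P tame_const that faces_ofD(1)[OF that(4)])
  show "lin_on V (\<lambda>v. b_h M v q)" if q: "q \<in> raw_P"
    unfolding b_h_def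
    by (intro lin_on_sums lin_on_minus lin_on_integral_tame solid_elem solid_face subspace_raw_U t1 t2 q faces_ofD(1) lin_intros)
  show "lin_on raw_P (b_h M v)" if v: "v \<in> V"
    unfolding b_h_def
    by (intro lin_on_sums lin_on_minus lin_on_integral_tame solid_elem solid_face subspace_raw_P t1 t2 v faces_ofD(1) lin_intros lin_on_P lin_on_grad)
qed

lemma grad_const: "grad (\<lambda>x. c) x = 0"
proof -
  have "pdiff i (\<lambda>x. c) x = 0" for i by (rule pdiff_eq[OF has_derivative_const])
  then show ?thesis by (simp add: grad_def vec_eq_iff)
qed

text \<open>The two contributions of an internal face cancel, because its unknown is single-valued
  and the normals are opposite; those of boundary faces vanish.\<close>

lemma b_h_const:
  assumes v: "v \<in> V" and bd: "\<And>F x. F \<in> boundary_faces \<Omega> M \<Longrightarrow> x \<in> F \<Longrightarrow> snd v F x = 0"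
    and q: "\<And>T. T \<in> elems M \<Longrightarrow> q T = (\<lambda>x. c)"
  shows "b_h M v q = 0"
proof -
  define I where "I T F = (LINT x|face_measure F. (snd v F x \<bullet> normal_out T F) * c)" for T F
  have "b_h M v q = (\<Sum>T\<in>elems M. - (\<Sum>F\<in>faces_of M T. I T F))"
    unfolding b_h_def by (rule sum.cong[OF refl]) (simp add: q grad_const I_def)
  also have "\<dots> = - (\<Sum>T\<in>elems M. \<Sum>F\<in>{F \<in> faces M. F \<in> faces_of M T}. I T F)"
  proof -
    have "{F \<in> faces M. F \<in> faces_of M T} = faces_of M T" for T by (auto simp: faces_of_def)
    then show ?thesis by (simp add: sum_negf)
  qed
  also have "(\<Sum>T\<in>elems M. \<Sum>F\<in>{F \<in> faces M. F \<in> faces_of M T}. I T F) = (\<Sum>F\<in>faces M. \<Sum>T\<in>{T \<in> elems M. F \<in> faces_of M T}. I T F)"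
    by (rule sum.swap_restrict) simp_all
  also have "\<dots> = 0"
  proof (rule sum.neutral, rule ballI)
    fix F assume F: "F \<in> faces M"
    show "(\<Sum>T\<in>{T \<in> elems M. F \<in> faces_of M T}. I T F) = 0"
    proof (cases "F \<in> boundary_faces \<Omega> M")
      case True
      have "I T F = (LINT x|face_measure F. 0)" for T
        unfolding I_def by (rule Bochner_Integration.integral_cong) (simp_all add: bd[OF True])
      then show ?thesis by simp
    next
      case False
      then have i: "F \<in> internal_faces M" using F faces_split by blast
      have "I (side2 M F) F = - I (side1 M F) F"
        unfolding I_def sides(6)[OF i] by (subst Bochner_Integration.integral_minus[symmetric]) simp
      then show ?thesis unfolding sides(7)[OF i] using sides(3)[OF i] by simp
    qed
  qed
  finally show ?thesis by simp
qed

end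

section \<open>Integrals of broken polynomials\<close>

context hho_disc begin

lemma glue_on_elem:
  fixes v :: "'d point set \<Rightarrow> 'd point \<Rightarrow> 'b::euclidean_space"
  assumes T: "T \<in> elems M" and x: "x \<in> T" shows "glue M v x = v T x"
proof -
  have "glue M v x = (\<Sum>S\<in>elems M. if S = T then v T x else 0)"
    unfolding glue_def using disjoint_elems[OF T] x by (intro sum.cong) (auto simp: indicator_def)
  then show ?thesis using T by simp
qed

lemma AE_in_elem: "AE x in lebesgue. x \<in> \<Omega> \<longrightarrow> x \<in> \<Union>(elems M)"
proof -
  have "\<Omega> - \<Union>(elems M) \<in> null_sets lebesgue" using negligible_skeleton by (simp add: negligible_iff_null_sets)
  from AE_not_in[OF this] show ?thesis by eventually_elim auto
qed

lemma lmeas_elem: "T \<in> elems M \<Longrightarrow> T \<in> sets lebesgue" using open_elem by simp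
lemma lmeas_\<Omega>: "\<Omega> \<in> sets lebesgue" using open_\<Omega> by simp

lemma AE_\<Omega>_imp_elem: "AE x in lebesgue_on \<Omega>. P x \<Longrightarrow> T \<in> elems M \<Longrightarrow> AE x in lebesgue_on T. P x"
  using elem_subset_\<Omega>[of T] lmeas_elem[of T] lmeas_\<Omega>
  by (auto simp: AE_restrict_space_iff elim: eventually_mono)

lemma AE_elem_ex:
  assumes "AE x in lebesgue_on T. P x" "T \<in> elems M"
  shows "\<exists>x\<in>T. P x"
proof (rule ccontr)
  assume "\<not> (\<exists>x\<in>T. P x)"
  then have "AE x in lebesgue. x \<notin> T"
    using assms lmeas_elem[of T] by (auto simp: AE_restrict_space_iff elim: eventually_mono)
  then have "T \<in> null_sets lebesgue" using lmeas_elem[OF assms(2)] by (subst AE_iff_null_sets) auto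
  then show False
    using open_not_negligible[OF open_elem elem_nonempty] assms(2) by (simp add: negligible_iff_null_sets)
qed

lemma integral_over_elems:
  fixes h :: "'d point \<Rightarrow> real"
  assumes i: "\<And>T. T \<in> elems M \<Longrightarrow> integrable (lebesgue_on T) h"
  shows "(LINT x|lebesgue_on \<Omega>. h x) = (\<Sum>T\<in>elems M. LINT x|lebesgue_on T. h x)"
proof -
  have iT: "integrable lebesgue (\<lambda>x. indicat_real T x *\<^sub>R h x)" if "T \<in> elems M" for T
    using i[OF that] lmeas_elem[OF that] by (subst (asm) integrable_restrict_space) auto
  have isum: "integrable lebesgue (\<lambda>x. \<Sum>T\<in>elems M. indicat_real T x *\<^sub>R h x)"
    by (intro Bochner_Integration.integrable_sum iT)
  have ae: "AE x in lebesgue. (\<Sum>T\<in>elems M. indicat_real T x *\<^sub>R h x) = indicat_real \<Omega> x *\<^sub>R h x"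
    using AE_in_elem
  proof eventually_elim
    case (elim x)
    show ?case
    proof (cases "x \<in> \<Omega>")
      case True
      then obtain T where "T \<in> elems M" "x \<in> T" using elim by blast
      from glue_on_elem[OF this, of "\<lambda>_. h"] show ?thesis using True by (simp add: glue_def)
    next
      case False
      then have "x \<notin> T" if "T \<in> elems M" for T using elem_subset_\<Omega>[OF that] by blast
      then show ?thesis using False by simp
    qed
  qed
  have m: "(\<lambda>x. indicat_real \<Omega> x *\<^sub>R h x) \<in> borel_measurable lebesgue"
    by (rule borel_measurable_AE[OF borel_measurable_integrable[OF isum] ae])
  have "(LINT x|lebesgue_on \<Omega>. h x) = (LINT x|lebesgue. indicat_real \<Omega> x *\<^sub>R h x)"
    by (rule integral_restrict_space) (use lmeas_\<Omega> in simp)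
  also have "\<dots> = (LINT x|lebesgue. (\<Sum>T\<in>elems M. indicat_real T x *\<^sub>R h x))"
    using ae by (intro integral_cong_AE m borel_measurable_integrable[OF isum]) (auto elim: eventually_mono)
  also have "\<dots> = (\<Sum>T\<in>elems M. LINT x|lebesgue. indicat_real T x *\<^sub>R h x)"
    by (rule Bochner_Integration.integral_sum) (rule iT)
  also have "\<dots> = (\<Sum>T\<in>elems M. LINT x|lebesgue_on T. h x)"
    by (rule sum.cong[OF refl], rule integral_restrict_space[symmetric]) (use lmeas_elem in simp)
  finally show ?thesis .
qed

lemma integral_over_elems':
  fixes h :: "'d point \<Rightarrow> real"
  assumes h: "\<And>T x. T \<in> elems M \<Longrightarrow> x \<in> T \<Longrightarrow> h x = g T x" and i: "\<And>T. T \<in> elems M \<Longrightarrow> integrable (lebesgue_on T) (g T)"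
  shows "(LINT x|lebesgue_on \<Omega>. h x) = (\<Sum>T\<in>elems M. LINT x|lebesgue_on T. g T x)"
proof -
  have "integrable (lebesgue_on T) h" if "T \<in> elems M" for T
    using i[OF that] by (subst Bochner_Integration.integrable_cong[of _ _ h "g T"]) (auto simp: h[OF that])
  then have "(LINT x|lebesgue_on \<Omega>. h x) = (\<Sum>T\<in>elems M. LINT x|lebesgue_on T. h x)" by (rule integral_over_elems)
  also have "\<dots> = (\<Sum>T\<in>elems M. LINT x|lebesgue_on T. g T x)"
    by (intro sum.cong refl Bochner_Integration.integral_cong) (simp_all add: h)
  finally show ?thesis .
qed

lemma glue_measurable_bounded:
  fixes v :: "'d point set \<Rightarrow> 'd point \<Rightarrow> 'b::euclidean_space"
  assumes v: "\<And>T. T \<in> elems M \<Longrightarrow> v T \<in> poly_maps m"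
  shows "glue M v \<in> borel_measurable (lebesgue_on \<Omega>)" "\<exists>C. \<forall>x. norm (glue M v x) \<le> C"
proof -
  have "v T \<in> borel_measurable borel" if "T \<in> elems M" for T
    by (rule borel_measurable_continuous_onI[OF poly_maps_continuous[OF v[OF that]]])
  then have "glue M v \<in> borel_measurable borel" unfolding glue_def[abs_def] using open_elem
    by (intro borel_measurable_sum borel_measurable_scaleR borel_measurable_indicator) auto
  then have "glue M v \<in> borel_measurable lborel" by simp
  then have "glue M v \<in> borel_measurable lebesgue" by (rule measurable_completion)
  then show "glue M v \<in> borel_measurable (lebesgue_on \<Omega>)" by (rule measurable_restrict_space1)
  have "\<forall>T\<in>elems M. \<exists>C. \<forall>x\<in>T. norm (v T x) \<le> C"
    using tame_bounded[OF bounded_elem tame_poly_maps[OF v]] by blast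
  then obtain C where C: "\<And>T x. T \<in> elems M \<Longrightarrow> x \<in> T \<Longrightarrow> norm (v T x) \<le> C T" by metis
  have "norm (glue M v x) \<le> (\<Sum>T\<in>elems M. \<bar>C T\<bar>)" for x
    unfolding glue_def using C by (intro sum_norm_le) (auto simp: indicator_def intro: order_trans[OF C abs_ge_self])
  then show "\<exists>C. \<forall>x. norm (glue M v x) \<le> C" by blast
qed

text \<open>A broken polynomial is bounded on the domain, so its product with any integrable load is
  integrable.\<close>

lemma integrable_inner_glue:
  fixes v :: "'d point set \<Rightarrow> 'd point \<Rightarrow> 'b::euclidean_space"
  assumes f: "integrable (lebesgue_on \<Omega>) f" and v: "\<And>T. T \<in> elems M \<Longrightarrow> v T \<in> poly_maps m"
  shows "integrable (lebesgue_on \<Omega>) (\<lambda>x. f x \<bullet> glue M v x)"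
proof -
  obtain C where C: "\<And>x. norm (glue M v x) \<le> C" using glue_measurable_bounded(2)[of v m, OF v] by blast
  have "integrable (lebesgue_on \<Omega>) (\<lambda>x. norm (f x) * C)" using f by simp
  then show ?thesis
  proof (rule Bochner_Integration.integrable_bound)
    show "(\<lambda>x. f x \<bullet> glue M v x) \<in> borel_measurable (lebesgue_on \<Omega>)"
      using borel_measurable_integrable[OF f] glue_measurable_bounded(1)[of v m, OF v] by (intro borel_measurable_inner)
    have "norm (f x \<bullet> glue M v x) \<le> norm (norm (f x) * C)" for x
    proof -
      have "norm (f x \<bullet> glue M v x) \<le> norm (f x) * norm (glue M v x)" using Cauchy_Schwarz_ineq2 by simp
      also have "\<dots> \<le> norm (f x) * C" by (intro mult_left_mono C) simp
      finally show ?thesis by simp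
    qed
    then show "AE x in lebesgue_on \<Omega>. norm (f x \<bullet> glue M v x) \<le> norm (norm (f x) * C)" by simp
  qed
qed

lemma glue_add: "glue M (u + v) x = glue M u x + glue M v x"
  by (simp add: glue_def scaleR_add_right sum.distrib)

lemma glue_scale: "glue M (c *\<^sub>R u) x = c *\<^sub>R glue M u x"
  unfolding glue_def scaleR_sum_right by (intro sum.cong refl) (simp add: mult.commute)

lemma lin_on_load:
  assumes "integrable (lebesgue_on \<Omega>) f"
  shows "lin_on V (\<lambda>v. l2_prod \<Omega> f (glue M (fst v)))"
  unfolding l2_prod_def
proof (rule lin_on_integral[OF _ _ subspace_raw_U])
  fix v assume "v \<in> V"
  then show "integrable (lebesgue_on \<Omega>) (\<lambda>x. f x \<bullet> glue M (fst v) x)"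
    by (intro integrable_inner_glue[OF assms, of "fst v" k] raw_elem)
qed (simp add: lin_on_def glue_add glue_scale inner_add_right)

lemma lin_on_source:
  assumes "integrable (lebesgue_on \<Omega>) f"
  shows "lin_on raw_P (\<lambda>q. l2_prod \<Omega> f (glue M q))"
  unfolding l2_prod_def
proof (rule lin_on_integral[OF _ _ subspace_raw_P])
  fix q assume "q \<in> raw_P"
  then show "integrable (lebesgue_on \<Omega>) (\<lambda>x. f x \<bullet> glue M q x)"
    by (intro integrable_inner_glue[OF assms, of q k] raw_P_elem)
qed (simp add: lin_on_def glue_add glue_scale distrib_left)

lemma integrable_glue:
  assumes "q \<in> raw_P"
  shows "integrable (lebesgue_on \<Omega>) (glue M q)"
proof -
  have "integrable (lebesgue_on \<Omega>) (\<lambda>x. 1::real)"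
    by (rule tame_integrable[OF solid_lebesgue_on[OF open_\<Omega> bounded_\<Omega>] tame_const])
  from integrable_inner_glue[OF this, of q k] show ?thesis using raw_P_elem[OF assms] by simp
qed

lemma lin_on_mean: "lin_on raw_P (\<lambda>q. LINT x|lebesgue_on \<Omega>. glue M q x)"
  by (rule lin_on_integral[OF integrable_glue _ subspace_raw_P]) (simp_all add: lin_on_def glue_add glue_scale)

lemma l2_glue:
  assumes "p \<in> raw_P" "q \<in> raw_P"
  shows "l2_prod \<Omega> (glue M p) (glue M q) = (\<Sum>T\<in>elems M. LINT x|lebesgue_on T. p T x \<bullet> q T x)"
  unfolding l2_prod_def
  by (rule integral_over_elems') (simp add: glue_on_elem, intro tame_integrable[OF solid_elem] tame_inner tame_P assms)

lemma bilin_on_mass: "bilin_on raw_P (\<lambda>p q. l2_prod \<Omega> (glue M p) (glue M q))"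
proof (rule bilin_onI)
  fix p assume p: "p \<in> raw_P"
  show l: "lin_on raw_P (\<lambda>q. l2_prod \<Omega> (glue M p) (glue M q))" by (rule lin_on_source[OF integrable_glue[OF p]])
  have "l2_prod \<Omega> (glue M q) (glue M p) = l2_prod \<Omega> (glue M p) (glue M q)" for q
    unfolding l2_prod_def by (rule Bochner_Integration.integral_cong) (simp_all add: mult.commute)
  then show "lin_on raw_P (\<lambda>q. l2_prod \<Omega> (glue M q) (glue M p))" using l by simp
qed

lemma mass_definite:
  assumes q: "q \<in> raw_P"
  shows "0 \<le> l2_prod \<Omega> (glue M q) (glue M q)"
    "l2_prod \<Omega> (glue M q) (glue M q) = 0 \<Longrightarrow> T \<in> elems M \<Longrightarrow> q T = 0"
proof -
  show "0 \<le> l2_prod \<Omega> (glue M q) (glue M q)" by (simp add: l2_prod_def)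
  assume z: "l2_prod \<Omega> (glue M q) (glue M q) = 0" and T: "T \<in> elems M"
  have zT: "(LINT x|lebesgue_on T. q T x \<bullet> q T x) = 0"
    using z T unfolding l2_glue[OF q q] by (subst (asm) sum_nonneg_eq_0_iff) auto
  have "q T x = 0" if "x \<in> T" for x
    using solid_norm_zero[OF solid_elem[OF T] tame_P[OF q T] zT] that by simp
  then show "q T = 0" by (rule poly_maps_zero[OF raw_P_elem[OF q T] open_elem[OF T] elem_nonempty[OF T]])
qed

end

section \<open>The Darcy operator\<close>

text \<open>The permeability is constant on elements because each of them lies in one subdomain of
  the partition.\<close>

locale hho_darcy = hho_disc \<Omega> M ctr rad \<A> k
  for \<Omega> :: "'d::finite point set" and M :: "'d mesh" and ctr rad \<A> k +
  fixes \<kappa> :: "'d point \<Rightarrow> 'd tensor" and \<kappa>lo \<zeta> :: real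
  assumes \<kappa>_const: "\<And>T. T \<in> elems M \<Longrightarrow> \<exists>K. \<forall>x\<in>T. \<kappa> x = K"
    and \<kappa>lo: "0 < \<kappa>lo" and \<kappa>_pos: "AE x in lebesgue_on \<Omega>. \<forall>\<xi>. \<kappa>lo * (norm \<xi>)\<^sup>2 \<le> (\<kappa> x *v \<xi>) \<bullet> \<xi>"
begin

abbreviation "K \<equiv> const_value \<kappa>"

lemma \<kappa>_K: "T \<in> elems M \<Longrightarrow> x \<in> T \<Longrightarrow> \<kappa> x = K T"
proof -
  assume T: "T \<in> elems M" and x: "x \<in> T"
  obtain L where L: "\<forall>x\<in>T. \<kappa> x = L" using \<kappa>_const[OF T] by blast
  have "K T = L" unfolding const_value_def by (rule the_equality) (use L x in auto)
  then show "\<kappa> x = K T" using L x by simp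
qed

lemma K_pos: "T \<in> elems M \<Longrightarrow> \<kappa>lo * (norm \<xi>)\<^sup>2 \<le> (K T *v \<xi>) \<bullet> \<xi>"
  using AE_elem_ex[OF AE_\<Omega>_imp_elem[OF \<kappa>_pos]] \<kappa>_K by fastforce

lemma normal_perm_pos: "T \<in> elems M \<Longrightarrow> F \<in> faces_of M T \<Longrightarrow> 0 < normal_perm \<kappa> T F"
  using K_pos[of T "normal_out T F"] norm_normal_out[of T F] \<kappa>lo by (simp add: normal_perm_def)

lemma face_perm_pos: "F \<in> internal_faces M \<Longrightarrow> 0 < face_perm \<kappa> M F"
proof -
  assume F: "F \<in> internal_faces M"
  have "0 < normal_perm \<kappa> (side1 M F) F" "0 < normal_perm \<kappa> (side2 M F) F"
    by (rule normal_perm_pos[OF sides(1)[OF F] sides(4)[OF F]], rule normal_perm_pos[OF sides(2)[OF F] sides(5)[OF F]])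
  then show ?thesis by (simp add: face_perm_def Let_def)
qed

lemma tame_flux: "q \<in> raw_P \<Longrightarrow> T \<in> elems M \<Longrightarrow> tame X (darcy_flux \<kappa> q T)"
  unfolding darcy_flux_def[abs_def] by (intro tame_matrix_vector tame_grad)

lemma lin_on_flux: "T \<in> elems M \<Longrightarrow> lin_on raw_P (\<lambda>q. darcy_flux \<kappa> q T x)"
  unfolding darcy_flux_def by (intro lin_on_mult_vec lin_on_grad)

lemma tame_jump: "q \<in> raw_P \<Longrightarrow> F \<in> internal_faces M \<Longrightarrow> tame X (jump M F q)"
  unfolding jump_def[abs_def] by (intro tame_diff tame_P sides)

lemma lin_on_jump: "lin_on raw_P (\<lambda>q. jump M F q x)"
  unfolding jump_def by (intro lin_on_minus lin_on_P)

lemma tame_waverage: "q \<in> raw_P \<Longrightarrow> F \<in> internal_faces M \<Longrightarrow> tame X (waverage \<kappa> M F (darcy_flux \<kappa> q))"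
  unfolding waverage_def[abs_def] Let_def by (intro tame_add tame_scaleR tame_const tame_flux sides)

lemma lin_on_waverage: "F \<in> internal_faces M \<Longrightarrow> lin_on raw_P (\<lambda>q. waverage \<kappa> M F (darcy_flux \<kappa> q) x)"
  unfolding waverage_def Let_def by (intro lin_intros lin_on_flux sides)

lemma diffusion_eq:
  assumes "r \<in> raw_P" "q \<in> raw_P"
  shows "(LINT x|lebesgue_on \<Omega>. (\<kappa> x *v broken_grad M r x) \<bullet> broken_grad M q x) =
    (\<Sum>T\<in>elems M. LINT x|lebesgue_on T. (K T *v grad (r T) x) \<bullet> grad (q T) x)"
proof (rule integral_over_elems')
  show "(\<kappa> x *v broken_grad M r x) \<bullet> broken_grad M q x = (K T *v grad (r T) x) \<bullet> grad (q T) x" if "T \<in> elems M" "x \<in> T" for T x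
    using that by (simp add: broken_grad_def glue_on_elem \<kappa>_K)
  show "integrable (lebesgue_on T) (\<lambda>x. (K T *v grad (r T) x) \<bullet> grad (q T) x)" if "T \<in> elems M" for T
    by (intro tame_integrable[OF solid_elem[OF that]] tame_inner tame_matrix_vector tame_grad assms that)
qed

lemma internal_face: "F \<in> internal_faces M \<Longrightarrow> F \<in> faces M" by (simp add: internal_faces_def)

lemma bilin_on_c_h: "bilin_on raw_P (c_h \<kappa> \<zeta> \<Omega> M)"
proof -
  define d where "d r q = (\<Sum>T\<in>elems M. LINT x|lebesgue_on T. (K T *v grad (r T) x) \<bullet> grad (q T) x)" for r q
  define j where "j r q = (\<Sum>F\<in>internal_faces M. \<zeta> * face_perm \<kappa> M F / diameter F *
         (LINT x|face_measure F. jump M F r x * jump M F q x))" for r q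
  define c where "c r q = (\<Sum>F\<in>internal_faces M. LINT x|face_measure F.
         (jump M F r x *\<^sub>R waverage \<kappa> M F (darcy_flux \<kappa> q) x
          + jump M F q x *\<^sub>R waverage \<kappa> M F (darcy_flux \<kappa> r) x) \<bullet> normal_out (side1 M F) F)" for r q
  have eq: "c_h \<kappa> \<zeta> \<Omega> M r q = d r q + j r q - c r q" if "r \<in> raw_P" "q \<in> raw_P" for r q
    unfolding c_h_def diffusion_eq[OF that] d_def j_def c_def by simp
  have ld: "lin_on raw_P (d p)" if p: "p \<in> raw_P" for p
    unfolding d_def
    by (intro lin_on_sums lin_on_integral_tame solid_elem subspace_raw_P tame_inner tame_matrix_vector tame_grad p lin_on_grad lin_intros)
  have ld': "lin_on raw_P (\<lambda>q. d q p)" if p: "p \<in> raw_P" for p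
    unfolding d_def
    by (intro lin_on_sums lin_on_integral_tame solid_elem subspace_raw_P tame_inner tame_matrix_vector tame_grad p lin_on_grad lin_intros)
  have lj: "lin_on raw_P (j p)" if p: "p \<in> raw_P" for p
    unfolding j_def
    by (intro lin_on_sums lin_on_comps(6) lin_on_integral_tame solid_face internal_face subspace_raw_P tame_mult tame_jump p lin_on_jump)
  have jsym: "j r q = j q r" for r q
    unfolding j_def by (simp only: mult.commute[of "jump M _ r _"])
  have lj': "lin_on raw_P (\<lambda>q. j q p)" if "p \<in> raw_P" for p
    unfolding jsym[of _ p] by (rule lj[OF that])
  have lc: "lin_on raw_P (c p)" if p: "p \<in> raw_P" for p
    unfolding c_def
    by (intro lin_on_sums lin_on_integral_tame solid_face internal_face subspace_raw_P tame_inner tame_add tame_scaleR tame_const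
       tame_jump tame_waverage p lin_intros lin_on_jump lin_on_waverage)
  have csym: "c r q = c q r" for r q
    unfolding c_def by (intro sum.cong refl Bochner_Integration.integral_cong) (simp add: add.commute)
  have lc': "lin_on raw_P (\<lambda>q. c q p)" if "p \<in> raw_P" for p
    unfolding csym[of _ p] by (rule lc[OF that])
  have cong: "lin_on raw_P f" if "lin_on raw_P g" "\<And>q. q \<in> raw_P \<Longrightarrow> f q = g q" for f g :: "'d broken \<Rightarrow> real"
    using that subspace_add[OF subspace_raw_P] subspace_scale[OF subspace_raw_P] by (simp add: lin_on_def)
  show ?thesis
  proof (rule bilin_onI)
    fix p assume p: "p \<in> raw_P"
    show "lin_on raw_P (c_h \<kappa> \<zeta> \<Omega> M p)"
      by (rule cong[of "\<lambda>q. d p q + j p q - c p q"]) (intro lin_on_plus lin_on_minus ld lj lc p, simp add: eq p)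
    show "lin_on raw_P (\<lambda>q. c_h \<kappa> \<zeta> \<Omega> M q p)"
      by (rule cong[of "\<lambda>q. d q p + j q p - c q p"]) (intro lin_on_plus lin_on_minus ld' lj' lc' p, simp add: eq p)
  qed
qed

lemma c_h_const:
  assumes p: "p \<in> raw_P" and q: "\<And>T. T \<in> elems M \<Longrightarrow> q T = (\<lambda>x. c)"
  shows "c_h \<kappa> \<zeta> \<Omega> M p q = 0"
proof -
  have q': "q \<in> raw_P" by (auto simp: raw_P_def q const_in_poly_upto)
  have jq: "jump M F q x = 0" if "F \<in> internal_faces M" for F x
    using sides(1,2)[OF that] by (simp add: jump_def q)
  have "darcy_flux \<kappa> q T x = 0" if "T \<in> elems M" for T x
    using that by (simp add: darcy_flux_def q grad_const)
  then have wq: "waverage \<kappa> M F (darcy_flux \<kappa> q) x = 0" if "F \<in> internal_faces M" for F x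
    using sides(1,2)[OF that] by (simp add: waverage_def Let_def)
  show ?thesis unfolding c_h_def diffusion_eq[OF p q'] by (simp add: q grad_const jq wq)
qed

lemma kappa_norm_eq:
  assumes "q \<in> raw_P"
  shows "kappa_norm_sq \<kappa> M q = (\<Sum>T\<in>elems M. LINT x|lebesgue_on T. (K T *v grad (q T) x) \<bullet> grad (q T) x)
     + (\<Sum>F\<in>internal_faces M. face_perm \<kappa> M F / diameter F * (LINT x|face_measure F. (jump M F q x)\<^sup>2))"
  unfolding kappa_norm_sq_def
  by (intro arg_cong2[where f = "(+)"] sum.cong refl Bochner_Integration.integral_cong) (simp add: \<kappa>_K)

text \<open>Vanishing gradients make the pressure constant on each element, and vanishing jumps make
  the constants agree across internal faces, through which all elements are connected.\<close>

lemma kappa_norm_definite: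
  assumes q: "q \<in> raw_P"
  shows "0 \<le> kappa_norm_sq \<kappa> M q"
    and "kappa_norm_sq \<kappa> M q = 0 \<Longrightarrow> \<exists>c. \<forall>T\<in>elems M. q T = (\<lambda>x. c)"
proof -
  have n1: "0 \<le> (K T *v grad (q T) x) \<bullet> grad (q T) x" if "T \<in> elems M" for T x
    using K_pos[OF that, of "grad (q T) x"] \<kappa>lo by (smt (verit) mult_nonneg_nonneg zero_le_power2)
  have s1: "0 \<le> (LINT x|lebesgue_on T. (K T *v grad (q T) x) \<bullet> grad (q T) x)" if "T \<in> elems M" for T
    by (rule integral_nonneg_AE) (simp add: n1[OF that])
  have pf: "0 < face_perm \<kappa> M F / diameter F" if "F \<in> internal_faces M" for F
    using face_perm_pos[OF that] face_diameter_pos[OF internal_face[OF that]] by simp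
  have s2: "0 \<le> face_perm \<kappa> M F / diameter F * (LINT x|face_measure F. (jump M F q x)\<^sup>2)" if "F \<in> internal_faces M" for F
    using pf[OF that] by (intro mult_nonneg_nonneg) auto
  have S: "0 \<le> (\<Sum>T\<in>elems M. LINT x|lebesgue_on T. (K T *v grad (q T) x) \<bullet> grad (q T) x)"
    "0 \<le> (\<Sum>F\<in>internal_faces M. face_perm \<kappa> M F / diameter F * (LINT x|face_measure F. (jump M F q x)\<^sup>2))"
    by (rule sum_nonneg, rule s1, assumption) (rule sum_nonneg, rule s2, assumption)
  show "0 \<le> kappa_norm_sq \<kappa> M q" unfolding kappa_norm_eq[OF q] using S by (intro add_nonneg_nonneg)
  assume "kappa_norm_sq \<kappa> M q = 0"
  then have z: "(\<Sum>T\<in>elems M. LINT x|lebesgue_on T. (K T *v grad (q T) x) \<bullet> grad (q T) x) = 0"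
     "(\<Sum>F\<in>internal_faces M. face_perm \<kappa> M F / diameter F * (LINT x|face_measure F. (jump M F q x)\<^sup>2)) = 0"
    using S unfolding kappa_norm_eq[OF q] by linarith+
  have ex: "\<exists>c. q T = (\<lambda>x. c)" if T: "T \<in> elems M" for T
  proof -
    have zT: "(LINT x|lebesgue_on T. (K T *v grad (q T) x) \<bullet> grad (q T) x) = 0"
      using z(1) T s1 by (subst (asm) sum_nonneg_eq_0_iff) auto
    have "(K T *v grad (q T) x) \<bullet> grad (q T) x = 0" if "x \<in> T" for x
    proof (rule solid_integral_zero[OF solid_elem[OF T] _ n1[OF T] zT])
      show "tame (space (lebesgue_on T)) (\<lambda>x. (K T *v grad (q T) x) \<bullet> grad (q T) x)"
        by (intro tame_inner tame_matrix_vector tame_grad q T)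
    qed (use that in simp)
    then have "grad (q T) x = 0" if "x \<in> T" for x
      using K_pos[OF T, of "grad (q T) x"] \<kappa>lo that by (simp add: mult_le_0_iff)
    then have "pdiff i (q T) x = 0" if "x \<in> T" for i x using that by (simp add: grad_def vec_eq_iff)
    then have p0: "pdiff i (q T) = 0" for i
      by (intro poly_maps_zero[OF pdiff_in_poly_maps[OF raw_P_elem[OF q T]] open_elem[OF T] elem_nonempty[OF T]])
    have "(q T has_derivative (\<lambda>h. 0)) (at x)" for x
      using grad_has_derivative[OF poly_maps_differentiable[OF raw_P_elem[OF q T]], of x] by (simp add: grad_def p0 zero_vec_def[symmetric])
    then have "\<exists>c. \<forall>x. q T x = c" using has_derivative_zero_unique_strong_convex has_derivative_zero_constant[of UNIV "q T"] by auto
    then show ?thesis by auto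
  qed
  define val where "val T = (THE c. q T = (\<lambda>x. c))" for T
  have val: "q T = (\<lambda>x. val T)" if T: "T \<in> elems M" for T
  proof -
    obtain c where c: "q T = (\<lambda>x. c)" using ex[OF T] by blast
    have "val T = c" unfolding val_def by (rule the_equality) (use c in \<open>auto simp: fun_eq_iff\<close>)
    then show ?thesis using c by simp
  qed
  have same: "val (side1 M F) = val (side2 M F)" if F: "F \<in> internal_faces M" for F
  proof -
    have "face_perm \<kappa> M F / diameter F * (LINT x|face_measure F. (jump M F q x)\<^sup>2) = 0"
      using z(2) F s2 by (subst (asm) sum_nonneg_eq_0_iff) auto
    then have J0: "(LINT x|face_measure F. (jump M F q x)\<^sup>2) = 0"
      using pf[OF F] by (metis less_irrefl mult_eq_0_iff)
    obtain x where x: "x \<in> F" using faceD(1)[OF internal_face[OF F]] by blast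
    have "(jump M F q x)\<^sup>2 = 0"
    proof (rule solid_integral_zero[OF solid_face[OF internal_face[OF F]] _ _ J0])
      show "tame (space (face_measure F)) (\<lambda>x. (jump M F q x)\<^sup>2)" by (intro tame_power tame_jump q F)
    qed (use x in simp_all)
    then show ?thesis using val[OF sides(1)[OF F]] val[OF sides(2)[OF F]] by (simp add: jump_def)
  qed
  obtain T0 where T0: "T0 \<in> elems M" using elems_nonempty by blast
  define A where "A = {T \<in> elems M. val T = val T0}"
  have "A = elems M"
  proof (rule ccontr)
    assume "A \<noteq> elems M"
    moreover have "A \<subseteq> elems M" "A \<noteq> {}" using T0 by (auto simp: A_def)
    ultimately obtain F where F: "F \<in> internal_faces M"
      "side1 M F \<in> A \<and> side2 M F \<notin> A \<or> side1 M F \<notin> A \<and> side2 M F \<in> A"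
      using elements_connected_through_faces by blast
    then show False using same[OF F(1)] sides(1,2)[OF F(1)] by (auto simp: A_def)
  qed
  then show "\<exists>c. \<forall>T\<in>elems M. q T = (\<lambda>x. c)" using val by (intro exI[of _ "val T0"]) (auto simp: A_def)
qed

end

section \<open>The stress\<close>

lemma measurable_lebesgue_on_AE:
  fixes f g :: "'a::euclidean_space \<Rightarrow> 'b::euclidean_space"
  assumes T: "T \<in> sets lebesgue" and g: "g \<in> borel_measurable (lebesgue_on T)" and ae: "AE x in lebesgue_on T. g x = f x"
  shows "f \<in> borel_measurable (lebesgue_on T)"
proof -
  have "(\<lambda>x. indicat_real T x *\<^sub>R g x) \<in> borel_measurable lebesgue"
    using g T borel_measurable_restrict_space_iff[of T lebesgue g] by simp
  moreover have "AE x in lebesgue. indicat_real T x *\<^sub>R g x = indicat_real T x *\<^sub>R f x"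
  proof -
    have "AE x in lebesgue. x \<in> T \<longrightarrow> g x = f x" using ae T by (simp add: AE_restrict_space_iff)
    then show ?thesis by eventually_elim (auto simp: indicator_def)
  qed
  ultimately have "(\<lambda>x. indicat_real T x *\<^sub>R f x) \<in> borel_measurable lebesgue" by (rule borel_measurable_AE)
  then show ?thesis using T borel_measurable_restrict_space_iff[of T lebesgue f] by simp
qed

text \<open>The continuous projection onto symmetric tensors brings approximations of a symmetric
  tensor field back into the set on which the stress is controlled.\<close>

definition sym_part :: "'d::finite tensor \<Rightarrow> 'd tensor" where
  "sym_part A = (1/2) *\<^sub>R (A + transpose A)"

lemma sym_part_sym: "sym_part A \<in> sym_tensors"
  by (simp add: sym_part_def sym_tensors_def transpose_def vec_eq_iff add.commute)

lemma sym_part_id: "A \<in> sym_tensors \<Longrightarrow> sym_part A = A"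
  by (simp add: sym_part_def sym_tensors_def scaleR_2[symmetric])

lemma continuous_sym_part: "continuous_on UNIV (sym_part :: 'd::finite tensor \<Rightarrow> 'd tensor)"
proof -
  have eq: "(sym_part :: 'd tensor \<Rightarrow> 'd tensor) = (\<lambda>A. \<chi> i j. (1/2) * (A $ i $ j + A $ j $ i))"
    by (simp add: fun_eq_iff sym_part_def transpose_def vec_eq_iff)
  show ?thesis unfolding eq by (intro continuous_on_vec_lambda continuous_intros)
qed

text \<open>The argument is approximated by simple functions, for which measurability is that of
  countably many functions \<open>\<sigma>(\<cdot>, \<tau>)\<close>; continuity in the second
  variable gives the limit almost everywhere.\<close>

lemma caratheodory_measurable:
  fixes \<sigma> :: "'d::finite point \<Rightarrow> 'd tensor \<Rightarrow> 'd tensor"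
  assumes T: "T \<in> sets lebesgue"
    and cont: "AE x in lebesgue_on T. continuous_on sym_tensors (\<sigma> x)"
    and meas: "\<And>\<tau>. \<tau> \<in> sym_tensors \<Longrightarrow> (\<lambda>x. \<sigma> x \<tau>) \<in> borel_measurable (lebesgue_on T)"
    and A: "A \<in> borel_measurable (lebesgue_on T)" "\<And>x. A x \<in> sym_tensors"
  shows "(\<lambda>x. \<sigma> x (A x)) \<in> borel_measurable (lebesgue_on T)"
proof -
  let ?\<mu> = "lebesgue_on T"
  obtain s where s: "\<And>i. simple_function ?\<mu> (s i)" "\<And>x. x \<in> space ?\<mu> \<Longrightarrow> (\<lambda>i. s i x) \<longlonglongrightarrow> A x"
    using borel_measurable_implies_sequence_metric[OF A(1)] by blast
  obtain N where N: "N \<in> null_sets ?\<mu>" "{x \<in> space ?\<mu>. \<not> continuous_on sym_tensors (\<sigma> x)} \<subseteq> N"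
    using cont unfolding eventually_ae_filter by blast
  have Ns: "N \<in> sets ?\<mu>" using N(1) by auto
  define f where "f i x = \<sigma> x (sym_part (s i x))" for i :: nat and x
  have fm: "f i \<in> borel_measurable ?\<mu>" for i
    unfolding f_def
  proof (rule measurable_compose_countable'[where I = "s i ` space ?\<mu>" and f = "\<lambda>y x. \<sigma> x (sym_part y)" and g = "s i"])
    show "(\<lambda>x. \<sigma> x (sym_part y)) \<in> borel_measurable ?\<mu>" if "y \<in> s i ` space ?\<mu>" for y
      by (rule meas[OF sym_part_sym])
    show "countable (s i ` space ?\<mu>)" using s(1)[of i] by (simp add: simple_function_def countable_finite)
    have "s i \<in> measurable ?\<mu> (count_space UNIV)" by (rule measurable_simple_function[OF s(1)])
    then show "s i \<in> measurable ?\<mu> (count_space (s i ` space ?\<mu>))"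
      by (auto simp: measurable_def)
  qed
  have hm: "(\<lambda>x. indicat_real (space ?\<mu> - N) x *\<^sub>R f i x) \<in> borel_measurable ?\<mu>" for i
    using Ns by (intro borel_measurable_scaleR borel_measurable_indicator fm) auto
  have "(\<lambda>x. indicat_real (space ?\<mu> - N) x *\<^sub>R \<sigma> x (A x)) \<in> borel_measurable ?\<mu>"
  proof (rule borel_measurable_LIMSEQ_metric[OF hm])
    fix x assume x: "x \<in> space ?\<mu>"
    show "(\<lambda>i. indicat_real (space ?\<mu> - N) x *\<^sub>R f i x) \<longlonglongrightarrow> indicat_real (space ?\<mu> - N) x *\<^sub>R \<sigma> x (A x)"
    proof (cases "x \<in> N")
      case False
      then have c: "continuous_on sym_tensors (\<sigma> x)" using N(2) x by blast
      have "(\<lambda>i. sym_part (s i x)) \<longlonglongrightarrow> sym_part (A x)"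
        by (rule continuous_on_tendsto_compose[OF continuous_sym_part s(2)[OF x]]) auto
      then have "(\<lambda>i. sym_part (s i x)) \<longlonglongrightarrow> A x" using sym_part_id[OF A(2)] by simp
      then have "(\<lambda>i. f i x) \<longlonglongrightarrow> \<sigma> x (A x)" unfolding f_def
        by (rule continuous_on_tendsto_compose[OF c]) (auto simp: A(2) sym_part_sym)
      then show ?thesis by (intro tendsto_intros)
    qed simp
  qed
  moreover have "AE x in ?\<mu>. indicat_real (space ?\<mu> - N) x *\<^sub>R \<sigma> x (A x) = \<sigma> x (A x)"
    using AE_not_in[OF N(1)] by (rule AE_mp) (auto intro!: AE_I2)
  ultimately show ?thesis by (rule measurable_lebesgue_on_AE[OF T])
qed

locale hho_stress = hho_disc \<Omega> M ctr rad \<A> k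
  for \<Omega> :: "'d::finite point set" and M :: "'d mesh" and ctr rad \<A> k +
  fixes \<sigma> :: "'d point \<Rightarrow> 'd tensor \<Rightarrow> 'd tensor" and Cgr Ccv \<gamma> :: real
  assumes \<sigma>_cont: "AE x in lebesgue_on \<Omega>. continuous_on sym_tensors (\<sigma> x)"
    and \<sigma>_meas: "\<forall>\<tau>\<in>sym_tensors. (\<lambda>x. \<sigma> x \<tau>) \<in> borel_measurable (lebesgue_on \<Omega>)"
    and Cgr: "Cgr > 0" and Ccv: "Ccv > 0" and \<gamma>: "\<gamma> > 0"
    and growth: "AE x in lebesgue_on \<Omega>. \<forall>\<tau>\<in>sym_tensors. norm (\<sigma> x \<tau>) \<le> Cgr * norm \<tau>"
    and coercivity: "AE x in lebesgue_on \<Omega>. \<forall>\<tau>\<in>sym_tensors. \<sigma> x \<tau> \<bullet> \<tau> \<ge> Ccv\<^sup>2 * (norm \<tau>)\<^sup>2"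
    and monotonicity: "AE x in lebesgue_on \<Omega>. \<forall>\<tau>\<in>sym_tensors. \<forall>\<eta>\<in>sym_tensors.
        \<eta> \<noteq> \<tau> \<longrightarrow> (\<sigma> x \<tau> - \<sigma> x \<eta>) \<bullet> (\<tau> - \<eta>) > 0"
begin

lemma G_sym: "T \<in> elems M \<Longrightarrow> v \<in> V \<Longrightarrow> G T v x \<in> sym_tensors"
  using sym_grad_rec(1)[of T v] by (simp add: stpoly_upto_eq)

lemma G_bounded:
  assumes "T \<in> elems M" "v \<in> V" obtains C where "\<And>x. x \<in> T \<Longrightarrow> norm (G T v x) \<le> C" "0 \<le> C"
proof -
  obtain C where C: "\<And>x. x \<in> T \<Longrightarrow> norm (G T v x) \<le> C"
    using tame_bounded[OF bounded_elem[OF assms(1)] tame_G[OF assms]] by blast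
  then have "norm (G T v x) \<le> \<bar>C\<bar>" if "x \<in> T" for x using C[OF that] by simp
  then show ?thesis using that[of "\<bar>C\<bar>"] by simp
qed

lemma stress_measurable:
  assumes T: "T \<in> elems M" and v: "v \<in> V"
  shows "(\<lambda>x. \<sigma> x (G T v x)) \<in> borel_measurable (lebesgue_on T)"
proof (rule caratheodory_measurable[OF lmeas_elem[OF T] AE_\<Omega>_imp_elem[OF \<sigma>_cont T]])
  show "(\<lambda>x. \<sigma> x \<tau>) \<in> borel_measurable (lebesgue_on T)" if "\<tau> \<in> sym_tensors" for \<tau>
    using \<sigma>_meas that elem_subset_\<Omega>[OF T] measurable_restrict_mono by blast
  show "G T v \<in> borel_measurable (lebesgue_on T)" by (rule tame_measurable[OF solid_elem[OF T] tame_G[OF T v]])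
qed (rule G_sym[OF T v])

lemma stress_integrable:
  assumes T: "T \<in> elems M" and w: "w \<in> V" and v: "v \<in> V"
  shows "integrable (lebesgue_on T) (\<lambda>x. \<sigma> x (G T w x) \<bullet> G T v x)"
proof -
  obtain C where C: "\<And>x. x \<in> T \<Longrightarrow> norm (G T w x) \<le> C" "0 \<le> C" using G_bounded[OF T w] by blast
  obtain D where D: "\<And>x. x \<in> T \<Longrightarrow> norm (G T v x) \<le> D" "0 \<le> D" using G_bounded[OF T v] by blast
  show ?thesis
  proof (rule finite_measure.integrable_const_bound[where B = "Cgr * C * D"])
    show "finite_measure (lebesgue_on T)" using solid_elem[OF T] by (simp add: solid_def)
    have "AE x in lebesgue_on T. x \<in> T" by (rule AE_I2) simp
    then show "AE x in lebesgue_on T. norm (\<sigma> x (G T w x) \<bullet> G T v x) \<le> Cgr * C * D"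
      using AE_\<Omega>_imp_elem[OF growth T]
    proof eventually_elim
      case (elim x)
      have "norm (\<sigma> x (G T w x) \<bullet> G T v x) \<le> norm (\<sigma> x (G T w x)) * norm (G T v x)" using Cauchy_Schwarz_ineq2 by simp
      also have "\<dots> \<le> (Cgr * C) * D"
      proof (rule mult_mono)
        have "norm (\<sigma> x (G T w x)) \<le> Cgr * norm (G T w x)" using elim(2) G_sym[OF T w] by blast
        also have "\<dots> \<le> Cgr * C" using C(1)[OF elim(1)] Cgr by (intro mult_left_mono) auto
        finally show "norm (\<sigma> x (G T w x)) \<le> Cgr * C" .
      qed (use D elim C Cgr in auto)
      finally show ?case .
    qed
    show "(\<lambda>x. \<sigma> x (G T w x) \<bullet> G T v x) \<in> borel_measurable (lebesgue_on T)"
      by (intro borel_measurable_inner stress_measurable T w tame_measurable[OF solid_elem[OF T]] tame_G v)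
  qed
qed

definition stress_form :: "'d hho \<Rightarrow> 'd hho \<Rightarrow> real" where
  "stress_form w v = (\<Sum>T\<in>elems M. LINT x|lebesgue_on T. \<sigma> x (G T w x) \<bullet> G T v x)"

definition strain_form :: "'d hho \<Rightarrow> 'd hho \<Rightarrow> real" where
  "strain_form w v = (\<Sum>T\<in>elems M. LINT x|lebesgue_on T. G T w x \<bullet> G T v x)"

definition stab_form :: "'d hho \<Rightarrow> 'd hho \<Rightarrow> real" where
  "stab_form w v = (\<Sum>T\<in>elems M. \<Sum>F\<in>faces_of M T. \<gamma> / diameter F *
         (LINT x|face_measure F. face_residual k M T F w x \<bullet> face_residual k M T F v x))"

lemma a_h_eq: "a_h k \<sigma> \<gamma> M w v = stress_form w v + stab_form w v"
  by (simp add: a_h_def stress_form_def stab_form_def sum.distrib)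

lemma lin_on_stress: "w \<in> V \<Longrightarrow> lin_on V (stress_form w)"
  unfolding stress_form_def
  by (intro lin_on_sums lin_on_integral stress_integrable subspace_raw_U lin_intros lin_on_G_at)

lemma bilin_on_strain: "bilin_on V strain_form"
proof (rule bilin_onI)
  fix p assume p: "p \<in> V"
  show l: "lin_on V (strain_form p)"
    unfolding strain_form_def
    by (intro lin_on_sums lin_on_integral_tame solid_elem subspace_raw_U tame_inner tame_G p lin_intros lin_on_G_at)
  have "strain_form q p = strain_form p q" for q by (simp add: strain_form_def inner_commute)
  then show "lin_on V (\<lambda>q. strain_form q p)" using l by simp
qed

lemma bilin_on_stab: "bilin_on V stab_form"
proof (rule bilin_onI)
  fix p assume p: "p \<in> V"
  show l: "lin_on V (stab_form p)"
    unfolding stab_form_def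
  proof (intro lin_on_sums lin_on_comps(6))
    fix T F assume T: "T \<in> elems M" and F: "F \<in> faces_of M T"
    show "lin_on V (\<lambda>v. LINT x|face_measure F. face_residual k M T F p x \<bullet> face_residual k M T F v x)"
    proof (rule lin_on_integral_tame[OF solid_face[OF faces_ofD(1)[OF F]] subspace_raw_U])
      show "tame (space (face_measure F)) (\<lambda>x. face_residual k M T F p x \<bullet> face_residual k M T F v x)" if "v \<in> V" for v
        unfolding space_face_measure by (intro tame_inner tame_residual T F p that)
      show "lin_on V (\<lambda>v. face_residual k M T F p x \<bullet> face_residual k M T F v x)" if "x \<in> space (face_measure F)" for x
        using that by (intro lin_intros lin_on_residual T F) simp
    qed
  qed
  have "stab_form q p = stab_form p q" for q by (simp add: stab_form_def inner_commute)
  then show "lin_on V (\<lambda>q. stab_form q p)" using l by simp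
qed

lemma stab_weight_pos: "T \<in> elems M \<Longrightarrow> F \<in> faces_of M T \<Longrightarrow> 0 < \<gamma> / diameter F"
  using \<gamma> face_diameter_pos[OF faces_ofD(1)] by simp

lemma strain_nonneg: "0 \<le> strain_form v v"
  unfolding strain_form_def by (intro sum_nonneg integral_nonneg_AE) simp

lemma stab_nonneg: "0 \<le> stab_form v v"
  unfolding stab_form_def
proof (intro sum_nonneg mult_nonneg_nonneg)
  show "0 \<le> \<gamma> / diameter F" if "T \<in> elems M" "F \<in> faces_of M T" for T F
    using stab_weight_pos[OF that] by simp
qed (auto intro!: integral_nonneg_AE)

lemma G_zero_of_AE:
  assumes T: "T \<in> elems M" and v: "v \<in> V" and ae: "AE x in lebesgue_on T. G T v x = 0"
  shows "G T v = 0"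
proof (rule poly_maps_zero[OF stpoly_poly[OF sym_grad_rec(1)[OF T v]] open_elem[OF T] elem_nonempty[OF T]])
  fix x assume "x \<in> T"
  then show "G T v x = 0" using solid_AE_zero[OF solid_elem[OF T] tame_G[OF T v] ae] by simp
qed

lemma strain_zero:
  assumes v: "v \<in> V" and z: "strain_form v v = 0" and T: "T \<in> elems M"
  shows "G T v = 0"
proof (rule G_zero_of_AE[OF T v])
  have "(LINT x|lebesgue_on T. G T v x \<bullet> G T v x) = 0"
    using z T unfolding strain_form_def by (subst (asm) sum_nonneg_eq_0_iff) (auto intro!: integral_nonneg_AE)
  from solid_norm_zero[OF solid_elem[OF T] tame_G[OF T v] this]
  show "AE x in lebesgue_on T. G T v x = 0" by (intro AE_I2)
qed

lemma stab_zero: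
  assumes v: "v \<in> V" and z: "stab_form v v = 0" and T: "T \<in> elems M" and F: "F \<in> faces_of M T" and x: "x \<in> F"
  shows "face_residual k M T F v x = 0"
proof -
  let ?I = "\<lambda>T F. \<gamma> / diameter F * (LINT x|face_measure F. face_residual k M T F v x \<bullet> face_residual k M T F v x)"
  have nn: "0 \<le> ?I T F" if "T \<in> elems M" "F \<in> faces_of M T" for T F
    using stab_weight_pos[OF that] by (intro mult_nonneg_nonneg) (auto intro!: integral_nonneg_AE)
  have "(\<Sum>F\<in>faces_of M T. ?I T F) = 0"
    using z T nn unfolding stab_form_def by (subst (asm) sum_nonneg_eq_0_iff) (auto intro!: sum_nonneg)
  then have "?I T F = 0" using nn[OF T] F by (subst (asm) sum_nonneg_eq_0_iff) auto
  then have "(LINT x|face_measure F. face_residual k M T F v x \<bullet> face_residual k M T F v x) = 0"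
    using stab_weight_pos[OF T F] by (metis less_irrefl mult_eq_0_iff)
  moreover have "tame (space (face_measure F)) (face_residual k M T F v)"
    unfolding space_face_measure by (rule tame_residual[OF T F v])
  ultimately show ?thesis
    using solid_norm_zero[OF solid_face[OF faces_ofD(1)[OF F]]] x by simp
qed

lemma stress_coercive:
  assumes v: "v \<in> V"
  shows "Ccv\<^sup>2 * strain_form v v \<le> stress_form v v"
  unfolding strain_form_def stress_form_def sum_distrib_left
proof (rule sum_mono)
  fix T assume T: "T \<in> elems M"
  have "Ccv\<^sup>2 * (LINT x|lebesgue_on T. G T v x \<bullet> G T v x) = (LINT x|lebesgue_on T. Ccv\<^sup>2 * (G T v x \<bullet> G T v x))" by simp
  also have "\<dots> \<le> (LINT x|lebesgue_on T. \<sigma> x (G T v x) \<bullet> G T v x)"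
  proof (rule integral_mono_AE)
    show "integrable (lebesgue_on T) (\<lambda>x. Ccv\<^sup>2 * (G T v x \<bullet> G T v x))"
      by (intro tame_integrable[OF solid_elem[OF T]] tame_mult tame_const tame_inner tame_G T v)
    show "AE x in lebesgue_on T. Ccv\<^sup>2 * (G T v x \<bullet> G T v x) \<le> \<sigma> x (G T v x) \<bullet> G T v x"
      using AE_\<Omega>_imp_elem[OF coercivity T] by eventually_elim (use G_sym[OF T v] in \<open>auto simp: dot_square_norm\<close>)
  qed (rule stress_integrable[OF T v v])
  finally show "Ccv\<^sup>2 * (LINT x|lebesgue_on T. G T v x \<bullet> G T v x) \<le> (LINT x|lebesgue_on T. \<sigma> x (G T v x) \<bullet> G T v x)" .
qed

text \<open>Strict monotonicity is only pointwise, so equality of the integrals forces the strains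
  to agree almost everywhere; they are polynomials, hence they agree.\<close>

lemma stress_monotone:
  assumes w: "w \<in> V" and u: "u \<in> V"
  shows "stress_form u (w - u) \<le> stress_form w (w - u)"
    and "stress_form u (w - u) = stress_form w (w - u) \<Longrightarrow> T \<in> elems M \<Longrightarrow> G T (w - u) = 0"
proof -
  have d: "w - u \<in> V" by (rule subspace_diff[OF subspace_raw_U w u])
  let ?h = "\<lambda>T x. (\<sigma> x (G T w x) - \<sigma> x (G T u x)) \<bullet> G T (w - u) x"
  have Gd: "G T (w - u) x = G T w x - G T u x" if "T \<in> elems M" for T x
    by (rule lin_on_diff[OF lin_on_G_at[OF that] subspace_raw_U w u])
  have ih: "integrable (lebesgue_on T) (?h T)" if "T \<in> elems M" for T
    using stress_integrable[OF that w d] stress_integrable[OF that u d] by (simp add: inner_diff_left)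
  have nn: "AE x in lebesgue_on T. 0 \<le> ?h T x" if T: "T \<in> elems M" for T
    using AE_\<Omega>_imp_elem[OF monotonicity T]
  proof eventually_elim
    case (elim x)
    show ?case
    proof (cases "G T w x = G T u x")
      case False
      then show ?thesis using elim G_sym[OF T w, of x] G_sym[OF T u, of x] by (simp add: Gd[OF T] less_imp_le)
    qed (simp add: Gd[OF T])
  qed
  have diff: "stress_form w (w - u) - stress_form u (w - u) = (\<Sum>T\<in>elems M. LINT x|lebesgue_on T. ?h T x)"
    unfolding stress_form_def sum_subtractf[symmetric]
    by (rule sum.cong[OF refl]) (simp add: inner_diff_left stress_integrable w u d)
  have nnI: "0 \<le> (LINT x|lebesgue_on T. ?h T x)" if "T \<in> elems M" for T
    by (rule integral_nonneg_AE[OF nn[OF that]])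
  have "0 \<le> (\<Sum>T\<in>elems M. LINT x|lebesgue_on T. ?h T x)" by (rule sum_nonneg) (rule nnI)
  then show "stress_form u (w - u) \<le> stress_form w (w - u)" using diff by simp
  assume eq: "stress_form u (w - u) = stress_form w (w - u)" and T: "T \<in> elems M"
  have "(LINT x|lebesgue_on T. ?h T x) = 0"
    using eq diff T nnI sum_nonneg_eq_0_iff[OF finite_elems, of "\<lambda>T. LINT x|lebesgue_on T. ?h T x"] by auto
  then have "AE x in lebesgue_on T. ?h T x = 0"
    using integral_nonneg_eq_0_iff_AE[OF ih[OF T] nn[OF T]] by simp
  then have "AE x in lebesgue_on T. G T (w - u) x = 0"
    using AE_\<Omega>_imp_elem[OF monotonicity T]
  proof eventually_elim
    case (elim x)
    show ?case
    proof (rule ccontr)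
      assume "G T (w - u) x \<noteq> 0"
      then have "G T u x \<noteq> G T w x" by (simp add: Gd[OF T])
      then have "0 < ?h T x" using elim(2) G_sym[OF T w, of x] G_sym[OF T u, of x] by (simp add: Gd[OF T])
      then show False using elim(1) by simp
    qed
  qed
  then show "G T (w - u) = 0" by (rule G_zero_of_AE[OF T d])
qed

text \<open>Strains depend linearly on the coefficients, so they converge pointwise and stay
  bounded. Dominated convergence applies with the growth condition.\<close>

lemma stress_continuous:
  fixes b :: "nat \<Rightarrow> 'd hho" and c :: "nat \<Rightarrow> nat \<Rightarrow> real"
  assumes b: "\<And>i. i < m \<Longrightarrow> b i \<in> V" and v: "v \<in> V" and c: "\<And>i. i < m \<Longrightarrow> (\<lambda>n. c n i) \<longlonglongrightarrow> c' i"
  shows "(\<lambda>n. stress_form (\<Sum>i<m. c n i *\<^sub>R b i) v) \<longlonglongrightarrow> stress_form (\<Sum>i<m. c' i *\<^sub>R b i) v"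
  unfolding stress_form_def
proof (rule tendsto_sum)
  fix T assume T: "T \<in> elems M"
  have wV: "(\<Sum>i<m. e i *\<^sub>R b i) \<in> V" for e :: "nat \<Rightarrow> real"
    using b by (intro subspace_sum[OF subspace_raw_U] subspace_scale[OF subspace_raw_U]) auto
  have GS: "G T (\<Sum>i<m. e i *\<^sub>R b i) x = (\<Sum>i<m. e i *\<^sub>R G T (b i) x)" for e :: "nat \<Rightarrow> real" and x
    using lin_on_sum[OF lin_on_G_at[OF T] subspace_raw_U, of "{..<m}" b e] b by auto
  have "\<forall>i\<in>{..<m}. \<exists>C. \<forall>x\<in>T. norm (G T (b i) x) \<le> C"
    using tame_bounded[OF bounded_elem[OF T] tame_G[OF T b]] by blast
  then obtain C where C: "\<And>i x. i < m \<Longrightarrow> x \<in> T \<Longrightarrow> norm (G T (b i) x) \<le> C i" by (metis lessThan_iff)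
  have "\<forall>i\<in>{..<m}. \<exists>D. \<forall>n. norm (c n i) \<le> D"
    using convergent_imp_bounded[OF c] unfolding bounded_iff by blast
  then obtain D where D: "\<And>i n. i < m \<Longrightarrow> norm (c n i) \<le> D i" by (metis lessThan_iff)
  obtain E where E: "\<And>x. x \<in> T \<Longrightarrow> norm (G T v x) \<le> E" "0 \<le> E" using G_bounded[OF T v] by blast
  define B where "B = Cgr * (\<Sum>i<m. D i * C i) * E"
  show "(\<lambda>n. LINT x|lebesgue_on T. \<sigma> x (G T (\<Sum>i<m. c n i *\<^sub>R b i) x) \<bullet> G T v x) \<longlonglongrightarrow>
    (LINT x|lebesgue_on T. \<sigma> x (G T (\<Sum>i<m. c' i *\<^sub>R b i) x) \<bullet> G T v x)"
  proof (rule integral_dominated_convergence[where w = "\<lambda>x. B"])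
    show "(\<lambda>x. \<sigma> x (G T (\<Sum>i<m. c' i *\<^sub>R b i) x) \<bullet> G T v x) \<in> borel_measurable (lebesgue_on T)"
      by (rule borel_measurable_integrable[OF stress_integrable[OF T wV v]])
    show "(\<lambda>x. \<sigma> x (G T (\<Sum>i<m. c n i *\<^sub>R b i) x) \<bullet> G T v x) \<in> borel_measurable (lebesgue_on T)" for n
      by (rule borel_measurable_integrable[OF stress_integrable[OF T wV v]])
    show "integrable (lebesgue_on T) (\<lambda>x. B)" by (rule tame_integrable[OF solid_elem[OF T] tame_const])
    show "AE x in lebesgue_on T. (\<lambda>n. \<sigma> x (G T (\<Sum>i<m. c n i *\<^sub>R b i) x) \<bullet> G T v x) \<longlonglongrightarrow>
       \<sigma> x (G T (\<Sum>i<m. c' i *\<^sub>R b i) x) \<bullet> G T v x"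
      using AE_\<Omega>_imp_elem[OF \<sigma>_cont T]
    proof eventually_elim
      case (elim x)
      have "(\<lambda>n. G T (\<Sum>i<m. c n i *\<^sub>R b i) x) \<longlonglongrightarrow> G T (\<Sum>i<m. c' i *\<^sub>R b i) x"
        unfolding GS by (intro tendsto_sum tendsto_scaleR tendsto_const c) simp
      then have "(\<lambda>n. \<sigma> x (G T (\<Sum>i<m. c n i *\<^sub>R b i) x)) \<longlonglongrightarrow> \<sigma> x (G T (\<Sum>i<m. c' i *\<^sub>R b i) x)"
        by (rule continuous_on_tendsto_compose[OF elim]) (simp_all add: G_sym[OF T wV])
      then show ?case by (intro tendsto_intros)
    qed
    fix n
    have "AE x in lebesgue_on T. x \<in> T" by (rule AE_I2) simp
    then show "AE x in lebesgue_on T. norm (\<sigma> x (G T (\<Sum>i<m. c n i *\<^sub>R b i) x) \<bullet> G T v x) \<le> B"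
      using AE_\<Omega>_imp_elem[OF growth T]
    proof eventually_elim
      case (elim x)
      let ?A = "G T (\<Sum>i<m. c n i *\<^sub>R b i) x"
      have "norm ?A \<le> (\<Sum>i<m. D i * C i)"
        unfolding GS
      proof (rule sum_norm_le)
        fix i assume "i \<in> {..<m}"
        then have i: "i < m" by simp
        have "norm (c n i) * norm (G T (b i) x) \<le> D i * C i"
          using D[OF i, of n] C[OF i elim(1)] by (intro mult_mono) (auto intro: order_trans[OF norm_ge_zero])
        then show "norm (c n i *\<^sub>R G T (b i) x) \<le> D i * C i" by simp
      qed
      moreover have "norm (\<sigma> x ?A) \<le> Cgr * norm ?A" using elim(2) G_sym[OF T wV] by blast
      ultimately have "norm (\<sigma> x ?A) \<le> Cgr * (\<Sum>i<m. D i * C i)" using Cgr by (meson less_imp_le mult_left_mono order_trans)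
      then have "norm (\<sigma> x ?A) * norm (G T v x) \<le> B" unfolding B_def
        using E(1)[OF elim(1)] by (intro mult_mono) (auto intro: order_trans[OF norm_ge_zero])
      then show ?case using Cauchy_Schwarz_ineq2[of "\<sigma> x ?A" "G T v x"] by simp
    qed
  qed
qed

end

section \<open>Time averages\<close>

text \<open>A square-integrable function on a bounded set is integrable, so Fubini allows to
  exchange the average in time with the integral over \<open>X\<close>. Restricting \<open>f\<close>
  to the time interval of the step, by an indicator, keeps the product structure.\<close>

lemma time_mean_integrable:
  fixes f :: "real \<Rightarrow> 'd::finite point \<Rightarrow> 'b::euclidean_space"
  assumes f: "f \<in> L2_time tF X" and X: "X \<in> lmeasurable" and n: "n \<in> {1..N}" and tF: "tF > 0"
  defines "\<tau> \<equiv> tF / real N"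
  shows "integrable (lebesgue_on X) (time_mean \<tau> f n)"
    and "(AE t in lebesgue_on {0<..<tF}. (LINT x|lebesgue_on X. f t x) = 0) \<Longrightarrow> (LINT x|lebesgue_on X. time_mean \<tau> f n x) = 0"
proof -
  let ?J = "{0<..<tF}"
  let ?\<mu> = "lebesgue_on ?J" and ?\<nu> = "lebesgue_on X"
  have N: "0 < N" using n by auto
  have \<tau>: "\<tau> > 0" using tF N by (simp add: \<tau>_def)
  interpret m1: finite_measure ?\<mu> by (rule finite_measure_lebesgue_on) simp
  interpret m2: finite_measure ?\<nu> by (rule finite_measure_lebesgue_on[OF X])
  interpret P: pair_sigma_finite ?\<mu> ?\<nu> by unfold_locales
  interpret Q: pair_sigma_finite ?\<nu> ?\<mu> by unfold_locales
  interpret PF: finite_measure "?\<mu> \<Otimes>\<^sub>M ?\<nu>" by (rule finite_measure_pair_measure) unfold_locales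
  define I where "I = {(real n - 1) * \<tau><..<real n * \<tau>}"
  have IJ: "I \<subseteq> ?J"
  proof -
    have "real n * \<tau> \<le> real N * \<tau>" using n \<tau> by (intro mult_right_mono) auto
    also have "real N * \<tau> = tF" using N by (simp add: \<tau>_def)
    finally have "real n * \<tau> \<le> tF" .
    moreover have "0 \<le> (real n - 1) * \<tau>" using n \<tau> by simp
    ultimately show ?thesis by (auto simp: I_def)
  qed
  define F where "F z = indicat_real I (fst z) *\<^sub>R f (fst z) (snd z)" for z
  have fm: "(\<lambda>z. f (fst z) (snd z)) \<in> borel_measurable (?\<mu> \<Otimes>\<^sub>M ?\<nu>)"
    and f2: "integrable (?\<mu> \<Otimes>\<^sub>M ?\<nu>) (\<lambda>z. (norm (f (fst z) (snd z)))\<^sup>2)"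
    using f unfolding L2_time_def by (simp_all add: case_prod_beta')
  have Im: "I \<in> sets ?\<mu>" using IJ by (auto simp: I_def sets_restrict_space_iff)
  have "(\<lambda>t. indicat_real I t) \<in> borel_measurable ?\<mu>" by (rule borel_measurable_indicator[OF Im])
  then have Im': "(\<lambda>z. indicat_real I (fst z)) \<in> borel_measurable (?\<mu> \<Otimes>\<^sub>M ?\<nu>)"
    by (rule measurable_compose[OF measurable_fst])
  have Fm: "F \<in> borel_measurable (?\<mu> \<Otimes>\<^sub>M ?\<nu>)" unfolding F_def[abs_def] by (intro borel_measurable_scaleR Im' fm)
  have Fi: "integrable (?\<mu> \<Otimes>\<^sub>M ?\<nu>) F"
  proof (rule Bochner_Integration.integrable_bound[OF _ Fm])
    show "integrable (?\<mu> \<Otimes>\<^sub>M ?\<nu>) (\<lambda>z. 1 + (norm (f (fst z) (snd z)))\<^sup>2)" using f2 by simp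
    have "norm (F z) \<le> 1 + (norm (f (fst z) (snd z)))\<^sup>2" for z
    proof -
      have "0 \<le> (norm (f (fst z) (snd z)) - 1)\<^sup>2" by simp
      then have "norm (f (fst z) (snd z)) \<le> 1 + (norm (f (fst z) (snd z)))\<^sup>2"
        using norm_ge_zero[of "f (fst z) (snd z)"] unfolding power2_diff power_one by linarith
      moreover have "norm (F z) \<le> norm (f (fst z) (snd z))" by (simp add: F_def indicator_def)
      ultimately show ?thesis by simp
    qed
    then show "AE z in ?\<mu> \<Otimes>\<^sub>M ?\<nu>. norm (F z) \<le> norm (1 + (norm (f (fst z) (snd z)))\<^sup>2)"
      by (intro AE_I2) (smt (verit) real_norm_def zero_le_power2)
  qed
  have Fs: "integrable (?\<nu> \<Otimes>\<^sub>M ?\<mu>) (\<lambda>(x, t). F (t, x))" by (rule P.integrable_product_swap[OF Fi])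
  have tm: "time_mean \<tau> f n x = (1 / \<tau>) *\<^sub>R (LINT t|?\<mu>. (\<lambda>(x, t). F (t, x)) (x, t))" for x
  proof -
    have "(LINT t|?\<mu>. (\<lambda>(x, t). F (t, x)) (x, t)) = (LINT t|lebesgue. indicat_real ?J t *\<^sub>R (indicat_real I t *\<^sub>R f t x))"
      by (simp add: F_def integral_restrict_space)
    also have "\<dots> = (LINT t|lebesgue. indicat_real I t *\<^sub>R f t x)"
      using IJ by (intro Bochner_Integration.integral_cong) (auto simp: indicator_def)
    finally show ?thesis by (simp add: time_mean_def set_lebesgue_integral_def I_def)
  qed
  show "integrable ?\<nu> (time_mean \<tau> f n)"
    unfolding tm[abs_def] by (intro integrable_scaleR_right Q.integrable_fst'[OF Fs])
  assume z: "AE t in ?\<mu>. (LINT x|?\<nu>. f t x) = 0"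
  have "(LINT x|?\<nu>. LINT t|?\<mu>. (\<lambda>(x, t). F (t, x)) (x, t)) = integral\<^sup>L (?\<nu> \<Otimes>\<^sub>M ?\<mu>) (\<lambda>(x, t). F (t, x))"
    by (rule Q.integral_fst'[OF Fs])
  also have "\<dots> = integral\<^sup>L (?\<mu> \<Otimes>\<^sub>M ?\<nu>) F" by (rule P.integral_product_swap[OF Fm])
  also have "\<dots> = (LINT t|?\<mu>. LINT x|?\<nu>. F (t, x))" by (rule P.integral_fst'[OF Fi, symmetric])
  also have "\<dots> = 0"
  proof (rule integral_eq_zero_AE)
    show "AE t in ?\<mu>. (LINT x|?\<nu>. F (t, x)) = 0"
      using z by eventually_elim (simp add: F_def)
  qed
  finally show "(LINT x|?\<nu>. time_mean \<tau> f n x) = 0" unfolding tm by simp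
qed

section \<open>Zero-extended and extensional unknowns\<close>

text \<open>The discrete spaces consist of extensional functions, with value \<open>undefined\<close> off the
  elements and faces. They are not vector spaces, whereas the solvability result needs a
  finite-dimensional vector space. The latter consists of the functions that are zero off the
  elements and faces. Restriction is a bijection from it onto the discrete space, and all forms take
  the same values on an unknown and on its restriction, because they only depend on values
  at elements and faces.\<close>

lemma fin_dim_finite_support:
  assumes "finite I" "\<And>i. i \<in> I \<Longrightarrow> fin_dim (W i)"
  shows "fin_dim {f. (\<forall>i\<in>I. f i \<in> W i) \<and> (\<forall>i. i \<notin> I \<longrightarrow> f i = 0)}"
proof (rule fin_dim_subset)
  let ?e = "\<lambda>i p j. if j = i then p else 0"
  have "linear (?e i)" for i by (rule linearI) (auto simp: fun_eq_iff)
  then show "fin_dim {x. \<exists>y. (\<forall>i\<in>I. y i \<in> ?e i ` W i) \<and> x = (\<Sum>i\<in>I. y i)}"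
    by (intro fin_dim_sums fin_dim_linear_image assms)
  show "{f. (\<forall>i\<in>I. f i \<in> W i) \<and> (\<forall>i. i \<notin> I \<longrightarrow> f i = 0)} \<subseteq> {x. \<exists>y. (\<forall>i\<in>I. y i \<in> ?e i ` W i) \<and> x = (\<Sum>i\<in>I. y i)}"
  proof
    fix f assume f: "f \<in> {f. (\<forall>i\<in>I. f i \<in> W i) \<and> (\<forall>i. i \<notin> I \<longrightarrow> f i = 0)}"
    have "f j = (\<Sum>i\<in>I. ?e i (f i) j)" for j using f assms(1) by auto
    then have 1: "f = (\<Sum>i\<in>I. ?e i (f i))" by (simp add: fun_eq_iff)
    have 2: "\<forall>i\<in>I. ?e i (f i) \<in> ?e i ` W i" using f by auto
    show "f \<in> {x. \<exists>y. (\<forall>i\<in>I. y i \<in> ?e i ` W i) \<and> x = (\<Sum>i\<in>I. y i)}"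
      by (rule CollectI, rule exI[of _ "\<lambda>i. ?e i (f i)"], rule conjI[OF 2 1])
  qed
qed

lemma l2_proj_cong:
  assumes "\<And>x. x \<in> space \<mu> \<Longrightarrow> f x = g x"
  shows "l2_proj W \<mu> f = l2_proj W \<mu> g"
proof -
  have "(LINT x|\<mu>. f x * q x) = (LINT x|\<mu>. g x * q x)" for q :: "'a \<Rightarrow> real"
    by (rule Bochner_Integration.integral_cong) (simp_all add: assms)
  then show ?thesis by (simp add: l2_proj_def)
qed

definition same_U :: "'d::finite mesh \<Rightarrow> 'd hho \<Rightarrow> 'd hho \<Rightarrow> bool" where
  "same_U M u v \<longleftrightarrow> (\<forall>T\<in>elems M. fst u T = fst v T) \<and> (\<forall>F\<in>faces M. \<forall>x\<in>F. snd u F x = snd v F x)"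

definition same_P :: "'d::finite mesh \<Rightarrow> 'd broken \<Rightarrow> 'd broken \<Rightarrow> bool" where
  "same_P M p q \<longleftrightarrow> (\<forall>T\<in>elems M. p T = q T)"

definition zero_ext_U :: "'d::finite mesh \<Rightarrow> 'd hho \<Rightarrow> 'd hho" where
  "zero_ext_U M v = (\<lambda>T. if T \<in> elems M then fst v T else 0,
     \<lambda>F x. if F \<in> faces M \<and> x \<in> F then snd v F x else 0)"

definition zero_ext_P :: "'d::finite mesh \<Rightarrow> 'd broken \<Rightarrow> 'd broken" where
  "zero_ext_P M q = (\<lambda>T. if T \<in> elems M then q T else 0)"

definition restrict_U :: "'d::finite mesh \<Rightarrow> 'd hho \<Rightarrow> 'd hho" where
  "restrict_U M v = (restrict (fst v) (elems M), restrict (\<lambda>F. restrict (snd v F) F) (faces M))"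

lemma same_ext:
  "same_U M (zero_ext_U M v) v" "same_U M (restrict_U M v) v"
  "same_P M (zero_ext_P M q) q" "same_P M (restrict q (elems M)) q"
  by (simp_all add: same_U_def same_P_def zero_ext_U_def zero_ext_P_def restrict_U_def)

lemma same_sym: "same_U M u v \<Longrightarrow> same_U M v u" "same_P M p q \<Longrightarrow> same_P M q p"
  by (simp_all add: same_U_def same_P_def)

lemma glue_cong: "(\<And>T. T \<in> elems M \<Longrightarrow> p T = q T) \<Longrightarrow> glue M p = glue M q"
  by (simp add: glue_def fun_eq_iff)

lemma glue_same: "same_P M p q \<Longrightarrow> glue M p = glue M q" "same_U M u v \<Longrightarrow> glue M (fst u) = glue M (fst v)"
  by (auto intro!: glue_cong simp: same_P_def same_U_def)

context hho_disc begin

lemma rhs_same: "T \<in> elems M \<Longrightarrow> same_U M u v \<Longrightarrow> sym_grad_rhs T u \<tau> = sym_grad_rhs T v \<tau>"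
  unfolding sym_grad_rhs_def
  by (intro arg_cong2[where f = "(+)"] arg_cong[where f = uminus] sum.cong refl Bochner_Integration.integral_cong)
    (auto simp: same_U_def dest: faces_ofD(1))

lemma G_same: "T \<in> elems M \<Longrightarrow> same_U M u v \<Longrightarrow> G T u = G T v"
  by (simp add: sym_grad_rec_eq rhs_same[of T u v])

lemma skew_same: "same_U M u v \<Longrightarrow> face_skew T u i j = face_skew T v i j"
  unfolding face_skew_def
  by (intro sum.cong refl Bochner_Integration.integral_cong) (auto simp: same_U_def dest: faces_ofD(1))

lemma R_same: "T \<in> elems M \<Longrightarrow> same_U M u v \<Longrightarrow> R T u = R T v"
  by (simp add: disp_rec_eq is_disp_rec_def G_same[of T u v] skew_same[of u v]) (simp add: same_U_def)

lemma residual_same: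
  assumes T: "T \<in> elems M" and F: "F \<in> faces_of M T" and s: "same_U M u v" and x: "x \<in> F"
  shows "face_residual k M T F u x = face_residual k M T F v x"
proof -
  have e: "fst u T = fst v T" using s T by (simp add: same_U_def)
  have "l2_proj (face_poly k F) (face_measure F) (\<lambda>y. (R T u y - snd u F y) $ i)
    = l2_proj (face_poly k F) (face_measure F) (\<lambda>y. (R T v y - snd v F y) $ i)" for i
    using s faces_ofD(1)[OF F] by (intro l2_proj_cong) (simp add: R_same[OF T s] same_U_def)
  then show ?thesis by (simp add: face_residual_def proj_face_def proj_elem_def R_same[OF T s] e)
qed

lemma a_h_same:
  assumes u: "same_U M u u'" and v: "same_U M v v'"
  shows "a_h k \<sigma> \<gamma> M u v = a_h k \<sigma> \<gamma> M u' v'"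
  unfolding a_h_def
  by (intro sum.cong refl arg_cong2[where f = "(+)"] arg_cong2[where f = "(*)"] Bochner_Integration.integral_cong)
    (simp_all add: G_same[OF _ u] G_same[OF _ v] residual_same[OF _ _ u] residual_same[OF _ _ v])

lemma b_h_same:
  assumes v: "same_U M v v'" and q: "same_P M q q'"
  shows "b_h M v q = b_h M v' q'"
proof -
  have e: "fst v T = fst v' T" "q T = q' T" if "T \<in> elems M" for T
    using that v q by (simp_all add: same_U_def same_P_def)
  have f: "snd v F x = snd v' F x" if "F \<in> faces_of M T" "x \<in> F" for T F x
    using v that faces_ofD(1) by (auto simp: same_U_def)
  show ?thesis
    unfolding b_h_def
    by (intro sum.cong refl arg_cong2[where f = "(-)"] Bochner_Integration.integral_cong) (simp_all add: e f)
qed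

lemma c_h_same:
  assumes p: "same_P M p p'" and q: "same_P M q q'"
  shows "c_h \<kappa> \<zeta> \<Omega> M p q = c_h \<kappa> \<zeta> \<Omega> M p' q'"
proof -
  have e: "p T = p' T" "q T = q' T" if "T \<in> elems M" for T using that p q by (simp_all add: same_P_def)
  have g: "broken_grad M p = broken_grad M p'" "broken_grad M q = broken_grad M q'"
    unfolding broken_grad_def by (intro glue_cong, simp add: e)+
  have j: "jump M F p = jump M F p'" "jump M F q = jump M F q'" if "F \<in> internal_faces M" for F
    using sides(1,2)[OF that] by (simp_all add: jump_def[abs_def] e)
  have w: "waverage \<kappa> M F (darcy_flux \<kappa> p) = waverage \<kappa> M F (darcy_flux \<kappa> p')"
    "waverage \<kappa> M F (darcy_flux \<kappa> q) = waverage \<kappa> M F (darcy_flux \<kappa> q')" if "F \<in> internal_faces M" for F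
    using sides(1,2)[OF that] by (simp_all add: waverage_def[abs_def] darcy_flux_def[abs_def] e)
  show ?thesis by (simp add: c_h_def g j w)
qed

lemma kappa_norm_same:
  assumes q: "same_P M q q'"
  shows "kappa_norm_sq \<kappa> M q = kappa_norm_sq \<kappa> M q'"
proof -
  have e: "q T = q' T" if "T \<in> elems M" for T using that q by (simp add: same_P_def)
  have j: "jump M F q = jump M F q'" if "F \<in> internal_faces M" for F
    using sides(1,2)[OF that] by (simp add: jump_def[abs_def] e)
  show ?thesis by (simp add: kappa_norm_sq_def e j)
qed

definition zero_U :: "'d hho set" where
  "zero_U = {v \<in> V. (\<forall>F\<in>boundary_faces \<Omega> M. \<forall>x\<in>F. snd v F x = 0) \<and>
     (\<forall>T. T \<notin> elems M \<longrightarrow> fst v T = 0) \<and> (\<forall>F x. F \<notin> faces M \<or> x \<notin> F \<longrightarrow> snd v F x = 0)}"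

lemma subspace_zero_U: "subspace zero_U"
  using subspace_raw_U[of k M] unfolding subspace_def zero_U_def by auto

lemma fin_dim_zero_U: "fin_dim zero_U"
proof (rule fin_dim_subset)
  let ?r = "\<lambda>F (p :: 'd point \<Rightarrow> 'd point) x. if x \<in> F then p x else 0"
  let ?A = "{a. (\<forall>T\<in>elems M. a T \<in> poly_maps k) \<and> (\<forall>T. T \<notin> elems M \<longrightarrow> a T = 0)}"
  let ?B = "{b. (\<forall>F\<in>faces M. b F \<in> ?r F ` poly_maps k) \<and> (\<forall>F. F \<notin> faces M \<longrightarrow> b F = 0)}"
  have "linear (?r F)" for F by (rule linearI) (auto simp: fun_eq_iff)
  then show "fin_dim (?A \<times> ?B)"
    by (intro fin_dim_Times fin_dim_finite_support fin_dim_linear_image fin_dim_poly_maps finite_elems finite_faces)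
  show "zero_U \<subseteq> ?A \<times> ?B"
  proof
    fix v assume v: "v \<in> zero_U"
    have "snd v F \<in> ?r F ` poly_maps k" if F: "F \<in> faces M" for F
    proof -
      obtain p where p: "p \<in> poly_maps k" "\<forall>x\<in>F. snd v F x = p x" using raw_face[OF _ F, of v] v by (auto simp: zero_U_def)
      have "snd v F = ?r F p" using p v by (auto simp: fun_eq_iff zero_U_def)
      then show ?thesis using p(1) by (rule image_eqI)
    qed
    moreover have "snd v F = 0" if "F \<notin> faces M" for F using v that by (auto simp: zero_U_def fun_eq_iff)
    moreover have "fst v \<in> ?A" using v raw_elem[of v] by (auto simp: zero_U_def)
    ultimately show "v \<in> ?A \<times> ?B" by (simp add: mem_Times_iff)
  qed
qed

lemma boundary_face: "F \<in> boundary_faces \<Omega> M \<Longrightarrow> F \<in> faces M" by (simp add: boundary_faces_def)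

lemma UD_space_raw:
  assumes "v \<in> UD_space k \<Omega> M"
  shows "v \<in> V" "F \<in> boundary_faces \<Omega> M \<Longrightarrow> x \<in> F \<Longrightarrow> snd v F x = 0"
    "T \<notin> elems M \<Longrightarrow> fst v T = undefined" "F \<notin> faces M \<Longrightarrow> snd v F = undefined"
    "F \<in> faces M \<Longrightarrow> x \<notin> F \<Longrightarrow> snd v F x = undefined"
proof -
  have v1: "fst v \<in> (\<Pi>\<^sub>E T\<in>elems M. vpoly_upto k)" and v2: "snd v \<in> (\<Pi>\<^sub>E F\<in>faces M. face_vpoly k F)"
    using assms by (auto simp: UD_space_def U_space_def)
  have f: "\<exists>p\<in>poly_maps k. snd v F = restrict p F" if "F \<in> faces M" for F
    using PiE_mem[OF v2 that] by (auto simp: face_vpoly_def poly_maps_vector)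
  show "v \<in> V" unfolding raw_U_def using PiE_mem[OF v1] f by (fastforce simp: poly_maps_vector)
  show "F \<in> boundary_faces \<Omega> M \<Longrightarrow> x \<in> F \<Longrightarrow> snd v F x = 0" using assms by (simp add: UD_space_def)
  show "T \<notin> elems M \<Longrightarrow> fst v T = undefined" by (rule PiE_arb[OF v1])
  show "F \<notin> faces M \<Longrightarrow> snd v F = undefined" by (rule PiE_arb[OF v2])
  show "F \<in> faces M \<Longrightarrow> x \<notin> F \<Longrightarrow> snd v F x = undefined" using f by fastforce
qed

lemma zero_ext_U_in: "v \<in> UD_space k \<Omega> M \<Longrightarrow> zero_ext_U M v \<in> zero_U"
proof -
  assume v: "v \<in> UD_space k \<Omega> M"
  have "zero_ext_U M v \<in> V"
    using raw_elem[OF UD_space_raw(1)[OF v]] raw_face[OF UD_space_raw(1)[OF v]] by (simp add: raw_U_def zero_ext_U_def)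
  then show ?thesis using UD_space_raw(2)[OF v] by (simp add: zero_U_def zero_ext_U_def)
qed

lemma restrict_U_in: "v \<in> zero_U \<Longrightarrow> restrict_U M v \<in> UD_space k \<Omega> M"
proof -
  assume v: "v \<in> zero_U"
  have vV: "v \<in> V" using v by (simp add: zero_U_def)
  have "restrict (snd v F) F \<in> face_vpoly k F" if F: "F \<in> faces M" for F
  proof -
    obtain p where p: "p \<in> vpoly_upto k" "\<forall>x\<in>F. snd v F x = p x" using raw_face[OF vV F] by (auto simp: poly_maps_vector)
    then have "restrict (snd v F) F = restrict p F" by (auto simp: restrict_def)
    then show ?thesis unfolding face_vpoly_def using p(1) by (rule image_eqI)
  qed
  then have "restrict_U M v \<in> U_space k M"
    using raw_elem[OF vV] by (simp add: restrict_U_def U_space_def poly_maps_vector)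
  moreover have "snd (restrict_U M v) F x = 0" if "F \<in> boundary_faces \<Omega> M" "x \<in> F" for F x
    using v that boundary_face[OF that(1)] by (simp add: restrict_U_def zero_U_def)
  ultimately show ?thesis by (simp add: UD_space_def)
qed

lemma restrict_zero_ext_U: "v \<in> UD_space k \<Omega> M \<Longrightarrow> restrict_U M (zero_ext_U M v) = v"
proof -
  assume v: "v \<in> UD_space k \<Omega> M"
  have "fst (restrict_U M (zero_ext_U M v)) T = fst v T" for T
    using UD_space_raw(3)[OF v] by (simp add: restrict_U_def zero_ext_U_def)
  moreover have "snd (restrict_U M (zero_ext_U M v)) F x = snd v F x" for F x
    using UD_space_raw(4,5)[OF v] by (simp add: restrict_U_def zero_ext_U_def restrict_def)
  ultimately show ?thesis by (simp add: prod_eq_iff fun_eq_iff)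
qed

definition zero_P :: "real \<Rightarrow> 'd broken set" where
  "zero_P C0 = {q \<in> raw_P. (\<forall>T. T \<notin> elems M \<longrightarrow> q T = 0) \<and> (C0 = 0 \<longrightarrow> (LINT x|lebesgue_on \<Omega>. glue M q x) = 0)}"

lemma subspace_zero_P: "subspace (zero_P C0)"
proof (rule subspaceI)
  show "0 \<in> zero_P C0" using subspace_0[OF subspace_raw_P] lin_on_0[OF lin_on_mean subspace_raw_P] by (simp add: zero_P_def)
qed (auto simp: zero_P_def lin_on_add[OF lin_on_mean] lin_on_scale[OF lin_on_mean]
    intro: subspace_add[OF subspace_raw_P] subspace_scale[OF subspace_raw_P])

lemma fin_dim_zero_P: "fin_dim (zero_P C0)"
  by (rule fin_dim_subset[OF fin_dim_finite_support[OF finite_elems fin_dim_poly_upto]]) (auto simp: zero_P_def raw_P_def)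

lemma broken_poly_raw: "q \<in> broken_poly k M \<Longrightarrow> q \<in> raw_P"
  by (auto simp: broken_poly_def raw_P_def)

lemma P_space_broken: "q \<in> P_space k C0 \<Omega> M \<Longrightarrow> q \<in> broken_poly k M"
  by (auto simp: P_space_def split: if_splits)

lemma zero_ext_P_raw: "q \<in> raw_P \<Longrightarrow> zero_ext_P M q \<in> raw_P"
  by (simp add: raw_P_def zero_ext_P_def)

lemma zero_ext_P_in: "0 \<le> C0 \<Longrightarrow> q \<in> P_space k C0 \<Omega> M \<Longrightarrow> zero_ext_P M q \<in> zero_P C0"
proof -
  assume C0: "0 \<le> C0" and q: "q \<in> P_space k C0 \<Omega> M"
  have "zero_ext_P M q \<in> raw_P" by (rule zero_ext_P_raw[OF broken_poly_raw[OF P_space_broken[OF q]]])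
  moreover have "zero_ext_P M q T = 0" if "T \<notin> elems M" for T using that by (simp add: zero_ext_P_def)
  moreover have "C0 = 0 \<Longrightarrow> (LINT x|lebesgue_on \<Omega>. glue M q x) = 0" using q by (simp add: P_space_def)
  ultimately show ?thesis unfolding zero_P_def by (simp add: glue_same(1)[OF same_ext(3)])
qed

lemma restrict_P_in: "0 \<le> C0 \<Longrightarrow> q \<in> zero_P C0 \<Longrightarrow> restrict q (elems M) \<in> P_space k C0 \<Omega> M"
proof -
  assume C0: "0 \<le> C0" and q: "q \<in> zero_P C0"
  have "restrict q (elems M) \<in> broken_poly k M" using zero_P_def raw_P_def q by (simp add: broken_poly_def)
  moreover have "C0 = 0 \<Longrightarrow> (LINT x|lebesgue_on \<Omega>. glue M q x) = 0" using q by (simp add: zero_P_def)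
  ultimately show ?thesis using C0 by (simp add: P_space_def glue_same(1)[OF same_ext(4)])
qed

lemma restrict_zero_ext_P: "q \<in> P_space k C0 \<Omega> M \<Longrightarrow> restrict (zero_ext_P M q) (elems M) = q"
proof -
  assume "q \<in> P_space k C0 \<Omega> M"
  then have "q T = undefined" if "T \<notin> elems M" for T
    using P_space_broken PiE_arb that unfolding broken_poly_def by blast
  then show ?thesis by (intro ext) (simp add: zero_ext_P_def restrict_def)
qed

definition const_P :: "'d broken" where
  "const_P = (\<lambda>T. if T \<in> elems M then (\<lambda>x. 1) else 0)"

lemma const_P: "const_P \<in> raw_P" "T \<in> elems M \<Longrightarrow> const_P T = (\<lambda>x. 1)"
  by (simp_all add: raw_P_def const_P_def const_in_poly_upto)

text \<open>Up to a null set the elements cover the domain, so the constant pressure 1 is indeed 1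
  almost everywhere.\<close>

lemma l2_const_P:
  assumes "integrable (lebesgue_on \<Omega>) f"
  shows "l2_prod \<Omega> f (glue M const_P) = (LINT x|lebesgue_on \<Omega>. f x)"
  unfolding l2_prod_def
proof (rule integral_cong_AE)
  show "(\<lambda>x. f x \<bullet> glue M const_P x) \<in> borel_measurable (lebesgue_on \<Omega>)"
    by (rule borel_measurable_integrable[OF integrable_inner_glue[OF assms raw_P_elem[OF const_P(1)]]])
  show "f \<in> borel_measurable (lebesgue_on \<Omega>)" by (rule borel_measurable_integrable[OF assms])
  have "AE x in lebesgue. x \<in> \<Omega> \<longrightarrow> f x \<bullet> glue M const_P x = f x"
    using AE_in_elem by eventually_elim (auto simp: glue_on_elem const_P(2))
  then show "AE x in lebesgue_on \<Omega>. f x \<bullet> glue M const_P x = f x"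
    using lmeas_\<Omega> by (simp add: AE_restrict_space_iff)
qed

lemma mean_const_P: "(LINT x|lebesgue_on \<Omega>. glue M const_P x) > 0"
proof -
  have i: "integrable (lebesgue_on \<Omega>) (\<lambda>x. 1::real)"
    by (rule tame_integrable[OF solid_lebesgue_on[OF open_\<Omega> bounded_\<Omega>] tame_const])
  have "(LINT x|lebesgue_on \<Omega>. glue M const_P x) = (LINT x|lebesgue_on \<Omega>. 1)"
    using l2_const_P[OF i] by (simp add: l2_prod_def)
  also have "\<dots> = measure lebesgue \<Omega>" using lmeas_\<Omega> by (simp add: measure_restrict_space)
  also have "\<dots> > 0"
  proof -
    have "\<Omega> \<in> lmeasurable" using open_\<Omega> bounded_\<Omega> by (simp add: lmeasurable_open)
    then have "measure lebesgue \<Omega> \<noteq> 0" using open_not_negligible[OF open_\<Omega> nonempty_\<Omega>] by (simp add: negligible_iff_measure0)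
    then show ?thesis by (simp add: zero_less_measure_iff)
  qed
  finally show ?thesis .
qed

end

section \<open>One time step\<close>

text \<open>The pair of a Darcy problem and a stress on the same mesh; \<open>\<nu>\<close> is the
  coercivity constant of the Darcy form.\<close>

locale hho_problem = hho_darcy \<Omega> M ctr rad \<A> k \<kappa> \<kappa>lo \<zeta> + hho_stress \<Omega> M ctr rad \<A> k \<sigma> Cgr Ccv \<gamma>
  for \<Omega> :: "'d::finite point set" and M :: "'d mesh" and ctr rad \<A> k \<kappa> \<kappa>lo \<zeta> \<sigma> Cgr Ccv \<gamma> +
  fixes C0 \<nu> :: real
  assumes C0: "0 \<le> C0" and \<nu>: "0 < \<nu>"
    and c_h_coercive: "\<And>q. q \<in> P_space k C0 \<Omega> M \<Longrightarrow> \<nu> * kappa_norm_sq \<kappa> M q \<le> c_h \<kappa> \<zeta> \<Omega> M q q"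
begin

abbreviation "c \<equiv> c_h \<kappa> \<zeta> \<Omega> M"
abbreviation "mass p q \<equiv> l2_prod \<Omega> (glue M p) (glue M q)"
abbreviation "S \<equiv> zero_U \<times> zero_P C0"

lemma zero_U_raw: "v \<in> zero_U \<Longrightarrow> v \<in> V" by (simp add: zero_U_def)
lemma zero_P_raw: "q \<in> zero_P C0 \<Longrightarrow> q \<in> raw_P" by (simp add: zero_P_def)

lemma definite_U:
  assumes v: "v \<in> zero_U" and "\<And>T. T \<in> elems M \<Longrightarrow> G T v = 0" and "stab_form v v = 0"
  shows "v = 0"
proof -
  have vV: "v \<in> V" by (rule zero_U_raw[OF v])
  have bd: "snd v F x = 0" if "F \<in> boundary_faces \<Omega> M" "x \<in> F" for F x using v that by (simp add: zero_U_def)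
  have z1: "fst v T = 0" if "T \<in> elems M" for T
    by (rule global_rigidity(1)[OF vV bd assms(2) stab_zero[OF vV assms(3)]]) (use that in auto)
  have z2: "snd v F x = 0" if "F \<in> faces M" "x \<in> F" for F x
    by (rule global_rigidity(2)[OF vV bd assms(2) stab_zero[OF vV assms(3)]]) (use that in auto)
  have "fst v T = 0" for T using z1 v by (cases "T \<in> elems M") (auto simp: zero_U_def)
  moreover have "snd v F x = 0" for F x using z2 v by (cases "F \<in> faces M \<and> x \<in> F") (auto simp: zero_U_def)
  ultimately show ?thesis by (simp add: prod_eq_iff fun_eq_iff)
qed

lemma c_coercive:
  assumes "q \<in> zero_P C0" shows "\<nu> * kappa_norm_sq \<kappa> M q \<le> c q q"
  using c_h_coercive[OF restrict_P_in[OF C0 assms]]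
  by (simp add: c_h_same[OF same_ext(4) same_ext(4)] kappa_norm_same[OF same_ext(4)])

lemma c_nonneg: "q \<in> zero_P C0 \<Longrightarrow> 0 \<le> c q q"
  using c_coercive[of q] kappa_norm_definite(1)[OF zero_P_raw, of q] \<nu>
  by (meson less_imp_le mult_nonneg_nonneg order_trans)

lemma definite_P:
  assumes q: "q \<in> zero_P C0" and m: "C0 * mass q q = 0" and z: "c q q = 0"
  shows "q = 0"
proof -
  have qr: "q \<in> raw_P" by (rule zero_P_raw[OF q])
  have "\<nu> * kappa_norm_sq \<kappa> M q \<le> 0" using c_coercive[OF q] z by simp
  then have "kappa_norm_sq \<kappa> M q = 0"
    using kappa_norm_definite(1)[OF qr] \<nu> by (simp add: mult_le_0_iff)
  then obtain a where a: "\<And>T. T \<in> elems M \<Longrightarrow> q T = (\<lambda>x. a)" using kappa_norm_definite(2)[OF qr] by blast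
  have q0: "q T = 0" if T: "T \<in> elems M" for T
  proof (cases "C0 = 0")
    case True
    have "same_P M q (a *\<^sub>R const_P)" by (simp add: same_P_def a const_P(2) fun_eq_iff)
    then have "glue M q x = a * glue M const_P x" for x by (simp add: glue_same(1) glue_scale)
    then have "(LINT x|lebesgue_on \<Omega>. glue M q x) = a * (LINT x|lebesgue_on \<Omega>. glue M const_P x)" by simp
    moreover have "(LINT x|lebesgue_on \<Omega>. glue M q x) = 0" using q True by (simp add: zero_P_def)
    ultimately have "a * (LINT x|lebesgue_on \<Omega>. glue M const_P x) = 0" by simp
    then have "a = 0" using mean_const_P by simp
    then show ?thesis using a[OF T] by (simp add: fun_eq_iff)
  next
    case False
    then show ?thesis using mass_definite(2)[OF qr _ T] m by simp
  qed
  then have "q T = 0" for T using q by (cases "T \<in> elems M") (auto simp: zero_P_def)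
  then show ?thesis by (simp add: fun_eq_iff)
qed

text \<open>The left-hand side of one time step, as a functional on pairs of test functions. The
  mass balance is multiplied by the time step \<open>\<tau>\<close>.\<close>

definition step_form :: "real \<Rightarrow> 'd hho \<times> 'd broken \<Rightarrow> 'd hho \<times> 'd broken \<Rightarrow> real" where
  "step_form \<tau> x y = a_h k \<sigma> \<gamma> M (fst x) (fst y) + b_h M (fst y) (snd x)
     + (C0 * mass (snd x) (snd y) - b_h M (fst x) (snd y) + \<tau> * c (snd x) (snd y))"

text \<open>The bilinear lower bound of \<open>step_form\<close> on the diagonal: coercivity of the
  stress replaces it by a linear one. It is definite by \<open>definite_U\<close> and
  \<open>definite_P\<close>.\<close>

definition energy :: "real \<Rightarrow> 'd hho \<times> 'd broken \<Rightarrow> 'd hho \<times> 'd broken \<Rightarrow> real" where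
  "energy \<tau> x y = Ccv\<^sup>2 * strain_form (fst x) (fst y) + stab_form (fst x) (fst y)
     + C0 * mass (snd x) (snd y) + \<tau> * c (snd x) (snd y)"

lemma lin_on_first: "lin_on V h \<Longrightarrow> lin_on S (\<lambda>x. h (fst x))"
  and lin_on_second: "lin_on raw_P h' \<Longrightarrow> lin_on S (\<lambda>x. h' (snd x))"
  by (auto simp: lin_on_def zero_U_raw zero_P_raw)

lemma stepD: "x \<in> S \<Longrightarrow> fst x \<in> V" "x \<in> S \<Longrightarrow> snd x \<in> raw_P" "x \<in> S \<Longrightarrow> fst x \<in> zero_U" "x \<in> S \<Longrightarrow> snd x \<in> zero_P C0"
  by (auto simp: zero_U_raw zero_P_raw)

lemma bilin_on_energy: "bilin_on S (energy \<tau>)"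
  unfolding energy_def
  by (intro bilin_onI lin_intros lin_on_first[OF bilin_onD(1)[OF bilin_on_strain]] lin_on_first[OF bilin_onD(2)[OF bilin_on_strain]]
      lin_on_first[OF bilin_onD(1)[OF bilin_on_stab]] lin_on_first[OF bilin_onD(2)[OF bilin_on_stab]]
      lin_on_second[OF bilin_onD(1)[OF bilin_on_mass]] lin_on_second[OF bilin_onD(2)[OF bilin_on_mass]]
      lin_on_second[OF bilin_onD(1)[OF bilin_on_c_h]] lin_on_second[OF bilin_onD(2)[OF bilin_on_c_h]] stepD)

lemma subspace_S: "subspace S" by (intro subspace_Times subspace_zero_U subspace_zero_P)

lemma energy_pos:
  assumes x: "x \<in> S" "x \<noteq> 0" and \<tau>: "0 < \<tau>"
  shows "0 < energy \<tau> x x"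
proof (rule ccontr)
  assume n: "\<not> 0 < energy \<tau> x x"
  have p: "0 \<le> Ccv\<^sup>2 * strain_form (fst x) (fst x)" "0 \<le> stab_form (fst x) (fst x)" "0 \<le> C0 * mass (snd x) (snd x)"
    "0 \<le> \<tau> * c (snd x) (snd x)"
    using strain_nonneg stab_nonneg C0 \<tau> mass_definite(1)[OF stepD(2)[OF x(1)]] c_nonneg[OF stepD(4)[OF x(1)]] by simp_all
  have z: "Ccv\<^sup>2 * strain_form (fst x) (fst x) = 0" "stab_form (fst x) (fst x) = 0" "C0 * mass (snd x) (snd x) = 0"
    "\<tau> * c (snd x) (snd x) = 0"
    using n p unfolding energy_def by linarith+
  have s0: "strain_form (fst x) (fst x) = 0" using z(1) Ccv by simp
  have "fst x = 0" by (rule definite_U[OF stepD(3)[OF x(1)] strain_zero[OF stepD(1)[OF x(1)] s0] z(2)])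
  moreover have "snd x = 0" using \<tau> z by (intro definite_P[OF stepD(4)[OF x(1)]]) auto
  ultimately show False using x(2) by (simp add: prod_eq_iff)
qed

lemma step_form_coercive: "x \<in> S \<Longrightarrow> energy \<tau> x x \<le> step_form \<tau> x x"
  using stress_coercive[OF stepD(1)] by (simp add: energy_def step_form_def a_h_eq)

text \<open>The coupling terms are \<open>b(u - w, p - r) - b(u - w, p - r) = 0\<close>. Each of the
  remaining terms is nonnegative, so if their sum is not positive, all of them vanish, and
  definiteness gives \<open>x = y\<close>.\<close>

lemma step_form_monotone:
  assumes x: "x \<in> S" and y: "y \<in> S" and ne: "x \<noteq> y" and \<tau>: "0 < \<tau>"
  shows "step_form \<tau> y (x - y) < step_form \<tau> x (x - y)"
proof (rule ccontr)
  let ?u = "fst x" and ?w = "fst y" and ?p = "snd x" and ?r = "snd y"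
  note D = stepD[OF x] stepD[OF y]
  have d: "x - y \<in> S" by (rule subspace_diff[OF subspace_S x y])
  have dU: "?u - ?w \<in> V" and dP: "?p - ?r \<in> raw_P" and dU0: "?u - ?w \<in> zero_U" and dP0: "?p - ?r \<in> zero_P C0"
    using stepD[OF d] by simp_all
  have st: "stab_form ?u (?u - ?w) - stab_form ?w (?u - ?w) = stab_form (?u - ?w) (?u - ?w)"
    using lin_on_diff[OF bilin_onD(2)[OF bilin_on_stab dU] subspace_raw_U D(1,5)] by simp
  have m: "mass ?p (?p - ?r) - mass ?r (?p - ?r) = mass (?p - ?r) (?p - ?r)"
    using lin_on_diff[OF bilin_onD(2)[OF bilin_on_mass dP] subspace_raw_P D(2,6)] by simp
  have cc: "c ?p (?p - ?r) - c ?r (?p - ?r) = c (?p - ?r) (?p - ?r)"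
    using lin_on_diff[OF bilin_onD(2)[OF bilin_on_c_h dP] subspace_raw_P D(2,6)] by simp
  have b1: "b_h M (?u - ?w) ?p - b_h M (?u - ?w) ?r = b_h M (?u - ?w) (?p - ?r)"
    using lin_on_diff[OF lin_on_b_h(2)[OF dU] subspace_raw_P D(2,6)] by simp
  have b2: "b_h M ?u (?p - ?r) - b_h M ?w (?p - ?r) = b_h M (?u - ?w) (?p - ?r)"
    using lin_on_diff[OF lin_on_b_h(1)[OF dP] subspace_raw_U D(1,5)] by simp
  have "step_form \<tau> x (x - y) - step_form \<tau> y (x - y) =
    (stress_form ?u (?u - ?w) - stress_form ?w (?u - ?w)) + (stab_form ?u (?u - ?w) - stab_form ?w (?u - ?w))
    + (b_h M (?u - ?w) ?p - b_h M (?u - ?w) ?r) - (b_h M ?u (?p - ?r) - b_h M ?w (?p - ?r))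
    + C0 * (mass ?p (?p - ?r) - mass ?r (?p - ?r)) + \<tau> * (c ?p (?p - ?r) - c ?r (?p - ?r))"
    by (simp add: step_form_def a_h_eq right_diff_distrib)
  then have eq: "step_form \<tau> x (x - y) - step_form \<tau> y (x - y) =
    (stress_form ?u (?u - ?w) - stress_form ?w (?u - ?w)) + stab_form (?u - ?w) (?u - ?w)
    + C0 * mass (?p - ?r) (?p - ?r) + \<tau> * c (?p - ?r) (?p - ?r)"
    unfolding st m cc b1 b2 by simp
  have nn: "0 \<le> stress_form ?u (?u - ?w) - stress_form ?w (?u - ?w)" "0 \<le> stab_form (?u - ?w) (?u - ?w)"
    "0 \<le> C0 * mass (?p - ?r) (?p - ?r)" "0 \<le> \<tau> * c (?p - ?r) (?p - ?r)"
    using stress_monotone(1)[OF D(1,5)] stab_nonneg C0 \<tau> mass_definite(1)[OF dP] c_nonneg[OF dP0] by simp_all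
  assume "\<not> step_form \<tau> y (x - y) < step_form \<tau> x (x - y)"
  then have z: "stress_form ?u (?u - ?w) - stress_form ?w (?u - ?w) = 0" "stab_form (?u - ?w) (?u - ?w) = 0"
    "C0 * mass (?p - ?r) (?p - ?r) = 0" "\<tau> * c (?p - ?r) (?p - ?r) = 0"
    using eq nn by linarith+
  have "G T (?u - ?w) = 0" if "T \<in> elems M" for T
    using stress_monotone(2)[OF D(1,5) _ that] z(1) by simp
  then have "?u - ?w = 0" by (rule definite_U[OF dU0 _ z(2)])
  moreover have "?p - ?r = 0" using \<tau> z by (intro definite_P[OF dP0]) auto
  ultimately show False using ne by (simp add: prod_eq_iff)
qed

lemma lin_on_step: "x \<in> S \<Longrightarrow> lin_on S (step_form \<tau> x)"
  unfolding step_form_def a_h_eq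
  by (intro lin_intros lin_on_first[OF lin_on_stress] lin_on_first[OF bilin_onD(1)[OF bilin_on_stab]]
      lin_on_first[OF lin_on_b_h(1)] lin_on_second[OF lin_on_b_h(2)] lin_on_second[OF bilin_onD(1)[OF bilin_on_mass]]
      lin_on_second[OF bilin_onD(1)[OF bilin_on_c_h]] stepD)

text \<open>All terms but the stress are linear in the unknown.\<close>

lemma step_form_continuous:
  fixes b :: "nat \<Rightarrow> 'd hho \<times> 'd broken" and e :: "nat \<Rightarrow> nat \<Rightarrow> real"
  assumes b: "\<forall>i<m. b i \<in> S" and y: "y \<in> S" and e: "\<forall>i<m. (\<lambda>n. e n i) \<longlonglongrightarrow> e' i"
  shows "(\<lambda>n. step_form \<tau> (\<Sum>i<m. e n i *\<^sub>R b i) y) \<longlonglongrightarrow> step_form \<tau> (\<Sum>i<m. e' i *\<^sub>R b i) y"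
proof -
  define L where "L x = stab_form (fst x) (fst y) + b_h M (fst y) (snd x)
     + (C0 * mass (snd x) (snd y) - b_h M (fst x) (snd y) + \<tau> * c (snd x) (snd y))" for x
  have L: "lin_on S L"
    unfolding L_def
    by (intro lin_intros lin_on_first[OF bilin_onD(2)[OF bilin_on_stab]]
      lin_on_first[OF lin_on_b_h(1)] lin_on_second[OF lin_on_b_h(2)] lin_on_second[OF bilin_onD(2)[OF bilin_on_mass]]
      lin_on_second[OF bilin_onD(2)[OF bilin_on_c_h]] stepD y)
  have sL: "L (\<Sum>i<m. d i *\<^sub>R b i) = (\<Sum>i<m. d i *\<^sub>R L (b i))" for d
    using b by (intro lin_on_sum[OF L subspace_S]) auto
  have sf: "fst (\<Sum>i<m. d i *\<^sub>R b i) = (\<Sum>i<m. d i *\<^sub>R fst (b i))" for d by (simp add: fst_sum)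
  have bV: "fst (b i) \<in> V" if "i < m" for i using b that by (blast intro: stepD)
  have "(\<lambda>n. stress_form (\<Sum>i<m. e n i *\<^sub>R fst (b i)) (fst y) + (\<Sum>i<m. e n i *\<^sub>R L (b i)))
    \<longlonglongrightarrow> stress_form (\<Sum>i<m. e' i *\<^sub>R fst (b i)) (fst y) + (\<Sum>i<m. e' i *\<^sub>R L (b i))"
    using e by (intro tendsto_add stress_continuous bV stepD(1)[OF y] tendsto_sum tendsto_scaleR tendsto_const) auto
  moreover have "step_form \<tau> x y = stress_form (fst x) (fst y) + L x" for x
    by (simp add: step_form_def a_h_eq L_def)
  ultimately show ?thesis by (simp only: sL sf)
qed

definition momentum_balance :: "('d point \<Rightarrow> 'd point) \<Rightarrow> 'd hho \<times> 'd broken \<Rightarrow> 'd hho \<Rightarrow> bool" where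
  "momentum_balance f s v \<longleftrightarrow>
     a_h k \<sigma> \<gamma> M (fst s) v + b_h M v (snd s) = l2_prod \<Omega> f (glue M (fst v))"

text \<open>The mass balance of one step, multiplied by the time step; \<open>stored\<close> is the
  fluid content before the step, tested against \<open>q\<close>.\<close>

definition mass_balance :: "real \<Rightarrow> ('d point \<Rightarrow> real) \<Rightarrow> ('d broken \<Rightarrow> real) \<Rightarrow> 'd hho \<times> 'd broken \<Rightarrow> 'd broken \<Rightarrow> bool" where
  "mass_balance \<tau> g stored s q \<longleftrightarrow>
     C0 * mass (snd s) q - b_h M (fst s) q + \<tau> * c (snd s) q = stored q + \<tau> * l2_prod \<Omega> g (glue M q)"

text \<open>Testing with \<open>(v, 0)\<close> and \<open>(0, q)\<close> separates the two
  balances.\<close>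

lemma step_ex1:
  assumes \<tau>: "0 < \<tau>" and f: "integrable (lebesgue_on \<Omega>) f" and g: "integrable (lebesgue_on \<Omega>) g"
    and stored: "lin_on raw_P stored"
  shows "\<exists>!s. s \<in> S \<and> (\<forall>v\<in>zero_U. momentum_balance f s v) \<and> (\<forall>q\<in>zero_P C0. mass_balance \<tau> g stored s q)"
proof -
  let ?l = "\<lambda>y :: 'd hho \<times> 'd broken. l2_prod \<Omega> f (glue M (fst (fst y))) + (stored (snd y) + \<tau> * l2_prod \<Omega> g (glue M (snd y)))"
  have l: "lin_on S ?l"
    by (intro lin_intros lin_on_first[OF lin_on_load[OF f]] lin_on_second[OF stored] lin_on_second[OF lin_on_source[OF g]])
  have "\<exists>!s. s \<in> S \<and> (\<forall>y\<in>S. step_form \<tau> s y = ?l y)"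
  proof (rule monotone_coercive_problem_solvable[where B = "energy \<tau>"])
    show "subspace S" by (rule subspace_S)
    show "fin_dim S" by (intro fin_dim_Times fin_dim_zero_U fin_dim_zero_P)
    show "bilin_on S (energy \<tau>)" by (rule bilin_on_energy)
    show "0 < energy \<tau> x x" if "x \<in> S" "x \<noteq> 0" for x by (rule energy_pos[OF that \<tau>])
    show "lin_on S (step_form \<tau> x)" if "x \<in> S" for x by (rule lin_on_step[OF that])
    show "energy \<tau> x x \<le> step_form \<tau> x x" if "x \<in> S" for x by (rule step_form_coercive[OF that])
    show "step_form \<tau> y (x - y) < step_form \<tau> x (x - y)" if "x \<in> S" "y \<in> S" "x \<noteq> y" for x y
      by (rule step_form_monotone[OF that \<tau>])
    show "lin_on S ?l" by (rule l)
    show "(\<lambda>n. step_form \<tau> (\<Sum>i<m. e n i *\<^sub>R b i) y) \<longlonglongrightarrow> step_form \<tau> (\<Sum>i<m. e' i *\<^sub>R b i) y"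
      if "\<And>i. i < m \<Longrightarrow> b i \<in> S" "y \<in> S" "\<And>i. i < m \<Longrightarrow> (\<lambda>n. e n i) \<longlonglongrightarrow> e' i"
      for m and b :: "nat \<Rightarrow> 'd hho \<times> 'd broken" and e :: "nat \<Rightarrow> nat \<Rightarrow> real" and e' y
      using that by (intro step_form_continuous) auto
  qed
  moreover have "(\<forall>y\<in>S. step_form \<tau> s y = ?l y) \<longleftrightarrow>
    (\<forall>v\<in>zero_U. momentum_balance f s v) \<and> (\<forall>q\<in>zero_P C0. mass_balance \<tau> g stored s q)" if s: "s \<in> S" for s
  proof -
    have z: "0 \<in> zero_U" "0 \<in> zero_P C0" by (rule subspace_0[OF subspace_zero_U], rule subspace_0[OF subspace_zero_P])
    have "step_form \<tau> s (v, 0) = a_h k \<sigma> \<gamma> M (fst s) v + b_h M v (snd s)" for v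
      using lin_on_0[OF bilin_onD(1)[OF bilin_on_mass] subspace_raw_P] lin_on_0[OF bilin_onD(1)[OF bilin_on_c_h] subspace_raw_P]
        lin_on_0[OF lin_on_b_h(2) subspace_raw_P] stepD[OF s] by (simp add: step_form_def)
    moreover have "?l (v, 0) = l2_prod \<Omega> f (glue M (fst v))" for v
      using lin_on_0[OF stored subspace_raw_P] lin_on_0[OF lin_on_source[OF g] subspace_raw_P] by simp
    ultimately have 1: "step_form \<tau> s (v, 0) = ?l (v, 0) \<longleftrightarrow> momentum_balance f s v" for v
      by (simp add: momentum_balance_def)
    have "step_form \<tau> s (0, q) = C0 * mass (snd s) q - b_h M (fst s) q + \<tau> * c (snd s) q" for q
      using lin_on_0[OF lin_on_stress subspace_raw_U] lin_on_0[OF bilin_onD(1)[OF bilin_on_stab] subspace_raw_U]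
        lin_on_0[OF lin_on_b_h(1) subspace_raw_U] stepD[OF s] by (simp add: step_form_def a_h_eq)
    moreover have "?l (0, q) = stored q + \<tau> * l2_prod \<Omega> g (glue M q)" for q
      using lin_on_0[OF lin_on_load[OF f] subspace_raw_U] by simp
    ultimately have 2: "step_form \<tau> s (0, q) = ?l (0, q) \<longleftrightarrow> mass_balance \<tau> g stored s q" for q
      by (simp add: mass_balance_def)
    have 3: "step_form \<tau> s y = ?l y" if "momentum_balance f s (fst y)" "mass_balance \<tau> g stored s (snd y)" for y
      using that by (simp add: step_form_def momentum_balance_def mass_balance_def)
    show ?thesis
    proof (intro iffI conjI ballI)
      fix v assume a: "\<forall>y\<in>S. step_form \<tau> s y = ?l y" and m: "v \<in> zero_U"
      have "(v, 0) \<in> S" using m z by simp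
      then have "step_form \<tau> s (v, 0) = ?l (v, 0)" by (rule bspec[OF a])
      then show "momentum_balance f s v" by (simp only: 1)
    next
      fix q assume a: "\<forall>y\<in>S. step_form \<tau> s y = ?l y" and m: "q \<in> zero_P C0"
      have "(0, q) \<in> S" using m z by simp
      then have "step_form \<tau> s (0, q) = ?l (0, q)" by (rule bspec[OF a])
      then show "mass_balance \<tau> g stored s q" by (simp only: 2)
    next
      fix y assume "(\<forall>v\<in>zero_U. momentum_balance f s v) \<and> (\<forall>q\<in>zero_P C0. mass_balance \<tau> g stored s q)" "y \<in> S"
      then show "step_form \<tau> s y = ?l y" using stepD(3,4)[of y] by (intro 3) auto
    qed
  qed
  ultimately show ?thesis by (simp only: cong: conj_cong)
qed

text \<open>If \<open>C0 = 0\<close>, a test function is the sum of a constant and one of zero mean,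
  and on constants every term of the balance vanishes.\<close>

lemma mass_balance_all:
  assumes s: "s \<in> S" and g: "integrable (lebesgue_on \<Omega>) g" and stored: "lin_on raw_P stored"
    and compat: "C0 = 0 \<Longrightarrow> stored const_P = 0" "C0 = 0 \<Longrightarrow> (LINT x|lebesgue_on \<Omega>. g x) = 0"
    and bal: "\<And>q. q \<in> zero_P C0 \<Longrightarrow> mass_balance \<tau> g stored s q"
    and q: "q \<in> raw_P" "\<And>T. T \<notin> elems M \<Longrightarrow> q T = 0"
  shows "mass_balance \<tau> g stored s q"
proof (cases "C0 = 0")
  case False
  then show ?thesis using q by (intro bal) (simp add: zero_P_def)
next
  case True
  define D where "D q = C0 * mass (snd s) q - b_h M (fst s) q + \<tau> * c (snd s) q - stored q - \<tau> * l2_prod \<Omega> g (glue M q)" for q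
  have D: "lin_on raw_P D"
    unfolding D_def
    by (intro lin_intros stored lin_on_b_h(2) bilin_onD(1)[OF bilin_on_mass] bilin_onD(1)[OF bilin_on_c_h] lin_on_source g stepD s)
  have bd: "snd (fst s) F x = 0" if "F \<in> boundary_faces \<Omega> M" "x \<in> F" for F x
    using stepD(3)[OF s] that by (simp add: zero_U_def)
  have D1: "D const_P = 0"
    using b_h_const[OF stepD(1)[OF s] bd const_P(2)] c_h_const[OF stepD(2)[OF s] const_P(2)] compat[OF True] l2_const_P[OF g] True
    by (simp add: D_def)
  (* subtracting the constant a leaves zero mean *)
  define a where "a = (LINT x|lebesgue_on \<Omega>. glue M q x) / (LINT x|lebesgue_on \<Omega>. glue M const_P x)"
  have ac: "a *\<^sub>R const_P \<in> raw_P" by (rule subspace_scale[OF subspace_raw_P const_P(1)])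
  have q': "q - a *\<^sub>R const_P \<in> raw_P" by (rule subspace_diff[OF subspace_raw_P q(1) ac])
  have "(LINT x|lebesgue_on \<Omega>. glue M (q - a *\<^sub>R const_P) x) = 0"
    using lin_on_diff[OF lin_on_mean subspace_raw_P q(1) ac] lin_on_scale[OF lin_on_mean const_P(1), of a] mean_const_P
    by (simp add: a_def)
  then have "q - a *\<^sub>R const_P \<in> zero_P C0" using q' q(2) by (simp add: zero_P_def const_P_def)
  from bal[OF this] have "D (q - a *\<^sub>R const_P) = 0" by (simp add: mass_balance_def D_def)
  then have "D q = 0" using lin_on_diff[OF D subspace_raw_P q(1) ac] lin_on_scale[OF D const_P(1), of a] D1 by simp
  then show ?thesis by (simp add: mass_balance_def D_def)
qed

lemma momentum_same:
  "same_U M u u' \<Longrightarrow> same_P M p p' \<Longrightarrow> same_U M v v' \<Longrightarrow> momentum_balance f (u, p) v = momentum_balance f (u', p') v'"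
  by (simp add: momentum_balance_def a_h_same[of u u' v v'] b_h_same[of v v' p p'] glue_same(2)[of M v v'])

lemma mass_same:
  "same_U M u u' \<Longrightarrow> same_P M p p' \<Longrightarrow> same_P M q q' \<Longrightarrow> stored q = stored q' \<Longrightarrow>
    mass_balance \<tau> g stored (u, p) q = mass_balance \<tau> g stored (u', p') q'"
  by (simp add: mass_balance_def glue_same(1)[of M p p'] glue_same(1)[of M q q'] b_h_same[of u u' q q'] c_h_same[of p p' q q'])

text \<open>The solution in the space of zero-extended functions is moved to the discrete space by
  restriction, and the test functions back by zero extension.\<close>

lemma time_step_ex1:
  assumes \<tau>: "0 < \<tau>" and f: "integrable (lebesgue_on \<Omega>) f" and g: "integrable (lebesgue_on \<Omega>) g"
    and stored: "lin_on raw_P stored" and stored_same: "\<And>q q'. same_P M q q' \<Longrightarrow> stored q = stored q'"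
    and compat: "C0 = 0 \<Longrightarrow> stored const_P = 0" "C0 = 0 \<Longrightarrow> (LINT x|lebesgue_on \<Omega>. g x) = 0"
  shows "\<exists>!s. s \<in> UD_space k \<Omega> M \<times> P_space k C0 \<Omega> M \<and>
    (\<forall>v\<in>UD_space k \<Omega> M. momentum_balance f s v) \<and> (\<forall>q\<in>broken_poly k M. mass_balance \<tau> g stored s q)"
proof -
  let ?X = "UD_space k \<Omega> M \<times> P_space k C0 \<Omega> M"
  obtain u p where x: "(u, p) \<in> S" "\<And>v. v \<in> zero_U \<Longrightarrow> momentum_balance f (u, p) v"
      "\<And>q. q \<in> zero_P C0 \<Longrightarrow> mass_balance \<tau> g stored (u, p) q"
    and uniq: "\<And>s. s \<in> S \<Longrightarrow> (\<forall>v\<in>zero_U. momentum_balance f s v) \<Longrightarrow> (\<forall>q\<in>zero_P C0. mass_balance \<tau> g stored s q) \<Longrightarrow> s = (u, p)"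
    using step_ex1[OF \<tau> f g stored] by (metis prod.collapse)
  let ?s = "(restrict_U M u, restrict p (elems M))"
  show ?thesis
  proof (rule ex1I[of _ ?s], intro conjI ballI)
    show "?s \<in> ?X" using x(1) C0 by (simp add: restrict_U_in restrict_P_in)
    show "momentum_balance f ?s v" if v: "v \<in> UD_space k \<Omega> M" for v
      using x(2)[OF zero_ext_U_in[OF v]] momentum_same[OF same_ext(2) same_ext(4) same_sym(1)[OF same_ext(1)]] by blast
    show "mass_balance \<tau> g stored ?s q" if q: "q \<in> broken_poly k M" for q
    proof -
      have "mass_balance \<tau> g stored (u, p) (zero_ext_P M q)"
        by (rule mass_balance_all[OF x(1) g stored compat x(3) zero_ext_P_raw[OF broken_poly_raw[OF q]]])
          (simp_all add: zero_ext_P_def)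
      then show ?thesis
        using mass_same[where stored = stored, OF same_ext(2) same_ext(4) same_sym(2)[OF same_ext(3)] stored_same[OF same_sym(2)[OF same_ext(3)]]] by blast
    qed
  next
    fix s assume s: "s \<in> ?X \<and> (\<forall>v\<in>UD_space k \<Omega> M. momentum_balance f s v) \<and> (\<forall>q\<in>broken_poly k M. mass_balance \<tau> g stored s q)"
    obtain w r where wr: "s = (w, r)" by (cases s)
    have w: "w \<in> UD_space k \<Omega> M" and r: "r \<in> P_space k C0 \<Omega> M" using s by (auto simp: wr)
    have "(zero_ext_U M w, zero_ext_P M r) = (u, p)"
    proof (rule uniq)
      show "(zero_ext_U M w, zero_ext_P M r) \<in> S" by (simp add: zero_ext_U_in[OF w] zero_ext_P_in[OF C0 r])
      show "\<forall>v\<in>zero_U. momentum_balance f (zero_ext_U M w, zero_ext_P M r) v"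
      proof
        fix v assume "v \<in> zero_U"
        then have "momentum_balance f (w, r) (restrict_U M v)" using s restrict_U_in by (simp add: wr)
        then show "momentum_balance f (zero_ext_U M w, zero_ext_P M r) v"
          using momentum_same[OF same_ext(1) same_ext(3) same_sym(1)[OF same_ext(2)]] by blast
      qed
      show "\<forall>q\<in>zero_P C0. mass_balance \<tau> g stored (zero_ext_U M w, zero_ext_P M r) q"
      proof
        fix q assume "q \<in> zero_P C0"
        then have "mass_balance \<tau> g stored (w, r) (restrict q (elems M))"
          using s P_space_broken[OF restrict_P_in[OF C0]] by (simp add: wr)
        then show "mass_balance \<tau> g stored (zero_ext_U M w, zero_ext_P M r) q"
          using mass_same[where stored = stored, OF same_ext(1) same_ext(3) same_sym(2)[OF same_ext(4)] stored_same[OF same_sym(2)[OF same_ext(4)]]] by blast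
      qed
    qed
    then show "s = ?s" using restrict_zero_ext_U[OF w] restrict_zero_ext_P[OF r] by (auto simp: wr)
  qed
qed

end

section \<open>All time steps\<close>

text \<open>The predecessor of the first step is the value at 0 of an extensional sequence on
  \<open>{1..N}\<close>, which is \<open>undefined\<close>. The recursion starts there, and step 1
  has to be uniquely solvable whatever this value is.\<close>

lemma recursive_sequence_ex1:
  assumes "\<And>n y. 1 \<le> n \<Longrightarrow> n \<le> N \<Longrightarrow> (1 < n \<Longrightarrow> y \<in> X) \<Longrightarrow> \<exists>!x. x \<in> X \<and> Q n y x"
  shows "\<exists>!s. s \<in> (\<Pi>\<^sub>E n\<in>{1..N}. X) \<and> (\<forall>n\<in>{1..N::nat}. Q n (s (n - 1)) (s n))"
proof -
  define r where "r = rec_nat undefined (\<lambda>n y. THE x. x \<in> X \<and> Q (Suc n) y x)"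
  have r0: "r 0 = undefined" by (simp add: r_def)
  have rS: "r (Suc n) \<in> X \<and> Q (Suc n) (r n) (r (Suc n))" if "Suc n \<le> N" for n
    using that
  proof (induction n)
    case 0
    have "\<exists>!x. x \<in> X \<and> Q (Suc 0) (r 0) x" using 0 by (intro assms) auto
    from theI'[OF this] show ?case by (simp add: r_def)
  next
    case (Suc n)
    have "\<exists>!x. x \<in> X \<and> Q (Suc (Suc n)) (r (Suc n)) x" using Suc by (intro assms) auto
    from theI'[OF this] show ?case by (simp add: r_def)
  qed
  define s where "s = restrict r {1..N}"
  have sr: "s n = r n" if "n \<le> N" for n using that r0 by (cases n) (simp_all add: s_def)
  show ?thesis
  proof (rule ex1I[of _ s], intro conjI ballI)
    have "r n \<in> X" if "n \<in> {1..N}" for n using rS[of "n - 1"] that by auto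
    then show "s \<in> (\<Pi>\<^sub>E n\<in>{1..N}. X)" unfolding s_def by (intro restrict_PiE_iff[THEN iffD2]) blast
    show "Q n (s (n - 1)) (s n)" if "n \<in> {1..N}" for n
    proof -
      have n: "n \<le> N" using that by simp
      have "s (n - 1) = r (n - 1)" "s n = r n" by (rule sr[OF order_trans[OF diff_le_self n]], rule sr[OF n])
      then show ?thesis using rS[of "n - 1"] that by simp
    qed
  next
    fix t assume t: "t \<in> (\<Pi>\<^sub>E n\<in>{1..N}. X) \<and> (\<forall>n\<in>{1..N}. Q n (t (n - 1)) (t n))"
    have te: "t n = undefined" if "n \<notin> {1..N}" for n using t that PiE_arb by blast
    have "t n = s n" if "n \<le> N" for n
      using that
    proof (induction n)
      case 0
      then show ?case using te[of 0] r0 by (simp add: s_def)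
    next
      case (Suc n)
      then have p: "t n = r n" using sr[of n] by simp
      have m: "Suc n \<in> {1..N}" using Suc by simp
      have tX: "t (Suc n) \<in> X" using t m PiE_mem by blast
      have "Q (Suc n) (t (Suc n - 1)) (t (Suc n))" using t m by blast
      then have tQ: "Q (Suc n) (r n) (t (Suc n))" by (simp add: p)
      have "r n \<in> X" if "1 < Suc n" using rS[of "n - 1"] Suc that by simp
      then have "\<exists>!x. x \<in> X \<and> Q (Suc n) (r n) x" using Suc by (intro assms) auto
      then have "t (Suc n) = r (Suc n)" using rS[of n] Suc tX tQ by blast
      then show ?case using sr[of "Suc n"] Suc by simp
    qed
    then show "t = s" using te by (intro ext) (metis atLeastAtMost_iff restrict_apply s_def)
  qed
qed

context hho_problem begin

definition stored_before :: "('d point \<Rightarrow> real) \<Rightarrow> nat \<Rightarrow> 'd hho \<times> 'd broken \<Rightarrow> 'd broken \<Rightarrow> real" where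
  "stored_before \<phi> n y q = (if n = 1 then l2_prod \<Omega> \<phi> (glue M q) else C0 * mass (snd y) q - b_h M (fst y) q)"

lemma content_rate_eq:
  assumes \<tau>: "0 < \<tau>" and s: "fst (s n) \<in> V" "snd (s n) \<in> raw_P" and y: "n \<noteq> 1 \<Longrightarrow> fst (s (n - 1)) \<in> V" "n \<noteq> 1 \<Longrightarrow> snd (s (n - 1)) \<in> raw_P"
    and q: "q \<in> raw_P"
  shows "\<tau> * content_rate C0 \<phi> \<Omega> M \<tau> s n q = C0 * mass (snd (s n)) q - b_h M (fst (s n)) q - stored_before \<phi> n (s (n - 1)) q"
proof (cases "n = 1")
  case True
  then show ?thesis using \<tau> by (simp add: content_rate_def stored_before_def)
next
  case False
  let ?u = "fst (s n)" and ?p = "snd (s n)" and ?w = "fst (s (n - 1))" and ?r = "snd (s (n - 1))"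
  have w: "?w \<in> V" and r: "?r \<in> raw_P" using y False by auto
  have du: "?u - ?w \<in> V" and dp: "?p - ?r \<in> raw_P"
    by (rule subspace_diff[OF subspace_raw_U s(1) w], rule subspace_diff[OF subspace_raw_P s(2) r])
  have e1: "bdiff \<tau> ?p ?r = (1 / \<tau>) *\<^sub>R (?p - ?r)" by (simp add: bdiff_def fun_eq_iff)
  have e2: "bdiff_hho \<tau> ?u ?w = (1 / \<tau>) *\<^sub>R (?u - ?w)"
    by (simp add: bdiff_hho_def bdiff_def prod_eq_iff fun_eq_iff)
  note lm = bilin_onD(2)[OF bilin_on_mass q] and lb = lin_on_b_h(1)[OF q]
  have m: "\<tau> * mass (bdiff \<tau> ?p ?r) q = mass ?p q - mass ?r q"
    unfolding e1 lin_on_scale[OF lm dp] lin_on_diff[OF lm subspace_raw_P s(2) r] using \<tau> by simp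
  have b: "\<tau> * b_h M (bdiff_hho \<tau> ?u ?w) q = b_h M ?u q - b_h M ?w q"
    unfolding e2 lin_on_scale[OF lb du] lin_on_diff[OF lb subspace_raw_U s(1) w] using \<tau> by simp
  have "\<tau> * content_rate C0 \<phi> \<Omega> M \<tau> s n q =
      C0 * (\<tau> * mass (bdiff \<tau> ?p ?r) q) - \<tau> * b_h M (bdiff_hho \<tau> ?u ?w) q"
    using False by (simp add: content_rate_def right_diff_distrib)
  then show ?thesis unfolding m b using False by (simp add: stored_before_def right_diff_distrib)
qed

text \<open>Step by step, the content before the step is linear in the test function and, for
  \<open>C0 = 0\<close>, vanishes on constants: for the initial datum by compatibility, later
  because \<open>b\<close> vanishes on constants.\<close>

theorem discrete_problem_ex1:
  assumes tF: "0 < tF" and N: "1 \<le> N" and f: "f \<in> L2_time tF \<Omega>" and g: "g \<in> L2_time tF \<Omega>" and \<phi>: "\<phi> \<in> L2_on \<Omega>"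
    and compat: "C0 = 0 \<Longrightarrow> (LINT x|lebesgue_on \<Omega>. \<phi> x) = 0"
      "C0 = 0 \<Longrightarrow> AE t in lebesgue_on {0<..<tF}. (LINT x|lebesgue_on \<Omega>. g t x) = 0"
  shows "\<exists>!s. s \<in> (\<Pi>\<^sub>E n\<in>{1..N}. UD_space k \<Omega> M \<times> P_space k C0 \<Omega> M) \<and>
    discrete_problem k \<sigma> \<gamma> C0 \<kappa> \<zeta> f g \<phi> \<Omega> M tF N s"
proof -
  let ?X = "UD_space k \<Omega> M \<times> P_space k C0 \<Omega> M"
  define \<tau> where "\<tau> = tF / real N"
  have \<tau>: "0 < \<tau>" using tF N by (simp add: \<tau>_def)
  have lm: "\<Omega> \<in> lmeasurable" using open_\<Omega> bounded_\<Omega> by (simp add: lmeasurable_open)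
  have \<phi>i: "integrable (lebesgue_on \<Omega>) \<phi>"
  proof -
    interpret finite_measure "lebesgue_on \<Omega>" by (rule finite_measure_lebesgue_on[OF lm])
    have "\<phi> \<in> borel_measurable (lebesgue_on \<Omega>)" "integrable (lebesgue_on \<Omega>) (\<lambda>x. (\<phi> x)\<^sup>2)"
      using \<phi> by (simp_all add: L2_on_def)
    then show ?thesis by (rule square_integrable_imp_integrable)
  qed
  define Q where "Q n y s \<longleftrightarrow> (\<forall>v\<in>UD_space k \<Omega> M. momentum_balance (time_mean \<tau> f n) s v) \<and>
     (\<forall>q\<in>broken_poly k M. mass_balance \<tau> (time_mean \<tau> g n) (stored_before \<phi> n y) s q)" for n y s
  have "\<exists>!s. s \<in> (\<Pi>\<^sub>E n\<in>{1..N}. ?X) \<and> (\<forall>n\<in>{1..N}. Q n (s (n - 1)) (s n))"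
  proof (rule recursive_sequence_ex1)
    fix n :: nat and y assume n: "1 \<le> n" "n \<le> N" and y: "1 < n \<Longrightarrow> y \<in> ?X"
    have nN: "n \<in> {1..N}" using n by simp
    have yV: "fst y \<in> V" "snd y \<in> raw_P" if "n \<noteq> 1"
    proof -
      have "y \<in> ?X" using y n that by simp
      then have "fst y \<in> UD_space k \<Omega> M" "snd y \<in> P_space k C0 \<Omega> M" by (simp_all add: mem_Times_iff)
      then show "fst y \<in> V" "snd y \<in> raw_P" using UD_space_raw(1) broken_poly_raw P_space_broken by blast+
    qed
    show "\<exists>!x. x \<in> ?X \<and> Q n y x"
      unfolding Q_def
    proof (rule time_step_ex1[OF \<tau>])
      show "integrable (lebesgue_on \<Omega>) (time_mean \<tau> f n)" unfolding \<tau>_def by (rule time_mean_integrable(1)[OF f lm nN tF])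
      show "integrable (lebesgue_on \<Omega>) (time_mean \<tau> g n)" unfolding \<tau>_def by (rule time_mean_integrable(1)[OF g lm nN tF])
      show "(LINT x|lebesgue_on \<Omega>. time_mean \<tau> g n x) = 0" if "C0 = 0"
        unfolding \<tau>_def by (rule time_mean_integrable(2)[OF g lm nN tF compat(2)[OF that]])
      show "lin_on raw_P (stored_before \<phi> n y)"
      proof (cases "n = 1")
        case True
        then show ?thesis using lin_on_source[OF \<phi>i] by (simp add: stored_before_def[abs_def])
      next
        case False
        have "lin_on raw_P (\<lambda>q. C0 * mass (snd y) q - b_h M (fst y) q)"
          by (intro lin_intros bilin_onD(1)[OF bilin_on_mass] lin_on_b_h(2) yV False)
        then show ?thesis using False by (simp add: stored_before_def[abs_def])
      qed
      show "stored_before \<phi> n y q = stored_before \<phi> n y q'" if "same_P M q q'" for q q'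
        using glue_same(1)[OF that] b_h_same[OF _ that, of "fst y" "fst y"] by (simp add: stored_before_def same_U_def)
      show "stored_before \<phi> n y const_P = 0" if "C0 = 0"
      proof (cases "n = 1")
        case True
        then show ?thesis using l2_const_P[OF \<phi>i] compat(1)[OF that] by (simp add: stored_before_def)
      next
        case False
        have "fst y \<in> UD_space k \<Omega> M" using y n False by (simp add: mem_Times_iff)
        then have "b_h M (fst y) const_P = 0" by (intro b_h_const[OF UD_space_raw(1,2) const_P(2)])
        then show ?thesis unfolding stored_before_def using that False by simp
      qed
    qed
  qed
  moreover have "(\<forall>n\<in>{1..N}. Q n (s (n - 1)) (s n)) \<longleftrightarrow> discrete_problem k \<sigma> \<gamma> C0 \<kappa> \<zeta> f g \<phi> \<Omega> M tF N s"
    if s: "s \<in> (\<Pi>\<^sub>E n\<in>{1..N}. ?X)" for s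
  proof -
    have sX: "fst (s n) \<in> V" "snd (s n) \<in> raw_P" if "n \<in> {1..N}" for n
    proof -
      have "s n \<in> ?X" by (rule PiE_mem[OF s that])
      then have "fst (s n) \<in> UD_space k \<Omega> M" "snd (s n) \<in> P_space k C0 \<Omega> M" by (simp_all add: mem_Times_iff)
      then show "fst (s n) \<in> V" "snd (s n) \<in> raw_P" using UD_space_raw(1) broken_poly_raw P_space_broken by blast+
    qed
    have mb: "mass_balance \<tau> (time_mean \<tau> g n) (stored_before \<phi> n (s (n - 1))) (s n) q \<longleftrightarrow>
      content_rate C0 \<phi> \<Omega> M \<tau> s n q + c (snd (s n)) q = l2_prod \<Omega> (time_mean \<tau> g n) (glue M q)"
      if n: "n \<in> {1..N}" and q: "q \<in> broken_poly k M" for n q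
    proof -
      have p: "n - 1 \<in> {1..N}" if "n \<noteq> 1" using n that by auto
      have cr: "\<tau> * content_rate C0 \<phi> \<Omega> M \<tau> s n q = C0 * mass (snd (s n)) q - b_h M (fst (s n)) q - stored_before \<phi> n (s (n - 1)) q"
        by (rule content_rate_eq[OF \<tau> sX[OF n] sX[OF p] broken_poly_raw[OF q]])
      have "content_rate C0 \<phi> \<Omega> M \<tau> s n q + c (snd (s n)) q = l2_prod \<Omega> (time_mean \<tau> g n) (glue M q) \<longleftrightarrow>
        \<tau> * (content_rate C0 \<phi> \<Omega> M \<tau> s n q + c (snd (s n)) q) = \<tau> * l2_prod \<Omega> (time_mean \<tau> g n) (glue M q)"
        using \<tau> by simp
      also have "\<dots> \<longleftrightarrow> mass_balance \<tau> (time_mean \<tau> g n) (stored_before \<phi> n (s (n - 1))) (s n) q"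
        unfolding distrib_left cr mass_balance_def by linarith
      finally show ?thesis by simp
    qed
    have ne: "\<exists>v. v \<in> UD_space k \<Omega> M" "\<exists>q. q \<in> broken_poly k M"
      using restrict_U_in[OF subspace_0[OF subspace_zero_U]]
        P_space_broken[OF restrict_P_in[OF C0 subspace_0[OF subspace_zero_P]]] by blast+
    have "Q n (s (n - 1)) (s n) \<longleftrightarrow> (\<forall>v\<in>UD_space k \<Omega> M. \<forall>q\<in>broken_poly k M.
        a_h k \<sigma> \<gamma> M (fst (s n)) v + b_h M v (snd (s n)) = l2_prod \<Omega> (time_mean \<tau> f n) (glue M (fst v)) \<and>
        content_rate C0 \<phi> \<Omega> M \<tau> s n q + c (snd (s n)) q = l2_prod \<Omega> (time_mean \<tau> g n) (glue M q))"
      if "n \<in> {1..N}" for n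
      unfolding Q_def momentum_balance_def using mb[OF that] ne by auto
    then show ?thesis unfolding discrete_problem_def Let_def \<tau>_def[symmetric] by (intro ball_cong refl)
  qed
  ultimately show ?thesis by (simp only: cong: conj_cong)
qed

end

theorem theorem15:
  fixes \<Omega> :: "(real ^ 'd) set" and P\<Omega> :: "(real ^ 'd) set set"
    and \<kappa> :: "real ^ 'd \<Rightarrow> real ^ 'd ^ 'd"
    and \<sigma> :: "real ^ 'd \<Rightarrow> real ^ 'd ^ 'd \<Rightarrow> real ^ 'd ^ 'd"
    and f :: "real \<Rightarrow> real ^ 'd \<Rightarrow> real ^ 'd" and g :: "real \<Rightarrow> real ^ 'd \<Rightarrow> real"
    and \<phi>0 :: "real ^ 'd \<Rightarrow> real"
    and tF C0 \<kappa>lo \<kappa>hi Cgr Ccv \<gamma> \<zeta> \<zeta>lo \<rho> :: real and k :: nat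
    and H :: "real set" and M :: "real \<Rightarrow> 'd mesh"
  assumes dim: "CARD('d) \<in> {2, 3}"
    and domain: "polyhedral_set \<Omega>" "bounded \<Omega>" "connected \<Omega>" "diameter \<Omega> = 1"
    and data: "tF > 0" "C0 \<ge> 0" "k \<ge> 1"
    and kappa_sym: "\<forall>x\<in>\<Omega>. \<kappa> x \<in> sym_tensors"
    and kappa_pc: "polyhedral_partition \<Omega> P\<Omega>" "\<forall>D\<in>P\<Omega>. \<kappa> constant_on D"
    and kappa_bounds: "0 < \<kappa>lo" "\<kappa>lo \<le> \<kappa>hi"
      "AE x in lebesgue_on \<Omega>. \<forall>\<xi>. \<kappa>lo * (norm \<xi>)\<^sup>2 \<le> (\<kappa> x *v \<xi>) \<bullet> \<xi> \<and>
                                   (\<kappa> x *v \<xi>) \<bullet> \<xi> \<le> \<kappa>hi * (norm \<xi>)\<^sup>2"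
    and loads: "f \<in> L2_time tF \<Omega>" "g \<in> L2_time tF \<Omega>" "\<phi>0 \<in> L2_on \<Omega>"
    and compatibility: "C0 = 0 \<Longrightarrow> (LINT x|lebesgue_on \<Omega>. \<phi>0 x) = 0"
      "C0 = 0 \<Longrightarrow> AE t in lebesgue_on {0<..<tF}. (LINT x|lebesgue_on \<Omega>. g t x) = 0"
    and sigma_sym: "\<forall>x\<in>\<Omega>. \<forall>\<tau>\<in>sym_tensors. \<sigma> x \<tau> \<in> sym_tensors"
    and caratheodory: "AE x in lebesgue_on \<Omega>. continuous_on sym_tensors (\<sigma> x)"
      "\<forall>\<tau>\<in>sym_tensors. (\<lambda>x. \<sigma> x \<tau>) \<in> borel_measurable (lebesgue_on \<Omega>)"
    and constants: "Cgr > 0" "Ccv > 0"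
    and growth: "AE x in lebesgue_on \<Omega>. \<forall>\<tau>\<in>sym_tensors. norm (\<sigma> x \<tau>) \<le> Cgr * norm \<tau>"
    and coercivity: "AE x in lebesgue_on \<Omega>. \<forall>\<tau>\<in>sym_tensors. \<sigma> x \<tau> \<bullet> \<tau> \<ge> Ccv\<^sup>2 * (norm \<tau>)\<^sup>2"
    and strict_monotonicity: "AE x in lebesgue_on \<Omega>. \<forall>\<tau>\<in>sym_tensors. \<forall>\<eta>\<in>sym_tensors.
        \<eta> \<noteq> \<tau> \<longrightarrow> (\<sigma> x \<tau> - \<sigma> x \<eta>) \<bullet> (\<tau> - \<eta>) > 0"
    and stabilization: "\<gamma> \<in> {Ccv\<^sup>2..Cgr}"
    and meshes: "0 < \<rho>" "\<rho> < 1" "regular_mesh_sequence \<Omega> \<rho> H M"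
      "\<forall>h\<in>H. \<forall>T\<in>elems (M h). \<exists>D\<in>P\<Omega>. T \<subseteq> D"
    and penalty: "0 < \<zeta>lo" "\<zeta>lo < \<zeta>"
      "\<forall>h\<in>H. \<forall>q\<in>P_space k C0 \<Omega> (M h).
         c_h \<kappa> \<zeta> \<Omega> (M h) q q \<ge> (\<zeta> - \<zeta>lo) * inverse (1 + \<zeta>) * kappa_norm_sq \<kappa> (M h) q"
  shows "\<forall>h\<in>H. \<forall>N::nat. N \<ge> 1 \<longrightarrow>
    (\<exists>!s. s \<in> (\<Pi>\<^sub>E n\<in>{1..N}. UD_space k \<Omega> (M h) \<times> P_space k C0 \<Omega> (M h)) \<and>
          discrete_problem k \<sigma> \<gamma> C0 \<kappa> \<zeta> f g \<phi>0 \<Omega> (M h) tF N s)"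
proof (intro ballI allI impI)
  fix h and N :: nat assume h: "h \<in> H" and N: "1 \<le> N"
  have ne: "\<Omega> \<noteq> {}" using domain(4) by auto
  obtain ctr rad \<A> where "hho_mesh \<Omega> (M h) ctr rad \<A>"
    using regular_mesh_imp_hho_mesh[OF _ domain(1-3) ne meshes(3) h] dim by auto
  then interpret hho_mesh \<Omega> "M h" ctr rad \<A> .
  have gam: "0 < \<gamma>"
  proof -
    have "0 < Ccv\<^sup>2" using constants(2) by simp
    also have "\<dots> \<le> \<gamma>" using stabilization by simp
    finally show ?thesis .
  qed
  interpret hho_problem \<Omega> "M h" ctr rad \<A> k \<kappa> \<kappa>lo \<zeta> \<sigma> Cgr Ccv \<gamma> C0 "(\<zeta> - \<zeta>lo) * inverse (1 + \<zeta>)"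
  proof unfold_locales
    show "1 \<le> k" by (rule data(3))
    show "\<exists>K. \<forall>x\<in>T. \<kappa> x = K" if T: "T \<in> elems (M h)" for T
    proof -
      obtain D where "D \<in> P\<Omega>" "T \<subseteq> D" using meshes(4) h T by blast
      then show ?thesis using kappa_pc(2) unfolding constant_on_def by blast
    qed
    show "0 < \<kappa>lo" by (rule kappa_bounds(1))
    show "AE x in lebesgue_on \<Omega>. \<forall>\<xi>. \<kappa>lo * (norm \<xi>)\<^sup>2 \<le> (\<kappa> x *v \<xi>) \<bullet> \<xi>"
      using kappa_bounds(3) by (rule eventually_mono) blast
    show "0 < (\<zeta> - \<zeta>lo) * inverse (1 + \<zeta>)" using penalty(1,2) by simp
    show "(\<zeta> - \<zeta>lo) * inverse (1 + \<zeta>) * kappa_norm_sq \<kappa> (M h) q \<le> c_h \<kappa> \<zeta> \<Omega> (M h) q q"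
      if "q \<in> P_space k C0 \<Omega> (M h)" for q using penalty(3) h that by blast
  qed (fact caratheodory constants gam growth coercivity strict_monotonicity data(2))+
  show "\<exists>!s. s \<in> (\<Pi>\<^sub>E n\<in>{1..N}. UD_space k \<Omega> (M h) \<times> P_space k C0 \<Omega> (M h)) \<and>
          discrete_problem k \<sigma> \<gamma> C0 \<kappa> \<zeta> f g \<phi>0 \<Omega> (M h) tF N s"
    by (rule discrete_problem_ex1[OF data(1) N loads compatibility])
qed

end
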